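(* Let $\Lambda$ be an artin algebra. Let $\widetilde{Q}$ be the direct sum of representatives of the isomorphism classes of all indecomposable projective-injective $\Lambda$-modules, and let $\mathcal{C}_\Lambda=(\operatorname{Gen}\widetilde{Q})\cap(\operatorname{Cogen}\widetilde{Q})$. Then the subcategory $\mathcal{C}_\Lambda$ contains a tilting-cotilting module (a module which is both tilting and cotilting) if and only if $\Lambda$ is a $1$-Auslander-Gorenstein algebra.
   Context: All modules are finitely generated left modules. $\operatorname{Gen}(X)$ (resp. $\operatorname{Cogen}(X)$) is the full subcategory of modules $M$ admitting an epimorphism $X^m\to M$ (resp. a monomorphism $M\to X^m$) for some $m$. Dominant dimension: for a minimal injective resolution $0\to{}_\Lambda\Lambda\to I_0\to I_1\to\cdots$, $\operatorname{domdim}\Lambda=\sup\{k\mid I_i \text{ is projective for all } 0\le i<k\}$. An artin algebra $\Lambda$ is $m$-Auslander-Gorenstein if $\operatorname{injdim}{}_\Lambda\Lambda\le m+1\le\operatorname{domdim}\Lambda$. A basic $\Lambda$-module $T$ is tilting if (1) $\operatorname{projdim}T\le 1$, (2) $\operatorname{Ext}^1_\Lambda(T,T)=0$, (3) there is an exact sequence $0\to\Lambda\to T_0\to T_1\to 0$ with $T_0,T_1\in\operatorname{add}T$. A $\Lambda$-module $C$ is cotilting if (1) $\operatorname{injdim}C\le 1$, (2) $\operatorname{Ext}^1_\Lambda(C,C)=0$, (3) there is an exact sequence $0\to C_0\to C_1\to D\Lambda\to 0$ with $C_0,C_1\in\operatorname{add}C$, where $D$ is the standard duality. *)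

theory Defs
  imports
    "HOL-Algebra.Module"
    "HOL-Algebra.Ideal"
    "HOL-Algebra.Coset"
    "HOL-Library.FuncSet"
    "HOL-Library.Extended_Nat"
begin

section \<open>Finitely generated left modules over a possibly noncommutative ring\<close>

text \<open>
  The locale \<^locale>\<open>module\<close> requires a commutative base ring. The axioms below are the same with
  \<^locale>\<open>ring\<close> in place of \<^locale>\<open>cring\<close>. The fields \<^const>\<open>mult\<close> and \<^const>\<open>one\<close> of a module
  record carry no meaning.
\<close>

locale left_module = A?: ring A + M?: abelian_group M
  for A :: "('a, 'x) ring_scheme" and M :: "('a, 'm) module" (structure) +
  assumes smult_closed:
      "\<lbrakk>a \<in> carrier A; x \<in> carrier M\<rbrakk> \<Longrightarrow> a \<odot>\<^bsub>M\<^esub> x \<in> carrier M"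
    and smult_l_distr:
      "\<lbrakk>a \<in> carrier A; b \<in> carrier A; x \<in> carrier M\<rbrakk> \<Longrightarrow>
        (a \<oplus>\<^bsub>A\<^esub> b) \<odot>\<^bsub>M\<^esub> x = a \<odot>\<^bsub>M\<^esub> x \<oplus>\<^bsub>M\<^esub> b \<odot>\<^bsub>M\<^esub> x"
    and smult_r_distr:
      "\<lbrakk>a \<in> carrier A; x \<in> carrier M; y \<in> carrier M\<rbrakk> \<Longrightarrow>
        a \<odot>\<^bsub>M\<^esub> (x \<oplus>\<^bsub>M\<^esub> y) = a \<odot>\<^bsub>M\<^esub> x \<oplus>\<^bsub>M\<^esub> a \<odot>\<^bsub>M\<^esub> y"
    and smult_assoc:
      "\<lbrakk>a \<in> carrier A; b \<in> carrier A; x \<in> carrier M\<rbrakk> \<Longrightarrow>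
        (a \<otimes>\<^bsub>A\<^esub> b) \<odot>\<^bsub>M\<^esub> x = a \<odot>\<^bsub>M\<^esub> (b \<odot>\<^bsub>M\<^esub> x)"
    and smult_one:
      "x \<in> carrier M \<Longrightarrow> \<one>\<^bsub>A\<^esub> \<odot>\<^bsub>M\<^esub> x = x"

definition fg_module :: "('a, 'x) ring_scheme \<Rightarrow> ('a, 'm) module \<Rightarrow> bool" where
  "fg_module A M \<longleftrightarrow> left_module A M \<and>
    (\<exists>S. finite S \<and> S \<subseteq> carrier M \<and> (\<forall>H. submodule H A M \<and> S \<subseteq> H \<longrightarrow> H = carrier M))"

text \<open>
  Quantification over all finitely generated modules needs a type for their elements. A finitely
  generated module is isomorphic to a quotient of some \<open>A\<^sup>n\<close>, whose elements are cosets, that is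
  sets of maps from indices to \<open>A\<close>. Hence every isomorphism class has a representative
  of the following type.
\<close>

type_synonym 'a std_module = "('a, (nat \<Rightarrow> 'a) set) module"

definition module_hom ::
    "('a, 'x) ring_scheme \<Rightarrow> ('a, 'm) module \<Rightarrow> ('a, 'n) module \<Rightarrow> ('m \<Rightarrow> 'n) set" where
  "module_hom A M N = {f \<in> carrier M \<rightarrow> carrier N.
     (\<forall>x\<in>carrier M. \<forall>y\<in>carrier M. f (x \<oplus>\<^bsub>M\<^esub> y) = f x \<oplus>\<^bsub>N\<^esub> f y) \<and>
     (\<forall>a\<in>carrier A. \<forall>x\<in>carrier M. f (a \<odot>\<^bsub>M\<^esub> x) = a \<odot>\<^bsub>N\<^esub> f x)}"

definition module_mono ::
    "('a, 'x) ring_scheme \<Rightarrow> ('a, 'm) module \<Rightarrow> ('a, 'n) module \<Rightarrow> ('m \<Rightarrow> 'n) set" where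
  "module_mono A M N = {f \<in> module_hom A M N. inj_on f (carrier M)}"

definition module_epi ::
    "('a, 'x) ring_scheme \<Rightarrow> ('a, 'm) module \<Rightarrow> ('a, 'n) module \<Rightarrow> ('m \<Rightarrow> 'n) set" where
  "module_epi A M N = {f \<in> module_hom A M N. f ` carrier M = carrier N}"

definition isomorphic_modules ::
    "('a, 'x) ring_scheme \<Rightarrow> ('a, 'm) module \<Rightarrow> ('a, 'n) module \<Rightarrow> bool" where
  "isomorphic_modules A M N \<longleftrightarrow> (\<exists>f \<in> module_hom A M N. bij_betw f (carrier M) (carrier N))"

definition regular_module :: "('a, 'x) ring_scheme \<Rightarrow> ('a, 'a) module" where
  "regular_module A = \<lparr>carrier = carrier A, monoid.mult = mult A, one = one A,
     ring.zero = ring.zero A, add = add A, smult = mult A\<rparr>"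

definition quotient_module :: "('a, 'm) module \<Rightarrow> 'm set \<Rightarrow> ('a, 'm set) module" where
  "quotient_module M N = \<lparr>carrier = a_rcosets\<^bsub>M\<^esub> N, monoid.mult = undefined, one = undefined,
     ring.zero = N, add = (\<lambda>X Y. X <+>\<^bsub>M\<^esub> Y),
     smult = (\<lambda>a X. \<Union>x\<in>X. N +>\<^bsub>M\<^esub> (a \<odot>\<^bsub>M\<^esub> x))\<rparr>"

definition direct_sum :: "('a, 'm) module list \<Rightarrow> ('a, nat \<Rightarrow> 'm) module" where
  "direct_sum Ms =
    \<lparr>carrier = (\<Pi>\<^sub>E i\<in>{..<length Ms}. carrier (Ms ! i)),
     monoid.mult = undefined, one = undefined,
     ring.zero = (\<lambda>i\<in>{..<length Ms}. \<zero>\<^bsub>Ms ! i\<^esub>),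
     add = (\<lambda>x y. \<lambda>i\<in>{..<length Ms}. x i \<oplus>\<^bsub>Ms ! i\<^esub> y i),
     smult = (\<lambda>a x. \<lambda>i\<in>{..<length Ms}. a \<odot>\<^bsub>Ms ! i\<^esub> x i)\<rparr>"

definition module_power :: "('a, 'm) module \<Rightarrow> nat \<Rightarrow> ('a, nat \<Rightarrow> 'm) module" where
  "module_power M n = direct_sum (replicate n M)"

definition complementary_submodules ::
    "('a, 'x) ring_scheme \<Rightarrow> ('a, 'm) module \<Rightarrow> 'm set \<Rightarrow> 'm set \<Rightarrow> bool" where
  "complementary_submodules A M H K \<longleftrightarrow> submodule H A M \<and> submodule K A M \<and>
     H \<inter> K = {\<zero>\<^bsub>M\<^esub>} \<and> H <+>\<^bsub>M\<^esub> K = carrier M"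

definition indecomposable :: "('a, 'x) ring_scheme \<Rightarrow> ('a, 'm) module \<Rightarrow> bool" where
  "indecomposable A M \<longleftrightarrow> fg_module A M \<and> carrier M \<noteq> {\<zero>\<^bsub>M\<^esub>} \<and>
     (\<forall>H K. complementary_submodules A M H K \<longrightarrow> H = {\<zero>\<^bsub>M\<^esub>} \<or> K = {\<zero>\<^bsub>M\<^esub>})"

definition basic_module :: "('a, 'x) ring_scheme \<Rightarrow> ('a, 'm) module \<Rightarrow> bool" where
  "basic_module A M \<longleftrightarrow> fg_module A M \<and>
     (\<exists>Ms :: 'a std_module list. (\<forall>N\<in>set Ms. indecomposable A N) \<and>
        (\<forall>i<length Ms. \<forall>j<length Ms. i \<noteq> j \<longrightarrow> \<not> isomorphic_modules A (Ms ! i) (Ms ! j)) \<and>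
        isomorphic_modules A M (direct_sum Ms))"

text \<open>\<open>add X\<close>, \<open>Gen X\<close> and \<open>Cogen X\<close>, given by their classes of objects.\<close>

definition add_closure :: "('a, 'x) ring_scheme \<Rightarrow> ('a, 't) module \<Rightarrow> ('a, 'm) module set" where
  "add_closure A X = {M. fg_module A M \<and>
     (\<exists>n H K. complementary_submodules A (module_power X n) H K \<and>
        isomorphic_modules A M ((module_power X n)\<lparr>carrier := H\<rparr>))}"

definition Gen :: "('a, 'x) ring_scheme \<Rightarrow> ('a, 't) module \<Rightarrow> ('a, 'm) module set" where
  "Gen A X = {M. fg_module A M \<and> (\<exists>n. module_epi A (module_power X n) M \<noteq> {})}"

definition Cogen :: "('a, 'x) ring_scheme \<Rightarrow> ('a, 't) module \<Rightarrow> ('a, 'm) module set" where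
  "Cogen A X = {M. fg_module A M \<and> (\<exists>n. module_mono A M (module_power X n) \<noteq> {})}"


section \<open>Projective and injective modules, resolutions and dimensions\<close>

definition projective :: "('a, 'x) ring_scheme \<Rightarrow> ('a, 'm) module \<Rightarrow> bool" where
  "projective A P \<longleftrightarrow> fg_module A P \<and>
     (\<forall>(M :: 'a std_module) (N :: 'a std_module) g f.
        fg_module A M \<and> fg_module A N \<and> g \<in> module_epi A M N \<and> f \<in> module_hom A P N \<longrightarrow>
        (\<exists>h \<in> module_hom A P M. \<forall>x\<in>carrier P. g (h x) = f x))"

definition injective :: "('a, 'x) ring_scheme \<Rightarrow> ('a, 'm) module \<Rightarrow> bool" where
  "injective A I \<longleftrightarrow> fg_module A I \<and>
     (\<forall>(M :: 'a std_module) (N :: 'a std_module) g f.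
        fg_module A M \<and> fg_module A N \<and> g \<in> module_mono A M N \<and> f \<in> module_hom A M I \<longrightarrow>
        (\<exists>h \<in> module_hom A N I. \<forall>x\<in>carrier M. h (g x) = f x))"

definition essential_submodule ::
    "('a, 'x) ring_scheme \<Rightarrow> 'm set \<Rightarrow> ('a, 'm) module \<Rightarrow> bool" where
  "essential_submodule A H M \<longleftrightarrow> submodule H A M \<and>
     (\<forall>K. submodule K A M \<and> K \<inter> H = {\<zero>\<^bsub>M\<^esub>} \<longrightarrow> K = {\<zero>\<^bsub>M\<^esub>})"

definition injective_envelope ::
    "('a, 'x) ring_scheme \<Rightarrow> ('a, 'm) module \<Rightarrow> ('a, 'n) module \<Rightarrow> bool" where
  "injective_envelope A M E \<longleftrightarrow> injective A E \<and>
     (\<exists>i \<in> module_mono A M E. essential_submodule A (i ` carrier M) E)"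

definition short_exact ::
    "('a, 'x) ring_scheme \<Rightarrow> ('a, 'k) module \<Rightarrow> ('k \<Rightarrow> 'm) \<Rightarrow> ('a, 'm) module \<Rightarrow> ('m \<Rightarrow> 'n) \<Rightarrow>
      ('a, 'n) module \<Rightarrow> bool" where
  "short_exact A K f M g N \<longleftrightarrow> f \<in> module_mono A K M \<and> g \<in> module_epi A M N \<and>
     f ` carrier K = a_kernel M N g"

text \<open>\<open>\<cdots> \<rightarrow> P 2 \<rightarrow> P 1 \<rightarrow> P 0 \<rightarrow> M \<rightarrow> 0\<close>, where \<open>d n\<close> maps \<open>P (n + 1)\<close> to \<open>P n\<close>.\<close>

definition projective_resolution ::
    "('a, 'x) ring_scheme \<Rightarrow> ('a, 'm) module \<Rightarrow> ((nat \<Rightarrow> 'a) set \<Rightarrow> 'm) \<Rightarrow>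
      (nat \<Rightarrow> 'a std_module) \<Rightarrow> (nat \<Rightarrow> (nat \<Rightarrow> 'a) set \<Rightarrow> (nat \<Rightarrow> 'a) set) \<Rightarrow> bool" where
  "projective_resolution A M \<epsilon> P d \<longleftrightarrow> (\<forall>n. projective A (P n)) \<and>
     \<epsilon> \<in> module_epi A (P 0) M \<and>
     (\<forall>n. d n \<in> module_hom A (P (Suc n)) (P n)) \<and>
     d 0 ` carrier (P 1) = a_kernel (P 0) M \<epsilon> \<and>
     (\<forall>n. d (Suc n) ` carrier (P (Suc (Suc n))) = a_kernel (P (Suc n)) (P n) (d n))"

text \<open>\<open>0 \<rightarrow> M \<rightarrow> I 0 \<rightarrow> I 1 \<rightarrow> \<cdots>\<close>, where \<open>d n\<close> maps \<open>I n\<close> to \<open>I (n + 1)\<close>.\<close>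

definition injective_resolution ::
    "('a, 'x) ring_scheme \<Rightarrow> ('a, 'm) module \<Rightarrow> ('m \<Rightarrow> (nat \<Rightarrow> 'a) set) \<Rightarrow>
      (nat \<Rightarrow> 'a std_module) \<Rightarrow> (nat \<Rightarrow> (nat \<Rightarrow> 'a) set \<Rightarrow> (nat \<Rightarrow> 'a) set) \<Rightarrow> bool" where
  "injective_resolution A M \<eta> I d \<longleftrightarrow> (\<forall>n. injective A (I n)) \<and>
     \<eta> \<in> module_mono A M (I 0) \<and>
     (\<forall>n. d n \<in> module_hom A (I n) (I (Suc n))) \<and>
     \<eta> ` carrier M = a_kernel (I 0) (I 1) (d 0) \<and>
     (\<forall>n. d n ` carrier (I n) = a_kernel (I (Suc n)) (I (Suc (Suc n))) (d (Suc n)))"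

definition minimal_injective_resolution ::
    "('a, 'x) ring_scheme \<Rightarrow> ('a, 'm) module \<Rightarrow> ('m \<Rightarrow> (nat \<Rightarrow> 'a) set) \<Rightarrow>
      (nat \<Rightarrow> 'a std_module) \<Rightarrow> (nat \<Rightarrow> (nat \<Rightarrow> 'a) set \<Rightarrow> (nat \<Rightarrow> 'a) set) \<Rightarrow> bool" where
  "minimal_injective_resolution A M \<eta> I d \<longleftrightarrow> injective_resolution A M \<eta> I d \<and>
     essential_submodule A (\<eta> ` carrier M) (I 0) \<and>
     (\<forall>n. essential_submodule A (d n ` carrier (I n)) (I (Suc n)))"

definition projdim :: "('a, 'x) ring_scheme \<Rightarrow> ('a, 'm) module \<Rightarrow> enat" where
  "projdim A M = Inf {enat n | n. \<exists>\<epsilon> P d. projective_resolution A M \<epsilon> P d \<and>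
     (\<forall>i>n. carrier (P i) = {\<zero>\<^bsub>P i\<^esub>})}"

definition injdim :: "('a, 'x) ring_scheme \<Rightarrow> ('a, 'm) module \<Rightarrow> enat" where
  "injdim A M = Inf {enat n | n. \<exists>\<eta> I d. injective_resolution A M \<eta> I d \<and>
     (\<forall>i>n. carrier (I i) = {\<zero>\<^bsub>I i\<^esub>})}"

text \<open>
  A minimal injective resolution is unique up to isomorphism, so \<open>\<exists>\<close> selects
  the same set of \<open>k\<close> as any fixed choice of it.
\<close>

definition domdim :: "('a, 'x) ring_scheme \<Rightarrow> enat" where
  "domdim A = Sup {enat k | k. \<exists>\<eta> I d.
     minimal_injective_resolution A (regular_module A) \<eta> I d \<and> (\<forall>i<k. projective A (I i))}"


section \<open>Extension groups\<close>

text \<open>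
  Homomorphisms are taken in \<^const>\<open>extensional\<close> form, so that equality of group elements is
  equality of maps on the carrier.
\<close>

definition Hom_group ::
    "('a, 'x) ring_scheme \<Rightarrow> ('a, 'm) module \<Rightarrow> ('a, 'n) module \<Rightarrow> ('m \<Rightarrow> 'n) monoid" where
  "Hom_group A M N = \<lparr>carrier = module_hom A M N \<inter> extensional (carrier M),
     monoid.mult = (\<lambda>f g. \<lambda>x\<in>carrier M. f x \<oplus>\<^bsub>N\<^esub> g x),
     one = (\<lambda>x\<in>carrier M. \<zero>\<^bsub>N\<^esub>)\<rparr>"

definition Ext_cocycles ::
    "('a, 'x) ring_scheme \<Rightarrow> nat \<Rightarrow> (nat \<Rightarrow> ('a, 'p) module) \<Rightarrow> (nat \<Rightarrow> 'p \<Rightarrow> 'p) \<Rightarrow>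
      ('a, 'n) module \<Rightarrow> ('p \<Rightarrow> 'n) set" where
  "Ext_cocycles A n P d N =
     {f \<in> carrier (Hom_group A (P n) N). \<forall>x\<in>carrier (P (Suc n)). f (d n x) = \<zero>\<^bsub>N\<^esub>}"

fun Ext_coboundaries ::
    "('a, 'x) ring_scheme \<Rightarrow> nat \<Rightarrow> (nat \<Rightarrow> ('a, 'p) module) \<Rightarrow> (nat \<Rightarrow> 'p \<Rightarrow> 'p) \<Rightarrow>
      ('a, 'n) module \<Rightarrow> ('p \<Rightarrow> 'n) set" where
  "Ext_coboundaries A 0 P d N = {\<one>\<^bsub>Hom_group A (P 0) N\<^esub>}"
| "Ext_coboundaries A (Suc n) P d N =
     (\<lambda>f. \<lambda>x\<in>carrier (P (Suc n)). f (d n x)) ` carrier (Hom_group A (P n) N)"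

definition Ext_group ::
    "('a, 'x) ring_scheme \<Rightarrow> nat \<Rightarrow> (nat \<Rightarrow> ('a, 'p) module) \<Rightarrow> (nat \<Rightarrow> 'p \<Rightarrow> 'p) \<Rightarrow>
      ('a, 'n) module \<Rightarrow> ('p \<Rightarrow> 'n) set monoid" where
  "Ext_group A n P d N =
     (Hom_group A (P n) N)\<lparr>carrier := Ext_cocycles A n P d N\<rparr> Mod Ext_coboundaries A n P d N"

text \<open>
  \<open>Ext\<^sup>n(M, N) = 0\<close>. The group computed from any projective resolution of \<open>M\<close> is the same up to
  isomorphism.
\<close>

definition Ext_vanishes ::
    "('a, 'x) ring_scheme \<Rightarrow> nat \<Rightarrow> ('a, 'm) module \<Rightarrow> ('a, 'n) module \<Rightarrow> bool" where
  "Ext_vanishes A n M N \<longleftrightarrow> (\<exists>\<epsilon> P d. projective_resolution A M \<epsilon> P d \<and>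
     carrier (Ext_group A n P d N) = {\<one>\<^bsub>Ext_group A n P d N\<^esub>})"


section \<open>Artin algebras, standard duality, tilting and cotilting modules\<close>

definition artinian_cring :: "('r, 'x) ring_scheme \<Rightarrow> bool" where
  "artinian_cring R \<longleftrightarrow> cring R \<and>
     (\<forall>I :: nat \<Rightarrow> 'r set. (\<forall>n. ideal (I n) R \<and> I (Suc n) \<subseteq> I n) \<longrightarrow> (\<exists>n. \<forall>m\<ge>n. I m = I n))"

text \<open>
  \<open>L\<close> is a ring together with an \<open>R\<close>-module structure. The locale \<^locale>\<open>algebra\<close> would
  force \<open>L\<close> to be commutative, and centrality of \<open>R\<close> is stated by the two associativity laws.
\<close>

definition artin_algebra :: "('r, 'x) ring_scheme \<Rightarrow> ('r, 'a) module \<Rightarrow> bool" where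
  "artin_algebra R L \<longleftrightarrow> artinian_cring R \<and> ring L \<and> fg_module R L \<and>
     (\<forall>r\<in>carrier R. \<forall>x\<in>carrier L. \<forall>y\<in>carrier L.
        (r \<odot>\<^bsub>L\<^esub> x) \<otimes>\<^bsub>L\<^esub> y = r \<odot>\<^bsub>L\<^esub> (x \<otimes>\<^bsub>L\<^esub> y) \<and>
        x \<otimes>\<^bsub>L\<^esub> (r \<odot>\<^bsub>L\<^esub> y) = r \<odot>\<^bsub>L\<^esub> (x \<otimes>\<^bsub>L\<^esub> y))"

text \<open>The Jacobson radical; only meant for commutative rings.\<close>

definition jacobson_radical :: "('r, 'x) ring_scheme \<Rightarrow> 'r set" where
  "jacobson_radical R = {x \<in> carrier R. \<forall>I. maximalideal I R \<longrightarrow> x \<in> I}"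

text \<open>
  The standard duality is \<open>D = Hom\<^sub>R(-, J)\<close> with \<open>J\<close> the injective envelope of \<open>R / rad R\<close>.
\<close>

definition dualizing_module :: "('r, 'x) ring_scheme \<Rightarrow> ('r, 'j) module \<Rightarrow> bool" where
  "dualizing_module R J \<longleftrightarrow>
     injective_envelope R (quotient_module (regular_module R) (jacobson_radical R)) J"

text \<open>
  The left module \<open>D L\<close>, the dual of \<open>L\<close> as a right module over itself: \<open>(a f)(x) = f (x a)\<close>.
\<close>

definition dual_regular ::
    "('r, 'x) ring_scheme \<Rightarrow> ('r, 'j) module \<Rightarrow> ('r, 'a) module \<Rightarrow> ('a, 'a \<Rightarrow> 'j) module" where
  "dual_regular R J L =
    \<lparr>carrier = module_hom R L J \<inter> extensional (carrier L),
     monoid.mult = undefined, one = undefined,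
     ring.zero = (\<lambda>x\<in>carrier L. \<zero>\<^bsub>J\<^esub>),
     add = (\<lambda>f g. \<lambda>x\<in>carrier L. f x \<oplus>\<^bsub>J\<^esub> g x),
     smult = (\<lambda>a f. \<lambda>x\<in>carrier L. f (x \<otimes>\<^bsub>L\<^esub> a))\<rparr>"

definition tilting :: "('a, 'x) ring_scheme \<Rightarrow> ('a, 'm) module \<Rightarrow> bool" where
  "tilting L T \<longleftrightarrow> fg_module L T \<and> basic_module L T \<and>
     projdim L T \<le> 1 \<and>
     Ext_vanishes L 1 T T \<and>
     (\<exists>(T0 :: 'a std_module) (T1 :: 'a std_module) f g.
        T0 \<in> add_closure L T \<and> T1 \<in> add_closure L T \<and> short_exact L (regular_module L) f T0 g T1)"

definition cotilting ::
    "('r, 'x) ring_scheme \<Rightarrow> ('r, 'j) module \<Rightarrow> ('r, 'a) module \<Rightarrow> ('a, 'm) module \<Rightarrow> bool" where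
  "cotilting R J L C \<longleftrightarrow> fg_module L C \<and>
     injdim L C \<le> 1 \<and>
     Ext_vanishes L 1 C C \<and>
     (\<exists>(C0 :: 'a std_module) (C1 :: 'a std_module) f g.
        C0 \<in> add_closure L C \<and> C1 \<in> add_closure L C \<and> short_exact L C0 f C1 g (dual_regular R J L))"

definition auslander_gorenstein :: "nat \<Rightarrow> ('a, 'x) ring_scheme \<Rightarrow> bool" where
  "auslander_gorenstein m L \<longleftrightarrow>
     injdim L (regular_module L) \<le> enat (m + 1) \<and> enat (m + 1) \<le> domdim L"

text \<open>\<open>Qs\<close> lists, up to isomorphism and without repetition, the indecomposable
  projective-injective modules.\<close>

definition proj_inj_representatives :: "('a, 'x) ring_scheme \<Rightarrow> 'a std_module list \<Rightarrow> bool" where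
  "proj_inj_representatives L Qs \<longleftrightarrow>
     (\<forall>Q\<in>set Qs. indecomposable L Q \<and> projective L Q \<and> injective L Q) \<and>
     (\<forall>i<length Qs. \<forall>j<length Qs. i \<noteq> j \<longrightarrow> \<not> isomorphic_modules L (Qs ! i) (Qs ! j)) \<and>
     (\<forall>M :: 'a std_module. indecomposable L M \<and> projective L M \<and> injective L M \<longrightarrow>
        (\<exists>Q\<in>set Qs. isomorphic_modules L M Q))"

end

theory Submission
  imports Defs
begin

text \<open>
  Suppose \<open>T\<close> in \<open>Gen Q \<inter> Cogen Q\<close> is tilting and cotilting, with \<open>0 \<rightarrow> \<Lambda> \<rightarrow> T\<^sub>0 \<rightarrow> T\<^sub>1 \<rightarrow> 0\<close>. Embed \<open>T\<^sub>0\<close> into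
  \<open>I = Q\<^sup>n\<close>. As \<open>T\<^sub>0\<close> is generated by the injective module \<open>Q\<close>, the map \<open>\<Lambda> \<rightarrow> T\<^sub>0\<close> extends to \<open>I\<close>, and
  comparing the two embeddings of \<open>\<Lambda>\<close> shows that \<open>I / \<Lambda>\<close> is a direct summand of \<open>T\<^sub>1 \<oplus> I\<close>. So \<open>I / \<Lambda>\<close> is
  cogenerated by \<open>Q\<close> and has injective dimension at most one, which gives both required inequalities.

  Conversely let \<open>0 \<rightarrow> \<Lambda> \<rightarrow> I\<^sub>0 \<rightarrow> X\<^sub>0 \<rightarrow> 0\<close> start the minimal injective resolution. Then \<open>Q \<oplus> X\<^sub>0\<close>, made
  basic, is tilting, and only the sequence \<open>0 \<rightarrow> C\<^sub>0 \<rightarrow> C\<^sub>1 \<rightarrow> D\<Lambda> \<rightarrow> 0\<close> needs an argument. An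
  indecomposable noninjective projective \<open>P\<close> has a minimal injective resolution
  \<open>0 \<rightarrow> P \<rightarrow> E\<^sub>0 \<rightarrow> E\<^sub>1 \<rightarrow> E \<rightarrow> 0\<close> with \<open>E\<^sub>0\<close> and \<open>E\<^sub>1\<close> projective-injective; comparing endomorphisms of
  \<open>P\<close> and \<open>E\<close> modulo the obvious factorizations, \<open>E\<close> is indecomposable, not projective, and
  determines \<open>P\<close>. Counting isomorphism classes, every indecomposable injective is projective or of
  the form \<open>E\<close>, and the image of \<open>E\<^sub>0 \<rightarrow> E\<^sub>1\<close> lies in \<open>add (Q \<oplus> X\<^sub>0)\<close>.
\<close>

section \<open>Modules, submodules and homomorphisms\<close>

text \<open>Cogeneration by \<open>Q\<close> is tied to the dominant dimension by injective
  envelopes: a module cogenerated by \<open>Q\<close> has as envelope a summand of some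
  \<open>Q^n\<close>, which is projective. Applied to I / \<Lambda>, this makes the second term of
  the minimal resolution projective.

  In the converse the obstacle is that no map relates D \<Lambda> to \<open>Q\<close> and
  \<open>X0\<close>. The sequence 0 \<rightarrow> K \<rightarrow> E1 \<rightarrow> E \<rightarrow> 0
  is already of the required form, so the whole question is whether every injective is reached, and
  counting settles it. Projectivity of E0 and E1 lifts an endomorphism of E to P; injectivity of E0
  turns a factorization of the lift through E0 into one of the endomorphism through E1. These
  factorizations do no harm, because P is not injective and K is essential in E1. Fitting's lemma
  supplies local endomorphism rings. The count also needs a map back that is injective on
  isomorphism classes; it sends an indecomposable injective to the projective whose top is its
  socle.

  Finite length is derived from the descending chain condition on ideals of the commutative base
  ring.\<close>

lemma left_moduleI:
  assumes "ring A"
    and "\<And>x y. \<lbrakk>x \<in> carrier M; y \<in> carrier M\<rbrakk> \<Longrightarrow> x \<oplus>\<^bsub>M\<^esub> y \<in> carrier M"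
    and "\<zero>\<^bsub>M\<^esub> \<in> carrier M"
    and "\<And>x y z. \<lbrakk>x \<in> carrier M; y \<in> carrier M; z \<in> carrier M\<rbrakk> \<Longrightarrow>
      (x \<oplus>\<^bsub>M\<^esub> y) \<oplus>\<^bsub>M\<^esub> z = x \<oplus>\<^bsub>M\<^esub> (y \<oplus>\<^bsub>M\<^esub> z)"
    and "\<And>x y. \<lbrakk>x \<in> carrier M; y \<in> carrier M\<rbrakk> \<Longrightarrow> x \<oplus>\<^bsub>M\<^esub> y = y \<oplus>\<^bsub>M\<^esub> x"
    and "\<And>x. x \<in> carrier M \<Longrightarrow> \<zero>\<^bsub>M\<^esub> \<oplus>\<^bsub>M\<^esub> x = x"
    and "\<And>x. x \<in> carrier M \<Longrightarrow> \<exists>y\<in>carrier M. y \<oplus>\<^bsub>M\<^esub> x = \<zero>\<^bsub>M\<^esub>"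
    and "\<And>a x. \<lbrakk>a \<in> carrier A; x \<in> carrier M\<rbrakk> \<Longrightarrow> a \<odot>\<^bsub>M\<^esub> x \<in> carrier M"
    and "\<And>a b x. \<lbrakk>a \<in> carrier A; b \<in> carrier A; x \<in> carrier M\<rbrakk> \<Longrightarrow>
      (a \<oplus>\<^bsub>A\<^esub> b) \<odot>\<^bsub>M\<^esub> x = a \<odot>\<^bsub>M\<^esub> x \<oplus>\<^bsub>M\<^esub> b \<odot>\<^bsub>M\<^esub> x"
    and "\<And>a x y. \<lbrakk>a \<in> carrier A; x \<in> carrier M; y \<in> carrier M\<rbrakk> \<Longrightarrow>
      a \<odot>\<^bsub>M\<^esub> (x \<oplus>\<^bsub>M\<^esub> y) = a \<odot>\<^bsub>M\<^esub> x \<oplus>\<^bsub>M\<^esub> a \<odot>\<^bsub>M\<^esub> y"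
    and "\<And>a b x. \<lbrakk>a \<in> carrier A; b \<in> carrier A; x \<in> carrier M\<rbrakk> \<Longrightarrow>
      (a \<otimes>\<^bsub>A\<^esub> b) \<odot>\<^bsub>M\<^esub> x = a \<odot>\<^bsub>M\<^esub> (b \<odot>\<^bsub>M\<^esub> x)"
    and "\<And>x. x \<in> carrier M \<Longrightarrow> \<one>\<^bsub>A\<^esub> \<odot>\<^bsub>M\<^esub> x = x"
  shows "left_module A M"
  using assms by (auto intro!: left_module.intro abelian_groupI left_module_axioms.intro)

context left_module
begin

lemma smult_l_null: "x \<in> carrier M \<Longrightarrow> \<zero>\<^bsub>A\<^esub> \<odot>\<^bsub>M\<^esub> x = \<zero>\<^bsub>M\<^esub>"
proof -
  assume x: "x \<in> carrier M"
  have "\<zero>\<^bsub>A\<^esub> \<odot>\<^bsub>M\<^esub> x \<oplus>\<^bsub>M\<^esub> \<zero>\<^bsub>A\<^esub> \<odot>\<^bsub>M\<^esub> x = \<zero>\<^bsub>A\<^esub> \<odot>\<^bsub>M\<^esub> x"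
    using smult_l_distr[of "\<zero>\<^bsub>A\<^esub>" "\<zero>\<^bsub>A\<^esub>" x] x by simp
  then show ?thesis using x M.add.l_cancel_one smult_closed by (metis A.zero_closed)
qed

lemma smult_r_null: "a \<in> carrier A \<Longrightarrow> a \<odot>\<^bsub>M\<^esub> \<zero>\<^bsub>M\<^esub> = \<zero>\<^bsub>M\<^esub>"
proof -
  assume a: "a \<in> carrier A"
  have "a \<odot>\<^bsub>M\<^esub> \<zero>\<^bsub>M\<^esub> \<oplus>\<^bsub>M\<^esub> a \<odot>\<^bsub>M\<^esub> \<zero>\<^bsub>M\<^esub> = a \<odot>\<^bsub>M\<^esub> \<zero>\<^bsub>M\<^esub>"
    using smult_r_distr[of a "\<zero>\<^bsub>M\<^esub>" "\<zero>\<^bsub>M\<^esub>"] a by simp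
  then show ?thesis using a M.add.l_cancel_one smult_closed by (metis M.zero_closed)
qed

lemma smult_minus_one: "x \<in> carrier M \<Longrightarrow> (\<ominus>\<^bsub>A\<^esub> \<one>\<^bsub>A\<^esub>) \<odot>\<^bsub>M\<^esub> x = \<ominus>\<^bsub>M\<^esub> x"
proof -
  assume x: "x \<in> carrier M"
  have "(\<ominus>\<^bsub>A\<^esub> \<one>\<^bsub>A\<^esub>) \<odot>\<^bsub>M\<^esub> x \<oplus>\<^bsub>M\<^esub> x = \<zero>\<^bsub>M\<^esub>"
    using smult_l_distr[of "\<ominus>\<^bsub>A\<^esub> \<one>\<^bsub>A\<^esub>" "\<one>\<^bsub>A\<^esub>" x] x by (simp add: smult_one A.l_neg smult_l_null)
  then show ?thesis using x by (simp add: M.minus_equality smult_closed)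
qed

lemma minus_add_cancel: "\<lbrakk>x \<in> carrier M; y \<in> carrier M\<rbrakk> \<Longrightarrow> (x \<ominus>\<^bsub>M\<^esub> y) \<oplus>\<^bsub>M\<^esub> y = x"
  by (simp add: M.minus_eq M.a_assoc M.l_neg)

lemma add_minus_cancel: "\<lbrakk>x \<in> carrier M; y \<in> carrier M\<rbrakk> \<Longrightarrow> y \<oplus>\<^bsub>M\<^esub> (x \<ominus>\<^bsub>M\<^esub> y) = x"
  using minus_add_cancel[of x y] by (simp add: M.a_comm[of y])

lemma add_minus_cancel_right: "\<lbrakk>x \<in> carrier M; y \<in> carrier M\<rbrakk> \<Longrightarrow> (x \<oplus>\<^bsub>M\<^esub> y) \<ominus>\<^bsub>M\<^esub> y = x"
  by (simp add: M.minus_eq M.a_assoc M.r_neg)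

lemma minus_self: "x \<in> carrier M \<Longrightarrow> x \<ominus>\<^bsub>M\<^esub> x = \<zero>\<^bsub>M\<^esub>"
  by (simp add: M.minus_eq M.r_neg)

lemma minus_zero_right: "x \<in> carrier M \<Longrightarrow> x \<ominus>\<^bsub>M\<^esub> \<zero>\<^bsub>M\<^esub> = x"
  by (simp add: M.minus_eq)

lemma smult_minus_distr: "\<lbrakk>a \<in> carrier A; x \<in> carrier M; y \<in> carrier M\<rbrakk> \<Longrightarrow>
    a \<odot>\<^bsub>M\<^esub> (x \<ominus>\<^bsub>M\<^esub> y) = a \<odot>\<^bsub>M\<^esub> x \<ominus>\<^bsub>M\<^esub> a \<odot>\<^bsub>M\<^esub> y"
  by (metis add_minus_cancel_right minus_add_cancel smult_closed smult_r_distr M.minus_closed)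

lemma minus_add_minus: "\<lbrakk>x \<in> carrier M; y \<in> carrier M; z \<in> carrier M; w \<in> carrier M\<rbrakk> \<Longrightarrow>
    (x \<oplus>\<^bsub>M\<^esub> y) \<ominus>\<^bsub>M\<^esub> (z \<oplus>\<^bsub>M\<^esub> w) = (x \<ominus>\<^bsub>M\<^esub> z) \<oplus>\<^bsub>M\<^esub> (y \<ominus>\<^bsub>M\<^esub> w)"
  by (simp add: M.minus_eq M.minus_add M.a_ac)

lemma minus_swap: "\<lbrakk>x \<in> carrier M; y \<in> carrier M\<rbrakk> \<Longrightarrow> \<ominus>\<^bsub>M\<^esub> (x \<ominus>\<^bsub>M\<^esub> y) = y \<ominus>\<^bsub>M\<^esub> x"
  by (simp add: M.minus_eq M.minus_add M.a_comm M.minus_minus)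

lemma minus_minus_cancel: "\<lbrakk>x \<in> carrier M; y \<in> carrier M; z \<in> carrier M\<rbrakk> \<Longrightarrow>
    (x \<ominus>\<^bsub>M\<^esub> y) \<oplus>\<^bsub>M\<^esub> (y \<ominus>\<^bsub>M\<^esub> z) = x \<ominus>\<^bsub>M\<^esub> z"
  by (metis M.minus_closed M.minus_eq M.a_assoc M.a_inv_closed minus_add_cancel)

lemma eq_if_minus_zero: "\<lbrakk>x \<ominus>\<^bsub>M\<^esub> y = \<zero>\<^bsub>M\<^esub>; x \<in> carrier M; y \<in> carrier M\<rbrakk> \<Longrightarrow> x = y"
  by (metis M.l_zero minus_add_cancel)

lemma submoduleI:
  assumes "H \<subseteq> carrier M" "\<zero>\<^bsub>M\<^esub> \<in> H"
    and "\<And>x y. \<lbrakk>x \<in> H; y \<in> H\<rbrakk> \<Longrightarrow> x \<oplus>\<^bsub>M\<^esub> y \<in> H"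
    and "\<And>a x. \<lbrakk>a \<in> carrier A; x \<in> H\<rbrakk> \<Longrightarrow> a \<odot>\<^bsub>M\<^esub> x \<in> H"
  shows "submodule H A M"
proof -
  have "\<ominus>\<^bsub>M\<^esub> x \<in> H" if "x \<in> H" for x
    using assms(1,4) that smult_minus_one by (metis A.a_inv_closed A.one_closed subsetD)
  with assms show ?thesis
    by (intro submodule.intro subgroup.intro submodule_axioms.intro) (auto simp: a_inv_def)
qed

lemma carrier_submodule: "submodule (carrier M) A M"
  by (rule submoduleI) (auto simp: smult_closed)

lemma zero_submodule: "submodule {\<zero>\<^bsub>M\<^esub>} A M"
  by (rule submoduleI) (auto simp: smult_r_null)

end

section \<open>Submodules, their intersections and sums\<close>

lemma submodule_subset: "submodule H A M \<Longrightarrow> H \<subseteq> carrier M"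
  using subgroup.subset[OF submodule.axioms(1)] by fastforce

lemma submodule_mem: "submodule H A M \<Longrightarrow> x \<in> H \<Longrightarrow> x \<in> carrier M"
  using submodule_subset by blast

lemma submodule_zero: "submodule H A M \<Longrightarrow> \<zero>\<^bsub>M\<^esub> \<in> H"
  using subgroup.one_closed[OF submodule.axioms(1)] by fastforce

lemma submodule_add: "submodule H A M \<Longrightarrow> x \<in> H \<Longrightarrow> y \<in> H \<Longrightarrow> x \<oplus>\<^bsub>M\<^esub> y \<in> H"
  using subgroup.m_closed[OF submodule.axioms(1)] by fastforce

lemma submodule_smult: "submodule H A M \<Longrightarrow> a \<in> carrier A \<Longrightarrow> x \<in> H \<Longrightarrow> a \<odot>\<^bsub>M\<^esub> x \<in> H"
  by (rule submodule.smult_closed)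

lemma submodule_a_inv: "submodule H A M \<Longrightarrow> x \<in> H \<Longrightarrow> \<ominus>\<^bsub>M\<^esub> x \<in> H"
  using subgroup.m_inv_closed[OF submodule.axioms(1)] by (fastforce simp: a_inv_def)

lemma submodule_minus: "submodule H A M \<Longrightarrow> x \<in> H \<Longrightarrow> y \<in> H \<Longrightarrow> x \<ominus>\<^bsub>M\<^esub> y \<in> H"
  by (simp add: a_minus_def submodule_add submodule_a_inv)

lemmas submodule_closed = submodule_mem submodule_zero submodule_add submodule_smult submodule_minus

lemma set_add_iff: "x \<in> H <+>\<^bsub>M\<^esub> K \<longleftrightarrow> (\<exists>h\<in>H. \<exists>k\<in>K. x = h \<oplus>\<^bsub>M\<^esub> k)"
  by (auto simp: set_add_def set_mult_def)

lemma set_addI: "h \<in> H \<Longrightarrow> k \<in> K \<Longrightarrow> h \<oplus>\<^bsub>M\<^esub> k \<in> H <+>\<^bsub>M\<^esub> K"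
  by (auto simp: set_add_iff)

lemma submodule_Int:
  "submodule H A M \<Longrightarrow> submodule K A M \<Longrightarrow> left_module A M \<Longrightarrow> submodule (H \<inter> K) A M"
  by (rule left_module.submoduleI) (auto simp: submodule_closed)

lemma submodule_set_add:
  assumes "left_module A M" "submodule H A M" "submodule K A M"
  shows "submodule (H <+>\<^bsub>M\<^esub> K) A M"
proof -
  interpret left_module A M by fact
  show ?thesis
  proof (rule submoduleI)
    show "H <+>\<^bsub>M\<^esub> K \<subseteq> carrier M"
      using assms by (auto simp: set_add_iff submodule_mem)
    show "\<zero>\<^bsub>M\<^esub> \<in> H <+>\<^bsub>M\<^esub> K"
      using assms(2,3)[THEN submodule_zero] by (auto simp: set_add_iff intro!: bexI[of _ "\<zero>\<^bsub>M\<^esub>"])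
  next
    fix x y assume "x \<in> H <+>\<^bsub>M\<^esub> K" "y \<in> H <+>\<^bsub>M\<^esub> K"
    then obtain h k h' k' where *: "h \<in> H" "k \<in> K" "x = h \<oplus>\<^bsub>M\<^esub> k" "h' \<in> H" "k' \<in> K" "y = h' \<oplus>\<^bsub>M\<^esub> k'"
      by (auto simp: set_add_iff)
    then have "x \<oplus>\<^bsub>M\<^esub> y = (h \<oplus>\<^bsub>M\<^esub> h') \<oplus>\<^bsub>M\<^esub> (k \<oplus>\<^bsub>M\<^esub> k')"
      using assms by (simp add: M.a_ac submodule_mem[of _ A M])
    with * show "x \<oplus>\<^bsub>M\<^esub> y \<in> H <+>\<^bsub>M\<^esub> K"
      using submodule_add[OF assms(2)] submodule_add[OF assms(3)] unfolding set_add_iff by blast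
  next
    fix a x assume a: "a \<in> carrier A" and "x \<in> H <+>\<^bsub>M\<^esub> K"
    then obtain h k where *: "h \<in> H" "k \<in> K" "x = h \<oplus>\<^bsub>M\<^esub> k"
      by (auto simp: set_add_iff)
    then have "a \<odot>\<^bsub>M\<^esub> x = a \<odot>\<^bsub>M\<^esub> h \<oplus>\<^bsub>M\<^esub> a \<odot>\<^bsub>M\<^esub> k"
      using a assms by (simp add: smult_r_distr submodule_mem[of _ A M])
    with * a show "a \<odot>\<^bsub>M\<^esub> x \<in> H <+>\<^bsub>M\<^esub> K"
      using submodule_smult[OF assms(2)] submodule_smult[OF assms(3)] unfolding set_add_iff by blast
  qed
qed

lemma submodule_left_module:
  assumes "left_module A M" "submodule H A M"
  shows "left_module A (M\<lparr>carrier := H\<rparr>)"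
proof -
  interpret left_module A M by fact
  note mem = submodule_mem[OF assms(2)]
  show ?thesis
  proof (rule left_moduleI)
    show "ring A" ..
    show "\<exists>y\<in>carrier (M\<lparr>carrier := H\<rparr>). y \<oplus>\<^bsub>M\<lparr>carrier := H\<rparr>\<^esub> x = \<zero>\<^bsub>M\<lparr>carrier := H\<rparr>\<^esub>"
      if "x \<in> carrier (M\<lparr>carrier := H\<rparr>)" for x
      using that submodule_a_inv[OF assms(2)] mem M.l_neg by auto
  qed (use assms(2) in \<open>auto simp: submodule_closed mem M.a_ac smult_l_distr
        smult_r_distr smult_assoc smult_one\<close>)
qed

lemma submodule_restrict_iff:
  assumes "left_module A M" "submodule H A M"
  shows "submodule K A (M\<lparr>carrier := H\<rparr>) \<longleftrightarrow> submodule K A M \<and> K \<subseteq> H"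
proof
  assume K: "submodule K A (M\<lparr>carrier := H\<rparr>)"
  have "K \<subseteq> H" using submodule_subset[OF K] by simp
  moreover have "submodule K A M"
    using \<open>K \<subseteq> H\<close> submodule_subset[OF assms(2)] submodule_zero[OF K] submodule_add[OF K]
      submodule_smult[OF K]
    by (intro left_module.submoduleI[OF assms(1)]) auto
  ultimately show "submodule K A M \<and> K \<subseteq> H" by simp
next
  assume K: "submodule K A M \<and> K \<subseteq> H"
  then show "submodule K A (M\<lparr>carrier := H\<rparr>)"
    by (intro left_module.submoduleI[OF submodule_left_module[OF assms]])
      (auto simp: submodule_closed)
qed

section \<open>Homomorphisms, kernels, images and quotients\<close>

lemma module_homI:
  assumes "\<And>x. x \<in> carrier M \<Longrightarrow> f x \<in> carrier N"
    and "\<And>x y. \<lbrakk>x \<in> carrier M; y \<in> carrier M\<rbrakk> \<Longrightarrow> f (x \<oplus>\<^bsub>M\<^esub> y) = f x \<oplus>\<^bsub>N\<^esub> f y"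
    and "\<And>a x. \<lbrakk>a \<in> carrier A; x \<in> carrier M\<rbrakk> \<Longrightarrow> f (a \<odot>\<^bsub>M\<^esub> x) = a \<odot>\<^bsub>N\<^esub> f x"
  shows "f \<in> module_hom A M N"
  using assms by (auto simp: module_hom_def)

lemma hom_closed: "f \<in> module_hom A M N \<Longrightarrow> x \<in> carrier M \<Longrightarrow> f x \<in> carrier N"
  by (auto simp: module_hom_def)

lemma hom_add: "f \<in> module_hom A M N \<Longrightarrow> x \<in> carrier M \<Longrightarrow> y \<in> carrier M \<Longrightarrow>
    f (x \<oplus>\<^bsub>M\<^esub> y) = f x \<oplus>\<^bsub>N\<^esub> f y"
  by (auto simp: module_hom_def)

lemma hom_smult: "f \<in> module_hom A M N \<Longrightarrow> a \<in> carrier A \<Longrightarrow> x \<in> carrier M \<Longrightarrow>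
    f (a \<odot>\<^bsub>M\<^esub> x) = a \<odot>\<^bsub>N\<^esub> f x"
  by (auto simp: module_hom_def)

lemma hom_zero:
  assumes "f \<in> module_hom A M N" "left_module A M" "left_module A N"
  shows "f \<zero>\<^bsub>M\<^esub> = \<zero>\<^bsub>N\<^esub>"
proof -
  interpret M: left_module A M by fact
  interpret N: left_module A N by fact
  have "f \<zero>\<^bsub>M\<^esub> = f (\<zero>\<^bsub>A\<^esub> \<odot>\<^bsub>M\<^esub> \<zero>\<^bsub>M\<^esub>)" by (simp add: M.smult_l_null)
  then show ?thesis using assms(1) by (simp add: hom_smult N.smult_l_null hom_closed)
qed

lemma hom_minus:
  assumes "f \<in> module_hom A M N" "left_module A M" "left_module A N" "x \<in> carrier M" "y \<in> carrier M"
  shows "f (x \<ominus>\<^bsub>M\<^esub> y) = f x \<ominus>\<^bsub>N\<^esub> f y"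
proof -
  interpret M: left_module A M by fact
  interpret N: left_module A N by fact
  have "f (x \<ominus>\<^bsub>M\<^esub> y) \<oplus>\<^bsub>N\<^esub> f y = f x"
    using assms by (simp flip: hom_add[OF assms(1)] add: M.minus_add_cancel)
  then show ?thesis
    using assms by (metis N.add_minus_cancel_right hom_closed M.minus_closed)
qed

lemma hom_comp: "f \<in> module_hom A M N \<Longrightarrow> g \<in> module_hom A N P \<Longrightarrow> (\<lambda>x. g (f x)) \<in> module_hom A M P"
  by (auto simp: module_hom_def Pi_iff)

lemma hom_id: "(\<lambda>x. x) \<in> module_hom A M M"
  by (auto simp: module_hom_def)

lemma hom_addf:
  assumes "f \<in> module_hom A M N" "g \<in> module_hom A M N" "left_module A N"
  shows "(\<lambda>x. f x \<oplus>\<^bsub>N\<^esub> g x) \<in> module_hom A M N"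
proof -
  interpret N: left_module A N by fact
  show ?thesis
    by (rule module_homI)
      (use assms in \<open>auto simp: hom_closed hom_add hom_smult N.smult_r_distr N.M.a_ac\<close>)
qed

lemma hom_minusf:
  assumes "f \<in> module_hom A M N" "g \<in> module_hom A M N" "left_module A N"
  shows "(\<lambda>x. f x \<ominus>\<^bsub>N\<^esub> g x) \<in> module_hom A M N"
proof -
  interpret N: left_module A N by fact
  show ?thesis
    by (rule module_homI)
      (use assms in \<open>auto simp: hom_closed hom_add hom_smult N.smult_minus_distr N.minus_add_minus\<close>)
qed

lemma hom_zerof: "left_module A N \<Longrightarrow> (\<lambda>x. \<zero>\<^bsub>N\<^esub>) \<in> module_hom A M N"
  by (rule module_homI)
    (auto simp: left_module.smult_r_null abelian_monoid.r_zero abelian_monoid.zero_closed abelian_group.axioms(1)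
      dest: left_module.axioms(2))

lemma hom_restrict_dom: "f \<in> module_hom A M N \<Longrightarrow> H \<subseteq> carrier M \<Longrightarrow> f \<in> module_hom A (M\<lparr>carrier := H\<rparr>) N"
  by (auto simp: module_hom_def subset_iff)

lemma hom_restrict_cod: "f \<in> module_hom A M N \<Longrightarrow> (\<And>x. x \<in> carrier M \<Longrightarrow> f x \<in> H) \<Longrightarrow>
    f \<in> module_hom A M (N\<lparr>carrier := H\<rparr>)"
  by (auto simp: module_hom_def)

lemma hom_incl: "H \<subseteq> carrier M \<Longrightarrow> (\<lambda>x. x) \<in> module_hom A (M\<lparr>carrier := H\<rparr>) M"
  by (auto simp: module_hom_def)

lemma hom_cong: "f \<in> module_hom A M N \<Longrightarrow> (\<And>x. x \<in> carrier M \<Longrightarrow> f x = g x) \<Longrightarrow> left_module A M \<Longrightarrow>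
    g \<in> module_hom A M N"
  unfolding module_hom_def left_module_def left_module_axioms_def
  by (auto simp: Pi_iff abelian_monoid.a_closed abelian_group.axioms(1))

lemma mono_hom: "f \<in> module_mono A M N \<Longrightarrow> f \<in> module_hom A M N"
  by (simp add: module_mono_def)

lemma epi_hom: "f \<in> module_epi A M N \<Longrightarrow> f \<in> module_hom A M N"
  by (simp add: module_epi_def)

lemma mono_eq: "f \<in> module_mono A M N \<Longrightarrow> x \<in> carrier M \<Longrightarrow> y \<in> carrier M \<Longrightarrow> f x = f y \<Longrightarrow> x = y"
  by (auto simp: module_mono_def inj_on_def)

lemma epi_surj: "f \<in> module_epi A M N \<Longrightarrow> y \<in> carrier N \<Longrightarrow> \<exists>x\<in>carrier M. y = f x"
  by (auto simp: module_epi_def)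

lemma monoI:
  assumes "f \<in> module_hom A M N" "left_module A M" "left_module A N"
    and "\<And>x. x \<in> carrier M \<Longrightarrow> f x = \<zero>\<^bsub>N\<^esub> \<Longrightarrow> x = \<zero>\<^bsub>M\<^esub>"
  shows "f \<in> module_mono A M N"
proof -
  interpret M: left_module A M by fact
  interpret N: left_module A N by fact
  have "x = y" if "x \<in> carrier M" "y \<in> carrier M" "f x = f y" for x y
  proof (rule M.eq_if_minus_zero)
    show "x \<ominus>\<^bsub>M\<^esub> y = \<zero>\<^bsub>M\<^esub>"
      using that hom_closed[OF assms(1)] by (intro assms(4)) (simp_all add: hom_minus[OF assms(1-3)] N.minus_self)
  qed fact+
  with assms(1) show ?thesis by (auto simp: module_mono_def inj_on_def)
qed

lemma epiI: "f \<in> module_hom A M N \<Longrightarrow> (\<And>y. y \<in> carrier N \<Longrightarrow> \<exists>x\<in>carrier M. f x = y) \<Longrightarrow> f \<in> module_epi A M N"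
  by (force simp: module_epi_def module_hom_def)

lemma mono_zero: "f \<in> module_mono A M N \<Longrightarrow> left_module A M \<Longrightarrow> left_module A N \<Longrightarrow>
    x \<in> carrier M \<Longrightarrow> f x = \<zero>\<^bsub>N\<^esub> \<Longrightarrow> x = \<zero>\<^bsub>M\<^esub>"
  using hom_zero[OF mono_hom] mono_eq
  by (metis abelian_group_def abelian_monoid.zero_closed left_module.axioms(2))

lemma mono_comp: "f \<in> module_mono A M N \<Longrightarrow> g \<in> module_mono A N P \<Longrightarrow> (\<lambda>x. g (f x)) \<in> module_mono A M P"
  by (auto simp: module_mono_def hom_comp inj_on_def hom_closed)

lemma epi_comp: "f \<in> module_epi A M N \<Longrightarrow> g \<in> module_epi A N P \<Longrightarrow> (\<lambda>x. g (f x)) \<in> module_epi A M P"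
  unfolding module_epi_def using hom_comp[of f A M N g P] by (simp flip: image_image)

lemma ker_iff: "x \<in> a_kernel M N f \<longleftrightarrow> x \<in> carrier M \<and> f x = \<zero>\<^bsub>N\<^esub>"
  by (simp add: a_kernel_def')

lemma submodule_preimage:
  assumes "f \<in> module_hom A M N" "left_module A M" "left_module A N" "submodule K A N"
  shows "submodule {x \<in> carrier M. f x \<in> K} A M"
proof -
  interpret M: left_module A M by fact
  show ?thesis
    by (rule M.submoduleI)
      (use assms in \<open>auto simp: hom_zero hom_add hom_smult submodule_closed M.smult_closed\<close>)
qed

lemma submodule_ker:
  assumes "f \<in> module_hom A M N" "left_module A M" "left_module A N"
  shows "submodule (a_kernel M N f) A M"
  using submodule_preimage[OF assms left_module.zero_submodule[OF assms(3)]] by (simp add: a_kernel_def')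

lemma submodule_image:
  assumes "f \<in> module_hom A M N" "left_module A M" "left_module A N" "submodule H A M"
  shows "submodule (f ` H) A N"
proof -
  interpret M: left_module A M by fact
  interpret N: left_module A N by fact
  note mem = submodule_mem[OF assms(4)]
  show ?thesis
  proof (rule N.submoduleI)
    show "f ` H \<subseteq> carrier N" using mem hom_closed[OF assms(1)] by auto
    show "\<zero>\<^bsub>N\<^esub> \<in> f ` H" using hom_zero[OF assms(1-3)] submodule_zero[OF assms(4)] by (metis image_eqI)
  next
    fix x y assume "x \<in> f ` H" "y \<in> f ` H"
    then obtain u v where "u \<in> H" "v \<in> H" "x = f u" "y = f v" by blast
    then show "x \<oplus>\<^bsub>N\<^esub> y \<in> f ` H"
      using hom_add[OF assms(1)] mem submodule_add[OF assms(4)] by (metis image_eqI)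
  next
    fix a x assume "a \<in> carrier A" "x \<in> f ` H"
    then obtain u where "u \<in> H" "x = f u" by blast
    then show "a \<odot>\<^bsub>N\<^esub> x \<in> f ` H"
      using hom_smult[OF assms(1)] mem submodule_smult[OF assms(4)] \<open>a \<in> carrier A\<close> by (metis image_eqI)
  qed
qed

lemma submodule_range:
  assumes "f \<in> module_hom A M N" "left_module A M" "left_module A N"
  shows "submodule (f ` carrier M) A N"
  using submodule_image[OF assms left_module.carrier_submodule[OF assms(2)]] .

lemma fg_left_module: "fg_module A M \<Longrightarrow> left_module A M"
  by (simp add: fg_module_def)

text \<open>Both quotients and changes of the element type are instances of this construction.\<close>

lemma pushforward_module:
  fixes A :: "('a, 'x) ring_scheme" and M :: "('a, 'm) module" and q :: "'m \<Rightarrow> 'n"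
  assumes "left_module A M" "submodule H A M"
    and q: "\<And>x y. \<lbrakk>x \<in> carrier M; y \<in> carrier M\<rbrakk> \<Longrightarrow> q x = q y \<longleftrightarrow> x \<ominus>\<^bsub>M\<^esub> y \<in> H"
  obtains N :: "('a, 'n) module" where "left_module A N" "q \<in> module_epi A M N" "a_kernel M N q = H"
proof -
  interpret left_module A M by fact
  \<comment> \<open>Sums and multiples in \<open>N\<close> are computed on representatives chosen by
    \<open>r\<close>. Two representatives of one element differ by an element of \<open>H\<close>,
    so the result does not depend on the choice.\<close>
  define r where "r = inv_into (carrier M) q"
  define N :: "('a, 'n) module" where "N = \<lparr>carrier = q ` carrier M, monoid.mult = undefined, one = undefined,
    ring.zero = q \<zero>\<^bsub>M\<^esub>, add = (\<lambda>X Y. q (r X \<oplus>\<^bsub>M\<^esub> r Y)), smult = (\<lambda>a X. q (a \<odot>\<^bsub>M\<^esub> r X))\<rparr>"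
  have r: "r (q x) \<in> carrier M" "r (q x) \<ominus>\<^bsub>M\<^esub> x \<in> H" if "x \<in> carrier M" for x
  proof -
    show "r (q x) \<in> carrier M" using that by (simp add: r_def inv_into_into)
    then show "r (q x) \<ominus>\<^bsub>M\<^esub> x \<in> H"
      using that by (simp flip: q) (simp add: r_def f_inv_into_f)
  qed
  have N_add: "q x \<oplus>\<^bsub>N\<^esub> q y = q (x \<oplus>\<^bsub>M\<^esub> y)" if "x \<in> carrier M" "y \<in> carrier M" for x y
    using that r by (simp add: N_def q minus_add_minus submodule_add[OF assms(2)])
  have N_smult: "a \<odot>\<^bsub>N\<^esub> q x = q (a \<odot>\<^bsub>M\<^esub> x)" if "a \<in> carrier A" "x \<in> carrier M" for a x
    using that r by (simp add: N_def q smult_closed submodule_smult[OF assms(2)] flip: smult_minus_distr)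
  have N_simps [simp]: "carrier N = q ` carrier M" "\<zero>\<^bsub>N\<^esub> = q \<zero>\<^bsub>M\<^esub>" by (simp_all add: N_def)
  show thesis
  proof
    show "left_module A N"
    proof (rule left_moduleI)
      show "ring A" ..
      show "\<exists>y\<in>carrier N. y \<oplus>\<^bsub>N\<^esub> x = \<zero>\<^bsub>N\<^esub>" if x: "x \<in> carrier N" for x
      proof -
        obtain u where u: "x = q u" "u \<in> carrier M" using x unfolding N_simps by (rule imageE)
        then have "q (\<ominus>\<^bsub>M\<^esub> u) \<oplus>\<^bsub>N\<^esub> x = \<zero>\<^bsub>N\<^esub>"
          using N_add[of "\<ominus>\<^bsub>M\<^esub> u" u] by (simp add: M.l_neg)
        then show ?thesis using u(2) by auto
      qed
    qed (auto simp: N_add N_smult smult_closed M.a_assoc smult_l_distr smult_r_distr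
        smult_assoc smult_one, simp add: M.a_comm)
    show "q \<in> module_epi A M N"
      by (auto simp: module_epi_def module_hom_def N_add N_smult)
    show "a_kernel M N q = H"
      using submodule_mem[OF assms(2)] q[of _ "\<zero>\<^bsub>M\<^esub>"] by (auto simp: a_kernel_def' minus_zero_right)
  qed
qed

text \<open>The homomorphism theorem for an arbitrary surjection in place of a quotient map:
  \<open>f\<close> is constant on the fibres of \<open>p\<close> because differences within a fibre
  lie in the kernel.\<close>

lemma epi_factor:
  assumes "p \<in> module_epi A M N" "f \<in> module_hom A M W" "left_module A M" "left_module A N" "left_module A W"
    and ker: "\<And>x. x \<in> carrier M \<Longrightarrow> p x = \<zero>\<^bsub>N\<^esub> \<Longrightarrow> f x = \<zero>\<^bsub>W\<^esub>"
  obtains g where "g \<in> module_hom A N W" "\<And>x. x \<in> carrier M \<Longrightarrow> g (p x) = f x"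
proof -
  interpret M: left_module A M by fact
  interpret N: left_module A N by fact
  interpret W: left_module A W by fact
  note ph = epi_hom[OF assms(1)] and surj = epi_surj[OF assms(1)]
  define r where "r = inv_into (carrier M) p"
  have r: "r (p x) \<in> carrier M" "p (r (p x)) = p x" if "x \<in> carrier M" for x
    using that by (auto simp: r_def f_inv_into_f inv_into_into)
  have *: "f (r (p x)) = f x" if "x \<in> carrier M" for x
  proof -
    have "f (r (p x) \<ominus>\<^bsub>M\<^esub> x) = \<zero>\<^bsub>W\<^esub>"
      using that r hom_closed[OF ph] by (intro ker) (simp_all add: hom_minus[OF ph] assms N.minus_self)
    then show ?thesis
      using that r hom_closed[OF assms(2)] W.eq_if_minus_zero by (simp add: hom_minus[OF assms(2)] assms)
  qed
  show thesis
  proof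
    show "(\<lambda>y. f (r y)) \<in> module_hom A N W"
    proof (rule module_homI)
      show "f (r x) \<in> carrier W" if "x \<in> carrier N" for x
        using surj[OF that] * hom_closed[OF assms(2)] by auto
      show "f (r (x \<oplus>\<^bsub>N\<^esub> y)) = f (r x) \<oplus>\<^bsub>W\<^esub> f (r y)" if xy: "x \<in> carrier N" "y \<in> carrier N" for x y
      proof -
        obtain u v where "u \<in> carrier M" "v \<in> carrier M" "x = p u" "y = p v" using surj xy by blast
        then show ?thesis using *[of "u \<oplus>\<^bsub>M\<^esub> v"] * by (simp add: hom_add[OF ph] hom_add[OF assms(2)])
      qed
      show "f (r (a \<odot>\<^bsub>N\<^esub> x)) = a \<odot>\<^bsub>W\<^esub> f (r x)" if ax: "a \<in> carrier A" "x \<in> carrier N" for a x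
      proof -
        obtain u where "u \<in> carrier M" "x = p u" using surj ax by blast
        then show ?thesis using *[of "a \<odot>\<^bsub>M\<^esub> u"] * ax
          by (simp add: hom_smult[OF ph] hom_smult[OF assms(2)] M.smult_closed)
      qed
    qed
    show "f (r (p x)) = f x" if "x \<in> carrier M" for x using * that .
  qed
qed

lemma mono_factor:
  assumes "j \<in> module_mono A X E" "f \<in> module_hom A M E" "left_module A M" "left_module A X"
    and "\<And>x. x \<in> carrier M \<Longrightarrow> f x \<in> j ` carrier X"
  obtains g where "g \<in> module_hom A M X" "\<And>x. x \<in> carrier M \<Longrightarrow> j (g x) = f x"
proof -
  interpret M: left_module A M by fact
  interpret X: left_module A X by fact
  note jh = mono_hom[OF assms(1)] and je = mono_eq[OF assms(1)]
  define g where "g = (\<lambda>x. inv_into (carrier X) j (f x))"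
  have g: "g x \<in> carrier X" "j (g x) = f x" if "x \<in> carrier M" for x
    using assms(5)[OF that] by (auto simp: g_def inv_into_into f_inv_into_f)
  show thesis
  proof
    show "g \<in> module_hom A M X"
      by (rule module_homI)
        (use g in \<open>auto intro!: je simp: hom_add[OF jh] hom_smult[OF jh] hom_add[OF assms(2)] hom_smult[OF assms(2)]
          X.smult_closed M.smult_closed\<close>)
  qed (use g in auto)
qed

section \<open>Retracts, finite generation and direct sums\<close>

text \<open>These are the direct summands, given by a pair of maps instead of a complement. In this
  form they compose, survive products, and relate modules with different element types;
  \<open>retract_complementary\<close> recovers the complement.\<close>

definition retract ::
    "('a, 'x) ring_scheme \<Rightarrow> ('a, 'm) module \<Rightarrow> ('a, 'n) module \<Rightarrow> bool" where
  "retract A X Y \<longleftrightarrow> (\<exists>s\<in>module_hom A X Y. \<exists>r\<in>module_hom A Y X. \<forall>x\<in>carrier X. r (s x) = x)"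

text \<open>\<open>direct_sum\<close> takes a list of modules over one element type; sums such as
  \<open>prod_module Q X0\<close> mix two types and need a binary version.\<close>

definition prod_module :: "('a, 'm) module \<Rightarrow> ('a, 'n) module \<Rightarrow> ('a, 'm \<times> 'n) module" where
  "prod_module M N = \<lparr>carrier = carrier M \<times> carrier N, monoid.mult = undefined, one = undefined,
     ring.zero = (\<zero>\<^bsub>M\<^esub>, \<zero>\<^bsub>N\<^esub>), add = (\<lambda>x y. (fst x \<oplus>\<^bsub>M\<^esub> fst y, snd x \<oplus>\<^bsub>N\<^esub> snd y)),
     smult = (\<lambda>a x. (a \<odot>\<^bsub>M\<^esub> fst x, a \<odot>\<^bsub>N\<^esub> snd x))\<rparr>"

lemma prod_module_simps [simp]:
  "carrier (prod_module M N) = carrier M \<times> carrier N"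
  "\<zero>\<^bsub>prod_module M N\<^esub> = (\<zero>\<^bsub>M\<^esub>, \<zero>\<^bsub>N\<^esub>)"
  "x \<oplus>\<^bsub>prod_module M N\<^esub> y = (fst x \<oplus>\<^bsub>M\<^esub> fst y, snd x \<oplus>\<^bsub>N\<^esub> snd y)"
  "a \<odot>\<^bsub>prod_module M N\<^esub> x = (a \<odot>\<^bsub>M\<^esub> fst x, a \<odot>\<^bsub>N\<^esub> snd x)"
  by (simp_all add: prod_module_def)

lemma prod_left_module:
  assumes "left_module A M" "left_module A N"
  shows "left_module A (prod_module M N)"
proof -
  interpret M: left_module A M by fact
  interpret N: left_module A N by fact
  show ?thesis
  proof (rule left_moduleI)
    show "ring A" ..
    show "\<exists>y\<in>carrier (prod_module M N). y \<oplus>\<^bsub>prod_module M N\<^esub> x = \<zero>\<^bsub>prod_module M N\<^esub>"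
      if "x \<in> carrier (prod_module M N)" for x
      using that M.M.l_neg N.M.l_neg
      by (intro bexI[of _ "(\<ominus>\<^bsub>M\<^esub> fst x, \<ominus>\<^bsub>N\<^esub> snd x)"]) auto
  qed (auto simp: M.M.a_ac N.M.a_ac M.smult_closed N.smult_closed M.smult_l_distr M.smult_r_distr
      M.smult_assoc M.smult_one N.smult_l_distr N.smult_r_distr N.smult_assoc N.smult_one)
qed

lemma hom_fst: "fst \<in> module_hom A (prod_module M N) M"
  by (auto simp: module_hom_def)

lemma hom_snd: "snd \<in> module_hom A (prod_module M N) N"
  by (auto simp: module_hom_def)

lemma hom_pair: "f \<in> module_hom A X M \<Longrightarrow> g \<in> module_hom A X N \<Longrightarrow>
    (\<lambda>x. (f x, g x)) \<in> module_hom A X (prod_module M N)"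
  by (auto simp: module_hom_def)

lemma hom_copair:
  assumes "f \<in> module_hom A M X" "g \<in> module_hom A N X" "left_module A X"
  shows "(\<lambda>z. f (fst z) \<oplus>\<^bsub>X\<^esub> g (snd z)) \<in> module_hom A (prod_module M N) X"
  using hom_addf[OF hom_comp[OF hom_fst assms(1)] hom_comp[OF hom_snd assms(2)] assms(3)] .

lemma hom_incl_fst: "left_module A N \<Longrightarrow> (\<lambda>x. (x, \<zero>\<^bsub>N\<^esub>)) \<in> module_hom A M (prod_module M N)"
  by (rule hom_pair[OF hom_id hom_zerof])

lemma hom_incl_snd: "left_module A M \<Longrightarrow> (\<lambda>x. (\<zero>\<^bsub>M\<^esub>, x)) \<in> module_hom A N (prod_module M N)"
  by (rule hom_pair[OF hom_zerof hom_id])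

lemma retractE:
  assumes "retract A X Y"
  obtains s r where "s \<in> module_hom A X Y" "r \<in> module_hom A Y X" "\<And>x. x \<in> carrier X \<Longrightarrow> r (s x) = x"
  using assms by (auto simp: retract_def)

lemma retractI: "s \<in> module_hom A X Y \<Longrightarrow> r \<in> module_hom A Y X \<Longrightarrow>
    (\<And>x. x \<in> carrier X \<Longrightarrow> r (s x) = x) \<Longrightarrow> retract A X Y"
  by (auto simp: retract_def)

lemma retract_refl: "retract A X X"
  by (rule retractI[OF hom_id hom_id]) simp

lemma retract_trans:
  assumes "retract A X Y" "retract A Y Z"
  shows "retract A X Z"
proof -
  obtain s r where 1: "s \<in> module_hom A X Y" "r \<in> module_hom A Y X" "\<And>x. x \<in> carrier X \<Longrightarrow> r (s x) = x"
    using assms(1) by (rule retractE) blast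
  obtain s' r' where 2: "s' \<in> module_hom A Y Z" "r' \<in> module_hom A Z Y" "\<And>x. x \<in> carrier Y \<Longrightarrow> r' (s' x) = x"
    using assms(2) by (rule retractE) blast
  show ?thesis
    by (rule retractI[OF hom_comp[OF 1(1) 2(1)] hom_comp[OF 2(2) 1(2)]])
      (simp add: 1(3) 2(3) hom_closed[OF 1(1)])
qed

lemma retract_epi:
  assumes "retract A X Y" "left_module A X"
  obtains r where "r \<in> module_epi A Y X"
  using assms(1) by (rule retractE) (metis epiI hom_closed)

lemma retract_mono:
  assumes "retract A X Y"
  obtains s where "s \<in> module_mono A X Y"
  using assms by (rule retractE) (auto simp: module_mono_def inj_on_def, metis)

lemma retract_prod_fst: "left_module A M \<Longrightarrow> left_module A N \<Longrightarrow> retract A M (prod_module M N)"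
  by (rule retractI[OF hom_incl_fst hom_fst]) auto

lemma retract_prod_snd: "left_module A M \<Longrightarrow> left_module A N \<Longrightarrow> retract A N (prod_module M N)"
  by (rule retractI[OF hom_incl_snd hom_snd]) auto

lemma retract_prod:
  assumes "retract A X Y" "retract A X' Y'"
  shows "retract A (prod_module X X') (prod_module Y Y')"
proof -
  obtain s r where 1: "s \<in> module_hom A X Y" "r \<in> module_hom A Y X" "\<And>x. x \<in> carrier X \<Longrightarrow> r (s x) = x"
    using assms(1) by (rule retractE) blast
  obtain s' r' where 2: "s' \<in> module_hom A X' Y'" "r' \<in> module_hom A Y' X'"
      "\<And>x. x \<in> carrier X' \<Longrightarrow> r' (s' x) = x"
    using assms(2) by (rule retractE) blast
  show ?thesis
    by (rule retractI[OF hom_pair[OF hom_comp[OF hom_fst 1(1)] hom_comp[OF hom_snd 2(1)]]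
          hom_pair[OF hom_comp[OF hom_fst 1(2)] hom_comp[OF hom_snd 2(2)]]])
      (use 1(3) 2(3) in auto)
qed

lemma bij_hom_inverse:
  assumes "f \<in> module_hom A M N" "bij_betw f (carrier M) (carrier N)" "left_module A M"
  obtains g where "g \<in> module_hom A N M" "\<And>x. x \<in> carrier M \<Longrightarrow> g (f x) = x"
    "\<And>y. y \<in> carrier N \<Longrightarrow> f (g y) = y"
proof -
  interpret left_module A M by fact
  define g where "g = inv_into (carrier M) f"
  have gf: "g (f x) = x" if "x \<in> carrier M" for x
    using that assms(2) by (auto simp: g_def bij_betw_def)
  have fg: "f (g y) = y" "g y \<in> carrier M" if "y \<in> carrier N" for y
    using that assms(2) by (auto simp: g_def bij_betw_def f_inv_into_f inv_into_into)
  have "g \<in> module_hom A N M"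
  proof (rule module_homI)
    show "g (x \<oplus>\<^bsub>N\<^esub> y) = g x \<oplus>\<^bsub>M\<^esub> g y" if "x \<in> carrier N" "y \<in> carrier N" for x y
      using that gf[of "g x \<oplus>\<^bsub>M\<^esub> g y"] fg by (simp add: hom_add[OF assms(1)])
    show "g (a \<odot>\<^bsub>N\<^esub> x) = a \<odot>\<^bsub>M\<^esub> g x" if "a \<in> carrier A" "x \<in> carrier N" for a x
      using that gf[of "a \<odot>\<^bsub>M\<^esub> g x"] fg by (simp add: hom_smult[OF assms(1)] smult_closed)
  qed (use fg in auto)
  with gf fg(1) that show thesis by blast
qed

lemma isomorphic_modulesE:
  assumes "isomorphic_modules A M N" "left_module A M"
  obtains f g where "f \<in> module_hom A M N" "g \<in> module_hom A N M"
    "\<And>x. x \<in> carrier M \<Longrightarrow> g (f x) = x" "\<And>y. y \<in> carrier N \<Longrightarrow> f (g y) = y"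
proof -
  obtain f where f: "f \<in> module_hom A M N" "bij_betw f (carrier M) (carrier N)"
    using assms(1) by (auto simp: isomorphic_modules_def)
  show thesis by (rule bij_hom_inverse[OF f assms(2)]) (rule that[OF f(1)])
qed

lemma isomorphic_modulesI:
  assumes "f \<in> module_hom A M N" "g \<in> module_hom A N M"
    "\<And>x. x \<in> carrier M \<Longrightarrow> g (f x) = x" "\<And>y. y \<in> carrier N \<Longrightarrow> f (g y) = y"
  shows "isomorphic_modules A M N"
  unfolding isomorphic_modules_def
  by (rule bexI[OF _ assms(1)], rule bij_betw_byWitness[where f' = g])
    (use assms(3,4) hom_closed[OF assms(1)] hom_closed[OF assms(2)] in auto)

lemma isomorphic_modules_refl: "isomorphic_modules A M M"
  by (rule isomorphic_modulesI[OF hom_id hom_id]) auto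

lemma isomorphic_modules_sym:
  assumes "isomorphic_modules A M N" "left_module A M"
  shows "isomorphic_modules A N M"
  using assms by (rule isomorphic_modulesE) (rule isomorphic_modulesI)

lemma isomorphic_modules_trans [trans]:
  assumes "isomorphic_modules A M N" "isomorphic_modules A N P"
  shows "isomorphic_modules A M P"
proof -
  obtain f g where "f \<in> module_hom A M N" "bij_betw f (carrier M) (carrier N)"
      "g \<in> module_hom A N P" "bij_betw g (carrier N) (carrier P)"
    using assms by (auto simp: isomorphic_modules_def)
  then have "(\<lambda>x. g (f x)) \<in> module_hom A M P" "bij_betw (\<lambda>x. g (f x)) (carrier M) (carrier P)"
    using hom_comp[of f A M N g P] bij_betw_trans[of f "carrier M" "carrier N" g "carrier P"]
    by (simp_all add: comp_def)
  then show ?thesis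
    unfolding isomorphic_modules_def by blast
qed

lemma isomorphic_retract: "isomorphic_modules A M N \<Longrightarrow> left_module A M \<Longrightarrow> retract A M N"
  by (erule (1) isomorphic_modulesE) (rule retractI)

lemma isomorphic_prod:
  assumes "isomorphic_modules A M N" "isomorphic_modules A M' N'" "left_module A M" "left_module A M'"
  shows "isomorphic_modules A (prod_module M M') (prod_module N N')"
proof -
  obtain f g where 1: "f \<in> module_hom A M N" "g \<in> module_hom A N M"
    "\<And>x. x \<in> carrier M \<Longrightarrow> g (f x) = x" "\<And>y. y \<in> carrier N \<Longrightarrow> f (g y) = y"
    by (rule isomorphic_modulesE[OF assms(1,3)]) blast
  obtain f' g' where 2: "f' \<in> module_hom A M' N'" "g' \<in> module_hom A N' M'"
    "\<And>x. x \<in> carrier M' \<Longrightarrow> g' (f' x) = x" "\<And>y. y \<in> carrier N' \<Longrightarrow> f' (g' y) = y"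
    by (rule isomorphic_modulesE[OF assms(2,4)]) blast
  show ?thesis
    by (rule isomorphic_modulesI[OF hom_pair[OF hom_comp[OF hom_fst 1(1)] hom_comp[OF hom_snd 2(1)]]
          hom_pair[OF hom_comp[OF hom_fst 1(2)] hom_comp[OF hom_snd 2(2)]]])
      (use 1(3,4) 2(3,4) in auto)
qed

lemma complementary_projection:
  assumes "complementary_submodules A M H K" "left_module A M"
  obtains e where "e \<in> module_hom A M M" "\<And>x. x \<in> carrier M \<Longrightarrow> e x \<in> H" "\<And>x. x \<in> H \<Longrightarrow> e x = x"
    "\<And>x. x \<in> K \<Longrightarrow> e x = \<zero>\<^bsub>M\<^esub>" "\<And>x. x \<in> carrier M \<Longrightarrow> x \<ominus>\<^bsub>M\<^esub> e x \<in> K"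
proof -
  interpret left_module A M by fact
  have H: "submodule H A M" and K: "submodule K A M" and HK: "H \<inter> K = {\<zero>\<^bsub>M\<^esub>}"
    and sum: "H <+>\<^bsub>M\<^esub> K = carrier M"
    using assms(1) by (auto simp: complementary_submodules_def)
  note mem = submodule_mem[OF H] submodule_mem[OF K]
  \<comment> \<open>The component of \<open>x\<close> in \<open>H\<close>. Additivity and linearity
    are read off from its uniqueness, which holds because \<open>H\<close> and \<open>K\<close> meet
    only in zero.\<close>
  define e where "e = (\<lambda>x. SOME h. h \<in> H \<and> x \<ominus>\<^bsub>M\<^esub> h \<in> K)"
  have ex: "\<exists>h. h \<in> H \<and> x \<ominus>\<^bsub>M\<^esub> h \<in> K" if "x \<in> carrier M" for x
  proof -
    have "x \<in> H <+>\<^bsub>M\<^esub> K" using that sum by simp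
    then obtain h k where hk: "h \<in> H" "k \<in> K" "x = h \<oplus>\<^bsub>M\<^esub> k" unfolding set_add_iff by blast
    then have "x \<ominus>\<^bsub>M\<^esub> h = k" using mem by (metis M.a_comm add_minus_cancel_right)
    with hk show ?thesis by (intro exI[of _ h]) simp
  qed
  have e: "e x \<in> H" "x \<ominus>\<^bsub>M\<^esub> e x \<in> K" if "x \<in> carrier M" for x
    using someI_ex[OF ex[OF that]] by (auto simp: e_def)
  have uniq: "h = e x" if "x \<in> carrier M" "h \<in> H" "x \<ominus>\<^bsub>M\<^esub> h \<in> K" for x h
  proof -
    have "h \<ominus>\<^bsub>M\<^esub> x \<in> K"
      using submodule_a_inv[OF K that(3)] that(1) mem(1)[OF that(2)] by (simp add: minus_swap)
    from submodule_add[OF K this e(2)[OF that(1)]] have "h \<ominus>\<^bsub>M\<^esub> e x \<in> K"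
      using that(1) mem(1)[OF that(2)] mem(1)[OF e(1)[OF that(1)]] by (simp add: minus_minus_cancel)
    moreover have "h \<ominus>\<^bsub>M\<^esub> e x \<in> H" by (rule submodule_minus[OF H that(2) e(1)[OF that(1)]])
    ultimately have "h \<ominus>\<^bsub>M\<^esub> e x = \<zero>\<^bsub>M\<^esub>" using HK by auto
    then show ?thesis by (rule eq_if_minus_zero[OF _ mem(1)[OF that(2)] mem(1)[OF e(1)[OF that(1)]]])
  qed
  show thesis
  proof
    show "e \<in> module_hom A M M"
    proof (rule module_homI)
      show "e x \<in> carrier M" if "x \<in> carrier M" for x using e(1)[OF that] mem by simp
      show "e (x \<oplus>\<^bsub>M\<^esub> y) = e x \<oplus>\<^bsub>M\<^esub> e y" if xy: "x \<in> carrier M" "y \<in> carrier M" for x y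
        by (rule uniq[symmetric]) (use xy e mem in \<open>auto simp: minus_add_minus submodule_add[OF H] submodule_add[OF K]\<close>)
      show "e (a \<odot>\<^bsub>M\<^esub> x) = a \<odot>\<^bsub>M\<^esub> e x" if ax: "a \<in> carrier A" "x \<in> carrier M" for a x
        by (rule uniq[symmetric])
          (use ax e mem in \<open>auto simp: smult_closed submodule_smult[OF H] submodule_smult[OF K] simp flip: smult_minus_distr\<close>)
    qed
    show "e x = x" if "x \<in> H" for x
      using uniq[of x x] that mem(1)[OF that] submodule_zero[OF K] by (simp add: minus_self)
    show "e x = \<zero>\<^bsub>M\<^esub>" if "x \<in> K" for x
      using uniq[of x "\<zero>\<^bsub>M\<^esub>"] that mem(2)[OF that] submodule_zero[OF H] by (simp add: minus_zero_right)
  qed (use e in auto)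
qed

lemma retract_complementary:
  assumes "left_module A X" "left_module A Y" "s \<in> module_hom A X Y" "r \<in> module_hom A Y X"
    and rs: "\<And>x. x \<in> carrier X \<Longrightarrow> r (s x) = x"
  shows "complementary_submodules A Y (s ` carrier X) (a_kernel Y X r)"
  unfolding complementary_submodules_def
proof (intro conjI)
  interpret X: left_module A X by fact
  interpret Y: left_module A Y by fact
  show "submodule (s ` carrier X) A Y" by (rule submodule_range) fact+
  show "submodule (a_kernel Y X r) A Y" by (rule submodule_ker) fact+
  show "s ` carrier X \<inter> a_kernel Y X r = {\<zero>\<^bsub>Y\<^esub>}"
    using assms hom_zero[OF assms(3)] hom_zero[OF assms(4)] hom_closed[OF assms(3)]
    by (auto simp: ker_iff) (metis X.M.zero_closed image_eqI)
  show "s ` carrier X <+>\<^bsub>Y\<^esub> a_kernel Y X r = carrier Y"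
  proof (intro equalityI subsetI)
    fix y assume y: "y \<in> carrier Y"
    have "s (r y) \<in> s ` carrier X" using y hom_closed[OF assms(4)] by auto
    moreover have "y \<ominus>\<^bsub>Y\<^esub> s (r y) \<in> a_kernel Y X r"
      using y hom_closed[OF assms(4)] hom_closed[OF assms(3)] rs
      by (simp add: ker_iff hom_minus[OF assms(4,2,1)] X.minus_self)
    moreover have "y = s (r y) \<oplus>\<^bsub>Y\<^esub> (y \<ominus>\<^bsub>Y\<^esub> s (r y))"
      using y hom_closed[OF assms(4)] hom_closed[OF assms(3)] by (simp add: Y.add_minus_cancel)
    ultimately show "y \<in> s ` carrier X <+>\<^bsub>Y\<^esub> a_kernel Y X r" unfolding set_add_iff by blast
  qed (use hom_closed[OF assms(3)] in \<open>auto simp: set_add_iff ker_iff\<close>)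
qed

lemma complementary_isomorphic:
  assumes "complementary_submodules A M H K" "left_module A M"
  shows "isomorphic_modules A M (prod_module (M\<lparr>carrier := H\<rparr>) (M\<lparr>carrier := K\<rparr>))"
proof -
  interpret left_module A M by fact
  have H: "submodule H A M" and K: "submodule K A M" 
    using assms(1) by (auto simp: complementary_submodules_def)
  note mem = submodule_mem[OF H] submodule_mem[OF K]
  obtain e where e: "e \<in> module_hom A M M" "\<And>x. x \<in> carrier M \<Longrightarrow> e x \<in> H" "\<And>x. x \<in> H \<Longrightarrow> e x = x"
    "\<And>x. x \<in> K \<Longrightarrow> e x = \<zero>\<^bsub>M\<^esub>" "\<And>x. x \<in> carrier M \<Longrightarrow> x \<ominus>\<^bsub>M\<^esub> e x \<in> K"
    by (rule complementary_projection[OF assms]) blast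
  have e_add: "e (h \<oplus>\<^bsub>M\<^esub> k) = h" if "h \<in> H" "k \<in> K" for h k
    using that e(3,4) mem by (simp add: hom_add[OF e(1)])
  have k_eq: "h \<oplus>\<^bsub>M\<^esub> k \<ominus>\<^bsub>M\<^esub> h = k" if "h \<in> H" "k \<in> K" for h k
    using that mem by (metis M.a_comm add_minus_cancel_right)
  show ?thesis
  proof (rule isomorphic_modulesI)
    show "(\<lambda>x. (e x, x \<ominus>\<^bsub>M\<^esub> e x)) \<in> module_hom A M (prod_module (M\<lparr>carrier := H\<rparr>) (M\<lparr>carrier := K\<rparr>))"
      by (intro hom_pair hom_restrict_cod hom_minusf hom_id e(1,2,5) left_module_axioms)
    show "(\<lambda>z. fst z \<oplus>\<^bsub>M\<^esub> snd z) \<in> module_hom A (prod_module (M\<lparr>carrier := H\<rparr>) (M\<lparr>carrier := K\<rparr>)) M"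
      by (intro hom_copair hom_incl submodule_subset[OF H] submodule_subset[OF K]) fact
  qed (use e_add k_eq hom_closed[OF e(1)] in \<open>auto simp: add_minus_cancel\<close>)
qed

lemma fg_moduleI:
  assumes "left_module A M" "finite S" "S \<subseteq> carrier M"
    and "\<And>H x. submodule H A M \<Longrightarrow> S \<subseteq> H \<Longrightarrow> x \<in> carrier M \<Longrightarrow> x \<in> H"
  shows "fg_module A M"
proof -
  have "H = carrier M" if "submodule H A M" "S \<subseteq> H" for H
    using assms(4)[OF that] submodule_subset[OF that(1)] by blast
  with assms(1-3) show ?thesis unfolding fg_module_def by blast
qed

lemma fg_moduleE:
  assumes "fg_module A M"
  obtains S where "finite S" "S \<subseteq> carrier M" "\<And>H. submodule H A M \<Longrightarrow> S \<subseteq> H \<Longrightarrow> H = carrier M"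
  using assms by (auto simp: fg_module_def)

lemma fg_epi:
  assumes "fg_module A M" "f \<in> module_epi A M N" "left_module A N"
  shows "fg_module A N"
proof -
  note f = epi_hom[OF assms(2)] and M = fg_left_module[OF assms(1)]
  obtain S where S: "finite S" "S \<subseteq> carrier M" "\<And>H. submodule H A M \<Longrightarrow> S \<subseteq> H \<Longrightarrow> H = carrier M"
    by (rule fg_moduleE[OF assms(1)]) blast
  show ?thesis
  proof (rule fg_moduleI)
    show "f ` S \<subseteq> carrier N" using S(2) hom_closed[OF f] by auto
    fix H x assume H: "submodule H A N" "f ` S \<subseteq> H" and x: "x \<in> carrier N"
    have "{x \<in> carrier M. f x \<in> H} = carrier M"
      by (rule S(3)[OF submodule_preimage[OF f M assms(3) H(1)]]) (use S(2) H(2) in auto)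
    then show "x \<in> H" using epi_surj[OF assms(2) x] by blast
  qed (use assms S in auto)
qed

lemma fg_retract:
  assumes "retract A X Y" "fg_module A Y" "left_module A X"
  shows "fg_module A X"
  by (rule retract_epi[OF assms(1,3)], rule fg_epi[OF assms(2) _ assms(3)])

lemma fg_isomorphic:
  assumes "isomorphic_modules A M N" "fg_module A M" "left_module A N"
  shows "fg_module A N"
  using fg_retract[OF isomorphic_retract[OF isomorphic_modules_sym[OF assms(1)]] assms(2,3)] assms(2,3)
    fg_left_module by blast

lemma fg_zero:
  assumes "left_module A M" "carrier M = {\<zero>\<^bsub>M\<^esub>}"
  shows "fg_module A M"
  by (rule fg_moduleI[of _ _ "{}"]) (use assms submodule_zero in auto)

lemma fg_prod:
  assumes "fg_module A M" "fg_module A N"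
  shows "fg_module A (prod_module M N)"
proof -
  note M = fg_left_module[OF assms(1)] and N = fg_left_module[OF assms(2)]
  interpret M: left_module A M by fact
  interpret N: left_module A N by fact
  obtain S where S: "finite S" "S \<subseteq> carrier M" "\<And>H. submodule H A M \<Longrightarrow> S \<subseteq> H \<Longrightarrow> H = carrier M"
    by (rule fg_moduleE[OF assms(1)]) blast
  obtain T where T: "finite T" "T \<subseteq> carrier N" "\<And>H. submodule H A N \<Longrightarrow> T \<subseteq> H \<Longrightarrow> H = carrier N"
    by (rule fg_moduleE[OF assms(2)]) blast
  show ?thesis
  proof (rule fg_moduleI)
    show "left_module A (prod_module M N)" by (rule prod_left_module) fact+
    show "finite (S \<times> {\<zero>\<^bsub>N\<^esub>} \<union> {\<zero>\<^bsub>M\<^esub>} \<times> T)" using S T by auto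
    show "S \<times> {\<zero>\<^bsub>N\<^esub>} \<union> {\<zero>\<^bsub>M\<^esub>} \<times> T \<subseteq> carrier (prod_module M N)" using S(2) T(2) by auto
    fix H z assume H: "submodule H A (prod_module M N)" "S \<times> {\<zero>\<^bsub>N\<^esub>} \<union> {\<zero>\<^bsub>M\<^esub>} \<times> T \<subseteq> H"
      and "z \<in> carrier (prod_module M N)"
    then obtain x y where z: "z = (x, y)" "x \<in> carrier M" "y \<in> carrier N" by auto
    have "{x \<in> carrier M. (x, \<zero>\<^bsub>N\<^esub>) \<in> H} = carrier M"
      by (rule S(3)[OF submodule_preimage[OF hom_incl_fst[OF N] M prod_left_module[OF M N] H(1)]])
        (use S(2) H(2) in auto)
    moreover have "{y \<in> carrier N. (\<zero>\<^bsub>M\<^esub>, y) \<in> H} = carrier N"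
      by (rule T(3)[OF submodule_preimage[OF hom_incl_snd[OF M] N prod_left_module[OF M N] H(1)]])
        (use T(2) H(2) in auto)
    ultimately have "(x, \<zero>\<^bsub>N\<^esub>) \<in> H" "(\<zero>\<^bsub>M\<^esub>, y) \<in> H" using z by blast+
    from submodule_add[OF H(1) this] show "z \<in> H" using z by simp
  qed
qed

text \<open>Coefficients are functions on all of \<open>nat\<close>, of which only an initial part
  is read. A set of coefficient families then has exactly the element type of a
  \<open>std_module\<close>.\<close>

fun lincomb :: "('a, 'm) module \<Rightarrow> 'm list \<Rightarrow> (nat \<Rightarrow> 'a) \<Rightarrow> 'm" where
  "lincomb M [] c = \<zero>\<^bsub>M\<^esub>"
| "lincomb M (g # gs) c = c 0 \<odot>\<^bsub>M\<^esub> g \<oplus>\<^bsub>M\<^esub> lincomb M gs (\<lambda>i. c (Suc i))"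

context left_module
begin

lemma lincomb_closed: "set gs \<subseteq> carrier M \<Longrightarrow> (\<And>i. c i \<in> carrier A) \<Longrightarrow> lincomb M gs c \<in> carrier M"
  by (induction gs arbitrary: c) (auto simp: smult_closed)

lemma lincomb_add: "set gs \<subseteq> carrier M \<Longrightarrow> (\<And>i. c i \<in> carrier A) \<Longrightarrow> (\<And>i. d i \<in> carrier A) \<Longrightarrow>
    lincomb M gs (\<lambda>i. c i \<oplus>\<^bsub>A\<^esub> d i) = lincomb M gs c \<oplus>\<^bsub>M\<^esub> lincomb M gs d"
  by (induction gs arbitrary: c d)
    (auto simp: smult_closed smult_l_distr M.a_ac lincomb_closed)

lemma lincomb_smult: "set gs \<subseteq> carrier M \<Longrightarrow> (\<And>i. c i \<in> carrier A) \<Longrightarrow> a \<in> carrier A \<Longrightarrow>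
    lincomb M gs (\<lambda>i. a \<otimes>\<^bsub>A\<^esub> c i) = a \<odot>\<^bsub>M\<^esub> lincomb M gs c"
  by (induction gs arbitrary: c)
    (auto simp: smult_closed smult_r_distr smult_r_null smult_assoc lincomb_closed)

lemma lincomb_zero: "set gs \<subseteq> carrier M \<Longrightarrow> lincomb M gs (\<lambda>i. \<zero>\<^bsub>A\<^esub>) = \<zero>\<^bsub>M\<^esub>"
  by (induction gs) (auto simp: smult_l_null)

lemma lincomb_mem: "submodule H A M \<Longrightarrow> set gs \<subseteq> H \<Longrightarrow> (\<And>i. c i \<in> carrier A) \<Longrightarrow> lincomb M gs c \<in> H"
  by (induction gs arbitrary: c) (auto simp: submodule_zero submodule_add submodule_smult)

lemma lincomb_gen: "set gs \<subseteq> carrier M \<Longrightarrow> g \<in> set gs \<Longrightarrow> \<exists>c. (\<forall>i. c i \<in> carrier A) \<and> g = lincomb M gs c"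
proof (induction gs)
  case (Cons h gs)
  show ?case
  proof (cases "g = h")
    case True
    then show ?thesis using Cons.prems
      by (intro exI[of _ "\<lambda>i. if i = 0 then \<one>\<^bsub>A\<^esub> else \<zero>\<^bsub>A\<^esub>"]) (auto simp: smult_one lincomb_zero)
  next
    case False
    then obtain c where "\<forall>i. c i \<in> carrier A" "g = lincomb M gs c" using Cons by auto
    then show ?thesis using Cons.prems
      by (intro exI[of _ "case_nat \<zero>\<^bsub>A\<^esub> c"]) (auto simp: smult_l_null split: nat.split)
  qed
qed simp

lemma lincomb_submodule:
  assumes "set gs \<subseteq> carrier M"
  shows "submodule {lincomb M gs c | c. \<forall>i. c i \<in> carrier A} A M"
proof (rule submoduleI)
  show "{lincomb M gs c | c. \<forall>i. c i \<in> carrier A} \<subseteq> carrier M"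
    using assms lincomb_closed by auto
  show "\<zero>\<^bsub>M\<^esub> \<in> {lincomb M gs c | c. \<forall>i. c i \<in> carrier A}"
    using lincomb_zero[OF assms] by force
  fix x y assume "x \<in> {lincomb M gs c | c. \<forall>i. c i \<in> carrier A}" "y \<in> {lincomb M gs c | c. \<forall>i. c i \<in> carrier A}"
  then obtain c d where "\<forall>i. c i \<in> carrier A" "\<forall>i. d i \<in> carrier A" "x = lincomb M gs c" "y = lincomb M gs d"
    by auto
  then show "x \<oplus>\<^bsub>M\<^esub> y \<in> {lincomb M gs c | c. \<forall>i. c i \<in> carrier A}"
    using lincomb_add[OF assms, of c d] by (auto intro!: exI[of _ "\<lambda>i. c i \<oplus>\<^bsub>A\<^esub> d i"])
next
  fix a x assume "x \<in> {lincomb M gs c | c. \<forall>i. c i \<in> carrier A}" and a: "a \<in> carrier A"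
  then obtain c where "\<forall>i. c i \<in> carrier A" "x = lincomb M gs c"
    by auto
  then show "a \<odot>\<^bsub>M\<^esub> x \<in> {lincomb M gs c | c. \<forall>i. c i \<in> carrier A}"
    using lincomb_smult[OF assms, of c a] a by (auto intro!: exI[of _ "\<lambda>i. a \<otimes>\<^bsub>A\<^esub> c i"])
qed

end

lemma fg_generators:
  assumes "fg_module A M"
  obtains gs where "set gs \<subseteq> carrier M"
    "\<And>x. x \<in> carrier M \<Longrightarrow> \<exists>c. (\<forall>i. c i \<in> carrier A) \<and> x = lincomb M gs c"
proof -
  interpret left_module A M by (rule fg_left_module) fact
  obtain S where S: "finite S" "S \<subseteq> carrier M" "\<And>H. submodule H A M \<Longrightarrow> S \<subseteq> H \<Longrightarrow> H = carrier M"
    by (rule fg_moduleE[OF assms(1)]) blast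
  obtain gs where gs: "set gs = S" using finite_list[OF S(1)] by blast
  have "{lincomb M gs c | c. \<forall>i. c i \<in> carrier A} = carrier M"
    using gs S(2) lincomb_gen[of gs] by (intro S(3) lincomb_submodule) auto
  then have "\<exists>c. (\<forall>i. c i \<in> carrier A) \<and> x = lincomb M gs c" if "x \<in> carrier M" for x
    using that by blast
  with S(2) gs that[of gs] show thesis by blast
qed

text \<open>An element of \<open>M / H\<close> is encoded as the set of all coefficient families,
  over a fixed list of generators, whose combination lies in the given coset. Since every element of
  \<open>M\<close> is such a combination, different cosets yield different sets, and
  \<open>pushforward_module\<close> applies.\<close>

lemma std_quotient:
  fixes A :: "('a, 'x) ring_scheme" and M :: "('a, 'm) module"
  assumes "fg_module A M" "submodule H A M"
  obtains N :: "'a std_module" and q where "fg_module A N" "q \<in> module_epi A M N" "a_kernel M N q = H"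
proof -
  interpret left_module A M by (rule fg_left_module) fact
  obtain gs where gs: "set gs \<subseteq> carrier M"
    "\<And>x. x \<in> carrier M \<Longrightarrow> \<exists>c. (\<forall>i. c i \<in> carrier A) \<and> x = lincomb M gs c"
    by (rule fg_generators[OF assms(1)]) blast
  define q where "q = (\<lambda>x. {c. (\<forall>i. c i \<in> carrier A) \<and> lincomb M gs c \<ominus>\<^bsub>M\<^esub> x \<in> H})"
  have "q x = q y \<longleftrightarrow> x \<ominus>\<^bsub>M\<^esub> y \<in> H" if xy: "x \<in> carrier M" "y \<in> carrier M" for x y
  proof
    assume eq: "q x = q y"
    obtain c where c: "\<forall>i. c i \<in> carrier A" "x = lincomb M gs c" using gs(2) xy(1) by blast
    then have "c \<in> q x" using xy(1) submodule_zero[OF assms(2)] by (simp add: q_def minus_self)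
    then show "x \<ominus>\<^bsub>M\<^esub> y \<in> H" unfolding eq using c by (simp add: q_def)
  next
    assume H: "x \<ominus>\<^bsub>M\<^esub> y \<in> H"
    then have H': "y \<ominus>\<^bsub>M\<^esub> x \<in> H" using submodule_a_inv[OF assms(2) H] xy by (simp add: minus_swap)
    show "q x = q y"
    proof (intro equalityI subsetI)
      fix c assume "c \<in> q x"
      then have c: "\<forall>i. c i \<in> carrier A" "lincomb M gs c \<ominus>\<^bsub>M\<^esub> x \<in> H" by (auto simp: q_def)
      then show "c \<in> q y"
        using submodule_add[OF assms(2) c(2) H] xy gs(1) by (simp add: q_def minus_minus_cancel lincomb_closed)
    next
      fix c assume "c \<in> q y"
      then have c: "\<forall>i. c i \<in> carrier A" "lincomb M gs c \<ominus>\<^bsub>M\<^esub> y \<in> H" by (auto simp: q_def)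
      then show "c \<in> q x"
        using submodule_add[OF assms(2) c(2) H'] xy gs(1) by (simp add: q_def minus_minus_cancel lincomb_closed)
    qed
  qed
  then obtain N :: "'a std_module" where N: "left_module A N" "q \<in> module_epi A M N" "a_kernel M N q = H"
    by (rule pushforward_module[OF left_module_axioms assms(2)]) blast+
  with fg_epi[OF assms(1) N(2,1)] that show thesis by blast
qed

lemma std_representative:
  fixes A :: "('a, 'x) ring_scheme" and M :: "('a, 'm) module"
  assumes "fg_module A M"
  obtains N :: "'a std_module" where "fg_module A N" "isomorphic_modules A M N"
proof -
  note M = fg_left_module[OF assms]
  obtain N :: "'a std_module" and q where N: "fg_module A N" "q \<in> module_epi A M N" "a_kernel M N q = {\<zero>\<^bsub>M\<^esub>}"
    using std_quotient[OF assms left_module.zero_submodule[OF M]] by blast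
  have "q \<in> module_mono A M N"
    using N(3) by (intro monoI epi_hom[OF N(2)] M fg_left_module[OF N(1)]) (auto simp: a_kernel_def')
  with N(2) have "isomorphic_modules A M N"
    unfolding isomorphic_modules_def bij_betw_def module_mono_def module_epi_def by blast
  with N(1) that show thesis by blast
qed

section \<open>Finite direct sums\<close>

lemma direct_sum_simps:
  "carrier (direct_sum Ms) = (\<Pi>\<^sub>E i\<in>{..<length Ms}. carrier (Ms ! i))"
  "\<zero>\<^bsub>direct_sum Ms\<^esub> = (\<lambda>i\<in>{..<length Ms}. \<zero>\<^bsub>Ms ! i\<^esub>)"
  "x \<oplus>\<^bsub>direct_sum Ms\<^esub> y = (\<lambda>i\<in>{..<length Ms}. x i \<oplus>\<^bsub>Ms ! i\<^esub> y i)"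
  "a \<odot>\<^bsub>direct_sum Ms\<^esub> x = (\<lambda>i\<in>{..<length Ms}. a \<odot>\<^bsub>Ms ! i\<^esub> x i)"
  by (simp_all add: direct_sum_def)

lemma direct_sum_left_module:
  assumes "ring A" "\<And>M. M \<in> set Ms \<Longrightarrow> left_module A M"
  shows "left_module A (direct_sum Ms)"
proof -
  have lm: "left_module A (Ms ! i)" if "i < length Ms" for i
    using assms(2) that by simp
  have ag: "abelian_group (Ms ! i)" "abelian_monoid (Ms ! i)" if "i < length Ms" for i
    using left_module.axioms(2)[OF lm[OF that]] abelian_group.axioms(1) by auto
  note rules = abelian_monoid.a_closed[OF ag(2)] abelian_monoid.zero_closed[OF ag(2)]
    abelian_monoid.l_zero[OF ag(2)] abelian_group.a_inv_closed[OF ag(1)] abelian_group.l_neg[OF ag(1)]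
    left_module.smult_closed[OF lm] left_module.smult_one[OF lm] left_module.smult_assoc[OF lm]
    left_module.smult_l_distr[OF lm] left_module.smult_r_distr[OF lm] abelian_monoid.a_assoc[OF ag(2)]
  show ?thesis
  proof (rule left_moduleI)
    fix x y assume "x \<in> carrier (direct_sum Ms)" "y \<in> carrier (direct_sum Ms)"
    then show "x \<oplus>\<^bsub>direct_sum Ms\<^esub> y = y \<oplus>\<^bsub>direct_sum Ms\<^esub> x"
      by (auto simp: direct_sum_simps PiE_iff fun_eq_iff restrict_def abelian_monoid.a_comm[OF ag(2)])
  next
    fix x assume "x \<in> carrier (direct_sum Ms)"
    then show "\<exists>y\<in>carrier (direct_sum Ms). y \<oplus>\<^bsub>direct_sum Ms\<^esub> x = \<zero>\<^bsub>direct_sum Ms\<^esub>"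
      by (intro bexI[of _ "\<lambda>i\<in>{..<length Ms}. \<ominus>\<^bsub>Ms ! i\<^esub> x i"])
        (auto simp: direct_sum_simps PiE_iff fun_eq_iff restrict_def rules extensional_def)
  qed (use assms(1) in \<open>auto simp: direct_sum_simps PiE_iff fun_eq_iff restrict_def extensional_def rules\<close>)
qed

lemma direct_sum_append:
  "isomorphic_modules A (direct_sum (Ms @ Ns)) (prod_module (direct_sum Ms) (direct_sum Ns))"
proof (rule isomorphic_modulesI)
  let ?m = "length Ms" and ?n = "length Ns"
  let ?f = "\<lambda>x. ((\<lambda>i\<in>{..<?m}. x i), (\<lambda>i\<in>{..<?n}. x (?m + i)))"
  let ?g = "\<lambda>z. (\<lambda>i\<in>{..<?m + ?n}. if i < ?m then fst z i else snd z (i - ?m))"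
  show "?f \<in> module_hom A (direct_sum (Ms @ Ns)) (prod_module (direct_sum Ms) (direct_sum Ns))"
  proof (rule module_homI)
    fix x assume "x \<in> carrier (direct_sum (Ms @ Ns))"
    then have x: "x i \<in> carrier ((Ms @ Ns) ! i)" if "i < ?m + ?n" for i
      using that by (auto simp: direct_sum_simps)
    show "?f x \<in> carrier (prod_module (direct_sum Ms) (direct_sum Ns))"
    proof -
      have "x i \<in> carrier (Ms ! i)" if "i < ?m" for i
        using x[of i] that by (simp add: nth_append)
      moreover have "x (?m + i) \<in> carrier (Ns ! i)" if "i < ?n" for i
        using x[of "?m + i"] that by (simp add: nth_append)
      ultimately show ?thesis by (auto simp: direct_sum_simps)
    qed
  qed (auto simp: direct_sum_simps nth_append fun_eq_iff restrict_def)
  show "?g \<in> module_hom A (prod_module (direct_sum Ms) (direct_sum Ns)) (direct_sum (Ms @ Ns))"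
    by (rule module_homI) (auto simp: direct_sum_simps nth_append fun_eq_iff restrict_def PiE_iff extensional_def)
  show "?g (?f x) = x" if "x \<in> carrier (direct_sum (Ms @ Ns))" for x
    using that by (auto simp: direct_sum_simps fun_eq_iff restrict_def PiE_iff extensional_def)
  show "?f (?g z) = z" if "z \<in> carrier (prod_module (direct_sum Ms) (direct_sum Ns))" for z
    using that by (cases z) (auto simp: direct_sum_simps fun_eq_iff restrict_def PiE_iff extensional_def)
qed

lemma direct_sum_single: "isomorphic_modules A (direct_sum [M]) M"
proof (rule isomorphic_modulesI)
  show "(\<lambda>x. x 0) \<in> module_hom A (direct_sum [M]) M"
    by (rule module_homI) (simp_all add: direct_sum_simps PiE_iff)
  show "(\<lambda>x. \<lambda>i\<in>{..<Suc 0}. x) \<in> module_hom A M (direct_sum [M])"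
    by (rule module_homI; simp add: direct_sum_simps restrict_def)
      (simp_all add: PiE_iff extensional_def fun_eq_iff)
  show "(\<lambda>i\<in>{..<Suc 0}. x 0) = x" if "x \<in> carrier (direct_sum [M])" for x
  proof
    show "(\<lambda>i\<in>{..<Suc 0}. x 0) i = x i" for i
      using that by (cases i) (simp_all add: direct_sum_simps PiE_iff extensional_def)
  qed
qed simp

lemma direct_sum_Nil:
  "carrier (direct_sum ([] :: ('a, 'm) module list)) = {\<zero>\<^bsub>direct_sum ([] :: ('a, 'm) module list)\<^esub>}"
  by (auto simp: direct_sum_simps)

section \<open>Projective and injective modules\<close>

lemma injective_fg: "injective A I \<Longrightarrow> fg_module A I"
  by (simp add: injective_def)

lemma projective_fg: "projective A P \<Longrightarrow> fg_module A P"
  by (simp add: projective_def)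

lemma injectiveD:
  fixes M N :: "'a std_module"
  assumes "injective A I" "fg_module A M" "fg_module A N" "g \<in> module_mono A M N" "f \<in> module_hom A M I"
  shows "\<exists>h\<in>module_hom A N I. \<forall>x\<in>carrier M. h (g x) = f x"
  using assms(1)[unfolded injective_def, THEN conjunct2, rule_format, of M N g f] assms(2-) by blast

lemma projectiveD:
  fixes M N :: "'a std_module"
  assumes "projective A P" "fg_module A M" "fg_module A N" "g \<in> module_epi A M N" "f \<in> module_hom A P N"
  shows "\<exists>h\<in>module_hom A P M. \<forall>x\<in>carrier P. g (h x) = f x"
  using assms(1)[unfolded projective_def, THEN conjunct2, rule_format, of M N g f] assms(2-) by blast

text \<open>\<open>injective\<close> tests only against modules over the standard element type.
  Replacing \<open>M\<close> and \<open>N\<close> by isomorphic standard modules carries the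
  extension property to every element type; \<open>projective_lift\<close> does the same for
  lifting.\<close>

lemma injective_extend:
  fixes A :: "('a, 'x) ring_scheme" and M :: "('a, 'm) module" and N :: "('a, 'n) module"
  assumes "injective A I" "fg_module A M" "fg_module A N" "g \<in> module_mono A M N" "f \<in> module_hom A M I"
  obtains h where "h \<in> module_hom A N I" "\<And>x. x \<in> carrier M \<Longrightarrow> h (g x) = f x"
proof -
  obtain M' :: "'a std_module" where M': "fg_module A M'" "isomorphic_modules A M M'"
    using std_representative[OF assms(2)] .
  obtain N' :: "'a std_module" where N': "fg_module A N'" "isomorphic_modules A N N'"
    using std_representative[OF assms(3)] .
  obtain a b where ab: "a \<in> module_hom A M M'" "b \<in> module_hom A M' M"
    "\<And>x. x \<in> carrier M \<Longrightarrow> b (a x) = x" "\<And>y. y \<in> carrier M' \<Longrightarrow> a (b y) = y"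
    by (rule isomorphic_modulesE[OF M'(2) fg_left_module[OF assms(2)]]) blast
  obtain c d where cd: "c \<in> module_hom A N N'" "d \<in> module_hom A N' N"
    "\<And>x. x \<in> carrier N \<Longrightarrow> d (c x) = x" "\<And>y. y \<in> carrier N' \<Longrightarrow> c (d y) = y"
    by (rule isomorphic_modulesE[OF N'(2) fg_left_module[OF assms(3)]]) blast
  have inj: "x = y" if "x \<in> carrier M'" "y \<in> carrier M'" "c (g (b x)) = c (g (b y))" for x y
    using that ab cd hom_closed[OF ab(2)] hom_closed[OF mono_hom[OF assms(4)]] mono_eq[OF assms(4)]
    by metis
  have "(\<lambda>x. c (g (b x))) \<in> module_mono A M' N'"
    using hom_comp[OF hom_comp[OF ab(2) mono_hom[OF assms(4)]] cd(1)] inj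
    by (auto simp: module_mono_def inj_on_def)
  moreover have "(\<lambda>x. f (b x)) \<in> module_hom A M' I" by (rule hom_comp[OF ab(2) assms(5)])
  ultimately obtain h where h: "h \<in> module_hom A N' I" "\<And>x. x \<in> carrier M' \<Longrightarrow> h (c (g (b x))) = f (b x)"
    using injectiveD[OF assms(1) M'(1) N'(1)] by blast
  show thesis
  proof
    show "(\<lambda>x. h (c x)) \<in> module_hom A N I" by (rule hom_comp[OF cd(1) h(1)])
    show "h (c (g x)) = f x" if "x \<in> carrier M" for x
      using h(2)[OF hom_closed[OF ab(1) that]] ab(3)[OF that] by simp
  qed
qed

lemma projective_lift:
  fixes A :: "('a, 'x) ring_scheme" and M :: "('a, 'm) module" and N :: "('a, 'n) module"
  assumes "projective A P" "fg_module A M" "fg_module A N" "g \<in> module_epi A M N" "f \<in> module_hom A P N"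
  obtains h where "h \<in> module_hom A P M" "\<And>x. x \<in> carrier P \<Longrightarrow> g (h x) = f x"
proof -
  obtain M' :: "'a std_module" where M': "fg_module A M'" "isomorphic_modules A M M'"
    using std_representative[OF assms(2)] .
  obtain N' :: "'a std_module" where N': "fg_module A N'" "isomorphic_modules A N N'"
    using std_representative[OF assms(3)] .
  obtain a b where ab: "a \<in> module_hom A M M'" "b \<in> module_hom A M' M"
    "\<And>x. x \<in> carrier M \<Longrightarrow> b (a x) = x" "\<And>y. y \<in> carrier M' \<Longrightarrow> a (b y) = y"
    by (rule isomorphic_modulesE[OF M'(2) fg_left_module[OF assms(2)]]) blast
  obtain c d where cd: "c \<in> module_hom A N N'" "d \<in> module_hom A N' N"
    "\<And>x. x \<in> carrier N \<Longrightarrow> d (c x) = x" "\<And>y. y \<in> carrier N' \<Longrightarrow> c (d y) = y"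
    by (rule isomorphic_modulesE[OF N'(2) fg_left_module[OF assms(3)]]) blast
  have "(\<lambda>x. c (g (b x))) \<in> module_epi A M' N'"
  proof (rule epiI[OF hom_comp[OF hom_comp[OF ab(2) epi_hom[OF assms(4)]] cd(1)]])
    fix y assume y: "y \<in> carrier N'"
    obtain x where x: "x \<in> carrier M" "d y = g x" using epi_surj[OF assms(4) hom_closed[OF cd(2) y]] by blast
    show "\<exists>x\<in>carrier M'. c (g (b x)) = y"
      using x ab(3)[OF x(1)] cd(4)[OF y] hom_closed[OF ab(1) x(1)] by (intro bexI[of _ "a x"]) simp_all
  qed
  moreover have "(\<lambda>x. c (f x)) \<in> module_hom A P N'" by (rule hom_comp[OF assms(5) cd(1)])
  ultimately obtain h where h: "h \<in> module_hom A P M'" "\<And>x. x \<in> carrier P \<Longrightarrow> c (g (b (h x))) = c (f x)"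
    using projectiveD[OF assms(1) M'(1) N'(1)] by blast
  show thesis
  proof
    show "(\<lambda>x. b (h x)) \<in> module_hom A P M" by (rule hom_comp[OF h(1) ab(2)])
    fix x assume x: "x \<in> carrier P"
    have "d (c (g (b (h x)))) = d (c (f x))" using h(2)[OF x] by simp
    then show "g (b (h x)) = f x"
      using cd(3) x hom_closed[OF assms(5)] hom_closed[OF epi_hom[OF assms(4)]] hom_closed[OF ab(2)]
        hom_closed[OF h(1)] by simp
  qed
qed

lemma injective_retract:
  assumes "retract A X I" "injective A I" "left_module A X"
  shows "injective A X"
  unfolding injective_def
proof (intro conjI allI impI)
  show "fg_module A X" by (rule fg_retract[OF assms(1) injective_fg[OF assms(2)] assms(3)])
  obtain s r where sr: "s \<in> module_hom A X I" "r \<in> module_hom A I X" "\<And>x. x \<in> carrier X \<Longrightarrow> r (s x) = x"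
    using assms(1) by (rule retractE) blast
  fix M N :: "'a std_module" and g f
  assume *: "fg_module A M \<and> fg_module A N \<and> g \<in> module_mono A M N \<and> f \<in> module_hom A M X"
  then have "(\<lambda>x. s (f x)) \<in> module_hom A M I" using hom_comp[OF _ sr(1)] by blast
  with * obtain h where h: "h \<in> module_hom A N I" "\<And>x. x \<in> carrier M \<Longrightarrow> h (g x) = s (f x)"
    using injective_extend[OF assms(2)] by metis
  then show "\<exists>h\<in>module_hom A N X. \<forall>x\<in>carrier M. h (g x) = f x"
    using * sr(3) hom_closed[of f A M X] by (intro bexI[OF _ hom_comp[OF h(1) sr(2)]]) simp
qed

lemma projective_retract:
  assumes "retract A X P" "projective A P" "left_module A X"
  shows "projective A X"
  unfolding projective_def
proof (intro conjI allI impI)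
  show "fg_module A X" by (rule fg_retract[OF assms(1) projective_fg[OF assms(2)] assms(3)])
  obtain s r where sr: "s \<in> module_hom A X P" "r \<in> module_hom A P X" "\<And>x. x \<in> carrier X \<Longrightarrow> r (s x) = x"
    using assms(1) by (rule retractE) blast
  fix M N :: "'a std_module" and g f
  assume *: "fg_module A M \<and> fg_module A N \<and> g \<in> module_epi A M N \<and> f \<in> module_hom A X N"
  then have "(\<lambda>x. f (r x)) \<in> module_hom A P N" using hom_comp[OF sr(2)] by blast
  with * obtain h where h: "h \<in> module_hom A P M" "\<And>x. x \<in> carrier P \<Longrightarrow> g (h x) = f (r x)"
    using projective_lift[OF assms(2)] by metis
  then show "\<exists>h\<in>module_hom A X M. \<forall>x\<in>carrier X. g (h x) = f x"
    using sr(3) hom_closed[OF sr(1)] by (intro bexI[OF _ hom_comp[OF sr(1) h(1)]]) simp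
qed

lemma injective_prod:
  assumes "injective A I" "injective A J"
  shows "injective A (prod_module I J)"
  unfolding injective_def
proof (intro conjI allI impI)
  show "fg_module A (prod_module I J)" by (intro fg_prod injective_fg assms)
  fix M N :: "'a std_module" and g f
  assume *: "fg_module A M \<and> fg_module A N \<and> g \<in> module_mono A M N \<and> f \<in> module_hom A M (prod_module I J)"
  then obtain h where h: "h \<in> module_hom A N I" "\<And>x. x \<in> carrier M \<Longrightarrow> h (g x) = fst (f x)"
    using injective_extend[OF assms(1)] hom_comp[OF _ hom_fst] by metis
  from * obtain k where k: "k \<in> module_hom A N J" "\<And>x. x \<in> carrier M \<Longrightarrow> k (g x) = snd (f x)"
    using injective_extend[OF assms(2)] hom_comp[OF _ hom_snd] by metis
  show "\<exists>h\<in>module_hom A N (prod_module I J). \<forall>x\<in>carrier M. h (g x) = f x"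
    by (intro bexI[OF _ hom_pair[OF h(1) k(1)]]) (simp add: h k)
qed

lemma projective_prod:
  assumes "projective A P" "projective A P'"
  shows "projective A (prod_module P P')"
  unfolding projective_def
proof (intro conjI allI impI)
  note P = fg_left_module[OF projective_fg[OF assms(1)]] and P' = fg_left_module[OF projective_fg[OF assms(2)]]
  interpret P: left_module A P by (rule P)
  interpret P': left_module A P' by (rule P')
  show "fg_module A (prod_module P P')" by (intro fg_prod projective_fg assms)
  fix M N :: "'a std_module" and g f
  assume *: "fg_module A M \<and> fg_module A N \<and> g \<in> module_epi A M N \<and> f \<in> module_hom A (prod_module P P') N"
  then have g: "g \<in> module_hom A M N" and f: "f \<in> module_hom A (prod_module P P') N"
    and M: "left_module A M" by (auto simp: epi_hom fg_left_module)
  obtain h where h: "h \<in> module_hom A P M" "\<And>x. x \<in> carrier P \<Longrightarrow> g (h x) = f (x, \<zero>\<^bsub>P'\<^esub>)"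
    using projective_lift[OF assms(1), of M N g "\<lambda>x. f (x, \<zero>\<^bsub>P'\<^esub>)"] * hom_comp[OF hom_incl_fst[OF P'] f] by metis
  obtain k where k: "k \<in> module_hom A P' M" "\<And>x. x \<in> carrier P' \<Longrightarrow> g (k x) = f (\<zero>\<^bsub>P\<^esub>, x)"
    using projective_lift[OF assms(2), of M N g "\<lambda>x. f (\<zero>\<^bsub>P\<^esub>, x)"] * hom_comp[OF hom_incl_snd[OF P] f] by metis
  show "\<exists>h\<in>module_hom A (prod_module P P') M. \<forall>x\<in>carrier (prod_module P P'). g (h x) = f x"
  proof (intro bexI[OF _ hom_copair[OF h(1) k(1) M]] ballI)
    fix z assume "z \<in> carrier (prod_module P P')"
    then obtain x y where z: "z = (x, y)" "x \<in> carrier P" "y \<in> carrier P'" by auto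
    then show "g (h (fst z) \<oplus>\<^bsub>M\<^esub> k (snd z)) = f z"
      using hom_add[OF f, of "(x, \<zero>\<^bsub>P'\<^esub>)" "(\<zero>\<^bsub>P\<^esub>, y)"] hom_closed[OF h(1)] hom_closed[OF k(1)]
      by (simp add: hom_add[OF g] h(2) k(2))
  qed
qed

lemma injective_zero:
  assumes "left_module A Z" "carrier Z = {\<zero>\<^bsub>Z\<^esub>}"
  shows "injective A Z"
  unfolding injective_def
proof (intro conjI allI impI)
  show "fg_module A Z" by (rule fg_zero[OF assms])
  fix M N :: "'a std_module" and g f
  assume "fg_module A M \<and> fg_module A N \<and> g \<in> module_mono A M N \<and> f \<in> module_hom A M Z"
  then show "\<exists>h\<in>module_hom A N Z. \<forall>x\<in>carrier M. h (g x) = f x"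
    using hom_closed[of f A M Z] assms(2) by (intro bexI[OF _ hom_zerof[OF assms(1)]]) auto
qed

lemma projective_zero:
  assumes "left_module A Z" "carrier Z = {\<zero>\<^bsub>Z\<^esub>}"
  shows "projective A Z"
  unfolding projective_def
proof (intro conjI allI impI)
  show "fg_module A Z" by (rule fg_zero[OF assms])
  fix M N :: "'a std_module" and g f
  assume *: "fg_module A M \<and> fg_module A N \<and> g \<in> module_epi A M N \<and> f \<in> module_hom A Z N"
  then have M: "left_module A M" and N: "left_module A N" by (auto intro: fg_left_module)
  have "g \<zero>\<^bsub>M\<^esub> = \<zero>\<^bsub>N\<^esub>" "f \<zero>\<^bsub>Z\<^esub> = \<zero>\<^bsub>N\<^esub>"
    using * hom_zero[OF epi_hom M N] hom_zero[OF _ assms(1) N] by auto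
  then show "\<exists>h\<in>module_hom A Z M. \<forall>x\<in>carrier Z. g (h x) = f x"
    using assms(2) by (intro bexI[OF _ hom_zerof[OF M]]) auto
qed

lemma zero_restrict: "left_module A M \<Longrightarrow> left_module A (M\<lparr>carrier := {\<zero>\<^bsub>M\<^esub>}\<rparr>)"
  by (simp add: left_module.zero_submodule submodule_left_module)

section \<open>The regular module\<close>

lemma regular_module_simps [simp]:
  "carrier (regular_module A) = carrier A" "\<zero>\<^bsub>regular_module A\<^esub> = \<zero>\<^bsub>A\<^esub>"
  "x \<oplus>\<^bsub>regular_module A\<^esub> y = x \<oplus>\<^bsub>A\<^esub> y" "a \<odot>\<^bsub>regular_module A\<^esub> x = a \<otimes>\<^bsub>A\<^esub> x"
  by (simp_all add: regular_module_def)

lemma regular_left_module: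
  assumes "ring A"
  shows "left_module A (regular_module A)"
proof -
  interpret ring A by fact
  show ?thesis
    by (rule left_moduleI) (auto simp: ring_axioms a_ac l_distr r_distr m_assoc intro: l_neg)
qed

lemma regular_fg:
  assumes "ring A"
  shows "fg_module A (regular_module A)"
proof -
  interpret ring A by fact
  show ?thesis
  proof (rule fg_moduleI[OF regular_left_module[OF assms], of "{\<one>\<^bsub>A\<^esub>}"])
    fix H x assume "submodule H A (regular_module A)" "{\<one>\<^bsub>A\<^esub>} \<subseteq> H" "x \<in> carrier (regular_module A)"
    then show "x \<in> H" using submodule_smult[of H A "regular_module A" x "\<one>\<^bsub>A\<^esub>"] by simp
  qed auto
qed

lemma hom_regular:
  assumes "left_module A M" "x \<in> carrier M"
  shows "(\<lambda>a. a \<odot>\<^bsub>M\<^esub> x) \<in> module_hom A (regular_module A) M"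
  using assms by (intro module_homI) (auto simp: left_module.smult_closed left_module.smult_l_distr left_module.smult_assoc)

lemma hom_regular_eq:
  assumes "f \<in> module_hom A (regular_module A) M" "ring A" "a \<in> carrier A"
  shows "f a = a \<odot>\<^bsub>M\<^esub> f \<one>\<^bsub>A\<^esub>"
proof -
  interpret ring A by fact
  show ?thesis using hom_smult[OF assms(1,3), of "\<one>\<^bsub>A\<^esub>"] assms(3) by simp
qed

lemma projective_regular:
  assumes "ring A"
  shows "projective A (regular_module A)"
  unfolding projective_def
proof (intro conjI allI impI)
  interpret ring A by fact
  show "fg_module A (regular_module A)" by (rule regular_fg[OF assms])
  fix M N :: "'a std_module" and g f
  assume *: "fg_module A M \<and> fg_module A N \<and> g \<in> module_epi A M N \<and> f \<in> module_hom A (regular_module A) N"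
  then have f: "f \<in> module_hom A (regular_module A) N" by simp
  have "f \<one>\<^bsub>A\<^esub> \<in> carrier N" using hom_closed[OF f] by simp
  with * obtain m where m: "m \<in> carrier M" "g m = f \<one>\<^bsub>A\<^esub>" by (metis epi_surj)
  have "g (a \<odot>\<^bsub>M\<^esub> m) = f a" if "a \<in> carrier A" for a
    using that * m hom_smult[OF epi_hom[of g A M N] that m(1)] hom_regular_eq[OF f assms that] by simp
  then show "\<exists>h\<in>module_hom A (regular_module A) M. \<forall>x\<in>carrier (regular_module A). g (h x) = f x"
    using * m by (intro bexI[OF _ hom_regular[of A M m]]) (auto intro: fg_left_module)
qed

section \<open>Finiteness, injectivity and projectivity of direct sums and powers\<close>

lemma direct_sum_Cons:
  assumes "ring A" "\<And>N. N \<in> set (M # Ms) \<Longrightarrow> left_module A N"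
  shows "isomorphic_modules A (direct_sum (M # Ms)) (prod_module M (direct_sum Ms))"
proof -
  have "isomorphic_modules A (direct_sum ([M] @ Ms)) (prod_module (direct_sum [M]) (direct_sum Ms))"
    by (rule direct_sum_append)
  moreover have "isomorphic_modules A (prod_module (direct_sum [M]) (direct_sum Ms)) (prod_module M (direct_sum Ms))"
    using assms by (intro isomorphic_prod direct_sum_single isomorphic_modules_refl direct_sum_left_module) auto
  ultimately show ?thesis by (auto intro: isomorphic_modules_trans)
qed

lemma direct_sum_Nil_left_module: "ring A \<Longrightarrow> left_module A (direct_sum [])"
  by (rule direct_sum_left_module) auto

lemma fg_direct_sum:
  assumes "ring A" "\<And>N. N \<in> set Ms \<Longrightarrow> fg_module A N"
  shows "fg_module A (direct_sum Ms)"
  using assms(2)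
proof (induction Ms)
  case Nil
  then show ?case by (intro fg_zero direct_sum_Nil direct_sum_Nil_left_module assms(1))
next
  case (Cons M Ms)
  have lm: "left_module A N" if "N \<in> set (M # Ms)" for N using Cons.prems that fg_left_module by blast
  have "retract A (direct_sum (M # Ms)) (prod_module M (direct_sum Ms))"
    by (intro isomorphic_retract direct_sum_Cons direct_sum_left_module assms(1) lm)
  then show ?case
    by (rule fg_retract) (use Cons lm in \<open>auto intro!: fg_prod direct_sum_left_module assms(1)\<close>)
qed

lemma injective_direct_sum:
  assumes "ring A" "\<And>N. N \<in> set Ms \<Longrightarrow> injective A N"
  shows "injective A (direct_sum Ms)"
  using assms(2)
proof (induction Ms)
  case Nil
  then show ?case by (intro injective_zero direct_sum_Nil direct_sum_Nil_left_module assms(1))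
next
  case (Cons M Ms)
  have lm: "left_module A N" if "N \<in> set (M # Ms)" for N using Cons.prems that fg_left_module injective_fg by blast
  have "retract A (direct_sum (M # Ms)) (prod_module M (direct_sum Ms))"
    by (intro isomorphic_retract direct_sum_Cons direct_sum_left_module assms(1) lm)
  then show ?case
    by (rule injective_retract) (use Cons lm in \<open>auto intro!: injective_prod direct_sum_left_module assms(1)\<close>)
qed

lemma projective_direct_sum:
  assumes "ring A" "\<And>N. N \<in> set Ms \<Longrightarrow> projective A N"
  shows "projective A (direct_sum Ms)"
  using assms(2)
proof (induction Ms)
  case Nil
  then show ?case by (intro projective_zero direct_sum_Nil direct_sum_Nil_left_module assms(1))
next
  case (Cons M Ms)
  have lm: "left_module A N" if "N \<in> set (M # Ms)" for N using Cons.prems that fg_left_module projective_fg by blast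
  have "retract A (direct_sum (M # Ms)) (prod_module M (direct_sum Ms))"
    by (intro isomorphic_retract direct_sum_Cons direct_sum_left_module assms(1) lm)
  then show ?case
    by (rule projective_retract) (use Cons lm in \<open>auto intro!: projective_prod direct_sum_left_module assms(1)\<close>)
qed

lemma left_module_ring: "left_module A M \<Longrightarrow> ring A"
  by (rule left_module.axioms(1))

lemma retract_direct_sum:
  assumes "ring A" "\<And>N. N \<in> set Ms \<Longrightarrow> left_module A N" "M \<in> set Ms"
  shows "retract A M (direct_sum Ms)"
  using assms(2,3)
proof (induction Ms)
  case (Cons N Ms)
  have lm: "left_module A (direct_sum Ms)" "left_module A N" "left_module A (direct_sum (N # Ms))"
    using Cons.prems by (auto intro!: direct_sum_left_module assms(1))
  have "isomorphic_modules A (direct_sum (N # Ms)) (prod_module N (direct_sum Ms))"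
    using Cons.prems(1) by (intro direct_sum_Cons assms(1))
  from isomorphic_modules_sym[OF this lm(3)]
  have iso: "retract A (prod_module N (direct_sum Ms)) (direct_sum (N # Ms))"
    by (intro isomorphic_retract prod_left_module lm)
  show ?case
  proof (cases "M = N")
    case True
    then show ?thesis using retract_trans[OF retract_prod_fst[OF lm(2,1)] iso] by simp
  next
    case False
    then have "retract A M (direct_sum Ms)" using Cons by simp
    then show ?thesis by (rule retract_trans[OF retract_trans[OF _ retract_prod_snd[OF lm(2,1)]] iso])
  qed
qed simp

lemma module_power_left_module: "left_module A M \<Longrightarrow> left_module A (module_power M n)"
  unfolding module_power_def by (rule direct_sum_left_module) (auto intro: left_module_ring)

lemma fg_module_power: "fg_module A M \<Longrightarrow> fg_module A (module_power M n)"
  unfolding module_power_def by (rule fg_direct_sum) (auto intro: left_module_ring fg_left_module)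

lemma injective_module_power: "injective A M \<Longrightarrow> injective A (module_power M n)"
  unfolding module_power_def
  by (rule injective_direct_sum) (auto dest: injective_fg fg_left_module left_module_ring)

lemma projective_module_power: "projective A M \<Longrightarrow> projective A (module_power M n)"
  unfolding module_power_def
  by (rule projective_direct_sum) (auto dest: projective_fg fg_left_module left_module_ring)

lemma module_power_add:
  "isomorphic_modules A (module_power M (m + n)) (prod_module (module_power M m) (module_power M n))"
  unfolding module_power_def replicate_add by (rule direct_sum_append)

lemma module_power_one: "isomorphic_modules A (module_power M 1) M"
  unfolding module_power_def using direct_sum_single[of A M] by simp

lemma module_power_Suc:
  assumes "left_module A M"
  shows "isomorphic_modules A (module_power M (Suc n)) (prod_module M (module_power M n))"
proof -
  have "isomorphic_modules A (direct_sum (M # replicate n M)) (prod_module M (direct_sum (replicate n M)))"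
    by (rule direct_sum_Cons[OF left_module_ring[OF assms]]) (use assms in auto)
  then show ?thesis by (simp add: module_power_def)
qed

lemma module_power_zero: "carrier (module_power M 0) = {\<zero>\<^bsub>module_power M 0\<^esub>}"
  unfolding module_power_def using direct_sum_Nil by simp

lemma retract_module_power_add:
  assumes "left_module A M"
  shows "retract A (module_power M (m + n)) (prod_module (module_power M m) (module_power M n))"
    and "retract A (prod_module (module_power M m) (module_power M n)) (module_power M (m + n))"
  using module_power_add[of A M m n] module_power_left_module[OF assms] prod_left_module
  by (blast intro: isomorphic_retract isomorphic_modules_sym)+

lemma retract_module_power_Suc:
  assumes "left_module A M"
  shows "retract A (module_power M (Suc n)) (prod_module M (module_power M n))"
    and "retract A (prod_module M (module_power M n)) (module_power M (Suc n))"
  using module_power_Suc[OF assms, of n] module_power_left_module[OF assms] prod_left_module assms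
  by (blast intro: isomorphic_retract isomorphic_modules_sym)+

lemma retract_module_power_one:
  assumes "left_module A M"
  shows "retract A M (module_power M 1)"
  using module_power_one[of A M] module_power_left_module[OF assms]
  by (blast intro: isomorphic_retract isomorphic_modules_sym assms)

lemma retract_zero:
  assumes "left_module A M" "carrier M = {\<zero>\<^bsub>M\<^esub>}" "left_module A N"
  shows "retract A M N"
  using assms(2) by (intro retractI[OF hom_zerof[OF assms(3)] hom_zerof[OF assms(1)]]) auto

subsection \<open>The classes add, Gen and Cogen\<close>

text \<open>Membership in \<open>add X\<close> phrased by retracts, so that closure under products,
  summands and iteration becomes composition of maps. For finitely generated \<open>M\<close> it
  agrees with \<open>add_closure\<close>, by \<open>add_closure_iff\<close>.\<close>

definition in_add :: "('a, 'x) ring_scheme \<Rightarrow> ('a, 'm) module \<Rightarrow> ('a, 'n) module \<Rightarrow> bool" where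
  "in_add A X M \<longleftrightarrow> (\<exists>n. retract A M (module_power X n))"

lemma in_add_retract: "in_add A X N \<Longrightarrow> retract A M N \<Longrightarrow> in_add A X M"
  unfolding in_add_def using retract_trans by blast

lemma in_add_self: "left_module A X \<Longrightarrow> in_add A X X"
  unfolding in_add_def using retract_module_power_one by blast

lemma in_add_zero: "left_module A M \<Longrightarrow> carrier M = {\<zero>\<^bsub>M\<^esub>} \<Longrightarrow> left_module A X \<Longrightarrow> in_add A X M"
  unfolding in_add_def by (blast intro: retract_zero module_power_left_module)

lemma in_add_prod:
  assumes "in_add A X M" "in_add A X N" "left_module A X"
  shows "in_add A X (prod_module M N)"
proof -
  obtain m n where "retract A M (module_power X m)" "retract A N (module_power X n)"
    using assms(1,2) by (auto simp: in_add_def)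
  then have "retract A (prod_module M N) (module_power X (m + n))"
    using retract_trans[OF retract_prod retract_module_power_add(2)[OF assms(3)]] by blast
  then show ?thesis by (auto simp: in_add_def)
qed

lemma in_add_power:
  assumes "in_add A X M" "left_module A X" "left_module A M"
  shows "in_add A X (module_power M n)"
proof (induction n)
  case 0
  show ?case by (rule in_add_zero[OF module_power_left_module module_power_zero]) fact+
next
  case (Suc n)
  show ?case
    by (rule in_add_retract[OF in_add_prod[OF assms(1) Suc assms(2)] retract_module_power_Suc(1)]) fact
qed

lemma in_add_trans: "in_add A X Y \<Longrightarrow> in_add A Y Z \<Longrightarrow> left_module A X \<Longrightarrow> left_module A Y \<Longrightarrow> in_add A X Z"
  using in_add_power in_add_retract unfolding in_add_def[of A Y] by blast

lemma in_add_direct_sum: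
  assumes "left_module A X" "\<And>N. N \<in> set Ms \<Longrightarrow> left_module A N" "\<And>N. N \<in> set Ms \<Longrightarrow> in_add A X N"
  shows "in_add A X (direct_sum Ms)"
  using assms(2,3)
proof (induction Ms)
  case Nil
  then show ?case
    by (intro in_add_zero direct_sum_Nil direct_sum_Nil_left_module left_module_ring[OF assms(1)] assms(1))
next
  case (Cons M Ms)
  have "retract A (direct_sum (M # Ms)) (prod_module M (direct_sum Ms))"
    using Cons.prems(1) left_module_ring[OF assms(1)]
    by (intro isomorphic_retract direct_sum_Cons direct_sum_left_module) auto
  moreover have "in_add A X (prod_module M (direct_sum Ms))"
    using Cons.prems by (intro in_add_prod Cons.IH assms(1)) simp_all
  ultimately show ?case by (rule in_add_retract[rotated])
qed

lemma add_closure_iff: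
  assumes "left_module A X"
  shows "M \<in> add_closure A X \<longleftrightarrow> fg_module A M \<and> in_add A X M"
proof
  assume "M \<in> add_closure A X"
  then obtain n H K where M: "fg_module A M" and c: "complementary_submodules A (module_power X n) H K"
    and iso: "isomorphic_modules A M ((module_power X n)\<lparr>carrier := H\<rparr>)"
    by (auto simp: add_closure_def)
  note lm = module_power_left_module[OF assms, of n]
  obtain e where e: "e \<in> module_hom A (module_power X n) (module_power X n)"
    "\<And>x. x \<in> carrier (module_power X n) \<Longrightarrow> e x \<in> H" "\<And>x. x \<in> H \<Longrightarrow> e x = x"
    by (rule complementary_projection[OF c lm]) blast
  have "H \<subseteq> carrier (module_power X n)"
    using c submodule_subset by (auto simp: complementary_submodules_def)
  then have "retract A ((module_power X n)\<lparr>carrier := H\<rparr>) (module_power X n)"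
    using e by (intro retractI[OF hom_incl hom_restrict_cod[OF e(1)]]) auto
  then have "in_add A X M"
    using retract_trans[OF isomorphic_retract[OF iso fg_left_module[OF M]]] by (auto simp: in_add_def)
  with M show "fg_module A M \<and> in_add A X M" by blast
next
  assume "fg_module A M \<and> in_add A X M"
  then obtain n where M: "fg_module A M" and "retract A M (module_power X n)" by (auto simp: in_add_def)
  then obtain s r where sr: "s \<in> module_hom A M (module_power X n)" "r \<in> module_hom A (module_power X n) M"
    "\<And>x. x \<in> carrier M \<Longrightarrow> r (s x) = x" by (elim retractE) blast
  note lm = module_power_left_module[OF assms, of n]
  have sub: "s ` carrier M \<subseteq> carrier (module_power X n)" using hom_closed[OF sr(1)] by auto
  have "isomorphic_modules A M ((module_power X n)\<lparr>carrier := s ` carrier M\<rparr>)"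
    by (rule isomorphic_modulesI[OF hom_restrict_cod[OF sr(1)] hom_restrict_dom[OF sr(2) sub]])
      (auto simp: sr(3))
  then show "M \<in> add_closure A X"
    using retract_complementary[OF fg_left_module[OF M] lm sr(1,2), OF sr(3)] M unfolding add_closure_def by blast
qed

lemma Gen_iff: "M \<in> Gen A X \<longleftrightarrow> fg_module A M \<and> (\<exists>n f. f \<in> module_epi A (module_power X n) M)"
  by (auto simp: Gen_def)

lemma Cogen_iff: "M \<in> Cogen A X \<longleftrightarrow> fg_module A M \<and> (\<exists>n f. f \<in> module_mono A M (module_power X n))"
  by (auto simp: Cogen_def)

lemma Gen_epi: "M \<in> Gen A X \<Longrightarrow> f \<in> module_epi A M N \<Longrightarrow> left_module A N \<Longrightarrow> N \<in> Gen A X"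
  unfolding Gen_iff using fg_epi epi_comp by blast

lemma Cogen_mono: "M \<in> Cogen A X \<Longrightarrow> f \<in> module_mono A N M \<Longrightarrow> fg_module A N \<Longrightarrow> N \<in> Cogen A X"
  unfolding Cogen_iff using mono_comp by blast

lemma Gen_retract: "M \<in> Gen A X \<Longrightarrow> retract A N M \<Longrightarrow> left_module A N \<Longrightarrow> N \<in> Gen A X"
  by (rule retract_epi) (auto intro: Gen_epi)

lemma Cogen_retract: "M \<in> Cogen A X \<Longrightarrow> retract A N M \<Longrightarrow> left_module A N \<Longrightarrow> N \<in> Cogen A X"
  using fg_retract Cogen_mono Cogen_iff by (metis retract_mono)

lemma epi_prod:
  assumes "f \<in> module_epi A M N" "f' \<in> module_epi A M' N'"
  shows "(\<lambda>z. (f (fst z), f' (snd z))) \<in> module_epi A (prod_module M M') (prod_module N N')"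
proof (rule epiI)
  show "(\<lambda>z. (f (fst z), f' (snd z))) \<in> module_hom A (prod_module M M') (prod_module N N')"
    by (rule hom_pair[OF hom_comp[OF hom_fst epi_hom[OF assms(1)]] hom_comp[OF hom_snd epi_hom[OF assms(2)]]])
  fix y assume "y \<in> carrier (prod_module N N')"
  then obtain u v where "u \<in> carrier M" "fst y = f u" "v \<in> carrier M'" "snd y = f' v"
    using epi_surj[OF assms(1)] epi_surj[OF assms(2)] by (metis mem_Times_iff prod_module_simps(1))
  then show "\<exists>x\<in>carrier (prod_module M M'). (f (fst x), f' (snd x)) = y"
    by (intro bexI[of _ "(u, v)"]) (auto simp: prod_eq_iff)
qed

lemma mono_prod:
  assumes "f \<in> module_mono A M N" "f' \<in> module_mono A M' N'"
  shows "(\<lambda>z. (f (fst z), f' (snd z))) \<in> module_mono A (prod_module M M') (prod_module N N')"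
  using hom_pair[OF hom_comp[OF hom_fst mono_hom[OF assms(1)]] hom_comp[OF hom_snd mono_hom[OF assms(2)]]]
    mono_eq[OF assms(1)] mono_eq[OF assms(2)]
  by (auto simp: module_mono_def[of A "prod_module M M'"] inj_on_def)

lemma Gen_prod:
  assumes "M \<in> Gen A X" "N \<in> Gen A X" "left_module A X"
  shows "prod_module M N \<in> Gen A X"
proof -
  obtain m n f g where "f \<in> module_epi A (module_power X m) M" "g \<in> module_epi A (module_power X n) N"
    and fg: "fg_module A M" "fg_module A N"
    using assms(1,2) by (auto simp: Gen_iff)
  moreover obtain r where "r \<in> module_epi A (module_power X (m + n)) (prod_module (module_power X m) (module_power X n))"
    using retract_epi[OF retract_module_power_add(2)[OF assms(3)]]
      prod_left_module module_power_left_module[OF assms(3)] by metis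
  ultimately show ?thesis using epi_comp[OF _ epi_prod] fg_prod[OF fg] unfolding Gen_iff by blast
qed

lemma Cogen_prod:
  assumes "M \<in> Cogen A X" "N \<in> Cogen A X" "left_module A X"
  shows "prod_module M N \<in> Cogen A X"
proof -
  obtain m n f g where "f \<in> module_mono A M (module_power X m)" "g \<in> module_mono A N (module_power X n)"
    and fg: "fg_module A M" "fg_module A N"
    using assms(1,2) by (auto simp: Cogen_iff)
  moreover obtain r where "r \<in> module_mono A (prod_module (module_power X m) (module_power X n)) (module_power X (m + n))"
    using retract_mono[OF retract_module_power_add(2)[OF assms(3)]] .
  ultimately show ?thesis using mono_comp[OF mono_prod] fg_prod[OF fg] unfolding Cogen_iff by blast
qed

lemma Gen_zero:
  assumes "left_module A M" "carrier M = {\<zero>\<^bsub>M\<^esub>}" "left_module A X"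
  shows "M \<in> Gen A X"
proof -
  obtain r where "r \<in> module_epi A (module_power X 0) M"
    using retract_epi[OF retract_zero[OF assms(1,2) module_power_left_module[OF assms(3)]] assms(1)] .
  then show ?thesis using fg_zero[OF assms(1,2)] unfolding Gen_iff by blast
qed

lemma Cogen_zero:
  assumes "left_module A M" "carrier M = {\<zero>\<^bsub>M\<^esub>}" "left_module A X"
  shows "M \<in> Cogen A X"
proof -
  obtain r where "r \<in> module_mono A M (module_power X 0)"
    using retract_mono[OF retract_zero[OF assms(1,2) module_power_left_module[OF assms(3)]]] .
  then show ?thesis using fg_zero[OF assms(1,2)] unfolding Cogen_iff by blast
qed

lemma Gen_in_add:
  assumes "T \<in> Gen A X" "in_add A T M" "left_module A X" "left_module A M"
  shows "M \<in> Gen A X"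
proof -
  have T: "left_module A T" using assms(1) by (auto simp: Gen_iff intro: fg_left_module)
  have "module_power T n \<in> Gen A X" for n
  proof (induction n)
    case 0
    show ?case by (rule Gen_zero[OF module_power_left_module module_power_zero]) fact+
  next
    case (Suc n)
    show ?case
      by (rule Gen_retract[OF Gen_prod[OF assms(1) Suc assms(3)] retract_module_power_Suc(1)[OF T]
            module_power_left_module[OF T]])
  qed
  moreover obtain n where "retract A M (module_power T n)" using assms(2) by (auto simp: in_add_def)
  ultimately show ?thesis using Gen_retract assms(4) by blast
qed

lemma Cogen_in_add:
  assumes "T \<in> Cogen A X" "in_add A T M" "left_module A X" "left_module A M"
  shows "M \<in> Cogen A X"
proof -
  have T: "left_module A T" using assms(1) by (auto simp: Cogen_iff intro: fg_left_module)
  have "module_power T n \<in> Cogen A X" for n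
  proof (induction n)
    case 0
    show ?case by (rule Cogen_zero[OF module_power_left_module module_power_zero]) fact+
  next
    case (Suc n)
    show ?case
      by (rule Cogen_retract[OF Cogen_prod[OF assms(1) Suc assms(3)] retract_module_power_Suc(1)[OF T]
            module_power_left_module[OF T]])
  qed
  moreover obtain n where "retract A M (module_power T n)" using assms(2) by (auto simp: in_add_def)
  ultimately show ?thesis using Cogen_retract assms(4) by blast
qed

lemma Gen_self:
  assumes "fg_module A X"
  shows "X \<in> Gen A X"
proof -
  note X = fg_left_module[OF assms]
  obtain r where "r \<in> module_epi A (module_power X 1) X"
    using retract_epi[OF retract_module_power_one[OF X] X] .
  then show ?thesis using assms unfolding Gen_iff by blast
qed

lemma Cogen_self:
  assumes "fg_module A X"
  shows "X \<in> Cogen A X"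
proof -
  note X = fg_left_module[OF assms]
  obtain r where "r \<in> module_mono A X (module_power X 1)"
    using retract_mono[OF retract_module_power_one[OF X]] .
  then show ?thesis using assms unfolding Cogen_iff by blast
qed

lemma free_cover:
  assumes "fg_module A M"
  shows "M \<in> Gen A (regular_module A)"
proof -
  note M = fg_left_module[OF assms] and R = regular_left_module[OF left_module_ring[OF fg_left_module[OF assms]]]
  interpret left_module A M by fact
  obtain gs where gs: "set gs \<subseteq> carrier M"
    "\<And>x. x \<in> carrier M \<Longrightarrow> \<exists>c. (\<forall>i. c i \<in> carrier A) \<and> x = lincomb M gs c"
    by (rule fg_generators[OF assms]) blast
  \<comment> \<open>The induction on \<open>gs\<close> passes through shorter lists, which need not
    generate \<open>M\<close>; hence the claim is about all combinations of \<open>gs\<close> and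
    not about surjectivity.\<close>
  have "\<exists>f\<in>module_hom A (module_power (regular_module A) (length gs)) M.
      \<forall>c. (\<forall>i. c i \<in> carrier A) \<longrightarrow> lincomb M gs c \<in> f ` carrier (module_power (regular_module A) (length gs))"
    using gs(1)
  proof (induction gs)
    case Nil
    show ?case
      using module_power_zero[of "regular_module A"] by (intro bexI[OF _ hom_zerof[OF M]]) auto
  next
    case (Cons g gs)
    let ?P = "module_power (regular_module A)"
    obtain f where f: "f \<in> module_hom A (?P (length gs)) M"
      "\<And>c. (\<forall>i. c i \<in> carrier A) \<Longrightarrow> lincomb M gs c \<in> f ` carrier (?P (length gs))"
      using Cons by auto
    have g: "g \<in> carrier M" using Cons.prems by simp
    obtain r where r: "r \<in> module_epi A (?P (Suc (length gs))) (prod_module (regular_module A) (?P (length gs)))"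
      using retract_epi[OF retract_module_power_Suc(2)[OF R] prod_left_module[OF R module_power_left_module[OF R]]] .
    let ?h = "\<lambda>z. fst z \<odot>\<^bsub>M\<^esub> g \<oplus>\<^bsub>M\<^esub> f (snd z)"
    have h: "?h \<in> module_hom A (prod_module (regular_module A) (?P (length gs))) M"
      by (rule hom_copair[OF hom_regular[OF M g] f(1) M])
    show ?case
    proof (intro bexI[of _ "\<lambda>x. ?h (r x)"] allI impI)
      show "(\<lambda>x. ?h (r x)) \<in> module_hom A (?P (length (g # gs))) M"
        using hom_comp[OF epi_hom[OF r] h] by simp
    next
      fix c :: "nat \<Rightarrow> 'a" assume c: "\<forall>i. c i \<in> carrier A"
      then obtain y where y: "y \<in> carrier (?P (length gs))" "lincomb M gs (\<lambda>i. c (Suc i)) = f y"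
        using f(2)[of "\<lambda>i. c (Suc i)"] by auto
      then have "(c 0, y) \<in> carrier (prod_module (regular_module A) (?P (length gs)))" using c by simp
      from epi_surj[OF r this] obtain x where "x \<in> carrier (?P (Suc (length gs)))" "(c 0, y) = r x" by blast
      then show "lincomb M (g # gs) c \<in> (\<lambda>x. ?h (r x)) ` carrier (?P (length (g # gs)))"
        using y(2) by (intro image_eqI[of _ _ x]) (auto simp: prod_eq_iff)
    qed
  qed
  then obtain f where f: "f \<in> module_hom A (module_power (regular_module A) (length gs)) M"
    "\<And>c. (\<forall>i. c i \<in> carrier A) \<Longrightarrow> lincomb M gs c \<in> f ` carrier (module_power (regular_module A) (length gs))"
    by blast
  have "f \<in> module_epi A (module_power (regular_module A) (length gs)) M"
    using gs(2) f(2) by (intro epiI[OF f(1)]) (metis imageE)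
  then show ?thesis using assms unfolding Gen_iff by blast
qed

section \<open>Short exact sequences and comparison of presentations\<close>

definition fg_ses ::
    "('a, 'x) ring_scheme \<Rightarrow> ('a, 'k) module \<Rightarrow> ('k \<Rightarrow> 'm) \<Rightarrow> ('a, 'm) module \<Rightarrow> ('m \<Rightarrow> 'n) \<Rightarrow>
      ('a, 'n) module \<Rightarrow> bool" where
  "fg_ses A K f M g N \<longleftrightarrow> short_exact A K f M g N \<and> fg_module A K \<and> fg_module A M \<and> fg_module A N"

lemma fg_sesI:
  assumes "f \<in> module_mono A K M" "g \<in> module_epi A M N" "fg_module A K" "fg_module A M" "fg_module A N"
    and "\<And>x. x \<in> carrier K \<Longrightarrow> g (f x) = \<zero>\<^bsub>N\<^esub>"
    and "\<And>y. y \<in> carrier M \<Longrightarrow> g y = \<zero>\<^bsub>N\<^esub> \<Longrightarrow> \<exists>x\<in>carrier K. f x = y"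
  shows "fg_ses A K f M g N"
  unfolding fg_ses_def short_exact_def
  using assms hom_closed[OF mono_hom[OF assms(1)]] by (auto simp: ker_iff) (metis image_eqI)

lemma zero_ses:
  assumes "fg_module A E"
  shows "fg_ses A (E\<lparr>carrier := {\<zero>\<^bsub>E\<^esub>}\<rparr>) (\<lambda>x. x) E (\<lambda>x. x) E"
proof (rule fg_sesI)
  note E = fg_left_module[OF assms]
  let ?Z = "E\<lparr>carrier := {\<zero>\<^bsub>E\<^esub>}\<rparr>"
  have Z: "left_module A ?Z" by (rule zero_restrict[OF E])
  show "(\<lambda>x. x) \<in> module_mono A ?Z E"
    using hom_incl[of "{\<zero>\<^bsub>E\<^esub>}" E] submodule_zero[OF left_module.carrier_submodule[OF E]]
    by (auto simp: module_mono_def)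
  show "fg_module A ?Z" by (rule fg_zero[OF Z]) simp
qed (auto intro: epiI hom_id assms)

context
  fixes A :: "('a, 'x) ring_scheme" and K :: "('a, 'k) module" and f and M :: "('a, 'm) module"
    and g and N :: "('a, 'n) module"
  assumes ses: "fg_ses A K f M g N"
begin

lemma ses_mono: "f \<in> module_mono A K M" and ses_epi: "g \<in> module_epi A M N"
  and ses_hom1: "f \<in> module_hom A K M" and ses_hom2: "g \<in> module_hom A M N"
  and ses_fg: "fg_module A K" "fg_module A M" "fg_module A N"
  and ses_lm: "left_module A K" "left_module A M" "left_module A N"
  using ses by (auto simp: fg_ses_def short_exact_def mono_hom epi_hom fg_left_module)

lemma ses_zero: "x \<in> carrier K \<Longrightarrow> g (f x) = \<zero>\<^bsub>N\<^esub>"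
proof -
  assume "x \<in> carrier K"
  then have "f x \<in> a_kernel M N g" using ses by (auto simp: fg_ses_def short_exact_def)
  then show ?thesis by (simp add: ker_iff)
qed

lemma ses_ker: "y \<in> carrier M \<Longrightarrow> g y = \<zero>\<^bsub>N\<^esub> \<Longrightarrow> \<exists>x\<in>carrier K. f x = y"
proof -
  assume "y \<in> carrier M" "g y = \<zero>\<^bsub>N\<^esub>"
  then have "y \<in> f ` carrier K" using ses by (simp add: fg_ses_def short_exact_def ker_iff)
  then show ?thesis by blast
qed

lemma ses_inj: "x \<in> carrier K \<Longrightarrow> y \<in> carrier K \<Longrightarrow> f x = f y \<Longrightarrow> x = y"
  using mono_eq[OF ses_mono] .

lemma ses_surj: "y \<in> carrier N \<Longrightarrow> \<exists>x\<in>carrier M. y = g x"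
  using epi_surj[OF ses_epi] .

lemma ses_lift:
  assumes "h \<in> module_hom A X M" "left_module A X" "\<And>x. x \<in> carrier X \<Longrightarrow> g (h x) = \<zero>\<^bsub>N\<^esub>"
  obtains h' where "h' \<in> module_hom A X K" "\<And>x. x \<in> carrier X \<Longrightarrow> f (h' x) = h x"
proof (rule mono_factor[OF ses_mono assms(1,2) ses_lm(1)])
  show "h x \<in> f ` carrier K" if "x \<in> carrier X" for x
    using ses_ker[OF hom_closed[OF assms(1) that] assms(3)[OF that]] by (metis image_eqI)
  fix h' assume "h' \<in> module_hom A X K" "\<And>x. x \<in> carrier X \<Longrightarrow> f (h' x) = h x"
  then show thesis by (rule that)
qed

lemma ses_desc:
  assumes "h \<in> module_hom A M X" "left_module A X" "\<And>x. x \<in> carrier K \<Longrightarrow> h (f x) = \<zero>\<^bsub>X\<^esub>"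
  obtains h' where "h' \<in> module_hom A N X" "\<And>x. x \<in> carrier M \<Longrightarrow> h' (g x) = h x"
proof (rule epi_factor[OF ses_epi assms(1) ses_lm(2,3) assms(2)])
  show "h x = \<zero>\<^bsub>X\<^esub>" if "x \<in> carrier M" "g x = \<zero>\<^bsub>N\<^esub>" for x
    using ses_ker[OF that] assms(3) by auto
  fix h' assume "h' \<in> module_hom A N X" "\<And>x. x \<in> carrier M \<Longrightarrow> h' (g x) = h x"
  then show thesis by (rule that)
qed

end

lemma std_cokernel:
  fixes A :: "('a, 'x) ring_scheme" and K :: "('a, 'k) module" and M :: "('a, 'm) module"
  assumes "fg_module A K" "fg_module A M" "f \<in> module_mono A K M"
  obtains N :: "'a std_module" and g where "fg_ses A K f M g N"
proof -
  note lm = fg_left_module[OF assms(1)] fg_left_module[OF assms(2)]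
  obtain N :: "'a std_module" and g where "fg_module A N" "g \<in> module_epi A M N"
      "a_kernel M N g = f ` carrier K"
    using std_quotient[OF assms(2) submodule_range[OF mono_hom[OF assms(3)] lm]] by metis
  with assms that show thesis by (auto simp: fg_ses_def short_exact_def)
qed

lemma ses_prod:
  assumes "fg_ses A K f M g N" "fg_ses A K' f' M' g' N'"
  shows "fg_ses A (prod_module K K') (\<lambda>z. (f (fst z), f' (snd z))) (prod_module M M')
    (\<lambda>z. (g (fst z), g' (snd z))) (prod_module N N')"
proof (rule fg_sesI)
  show "\<exists>x\<in>carrier (prod_module K K'). (f (fst x), f' (snd x)) = y"
    if "y \<in> carrier (prod_module M M')" "(g (fst y), g' (snd y)) = \<zero>\<^bsub>prod_module N N'\<^esub>" for y
    using that ses_ker[OF assms(1), of "fst y"] ses_ker[OF assms(2), of "snd y"] by fastforce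
qed (use ses_zero[OF assms(1)] ses_zero[OF assms(2)] in \<open>auto intro!: mono_prod epi_prod fg_prod
    ses_mono[OF assms(1)] ses_mono[OF assms(2)] ses_epi[OF assms(1)] ses_epi[OF assms(2)]
    ses_fg[OF assms(1)] ses_fg[OF assms(2)]\<close>)

lemma ses_transport:
  assumes ses: "fg_ses A K f M g N"
    and ab: "a \<in> module_hom A K K'" "b \<in> module_hom A K' K"
      "\<And>x. x \<in> carrier K \<Longrightarrow> b (a x) = x" "\<And>y. y \<in> carrier K' \<Longrightarrow> a (b y) = y"
    and cd: "c \<in> module_hom A M M'" "d \<in> module_hom A M' M"
      "\<And>x. x \<in> carrier M \<Longrightarrow> d (c x) = x" "\<And>y. y \<in> carrier M' \<Longrightarrow> c (d y) = y"
    and e: "e \<in> module_hom A N N'" "e' \<in> module_hom A N' N"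
      "\<And>x. x \<in> carrier N \<Longrightarrow> e' (e x) = x" "\<And>y. y \<in> carrier N' \<Longrightarrow> e (e' y) = y"
    and lm: "left_module A K'" "left_module A M'" "left_module A N'"
  shows "fg_ses A K' (\<lambda>x. c (f (b x))) M' (\<lambda>y. e (g (d y))) N'"
proof (rule fg_sesI)
  note cl = hom_closed[OF ab(1)] hom_closed[OF ab(2)] hom_closed[OF cd(1)] hom_closed[OF cd(2)]
    hom_closed[OF e(1)] hom_closed[OF e(2)] hom_closed[OF ses_hom1[OF ses]] hom_closed[OF ses_hom2[OF ses]]
  have dc: "d (c (f (b x))) = f (b x)" if "x \<in> carrier K'" for x
    using that cl cd(3) by simp
  have "x = y" if xy: "x \<in> carrier K'" "y \<in> carrier K'" "c (f (b x)) = c (f (b y))" for x y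
  proof -
    have "f (b x) = f (b y)" using dc xy by metis
    then have "b x = b y" using ses_inj[OF ses] xy cl by blast
    then show ?thesis using xy ab(4) by metis
  qed
  then show "(\<lambda>x. c (f (b x))) \<in> module_mono A K' M'"
    using hom_comp[OF hom_comp[OF ab(2) ses_hom1[OF ses]] cd(1)] by (auto simp: module_mono_def inj_on_def)
  show "(\<lambda>y. e (g (d y))) \<in> module_epi A M' N'"
  proof (rule epiI[OF hom_comp[OF hom_comp[OF cd(2) ses_hom2[OF ses]] e(1)]])
    fix y assume y: "y \<in> carrier N'"
    obtain x where x: "x \<in> carrier M" "e' y = g x"
      using ses_surj[OF ses hom_closed[OF e(2) y]] by blast
    have "e (g (d (c x))) = y" using e(4)[OF y] by (simp add: cd(3)[OF x(1)] flip: x(2))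
    then show "\<exists>x\<in>carrier M'. e (g (d x)) = y" using hom_closed[OF cd(1) x(1)] by blast
  qed
  have iso: "isomorphic_modules A K K'" "isomorphic_modules A M M'" "isomorphic_modules A N N'"
    using isomorphic_modulesI[OF ab(1,2)] isomorphic_modulesI[OF cd(1,2)] isomorphic_modulesI[OF e(1,2)]
      ab(3,4) cd(3,4) e(3,4) by simp_all
  show "fg_module A K'" "fg_module A M'" "fg_module A N'"
    using fg_isomorphic iso lm ses_fg[OF ses] by blast+
  show "e (g (d (c (f (b x))))) = \<zero>\<^bsub>N'\<^esub>" if "x \<in> carrier K'" for x
    using that dc cl ses_zero[OF ses] hom_zero[OF e(1) ses_lm(3)[OF ses] lm(3)] by simp
  fix y assume y: "y \<in> carrier M'" "e (g (d y)) = \<zero>\<^bsub>N'\<^esub>"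
  then have "e' (e (g (d y))) = \<zero>\<^bsub>N\<^esub>" using hom_zero[OF e(2) lm(3) ses_lm(3)[OF ses]] by simp
  then have "g (d y) = \<zero>\<^bsub>N\<^esub>"
    using e(3)[OF hom_closed[OF ses_hom2[OF ses] hom_closed[OF cd(2) y(1)]]] by simp
  then obtain x where x: "x \<in> carrier K" "f x = d y"
    using ses_ker[OF ses hom_closed[OF cd(2) y(1)]] by blast
  have "c (f (b (a x))) = y" by (simp add: ab(3)[OF x(1)] x(2) cd(4)[OF y(1)])
  then show "\<exists>x\<in>carrier K'. c (f (b x)) = y" using hom_closed[OF ab(1) x(1)] by blast
qed

lemma ses_isomorphic:
  assumes ses: "fg_ses A K f M g N"
    and iso: "isomorphic_modules A K K'" "isomorphic_modules A M M'" "isomorphic_modules A N N'"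
    and lm: "left_module A K'" "left_module A M'" "left_module A N'"
  obtains f' g' where "fg_ses A K' f' M' g' N'"
proof -
  obtain a b where ab: "a \<in> module_hom A K K'" "b \<in> module_hom A K' K"
    "\<And>x. x \<in> carrier K \<Longrightarrow> b (a x) = x" "\<And>y. y \<in> carrier K' \<Longrightarrow> a (b y) = y"
    by (rule isomorphic_modulesE[OF iso(1) ses_lm(1)[OF ses]]) blast
  obtain c d where cd: "c \<in> module_hom A M M'" "d \<in> module_hom A M' M"
    "\<And>x. x \<in> carrier M \<Longrightarrow> d (c x) = x" "\<And>y. y \<in> carrier M' \<Longrightarrow> c (d y) = y"
    by (rule isomorphic_modulesE[OF iso(2) ses_lm(2)[OF ses]]) blast
  obtain e e' where e: "e \<in> module_hom A N N'" "e' \<in> module_hom A N' N"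
    "\<And>x. x \<in> carrier N \<Longrightarrow> e' (e x) = x" "\<And>y. y \<in> carrier N' \<Longrightarrow> e (e' y) = y"
    by (rule isomorphic_modulesE[OF iso(3) ses_lm(3)[OF ses]]) blast
  show thesis by (rule that[OF ses_transport[OF ses ab(1,2) _ _ cd(1,2) _ _ e(1,2) _ _ lm]]) (use ab cd e in auto)
qed

text \<open>
  If \<open>R S\<close> induces the identity on \<open>X\<close>, then \<open>1 - R S\<close> vanishes on \<open>X\<close> and therefore factors through
  \<open>C\<close>. This makes \<open>C\<close> a retract of \<open>D \<oplus> E\<close> without any splitting of the middle terms, and it
  replaces both Schanuel's lemma and closure under direct summands.
\<close>

lemma cosyzygy_retract_gen:
  assumes ses: "fg_ses A X j E p C" "fg_ses A Z k F q D"
    and S: "S \<in> module_hom A E F" and R: "R \<in> module_hom A F E"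
    and s: "s \<in> module_hom A X Z" and r: "r \<in> module_hom A Z X"
    and rs: "\<And>x. x \<in> carrier X \<Longrightarrow> r (s x) = x"
    and Sj: "\<And>x. x \<in> carrier X \<Longrightarrow> S (j x) = k (s x)"
    and Rk: "\<And>z. z \<in> carrier Z \<Longrightarrow> R (k z) = j (r z)"
  shows "retract A C (prod_module D E)"
proof -
  interpret E: left_module A E by (rule ses_lm(2)[OF ses(1)])
  interpret C: left_module A C by (rule ses_lm(3)[OF ses(1)])
  note lm = ses_lm[OF ses(1)] ses_lm[OF ses(2)]
  note p = ses_hom2[OF ses(1)] and q = ses_hom2[OF ses(2)] and j = ses_hom1[OF ses(1)] and k = ses_hom1[OF ses(2)]
  note cl = hom_closed[OF p] hom_closed[OF q] hom_closed[OF j] hom_closed[OF k] hom_closed[OF S]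
    hom_closed[OF R] hom_closed[OF s] hom_closed[OF r]
  obtain S' where S': "S' \<in> module_hom A C D" "\<And>x. x \<in> carrier E \<Longrightarrow> S' (p x) = q (S x)"
    by (rule ses_desc[OF ses(1) hom_comp[OF S q] lm(6)]) (use Sj cl ses_zero[OF ses(2)] in auto)
  obtain R' where R': "R' \<in> module_hom A D C" "\<And>x. x \<in> carrier F \<Longrightarrow> R' (q x) = p (R x)"
    by (rule ses_desc[OF ses(2) hom_comp[OF R p] lm(3)]) (use Rk cl ses_zero[OF ses(1)] in auto)
  obtain h where h: "h \<in> module_hom A C E" "\<And>x. x \<in> carrier E \<Longrightarrow> h (p x) = x \<ominus>\<^bsub>E\<^esub> R (S x)"
    by (rule ses_desc[OF ses(1) hom_minusf[OF hom_id hom_comp[OF S R] lm(2)] lm(2)])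
      (use Sj Rk rs cl in \<open>auto simp: E.minus_self\<close>)
  show ?thesis
  proof (rule retractI[OF hom_pair[OF S'(1) h(1)] hom_copair[OF R'(1) p lm(3)]])
    fix c assume "c \<in> carrier C"
    then obtain e where e: "e \<in> carrier E" "c = p e" using ses_surj[OF ses(1)] by blast
    then show "R' (fst (S' c, h c)) \<oplus>\<^bsub>C\<^esub> p (snd (S' c, h c)) = c"
      using cl by (simp add: S'(2) h(2) R'(2) hom_minus[OF p lm(2,3)] C.add_minus_cancel)
  qed
qed

text \<open>Injectivity of the two middle terms extends \<open>s\<close> and \<open>r\<close> to the
  maps \<open>S\<close> and \<open>R\<close> that \<open>cosyzygy_retract_gen\<close> takes as
  given. The two forms are kept apart because the sequence through \<open>T0\<close> of a tilting
  module supplies such maps for another reason.\<close>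

lemma cosyzygy_retract:
  assumes ses: "fg_ses A X j E p C" "fg_ses A Z k F q D" and inj: "injective A E" "injective A F"
    and "retract A X Z"
  shows "retract A C (prod_module D E)"
proof -
  obtain s r where sr: "s \<in> module_hom A X Z" "r \<in> module_hom A Z X" "\<And>x. x \<in> carrier X \<Longrightarrow> r (s x) = x"
    using assms(5) by (rule retractE) blast
  obtain S where S: "S \<in> module_hom A E F" "\<And>x. x \<in> carrier X \<Longrightarrow> S (j x) = k (s x)"
    using injective_extend[OF inj(2) ses_fg(1,2)[OF ses(1)] ses_mono[OF ses(1)] hom_comp[OF sr(1) ses_hom1[OF ses(2)]]]
    by blast
  obtain R where R: "R \<in> module_hom A F E" "\<And>x. x \<in> carrier Z \<Longrightarrow> R (k x) = j (r x)"
    using injective_extend[OF inj(1) ses_fg(1,2)[OF ses(2)] ses_mono[OF ses(2)] hom_comp[OF sr(2) ses_hom1[OF ses(1)]]]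
    by blast
  from cosyzygy_retract_gen[OF ses S(1) R(1) sr(1,2), OF sr(3) S(2) R(2)] show ?thesis by simp
qed

text \<open>The dual comparison for projective middle terms: \<open>1 - R S\<close> has values in
  \<open>K\<close>, which gives \<open>h\<close>. The maps themselves are recorded, beyond the
  retraction that they define, because \<open>ext_pres_ses_retract\<close> has to extend
  homomorphisms along them.\<close>

lemma syzygy_retract_maps:
  assumes ses: "fg_ses A K i P p X" "fg_ses A L l F q Z" and proj: "projective A P" "projective A F"
    and "retract A X Z"
  obtains S R S' R' h where "S \<in> module_hom A P F" "R \<in> module_hom A F P" "S' \<in> module_hom A K L"
    "R' \<in> module_hom A L K" "h \<in> module_hom A P K"
    "\<And>x. x \<in> carrier K \<Longrightarrow> l (S' x) = S (i x)" "\<And>x. x \<in> carrier L \<Longrightarrow> i (R' x) = R (l x)"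
    "\<And>x. x \<in> carrier K \<Longrightarrow> R' (S' x) \<oplus>\<^bsub>K\<^esub> h (i x) = x"
proof -
  interpret P: left_module A P by (rule ses_lm(2)[OF ses(1)])
  interpret X: left_module A X by (rule ses_lm(3)[OF ses(1)])
  interpret K: left_module A K by (rule ses_lm(1)[OF ses(1)])
  note lm = ses_lm[OF ses(1)] ses_lm[OF ses(2)]
  note p = ses_hom2[OF ses(1)] and q = ses_hom2[OF ses(2)] and i = ses_hom1[OF ses(1)] and l = ses_hom1[OF ses(2)]
  obtain s r where s: "s \<in> module_hom A X Z" and r: "r \<in> module_hom A Z X"
    and rs: "\<And>x. x \<in> carrier X \<Longrightarrow> r (s x) = x"
    using assms(5) by (rule retractE) blast
  obtain S where S: "S \<in> module_hom A P F" "\<And>x. x \<in> carrier P \<Longrightarrow> q (S x) = s (p x)"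
    using projective_lift[OF proj(1) ses_fg(2,3)[OF ses(2)] ses_epi[OF ses(2)] hom_comp[OF p s]] by blast
  obtain R where R: "R \<in> module_hom A F P" "\<And>x. x \<in> carrier F \<Longrightarrow> p (R x) = r (q x)"
    using projective_lift[OF proj(2) ses_fg(2,3)[OF ses(1)] ses_epi[OF ses(1)] hom_comp[OF q r]] by blast
  note cl = hom_closed[OF p] hom_closed[OF q] hom_closed[OF i] hom_closed[OF l] hom_closed[OF S(1)]
    hom_closed[OF R(1)] hom_closed[OF s] hom_closed[OF r]
  obtain S' where S': "S' \<in> module_hom A K L" "\<And>x. x \<in> carrier K \<Longrightarrow> l (S' x) = S (i x)"
    by (rule ses_lift[OF ses(2) hom_comp[OF i S(1)] lm(1)])
      (use S(2) cl ses_zero[OF ses(1)] hom_zero[OF s lm(3,6)] in auto)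
  obtain R' where R': "R' \<in> module_hom A L K" "\<And>x. x \<in> carrier L \<Longrightarrow> i (R' x) = R (l x)"
    by (rule ses_lift[OF ses(1) hom_comp[OF l R(1)] lm(4)])
      (use R(2) cl ses_zero[OF ses(2)] hom_zero[OF r lm(6,3)] in auto)
  obtain h where h: "h \<in> module_hom A P K" "\<And>x. x \<in> carrier P \<Longrightarrow> i (h x) = x \<ominus>\<^bsub>P\<^esub> R (S x)"
    by (rule ses_lift[OF ses(1) hom_minusf[OF hom_id hom_comp[OF S(1) R(1)] lm(2)] lm(2)])
      (use S(2) R(2) rs cl in \<open>auto simp: hom_minus[OF p lm(2,3)] X.minus_self\<close>)
  show thesis
  proof (rule that[OF S(1) R(1) S'(1) R'(1) h(1) S'(2) R'(2)])
    fix x assume x: "x \<in> carrier K"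
    have cl': "S' x \<in> carrier L" "R' (S' x) \<in> carrier K" "h (i x) \<in> carrier K"
      using x hom_closed[OF S'(1)] hom_closed[OF R'(1)] hom_closed[OF h(1)] cl by auto
    then have "i (R' (S' x) \<oplus>\<^bsub>K\<^esub> h (i x)) = i x"
      using x cl by (simp add: hom_add[OF i] R'(2) S'(2) h(2) P.add_minus_cancel)
    with cl' x show "R' (S' x) \<oplus>\<^bsub>K\<^esub> h (i x) = x" by (intro ses_inj[OF ses(1)]) auto
  qed
qed

lemma syzygy_retract:
  assumes ses: "fg_ses A K i P p X" "fg_ses A L l F q Z" and proj: "projective A P" "projective A F"
    and "retract A X Z"
  shows "retract A K (prod_module L P)"
proof -
  obtain S R S' R' h where *: "S' \<in> module_hom A K L" "R' \<in> module_hom A L K" "h \<in> module_hom A P K"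
    "\<And>x. x \<in> carrier K \<Longrightarrow> R' (S' x) \<oplus>\<^bsub>K\<^esub> h (i x) = x"
    by (rule syzygy_retract_maps[OF assms]) blast
  show ?thesis
    by (rule retractI[OF hom_pair[OF *(1) ses_hom1[OF ses(1)]] hom_copair[OF *(2,3) ses_lm(1)[OF ses(1)]]])
      (simp add: *(4))
qed

subsection \<open>Injective dimension at most one\<close>

text \<open>One short exact sequence instead of an infinite resolution. It is related to
  \<open>injdim\<close> by \<open>injdim_le_1_injdim\<close> and, for finitely generated modules, by
  \<open>injdim_le_1_if_injdim\<close>.\<close>

definition injdim_le_1 :: "('a, 'x) ring_scheme \<Rightarrow> ('a, 'm) module \<Rightarrow> bool" where
  "injdim_le_1 A X \<longleftrightarrow> (\<exists>(E :: 'a std_module) (C :: 'a std_module) f g.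
     fg_ses A X f E g C \<and> injective A E \<and> injective A C)"

lemma injective_isomorphic:
  assumes "isomorphic_modules A M N" "injective A M" "left_module A N"
  shows "injective A N"
  using injective_retract[OF isomorphic_retract[OF isomorphic_modules_sym[OF assms(1)]] assms(2,3)]
    assms(2,3) injective_fg fg_left_module by blast

lemma projective_isomorphic:
  assumes "isomorphic_modules A M N" "projective A M" "left_module A N"
  shows "projective A N"
  using projective_retract[OF isomorphic_retract[OF isomorphic_modules_sym[OF assms(1)]] assms(2,3)]
    assms(2,3) projective_fg fg_left_module by blast

lemma injdim_le_1I:
  fixes A :: "('a, 'x) ring_scheme"
  assumes "fg_ses A X f E g C" "injective A E" "injective A C"
  shows "injdim_le_1 A X"
proof -
  obtain E' :: "'a std_module" where E': "fg_module A E'" "isomorphic_modules A E E'"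
    using std_representative[OF ses_fg(2)[OF assms(1)]] .
  obtain C' :: "'a std_module" where C': "fg_module A C'" "isomorphic_modules A C C'"
    using std_representative[OF ses_fg(3)[OF assms(1)]] .
  obtain f' g' where "fg_ses A X f' E' g' C'"
    by (rule ses_isomorphic[OF assms(1) isomorphic_modules_refl E'(2) C'(2)
        ses_lm(1)[OF assms(1)] fg_left_module[OF E'(1)] fg_left_module[OF C'(1)]])
  then show ?thesis
    using injective_isomorphic[OF E'(2) assms(2)] injective_isomorphic[OF C'(2) assms(3)] E'(1) C'(1)
    unfolding injdim_le_1_def by (blast intro: fg_left_module)
qed

lemma injdim_le_1_injective:
  assumes "injective A X"
  shows "injdim_le_1 A X"
proof -
  note X = fg_left_module[OF injective_fg[OF assms]]
  let ?Z = "X\<lparr>carrier := {\<zero>\<^bsub>X\<^esub>}\<rparr>"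
  have Z: "left_module A ?Z" by (rule zero_restrict[OF X])
  have inj: "injective A ?Z" by (rule injective_zero[OF Z]) simp
  have "fg_ses A X (\<lambda>x. x) X (\<lambda>x. \<zero>\<^bsub>?Z\<^esub>) ?Z"
  proof (rule fg_sesI)
    show "(\<lambda>x. \<zero>\<^bsub>?Z\<^esub>) \<in> module_epi A X ?Z"
      using submodule_zero[OF left_module.carrier_submodule[OF X]] by (intro epiI hom_zerof[OF Z]) auto
    show "fg_module A ?Z" by (rule fg_zero[OF Z]) simp
  qed (auto simp: module_mono_def hom_id injective_fg[OF assms])
  from injdim_le_1I[OF this assms inj] show ?thesis .
qed

lemma injdim_le_1_prod:
  assumes "injdim_le_1 A X" "injdim_le_1 A Y"
  shows "injdim_le_1 A (prod_module X Y)"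
proof -
  obtain E C :: "'a std_module" and f g where 1: "fg_ses A X f E g C" "injective A E" "injective A C"
    using assms(1) by (auto simp: injdim_le_1_def)
  obtain E' C' :: "'a std_module" and f' g' where 2: "fg_ses A Y f' E' g' C'" "injective A E'" "injective A C'"
    using assms(2) by (auto simp: injdim_le_1_def)
  show ?thesis by (rule injdim_le_1I[OF ses_prod[OF 1(1) 2(1)]]) (intro injective_prod 1 2)+
qed

text \<open>Cosyzygies are unique up to injective summands: \<open>cosyzygy_retract\<close> makes
  \<open>C\<close> a retract of \<open>D \<oplus> E\<close>, where \<open>D\<close> is an injective
  cokernel belonging to \<open>Z\<close>.\<close>

lemma injdim_le_1_cokernel:
  assumes "injdim_le_1 A Z" "retract A X Z" "fg_ses A X j E p C" "injective A E"
  shows "injective A C"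
proof -
  obtain F D :: "'a std_module" and f g where 1: "fg_ses A Z f F g D" "injective A F" "injective A D"
    using assms(1) by (auto simp: injdim_le_1_def)
  show ?thesis
    by (rule injective_retract[OF cosyzygy_retract[OF assms(3) 1(1) assms(4) 1(2) assms(2)]
          injective_prod[OF 1(3) assms(4)] ses_lm(3)[OF assms(3)]])
qed

lemma injdim_le_1_retract:
  assumes "injdim_le_1 A Z" "retract A X Z" "left_module A X"
  shows "injdim_le_1 A X"
proof -
  obtain F D :: "'a std_module" and f g where 1: "fg_ses A Z f F g D" "injective A F" "injective A D"
    using assms(1) by (auto simp: injdim_le_1_def)
  obtain s where s: "s \<in> module_mono A X Z" using retract_mono[OF assms(2)] .
  have "fg_module A X" by (rule fg_retract[OF assms(2) ses_fg(1)[OF 1(1)] assms(3)])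
  from std_cokernel[OF this ses_fg(2)[OF 1(1)] mono_comp[OF s ses_mono[OF 1(1)]]]
  obtain C :: "'a std_module" and g' where C: "fg_ses A X (\<lambda>x. f (s x)) F g' C" by blast
  with injdim_le_1_cokernel[OF assms(1,2) C 1(2)] 1(2) show ?thesis by (blast intro: injdim_le_1I)
qed

lemma injdim_le_1_in_add:
  assumes "injdim_le_1 A X" "in_add A X M" "left_module A X" "left_module A M"
  shows "injdim_le_1 A M"
proof -
  have "injdim_le_1 A (module_power X n)" for n
  proof (induction n)
    case 0
    show ?case
      by (rule injdim_le_1_injective[OF injective_zero[OF module_power_left_module module_power_zero]]) fact
  next
    case (Suc n)
    show ?case
      by (rule injdim_le_1_retract[OF injdim_le_1_prod[OF assms(1) Suc] retract_module_power_Suc(1)[OF assms(3)]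
            module_power_left_module[OF assms(3)]])
  qed
  moreover obtain n where "retract A M (module_power X n)" using assms(2) by (auto simp: in_add_def)
  ultimately show ?thesis using injdim_le_1_retract assms(4) by blast
qed

subsection \<open>Projective presentations and extensions\<close>

text \<open>Projective dimension of \<open>M\<close> at most one together with \<open>Ext\<^sup>1(M, N) = 0\<close>.\<close>

definition ext_pres :: "('a, 'x) ring_scheme \<Rightarrow> ('a, 'n) module \<Rightarrow> ('a, 'm) module \<Rightarrow> bool" where
  "ext_pres A N M \<longleftrightarrow> (\<exists>(K :: 'a std_module) (P :: 'a std_module) i p.
     fg_ses A K i P p M \<and> projective A K \<and> projective A P \<and>
     (\<forall>f\<in>module_hom A K N. \<exists>h\<in>module_hom A P N. \<forall>x\<in>carrier K. h (i x) = f x))"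

lemma ext_presI:
  fixes A :: "('a, 'x) ring_scheme"
  assumes "fg_ses A K i P p M" "projective A K" "projective A P"
    and ext: "\<And>f. f \<in> module_hom A K N \<Longrightarrow> \<exists>h\<in>module_hom A P N. \<forall>x\<in>carrier K. h (i x) = f x"
  shows "ext_pres A N M"
proof -
  note ses = assms(1)
  obtain K' :: "'a std_module" where K': "fg_module A K'" "isomorphic_modules A K K'"
    using std_representative[OF ses_fg(1)[OF ses]] .
  obtain P' :: "'a std_module" where P': "fg_module A P'" "isomorphic_modules A P P'"
    using std_representative[OF ses_fg(2)[OF ses]] .
  note lm = fg_left_module[OF K'(1)] fg_left_module[OF P'(1)]
  obtain a b where ab: "a \<in> module_hom A K K'" "b \<in> module_hom A K' K"
    "\<And>x. x \<in> carrier K \<Longrightarrow> b (a x) = x" "\<And>y. y \<in> carrier K' \<Longrightarrow> a (b y) = y"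
    by (rule isomorphic_modulesE[OF K'(2) ses_lm(1)[OF ses]]) blast
  obtain c d where cd: "c \<in> module_hom A P P'" "d \<in> module_hom A P' P"
    "\<And>x. x \<in> carrier P \<Longrightarrow> d (c x) = x" "\<And>y. y \<in> carrier P' \<Longrightarrow> c (d y) = y"
    by (rule isomorphic_modulesE[OF P'(2) ses_lm(2)[OF ses]]) blast
  note cl = hom_closed[OF ab(2)] hom_closed[OF ses_hom1[OF ses]]
  have "fg_ses A K' (\<lambda>x. c (i (b x))) P' (\<lambda>y. p (d y)) M"
    by (rule ses_transport[OF ses ab(1,2) _ _ cd(1,2) _ _ hom_id hom_id _ _ lm ses_lm(3)[OF ses]])
      (use ab cd in auto)
  moreover have "\<exists>h\<in>module_hom A P' N. \<forall>x\<in>carrier K'. h (c (i (b x))) = f x" if f: "f \<in> module_hom A K' N" for f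
  proof -
    obtain h where h: "h \<in> module_hom A P N" "\<And>x. x \<in> carrier K \<Longrightarrow> h (i x) = f (a x)"
      using ext[OF hom_comp[OF ab(1) f]] by blast
    then show ?thesis
      using cl cd(3) ab(4) by (intro bexI[OF _ hom_comp[OF cd(2) h(1)]]) auto
  qed
  moreover have "projective A K'" "projective A P'"
    using projective_isomorphic[OF K'(2) assms(2) lm(1)] projective_isomorphic[OF P'(2) assms(3) lm(2)] by auto
  ultimately show ?thesis unfolding ext_pres_def by blast
qed

lemma ext_pres_projective:
  assumes "projective A P" "left_module A N"
  shows "ext_pres A N P"
proof (rule ext_presI[OF zero_ses[OF projective_fg[OF assms(1)]] _ assms(1)])
  let ?Z = "P\<lparr>carrier := {\<zero>\<^bsub>P\<^esub>}\<rparr>"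
  have Z: "left_module A ?Z" by (rule zero_restrict[OF fg_left_module[OF projective_fg[OF assms(1)]]])
  show "projective A ?Z" by (rule projective_zero[OF Z]) simp
  fix f assume f: "f \<in> module_hom A ?Z N"
  then show "\<exists>h\<in>module_hom A P N. \<forall>x\<in>carrier ?Z. h x = f x"
    using hom_zero[OF f Z assms(2)] by (intro bexI[OF _ hom_zerof[OF assms(2)]]) auto
qed

lemma ext_pres_prod:
  assumes "ext_pres A N M" "ext_pres A N M'" "left_module A N"
  shows "ext_pres A N (prod_module M M')"
proof -
  interpret N: left_module A N by fact
  obtain K P :: "'a std_module" and i p where 1: "fg_ses A K i P p M" "projective A K" "projective A P"
     "\<And>f. f \<in> module_hom A K N \<Longrightarrow> \<exists>h\<in>module_hom A P N. \<forall>x\<in>carrier K. h (i x) = f x"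
    using assms(1) by (auto simp: ext_pres_def)
  obtain K' P' :: "'a std_module" and i' p' where 2: "fg_ses A K' i' P' p' M'" "projective A K'" "projective A P'"
     "\<And>f. f \<in> module_hom A K' N \<Longrightarrow> \<exists>h\<in>module_hom A P' N. \<forall>x\<in>carrier K'. h (i' x) = f x"
    using assms(2) by (auto simp: ext_pres_def)
  note K = ses_lm(1)[OF 1(1)] and K' = ses_lm(1)[OF 2(1)]
  interpret K: left_module A K by fact
  interpret K': left_module A K' by fact
  show ?thesis
  proof (rule ext_presI[OF ses_prod[OF 1(1) 2(1)] projective_prod[OF 1(2) 2(2)] projective_prod[OF 1(3) 2(3)]])
    fix f assume f: "f \<in> module_hom A (prod_module K K') N"
    obtain h where h: "h \<in> module_hom A P N" "\<And>x. x \<in> carrier K \<Longrightarrow> h (i x) = f (x, \<zero>\<^bsub>K'\<^esub>)"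
      using 1(4)[OF hom_comp[OF hom_incl_fst[OF K'] f]] by blast
    obtain h' where h': "h' \<in> module_hom A P' N" "\<And>x. x \<in> carrier K' \<Longrightarrow> h' (i' x) = f (\<zero>\<^bsub>K\<^esub>, x)"
      using 2(4)[OF hom_comp[OF hom_incl_snd[OF K] f]] by blast
    have "h (i x) \<oplus>\<^bsub>N\<^esub> h' (i' y) = f (x, y)" if "x \<in> carrier K" "y \<in> carrier K'" for x y
      using that hom_add[OF f, of "(x, \<zero>\<^bsub>K'\<^esub>)" "(\<zero>\<^bsub>K\<^esub>, y)"] by (simp add: h(2) h'(2))
    then show "\<exists>h\<in>module_hom A (prod_module P P') N. \<forall>x\<in>carrier (prod_module K K'). h (i (fst x), i' (snd x)) = f x"
      by (intro bexI[OF _ hom_copair[OF h(1) h'(1) assms(3)]]) auto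
  qed
qed

text \<open>A map \<open>f\<close> on \<open>K\<close> is split along the identity
  \<open>x = R' (S' x) + h (i x)\<close>: \<open>f R'\<close> extends over the presentation of
  \<open>Z\<close>, and \<open>f h\<close> is already defined on \<open>P\<close>. Hence the
  condition passes to summands, and it holds for every projective presentation once it holds for
  one.\<close>

lemma ext_pres_ses_retract:
  assumes "ext_pres A N Z" "retract A M Z" "fg_ses A K i P p M" "projective A P" "left_module A N"
  shows "ext_pres A N M"
proof -
  interpret N: left_module A N by fact
  obtain L F :: "'a std_module" and l q where 1: "fg_ses A L l F q Z" "projective A L" "projective A F"
     "\<And>f. f \<in> module_hom A L N \<Longrightarrow> \<exists>h\<in>module_hom A F N. \<forall>x\<in>carrier L. h (l x) = f x"
    using assms(1) by (auto simp: ext_pres_def)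
  obtain S R S' R' h where maps: "S \<in> module_hom A P F" "R \<in> module_hom A F P" "S' \<in> module_hom A K L"
    "R' \<in> module_hom A L K" "h \<in> module_hom A P K"
    "\<And>x. x \<in> carrier K \<Longrightarrow> l (S' x) = S (i x)" "\<And>x. x \<in> carrier L \<Longrightarrow> i (R' x) = R (l x)"
    "\<And>x. x \<in> carrier K \<Longrightarrow> R' (S' x) \<oplus>\<^bsub>K\<^esub> h (i x) = x"
    by (rule syzygy_retract_maps[OF assms(3) 1(1) assms(4) 1(3) assms(2)]) blast
  have "projective A K"
    by (rule projective_retract[OF syzygy_retract[OF assms(3) 1(1) assms(4) 1(3) assms(2)]
          projective_prod[OF 1(2) assms(4)] ses_lm(1)[OF assms(3)]])
  then show ?thesis
  proof (rule ext_presI[OF assms(3) _ assms(4)])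
    fix f assume f: "f \<in> module_hom A K N"
    obtain g where g: "g \<in> module_hom A F N" "\<And>x. x \<in> carrier L \<Longrightarrow> g (l x) = f (R' x)"
      using 1(4)[OF hom_comp[OF maps(4) f]] by blast
    have "g (S (i x)) \<oplus>\<^bsub>N\<^esub> f (h (i x)) = f x" if x: "x \<in> carrier K" for x
    proof -
      have cl: "S' x \<in> carrier L" "R' (S' x) \<in> carrier K" "h (i x) \<in> carrier K"
        using x hom_closed[OF maps(3)] hom_closed[OF maps(4)] hom_closed[OF maps(5)]
          hom_closed[OF ses_hom1[OF assms(3)]] by auto
      have "g (S (i x)) = f (R' (S' x))" using maps(6)[OF x] g(2)[OF cl(1)] by simp
      then show ?thesis using maps(8)[OF x] cl by (simp flip: hom_add[OF f])
    qed
    then show "\<exists>h\<in>module_hom A P N. \<forall>x\<in>carrier K. h (i x) = f x"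
      by (intro bexI[OF _ hom_addf[OF hom_comp[OF maps(1) g(1)] hom_comp[OF maps(5) f] assms(5)]]) auto
  qed
qed

section \<open>Finite length\<close>

text \<open>
  Finite length is encoded by a strictly monotone rank function on the submodules; it gives both
  chain conditions, and it is additive in extensions.
\<close>

definition finite_length_on ::
    "('a, 'x) ring_scheme \<Rightarrow> ('a, 'm) module \<Rightarrow> 'm set \<Rightarrow> bool" where
  "finite_length_on A M H \<longleftrightarrow> (\<exists>rk :: 'm set \<Rightarrow> nat. \<forall>X Y.
     submodule X A M \<and> submodule Y A M \<and> X \<subset> Y \<and> Y \<subseteq> H \<longrightarrow> rk X < rk Y)"

lemma finite_length_onE:
  assumes "finite_length_on A M H"
  obtains rk :: "'m set \<Rightarrow> nat" where
    "\<And>X Y. submodule X A M \<Longrightarrow> submodule Y A M \<Longrightarrow> X \<subset> Y \<Longrightarrow> Y \<subseteq> H \<Longrightarrow> rk X < rk Y"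
    "\<And>X Y. submodule X A M \<Longrightarrow> submodule Y A M \<Longrightarrow> X \<subseteq> Y \<Longrightarrow> Y \<subseteq> H \<Longrightarrow> rk X \<le> rk Y"
proof -
  obtain rk :: "'m set \<Rightarrow> nat" where l:
    "\<And>X Y. submodule X A M \<Longrightarrow> submodule Y A M \<Longrightarrow> X \<subset> Y \<Longrightarrow> Y \<subseteq> H \<Longrightarrow> rk X < rk Y"
    using assms unfolding finite_length_on_def by blast
  have "rk X \<le> rk Y" if "submodule X A M" "submodule Y A M" "X \<subseteq> Y" "Y \<subseteq> H" for X Y
    using l[of X Y] that by (cases "X = Y") (auto simp: psubset_eq intro: less_imp_le)
  with l that show thesis by blast
qed

lemma finite_length_onI:
  fixes rk :: "'m set \<Rightarrow> nat"
  assumes "\<And>X Y. submodule X A M \<Longrightarrow> submodule Y A M \<Longrightarrow> X \<subset> Y \<Longrightarrow> Y \<subseteq> H \<Longrightarrow> rk X < rk Y"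
  shows "finite_length_on A M H"
  using assms unfolding finite_length_on_def by blast

lemma finite_length_on_subset: "finite_length_on A M H \<Longrightarrow> K \<subseteq> H \<Longrightarrow> finite_length_on A M K"
  unfolding finite_length_on_def by (meson subset_trans)

lemma finite_length_on_zero: "finite_length_on A M {\<zero>\<^bsub>M\<^esub>}"
proof (rule finite_length_onI)
  fix X Y assume "submodule X A M" "X \<subset> Y" "Y \<subseteq> {\<zero>\<^bsub>M\<^esub>}"
  then show "(0 :: nat) < 0" using submodule_zero[of X A M] by blast
qed

text \<open>The rank of \<open>X\<close> is the rank of \<open>X \<inter> H\<close> plus that of the
  image of \<open>X\<close> modulo \<open>H\<close>. The second is measured inside \<open>K\<close>,
  by \<open>(X + H) \<inter> K\<close>, so that no quotient module has to be formed.\<close>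

lemma finite_length_on_set_add:
  assumes "left_module A M" "submodule H A M" "submodule K A M"
    and "finite_length_on A M H" "finite_length_on A M K"
  shows "finite_length_on A M (H <+>\<^bsub>M\<^esub> K)"
proof -
  interpret left_module A M by fact
  obtain l1 where l1:
    "\<And>X Y. submodule X A M \<Longrightarrow> submodule Y A M \<Longrightarrow> X \<subset> Y \<Longrightarrow> Y \<subseteq> H \<Longrightarrow> (l1 X :: nat) < l1 Y"
    "\<And>X Y. submodule X A M \<Longrightarrow> submodule Y A M \<Longrightarrow> X \<subseteq> Y \<Longrightarrow> Y \<subseteq> H \<Longrightarrow> l1 X \<le> l1 Y"
    by (rule finite_length_onE[OF assms(4)]) blast
  obtain l2 where l2:
    "\<And>X Y. submodule X A M \<Longrightarrow> submodule Y A M \<Longrightarrow> X \<subset> Y \<Longrightarrow> Y \<subseteq> K \<Longrightarrow> (l2 X :: nat) < l2 Y"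
    "\<And>X Y. submodule X A M \<Longrightarrow> submodule Y A M \<Longrightarrow> X \<subseteq> Y \<Longrightarrow> Y \<subseteq> K \<Longrightarrow> l2 X \<le> l2 Y"
    by (rule finite_length_onE[OF assms(5)]) blast
  show ?thesis
  proof (rule finite_length_onI[where rk = "\<lambda>X. l1 (X \<inter> H) + l2 ((X <+>\<^bsub>M\<^esub> H) \<inter> K)"])
    fix X Y assume X: "submodule X A M" and Y: "submodule Y A M" and XY: "X \<subset> Y" and YHK: "Y \<subseteq> H <+>\<^bsub>M\<^esub> K"
    have sub: "submodule (X \<inter> H) A M" "submodule (Y \<inter> H) A M"
      "submodule ((X <+>\<^bsub>M\<^esub> H) \<inter> K) A M" "submodule ((Y <+>\<^bsub>M\<^esub> H) \<inter> K) A M"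
      using X Y assms(1-3) by (auto intro!: submodule_Int submodule_set_add)
    have incl: "X \<inter> H \<subseteq> Y \<inter> H" "(X <+>\<^bsub>M\<^esub> H) \<inter> K \<subseteq> (Y <+>\<^bsub>M\<^esub> H) \<inter> K"
      using XY by (auto simp: set_add_def set_mult_def)
    have "X \<inter> H \<noteq> Y \<inter> H \<or> (X <+>\<^bsub>M\<^esub> H) \<inter> K \<noteq> (Y <+>\<^bsub>M\<^esub> H) \<inter> K"
    proof (rule ccontr)
      assume "\<not> ?thesis"
      then have eq: "X \<inter> H = Y \<inter> H" "(X <+>\<^bsub>M\<^esub> H) \<inter> K = (Y <+>\<^bsub>M\<^esub> H) \<inter> K" by auto
      have "y \<in> X" if y: "y \<in> Y" for y
      proof -
        note mem = submodule_mem[OF X] submodule_mem[OF Y] submodule_mem[OF assms(2)] submodule_mem[OF assms(3)]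
        \<comment> \<open>The modular law by hand: \<open>y\<close> differs from some
          \<open>x\<close> in \<open>X\<close> by an element of \<open>Y \<inter> H\<close>, which
          equals \<open>X \<inter> H\<close>.\<close>
        obtain h k where hk: "h \<in> H" "k \<in> K" "y = h \<oplus>\<^bsub>M\<^esub> k" using subsetD[OF YHK y] unfolding set_add_iff by blast
        have "k = y \<oplus>\<^bsub>M\<^esub> (\<ominus>\<^bsub>M\<^esub> h)"
          using hk mem add_minus_cancel_right[of k h] by (simp add: M.a_comm[of h k] M.minus_eq)
        then have "k \<in> (Y <+>\<^bsub>M\<^esub> H) \<inter> K"
          using hk y submodule_a_inv[OF assms(2) hk(1)] by (auto simp: set_add_iff)
        then obtain x h' where xh: "x \<in> X" "h' \<in> H" "k = x \<oplus>\<^bsub>M\<^esub> h'" using eq(2)[symmetric] by (auto simp: set_add_iff)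
        have "y = (h \<oplus>\<^bsub>M\<^esub> h') \<oplus>\<^bsub>M\<^esub> x" using hk xh mem by (simp add: M.a_ac)
        then have d: "y \<ominus>\<^bsub>M\<^esub> x = h \<oplus>\<^bsub>M\<^esub> h'" using hk xh mem by (simp add: add_minus_cancel_right)
        then have "y \<ominus>\<^bsub>M\<^esub> x \<in> Y \<inter> H"
          using submodule_minus[OF Y y, of x] xh XY submodule_add[OF assms(2) hk(1) xh(2)] by auto
        then have "y \<ominus>\<^bsub>M\<^esub> x \<in> X" using eq(1) by auto
        from submodule_add[OF X this xh(1)] show "y \<in> X" using mem y xh(1) by (simp add: minus_add_cancel)
      qed
      with XY show False by blast
    qed
    then show "l1 (X \<inter> H) + l2 ((X <+>\<^bsub>M\<^esub> H) \<inter> K) < l1 (Y \<inter> H) + l2 ((Y <+>\<^bsub>M\<^esub> H) \<inter> K)"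
    proof
      assume "X \<inter> H \<noteq> Y \<inter> H"
      then have "l1 (X \<inter> H) < l1 (Y \<inter> H)" by (intro l1(1) sub) (use incl in auto)
      moreover have "l2 ((X <+>\<^bsub>M\<^esub> H) \<inter> K) \<le> l2 ((Y <+>\<^bsub>M\<^esub> H) \<inter> K)" by (intro l2(2) sub incl) auto
      ultimately show ?thesis by simp
    next
      assume "(X <+>\<^bsub>M\<^esub> H) \<inter> K \<noteq> (Y <+>\<^bsub>M\<^esub> H) \<inter> K"
      then have "l2 ((X <+>\<^bsub>M\<^esub> H) \<inter> K) < l2 ((Y <+>\<^bsub>M\<^esub> H) \<inter> K)" by (intro l2(1) sub) (use incl in auto)
      moreover have "l1 (X \<inter> H) \<le> l1 (Y \<inter> H)" by (intro l1(2) sub incl) auto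
      ultimately show ?thesis by simp
    qed
  qed
qed

lemma finite_length_on_image:
  assumes f: "f \<in> module_hom A M N" and lm: "left_module A M" "left_module A N"
    and "submodule H A M" "finite_length_on A M H"
  shows "finite_length_on A N (f ` H)"
proof -
  obtain l where l:
    "\<And>X Y. submodule X A M \<Longrightarrow> submodule Y A M \<Longrightarrow> X \<subset> Y \<Longrightarrow> Y \<subseteq> H \<Longrightarrow> (l X :: nat) < l Y"
    by (rule finite_length_onE[OF assms(5)]) blast
  show ?thesis
  proof (rule finite_length_onI[where rk = "\<lambda>X. l ({x \<in> carrier M. f x \<in> X} \<inter> H)"])
    fix X Y assume *: "submodule X A N" "submodule Y A N" "X \<subset> Y" "Y \<subseteq> f ` H"
    show "l ({x \<in> carrier M. f x \<in> X} \<inter> H) < l ({x \<in> carrier M. f x \<in> Y} \<inter> H)"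
    proof (rule l)
      obtain y where "y \<in> Y" "y \<notin> X" using *(3) by blast
      then obtain h where "h \<in> H" "f h \<in> Y" "f h \<notin> X" using *(4) by blast
      then show "{x \<in> carrier M. f x \<in> X} \<inter> H \<subset> {x \<in> carrier M. f x \<in> Y} \<inter> H"
        using *(3) submodule_mem[OF assms(4)] by blast
    qed (intro submodule_Int submodule_preimage[OF f lm] * assms(4) lm | blast)+
  qed
qed

text \<open>Adds the rank of the image to the rank of the part in the kernel: nested submodules that
  agree in both are equal.\<close>

lemma finite_length_on_ext:
  assumes f: "f \<in> module_hom A M N" and lm: "left_module A M" "left_module A N"
    and H: "submodule H A M" and "finite_length_on A N (f ` H)" "finite_length_on A M (H \<inter> a_kernel M N f)"
  shows "finite_length_on A M H"
proof -
  interpret M: left_module A M by fact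
  interpret N: left_module A N by fact
  obtain l1 where l1:
    "\<And>X Y. submodule X A N \<Longrightarrow> submodule Y A N \<Longrightarrow> X \<subset> Y \<Longrightarrow> Y \<subseteq> f ` H \<Longrightarrow> (l1 X :: nat) < l1 Y"
    "\<And>X Y. submodule X A N \<Longrightarrow> submodule Y A N \<Longrightarrow> X \<subseteq> Y \<Longrightarrow> Y \<subseteq> f ` H \<Longrightarrow> l1 X \<le> l1 Y"
    by (rule finite_length_onE[OF assms(5)]) blast
  let ?K = "a_kernel M N f"
  obtain l2 where l2:
    "\<And>X Y. submodule X A M \<Longrightarrow> submodule Y A M \<Longrightarrow> X \<subset> Y \<Longrightarrow> Y \<subseteq> H \<inter> ?K \<Longrightarrow> (l2 X :: nat) < l2 Y"
    "\<And>X Y. submodule X A M \<Longrightarrow> submodule Y A M \<Longrightarrow> X \<subseteq> Y \<Longrightarrow> Y \<subseteq> H \<inter> ?K \<Longrightarrow> l2 X \<le> l2 Y"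
    by (rule finite_length_onE[OF assms(6)]) blast
  show ?thesis
  proof (rule finite_length_onI[where rk = "\<lambda>X. l1 (f ` X) + l2 (X \<inter> ?K)"])
    fix X Y assume X: "submodule X A M" and Y: "submodule Y A M" and XY: "X \<subset> Y" and YH: "Y \<subseteq> H"
    note mem = submodule_mem[OF X] submodule_mem[OF Y]
    have sub: "submodule (f ` X) A N" "submodule (f ` Y) A N" "submodule (X \<inter> ?K) A M" "submodule (Y \<inter> ?K) A M"
      by (intro submodule_image[OF f lm] submodule_Int submodule_ker[OF f lm] X Y lm)+
    have incl: "f ` X \<subseteq> f ` Y" "X \<inter> ?K \<subseteq> Y \<inter> ?K" "f ` Y \<subseteq> f ` H" "Y \<inter> ?K \<subseteq> H \<inter> ?K"
      using XY YH by auto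
    have "f ` X \<noteq> f ` Y \<or> X \<inter> ?K \<noteq> Y \<inter> ?K"
    proof (rule ccontr)
      assume "\<not> ?thesis"
      then have eq: "f ` X = f ` Y" "X \<inter> ?K = Y \<inter> ?K" by auto
      have "y \<in> X" if y: "y \<in> Y" for y
      proof -
        have "f y \<in> f ` X" using eq(1) y by auto
        then obtain x where x: "x \<in> X" "f y = f x" by blast
        then have xY: "x \<in> Y" using XY by blast
        have "f (y \<ominus>\<^bsub>M\<^esub> x) = \<zero>\<^bsub>N\<^esub>"
          using x(2) mem(2)[OF y] mem(2)[OF xY] hom_closed[OF f] by (simp add: hom_minus[OF f lm] N.minus_self)
        then have "y \<ominus>\<^bsub>M\<^esub> x \<in> Y \<inter> ?K" using submodule_minus[OF Y y xY] mem(2) by (simp add: ker_iff)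
        then have "y \<ominus>\<^bsub>M\<^esub> x \<in> X" using eq(2) by auto
        from submodule_add[OF X this x(1)] show "y \<in> X"
          using mem(2)[OF y] mem(2)[OF xY] by (simp add: M.minus_add_cancel)
      qed
      with XY show False by blast
    qed
    then show "l1 (f ` X) + l2 (X \<inter> ?K) < l1 (f ` Y) + l2 (Y \<inter> ?K)"
    proof
      assume "f ` X \<noteq> f ` Y"
      then have "l1 (f ` X) < l1 (f ` Y)" using incl by (intro l1(1) sub) auto
      moreover have "l2 (X \<inter> ?K) \<le> l2 (Y \<inter> ?K)" by (intro l2(2) sub incl)
      ultimately show ?thesis by simp
    next
      assume "X \<inter> ?K \<noteq> Y \<inter> ?K"
      then have "l2 (X \<inter> ?K) < l2 (Y \<inter> ?K)" using incl by (intro l2(1) sub) auto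
      moreover have "l1 (f ` X) \<le> l1 (f ` Y)" by (intro l1(2) sub incl)
      ultimately show ?thesis by simp
    qed
  qed
qed

subsection \<open>Commutative artinian rings\<close>

context cring
begin

lemma submodule_regular_ideal:
  assumes "submodule I R (regular_module R)"
  shows "ideal I R"
proof (rule idealI)
  show "subgroup I (add_monoid R)"
    using submodule.axioms(1)[OF assms] unfolding subgroup_def by (simp add: regular_module_def a_inv_def m_inv_def)
  show "x \<otimes> a \<in> I" if "a \<in> I" "x \<in> carrier R" for a x
    using submodule_smult[OF assms that(2,1)] by simp
  then show "a \<otimes> x \<in> I" if "a \<in> I" "x \<in> carrier R" for a x
    using that submodule_mem[OF assms that(1)] by (simp add: m_comm[of a x])
qed (rule ring_axioms)

lemma hom_mult: "x \<in> carrier R \<Longrightarrow> (\<lambda>y. x \<otimes> y) \<in> module_hom R (regular_module R) (regular_module R)"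
  by (rule module_homI) (auto simp: r_distr m_lcomm)

end

text \<open>Submodules of the regular module are ideals, so the descending chain condition makes
  strict inclusion well-founded. The predicate \<open>P\<close> is kept arbitrary because two
  different families of ideals are minimized below.\<close>

lemma artinian_minimal:
  assumes "artinian_cring R" "submodule I R (regular_module R)" "P I"
  shows "\<exists>J. submodule J R (regular_module R) \<and> P J \<and>
    (\<forall>K. submodule K R (regular_module R) \<and> K \<subset> J \<longrightarrow> \<not> P K)"
proof -
  interpret cring R using assms(1) by (simp add: artinian_cring_def)
  let ?r = "{(K, J). submodule K R (regular_module R) \<and> submodule J R (regular_module R) \<and> K \<subset> J}"
  have "wf ?r"
    unfolding wf_iff_no_infinite_down_chain
  proof
    assume "\<exists>f. \<forall>i. (f (Suc i), f i) \<in> ?r"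
    then obtain f where "\<forall>i. (f (Suc i), f i) \<in> ?r" by blast
    then have f: "\<And>i. submodule (f i) R (regular_module R)" "\<And>i. f (Suc i) \<subset> f i" by simp_all
    then have "\<forall>n. ideal (f n) R \<and> f (Suc n) \<subseteq> f n" using submodule_regular_ideal by blast
    then obtain n where "\<forall>m\<ge>n. f m = f n" using assms(1) unfolding artinian_cring_def by blast
    then have "f (Suc n) = f n" using le_SucI[OF le_refl] by blast
    with f(2)[of n] show False by simp
  qed
  then have "\<exists>J\<in>{J. submodule J R (regular_module R) \<and> P J}.
      \<forall>K. (K, J) \<in> ?r \<longrightarrow> K \<notin> {J. submodule J R (regular_module R) \<and> P J}"
    using assms(2,3) unfolding wf_eq_minimal
    by (elim allE[of _ "{J. submodule J R (regular_module R) \<and> P J}"]) blast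
  then show ?thesis by auto
qed

text \<open>
  A minimal ideal \<open>I\<close> of infinite length is, since each ring element acts on it by zero or
  surjectively, a vector space over a residue field. A hyperplane of \<open>I\<close> has finite length by
  minimality, hence so has \<open>I\<close>, a contradiction.
\<close>

lemma artinian_finite_length:
  fixes R (structure)
  assumes "artinian_cring R"
  shows "finite_length_on R (regular_module R) (carrier R)"
proof (rule ccontr)
  interpret cring R using assms by (simp add: artinian_cring_def)
  let ?M = "regular_module R"
  assume "\<not> finite_length_on R ?M (carrier R)"
  note lm = regular_left_module[OF ring_axioms]
  interpret M: left_module R ?M by (rule lm)
  have "submodule (carrier R) R ?M" using M.carrier_submodule by simp
  from artinian_minimal[of R _ "\<lambda>I. \<not> finite_length_on R ?M I", OF assms this \<open>\<not> finite_length_on R ?M (carrier R)\<close>]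
  obtain I where I: "submodule I R ?M" and nI: "\<not> finite_length_on R ?M I"
    and min: "\<And>K. submodule K R ?M \<Longrightarrow> K \<subset> I \<Longrightarrow> finite_length_on R ?M K"
    by auto
  have memI: "u \<in> carrier R" if "u \<in> I" for u using submodule_mem[OF I that] by simp
  \<comment> \<open>If \<open>x\<close> acts on \<open>I\<close> neither as zero nor onto, then
    image and kernel are both proper submodules of \<open>I\<close>. Both have finite length by
    minimality, and therefore so has \<open>I\<close>.\<close>
  have onto: "(\<lambda>y. x \<otimes> y) ` I = I" if x: "x \<in> carrier R" and "u \<in> I" "x \<otimes> u \<noteq> \<zero>" for x u
  proof (rule ccontr)
    assume neq: "(\<lambda>y. x \<otimes> y) ` I \<noteq> I"
    have "(\<lambda>y. x \<otimes> y) ` I \<subset> I" using neq submodule_smult[OF I x] by auto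
    moreover have "submodule ((\<lambda>y. x \<otimes> y) ` I) R ?M" by (rule submodule_image[OF hom_mult[OF x] lm lm I])
    ultimately have 1: "finite_length_on R ?M ((\<lambda>y. x \<otimes> y) ` I)" using min by blast
    have "submodule (I \<inter> a_kernel ?M ?M (\<lambda>y. x \<otimes> y)) R ?M"
      by (intro submodule_Int I submodule_ker[OF hom_mult[OF x] lm lm] lm)
    moreover have "I \<inter> a_kernel ?M ?M (\<lambda>y. x \<otimes> y) \<subset> I" using that(2,3) by (auto simp: ker_iff)
    ultimately have 2: "finite_length_on R ?M (I \<inter> a_kernel ?M ?M (\<lambda>y. x \<otimes> y))" using min by blast
    show False using finite_length_on_ext[OF hom_mult[OF x] lm lm I 1 2] nI by blast
  qed
  have inverse: "\<exists>y\<in>carrier R. \<forall>u\<in>I. y \<otimes> (x \<otimes> u) = u" if x: "x \<in> carrier R" and u: "u \<in> I" "x \<otimes> u \<noteq> \<zero>" for x u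
  proof -
    \<comment> \<open>An inverse for the action of \<open>x\<close> comes from a second minimal
      choice: among the principal ideals \<open>R s\<close> with \<open>s I = I\<close>, take a
      minimal one. As \<open>x s\<close> also acts onto, \<open>R (x s) = R s\<close>, so
      \<open>s = y x s\<close> for some \<open>y\<close>, and \<open>y x\<close> is the identity on
      \<open>s I = I\<close>.\<close>
    let ?P = "\<lambda>K. \<exists>s\<in>carrier R. (\<lambda>y. s \<otimes> y) ` I = I \<and> K = (\<lambda>a. a \<otimes> s) ` carrier R"
    have sub: "submodule ((\<lambda>a. a \<otimes> s) ` carrier R) R ?M" if "s \<in> carrier R" for s
      using submodule_range[OF hom_regular[OF lm, of s] lm lm] that by simp
    have "(\<lambda>y. \<one> \<otimes> y) ` I = I" using memI by (simp cong: image_cong)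
    then have "?P ((\<lambda>a. a \<otimes> \<one>) ` carrier R)" by blast
    from artinian_minimal[of R _ ?P, OF assms sub[OF one_closed] this]
    obtain K where K: "?P K" and "\<forall>K'. submodule K' R ?M \<and> K' \<subset> K \<longrightarrow> \<not> ?P K'"
      by (elim exE conjE)
    then have Kmin: "\<not> ?P K'" if "submodule K' R ?M" "K' \<subset> K" for K'
      using that by simp
    from K obtain s where s: "s \<in> carrier R" "(\<lambda>y. s \<otimes> y) ` I = I" "K = (\<lambda>a. a \<otimes> s) ` carrier R" by blast
    have "(\<lambda>y. x \<otimes> s \<otimes> y) ` I = (\<lambda>y. x \<otimes> y) ` ((\<lambda>y. s \<otimes> y) ` I)"
      using x s(1) memI by (auto simp: m_assoc image_image)
    then have xs: "(\<lambda>y. x \<otimes> s \<otimes> y) ` I = I" using onto[OF x u] s(2) by simp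
    have "(\<lambda>a. a \<otimes> (x \<otimes> s)) ` carrier R \<subseteq> K"
      using x s(1) unfolding s(3) by (auto simp flip: m_assoc)
    moreover have "?P ((\<lambda>a. a \<otimes> (x \<otimes> s)) ` carrier R)" using xs x s(1) by blast
    ultimately have "(\<lambda>a. a \<otimes> (x \<otimes> s)) ` carrier R = K" using Kmin sub[of "x \<otimes> s"] x s(1) by auto
    moreover have "s \<in> K" unfolding s(3) using s(1) by (intro image_eqI[of _ _ \<one>]) auto
    ultimately obtain y where y: "y \<in> carrier R" "s = y \<otimes> (x \<otimes> s)" by blast
    have "y \<otimes> (x \<otimes> v) = v" if v: "v \<in> I" for v
    proof -
      obtain w where w: "w \<in> I" "v = s \<otimes> w" using s(2) v by blast
      have "y \<otimes> (x \<otimes> (s \<otimes> w)) = y \<otimes> (x \<otimes> s) \<otimes> w" using y(1) x s(1) memI[OF w(1)] by (simp add: m_assoc)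
      also have "\<dots> = s \<otimes> w" by (rule arg_cong[OF y(2)[symmetric]])
      finally show ?thesis by (simp only: w(2))
    qed
    with y(1) show ?thesis by blast
  qed
  obtain v where v: "v \<in> I" "v \<noteq> \<zero>"
    using nI submodule_zero[OF I] finite_length_on_zero[of R ?M] finite_length_on_subset[of R ?M "{\<zero>}" I] by auto
  let ?Rv = "(\<lambda>a. a \<otimes> v) ` carrier R"
  have Rv: "submodule ?Rv R ?M"
    using submodule_range[OF hom_regular[OF lm, of v] lm lm] memI[OF v(1)] by simp
  \<comment> \<open>\<open>R v\<close> is simple, since any nonzero \<open>x v\<close> can be
    multiplied back to \<open>v\<close>; rank 0 for the zero submodule and 1 otherwise is therefore
    enough.\<close>
  have flRv: "finite_length_on R ?M ?Rv"
  proof (rule finite_length_onI[where rk = "\<lambda>X. if X = {\<zero>} then 0 else 1"])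
    fix X Y assume X: "submodule X R ?M" and "submodule Y R ?M" and XY: "X \<subset> Y" "Y \<subseteq> ?Rv"
    have "X = {\<zero>}"
    proof (rule ccontr)
      assume "X \<noteq> {\<zero>}"
      then obtain w where w: "w \<in> X" "w \<noteq> \<zero>" using submodule_zero[OF X] by auto
      then obtain x where x: "x \<in> carrier R" "w = x \<otimes> v" using XY by blast
      then obtain y where y: "y \<in> carrier R" "y \<otimes> (x \<otimes> v) = v" using inverse[OF x(1) v(1)] v(1) w(2) by blast
      then have "v \<in> X" using submodule_smult[OF X y(1) w(1)] x by simp
      then have "?Rv \<subseteq> X" using submodule_smult[OF X] by auto
      with XY show False by blast
    qed
    moreover have "Y \<noteq> {\<zero>}" using XY(1) \<open>X = {\<zero>}\<close> by blast
    ultimately show "(if X = {\<zero>} then 0 else 1 :: nat) < (if Y = {\<zero>} then 0 else 1)" by simp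
  qed
  \<comment> \<open>A submodule of \<open>I\<close> maximal among those avoiding \<open>v\<close>
    plays the role of a hyperplane complementary to \<open>R v\<close>.\<close>
  let ?W = "{W. submodule W R ?M \<and> W \<subseteq> I \<and> v \<notin> W}"
  have ex: "\<exists>W\<in>?W. \<forall>X\<in>?W. W \<subseteq> X \<longrightarrow> X = W"
  proof (rule subset_Zorn_nonempty)
    have "{\<zero>} \<in> ?W" using M.zero_submodule v submodule_zero[OF I] by simp
    then show "?W \<noteq> {}" by (metis empty_iff)
    fix \<C> assume \<C>: "\<C> \<noteq> {}" "subset.chain ?W \<C>"
    then have mem: "\<And>W. W \<in> \<C> \<Longrightarrow> submodule W R ?M \<and> W \<subseteq> I \<and> v \<notin> W"
      and comp: "\<And>W X. W \<in> \<C> \<Longrightarrow> X \<in> \<C> \<Longrightarrow> W \<subseteq> X \<or> X \<subseteq> W"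
      by (auto simp: subset.chain_def)
    have "submodule (\<Union>\<C>) R ?M"
    proof (rule M.submoduleI)
      show "\<Union>\<C> \<subseteq> carrier ?M" using mem submodule_subset by blast
      obtain X where "X \<in> \<C>" using \<C>(1) by blast
      then show "\<zero>\<^bsub>?M\<^esub> \<in> \<Union>\<C>" using mem submodule_zero[of X R ?M] by blast
      show "a \<odot>\<^bsub>?M\<^esub> x \<in> \<Union>\<C>" if a: "a \<in> carrier R" and x: "x \<in> \<Union>\<C>" for a x
      proof -
        obtain X where "X \<in> \<C>" "x \<in> X" using x by blast
        then show ?thesis using mem submodule_smult[of X R ?M a x] a by blast
      qed
      fix x y assume "x \<in> \<Union>\<C>" "y \<in> \<Union>\<C>"
      then obtain X Y where XY: "X \<in> \<C>" "x \<in> X" "Y \<in> \<C>" "y \<in> Y" by blast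
      then have "x \<in> Y \<and> y \<in> Y \<or> x \<in> X \<and> y \<in> X" using comp by blast
      then show "x \<oplus>\<^bsub>?M\<^esub> y \<in> \<Union>\<C>"
        using mem XY(1,3) submodule_add[of X R ?M x y] submodule_add[of Y R ?M x y] by blast
    qed
    then show "\<Union>\<C> \<in> ?W" using mem by blast
  qed
  then obtain W where W: "submodule W R ?M" "W \<subseteq> I" "v \<notin> W"
    and max': "\<forall>X\<in>?W. W \<subseteq> X \<longrightarrow> X = W" by auto
  have max: "X = W" if "submodule X R ?M" "X \<subseteq> I" "v \<notin> X" "W \<subseteq> X" for X
    using max' that by simp
  have "I \<subseteq> W <+>\<^bsub>?M\<^esub> ?Rv"
  proof
    fix u assume u: "u \<in> I"
    show "u \<in> W <+>\<^bsub>?M\<^esub> ?Rv"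
    proof (cases "u \<in> W")
      case True
      have "\<zero> \<in> ?Rv" using submodule_zero[OF Rv] by simp
      from set_addI[OF True this, of ?M] show ?thesis using memI[OF u] by simp
    next
      case False
      let ?Ru = "(\<lambda>a. a \<otimes> u) ` carrier R"
      have Ru: "submodule ?Ru R ?M"
        using submodule_range[OF hom_regular[OF lm, of u] lm lm] memI[OF u] by simp
      let ?X = "W <+>\<^bsub>?M\<^esub> ?Ru"
      have X: "submodule ?X R ?M" by (rule submodule_set_add[OF lm W(1) Ru])
      have WX: "W \<subseteq> ?X"
      proof
        fix w assume w: "w \<in> W"
        have "\<zero> \<in> ?Ru" using submodule_zero[OF Ru] by simp
        from set_addI[OF w this, of ?M] show "w \<in> ?X" using submodule_mem[OF W(1) w] by simp
      qed
      have "u \<in> ?X"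
      proof -
        have "u = \<zero> \<oplus> u" "u = \<one> \<otimes> u" using memI[OF u] by auto
        then have "u \<in> ?Ru" by blast
        from set_addI[OF submodule_zero[OF W(1)] this, of ?M] show ?thesis using memI[OF u] by simp
      qed
      moreover have "?X \<subseteq> I"
      proof
        fix z assume "z \<in> ?X"
        then obtain w a where "w \<in> W" "a \<in> carrier R" "z = w \<oplus> a \<otimes> u" by (auto simp: set_add_iff)
        then show "z \<in> I"
          using submodule_add[OF I, of w "a \<otimes> u"] submodule_smult[OF I _ u, of a] W(2) by auto
      qed
      \<comment> \<open>\<open>W + R u\<close> is strictly larger than \<open>W\<close>, hence
        contains \<open>v = w + x u\<close>. Here \<open>x u\<close> is nonzero because
        \<open>v\<close> is not in \<open>W\<close>, so \<open>x\<close> can be inverted on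
        \<open>I\<close> and the equation solved for \<open>u\<close>.\<close>
      ultimately have "v \<in> ?X" using max[OF X _ _ WX] False by blast
      then obtain w x where wx: "w \<in> W" "x \<in> carrier R" "v = w \<oplus> x \<otimes> u" by (auto simp: set_add_iff)
      note cl = submodule_mem[OF W(1) wx(1), simplified] memI[OF u] wx(2)
      have "x \<otimes> u \<noteq> \<zero>" using wx W(3) cl by auto
      then obtain y where y: "y \<in> carrier R" "y \<otimes> (x \<otimes> u) = u" using inverse[OF wx(2) u] u by blast
      have "y \<otimes> v = y \<otimes> w \<oplus> u" unfolding wx(3) using cl y by (simp add: r_distr)
      then have "u = (\<ominus> y) \<otimes> w \<oplus> y \<otimes> v" using cl y(1) by (simp add: l_minus r_neg1)
      moreover have "(\<ominus> y) \<otimes> w \<in> W" using submodule_smult[OF W(1) _ wx(1), of "\<ominus> y"] y(1) by simp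
      moreover have "y \<otimes> v \<in> ?Rv" using y(1) by blast
      ultimately show ?thesis using set_addI[of _ W "y \<otimes> v" ?Rv ?M] by simp
    qed
  qed
  moreover have "finite_length_on R ?M (W <+>\<^bsub>?M\<^esub> ?Rv)"
    using min[OF W(1)] W v(1) by (intro finite_length_on_set_add lm W(1) Rv flRv) blast
  ultimately show False using nI finite_length_on_subset by blast
qed

subsection \<open>Consequences of finite length\<close>

text \<open>Both chain conditions for left modules at once. It is instantiated for the commutative
  base ring, from which finiteness of the algebra and of D \<Lambda> is derived, and for the algebra
  itself.\<close>

locale finite_length_ring =
  fixes A :: "('a, 'x) ring_scheme"
  assumes ring: "ring A"
    and finite_length: "finite_length_on A (regular_module A) (carrier A)"
begin

lemma fg_finite_length:
  assumes "fg_module A M"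
  shows "finite_length_on A M (carrier M)"
proof -
  note M = fg_left_module[OF assms] and R = regular_left_module[OF ring]
  interpret left_module A M by fact
  obtain gs where gs: "set gs \<subseteq> carrier M"
    "\<And>x. x \<in> carrier M \<Longrightarrow> \<exists>c. (\<forall>i. c i \<in> carrier A) \<and> x = lincomb M gs c"
    by (rule fg_generators[OF assms]) blast
  have "finite_length_on A M {lincomb M gs c | c. \<forall>i. c i \<in> carrier A}" using gs(1)
  proof (induction gs)
    case Nil
    show ?case by (rule finite_length_on_subset[OF finite_length_on_zero]) auto
  next
    case (Cons g gs)
    then have g: "g \<in> carrier M" by simp
    let ?f = "\<lambda>a. a \<odot>\<^bsub>M\<^esub> g"
    let ?S = "{lincomb M gs c | c. \<forall>i. c i \<in> carrier A}"
    note f = hom_regular[OF M g]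
    have "finite_length_on A M (?f ` carrier A)"
      using finite_length_on_image[OF f R M] left_module.carrier_submodule[OF R] finite_length by simp
    then have "finite_length_on A M ((?f ` carrier A) <+>\<^bsub>M\<^esub> ?S)"
      using Cons submodule_range[OF f R M] by (intro finite_length_on_set_add M lincomb_submodule) auto
    then show ?case
    proof (rule finite_length_on_subset, intro subsetI)
      fix x assume "x \<in> {lincomb M (g # gs) c | c. \<forall>i. c i \<in> carrier A}"
      then obtain c where c: "\<forall>i. c i \<in> carrier A" "x = lincomb M (g # gs) c" by blast
      have "c 0 \<odot>\<^bsub>M\<^esub> g \<in> ?f ` carrier A" "lincomb M gs (\<lambda>i. c (Suc i)) \<in> ?S"
        using c(1) by blast+
      from set_addI[OF this] show "x \<in> (?f ` carrier A) <+>\<^bsub>M\<^esub> ?S" using c(2) by simp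
    qed
  qed
  then show ?thesis by (rule finite_length_on_subset) (use gs(2) in blast)
qed

lemma rankE:
  assumes "fg_module A M"
  obtains rk :: "'m set \<Rightarrow> nat" where
    "\<And>X Y. submodule X A M \<Longrightarrow> submodule Y A M \<Longrightarrow> X \<subset> Y \<Longrightarrow> rk X < rk Y"
    "\<And>X Y. submodule X A M \<Longrightarrow> submodule Y A M \<Longrightarrow> X \<subseteq> Y \<Longrightarrow> rk X \<le> rk Y"
proof (rule finite_length_onE[OF fg_finite_length[OF assms]])
  fix rk :: "'m set \<Rightarrow> nat"
  assume 1: "\<And>X Y. submodule X A M \<Longrightarrow> submodule Y A M \<Longrightarrow> X \<subset> Y \<Longrightarrow> Y \<subseteq> carrier M \<Longrightarrow> rk X < rk Y"
    and 2: "\<And>X Y. submodule X A M \<Longrightarrow> submodule Y A M \<Longrightarrow> X \<subseteq> Y \<Longrightarrow> Y \<subseteq> carrier M \<Longrightarrow> rk X \<le> rk Y"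
  show thesis
  proof
    show "rk X < rk Y" if "submodule X A M" "submodule Y A M" "X \<subset> Y" for X Y
      by (rule 1[OF that submodule_subset[OF that(2)]])
    show "rk X \<le> rk Y" if "submodule X A M" "submodule Y A M" "X \<subseteq> Y" for X Y
      by (rule 2[OF that submodule_subset[OF that(2)]])
  qed
qed

lemma submodule_minimal:
  assumes "fg_module A M" "submodule I A M" "P I"
  shows "\<exists>J. submodule J A M \<and> P J \<and> (\<forall>K. submodule K A M \<and> P K \<and> K \<subseteq> J \<longrightarrow> K = J)"
proof -
  obtain rk :: "'b set \<Rightarrow> nat" where rk: "\<And>X Y. submodule X A M \<Longrightarrow> submodule Y A M \<Longrightarrow> X \<subset> Y \<Longrightarrow> rk X < rk Y"
    by (rule rankE[OF assms(1)]) blast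
  have "\<exists>J. (submodule J A M \<and> P J) \<and> (\<forall>K. submodule K A M \<and> P K \<longrightarrow> rk J \<le> rk K)"
    by (rule ex_has_least_nat[of _ I]) (use assms(2,3) in simp)
  then obtain J where J: "submodule J A M" "P J" and "\<forall>K. submodule K A M \<and> P K \<longrightarrow> rk J \<le> rk K"
    by (elim exE conjE)
  then have Jmin: "rk J \<le> rk K" if "submodule K A M" "P K" for K
    using that by simp
  have "K = J" if K: "submodule K A M" "P K" "K \<subseteq> J" for K
    using rk[OF K(1) J(1)] Jmin[OF K(1,2)] K(3) by fastforce
  with J show ?thesis by blast
qed

lemma fg_submodule:
  assumes "fg_module A M" "submodule H A M"
  shows "fg_module A (M\<lparr>carrier := H\<rparr>)"
proof -
  note M = fg_left_module[OF assms(1)]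
  interpret left_module A M by (rule M)
  obtain rk :: "'b set \<Rightarrow> nat" where rk: "\<And>X Y. submodule X A M \<Longrightarrow> submodule Y A M \<Longrightarrow> X \<subset> Y \<Longrightarrow> rk X < rk Y"
    "\<And>X Y. submodule X A M \<Longrightarrow> submodule Y A M \<Longrightarrow> X \<subseteq> Y \<Longrightarrow> rk X \<le> rk Y"
    by (rule rankE[OF assms(1)]) blast
  let ?S = "\<lambda>gs. {lincomb M gs c | c. \<forall>i. c i \<in> carrier A}"
  note HM = submodule_subset[OF assms(2)]
  have sub: "submodule (?S gs) A M" if "set gs \<subseteq> H" for gs
    using that HM by (intro lincomb_submodule) auto
  have subH: "?S gs \<subseteq> H" if "set gs \<subseteq> H" for gs
    using lincomb_mem[OF assms(2) that] by auto
  have bound: "\<forall>gs. set gs \<subseteq> H \<longrightarrow> rk (?S gs) < Suc (rk H)"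
    using rk(2)[OF sub assms(2) subH] by (simp add: less_Suc_eq_le)
  have "set [] \<subseteq> H" by simp
  \<comment> \<open>The noetherian argument by rank: take a finite list in \<open>H\<close> whose
    span has the largest rank. Adding any further element of \<open>H\<close> then leaves the span
    unchanged.\<close>
  from ex_has_greatest_nat[of "\<lambda>gs. set gs \<subseteq> H" "[]" "\<lambda>gs. rk (?S gs)" "Suc (rk H)", OF this bound]
  obtain gs where gs: "set gs \<subseteq> H" "\<And>hs. set hs \<subseteq> H \<Longrightarrow> rk (?S hs) \<le> rk (?S gs)" by blast
  have H: "H = ?S gs"
  proof
    show "H \<subseteq> ?S gs"
    proof
      fix x assume x: "x \<in> H"
      have xgs: "set (x # gs) \<subseteq> H" "set (x # gs) \<subseteq> carrier M" using x gs(1) HM by auto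
      have "?S gs \<subseteq> ?S (x # gs)"
      proof (rule subsetI)
        fix z assume "z \<in> ?S gs"
        then obtain c where "\<forall>i. c i \<in> carrier A" "z = lincomb M gs c" by blast
        moreover have "set gs \<subseteq> ?S (x # gs)"
        proof
          fix g assume "g \<in> set gs"
          then have "\<exists>c. (\<forall>i. c i \<in> carrier A) \<and> g = lincomb M (x # gs) c" by (intro lincomb_gen[OF xgs(2)]) simp
          then show "g \<in> ?S (x # gs)" by blast
        qed
        ultimately show "z \<in> ?S (x # gs)"
          using lincomb_mem[OF lincomb_submodule[OF xgs(2)], of gs c] by blast
      qed
      then have "?S gs = ?S (x # gs)"
        using rk(1)[OF sub[OF gs(1)] sub[OF xgs(1)]] gs(2)[OF xgs(1)] by fastforce
      moreover have "x \<in> ?S (x # gs)" using lincomb_gen[OF xgs(2), of x] by auto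
      ultimately show "x \<in> ?S gs" by simp
    qed
  qed (rule subH[OF gs(1)])
  show ?thesis
  proof (rule fg_moduleI[OF submodule_left_module[OF M assms(2)], of "set gs"])
    fix K x assume K: "submodule K A (M\<lparr>carrier := H\<rparr>)" "set gs \<subseteq> K" "x \<in> carrier (M\<lparr>carrier := H\<rparr>)"
    then have "submodule K A M" using submodule_restrict_iff[OF M assms(2)] by blast
    moreover obtain c where "\<forall>i. c i \<in> carrier A" "x = lincomb M gs c" using K(3) H by auto
    ultimately show "x \<in> K" using lincomb_mem[OF _ K(2)] by blast
  qed (use gs in auto)
qed

lemma fg_mono:
  assumes "f \<in> module_mono A M N" "fg_module A N" "left_module A M"
  shows "fg_module A M"
proof -
  note N = fg_left_module[OF assms(2)]
  have sub: "submodule (f ` carrier M) A N" by (rule submodule_range[OF mono_hom[OF assms(1)] assms(3) N])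
  let ?I = "N\<lparr>carrier := f ` carrier M\<rparr>"
  have "isomorphic_modules A M ?I"
    unfolding isomorphic_modules_def
    using hom_restrict_cod[OF mono_hom[OF assms(1)]] assms(1) by (auto simp: bij_betw_def module_mono_def)
  from isomorphic_retract[OF this assms(3)] show ?thesis
    by (rule fg_retract[OF _ fg_submodule[OF assms(2) sub] assms(3)])
qed

lemma kernel_ses:
  assumes "p \<in> module_epi A M N" "fg_module A M" "left_module A N"
  shows "fg_ses A (M\<lparr>carrier := a_kernel M N p\<rparr>) (\<lambda>x. x) M p N"
proof (rule fg_sesI)
  note sub = submodule_ker[OF epi_hom[OF assms(1)] fg_left_module[OF assms(2)] assms(3)]
  show "(\<lambda>x. x) \<in> module_mono A (M\<lparr>carrier := a_kernel M N p\<rparr>) M"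
    using hom_incl[OF submodule_subset[OF sub]] by (auto simp: module_mono_def)
  show "fg_module A (M\<lparr>carrier := a_kernel M N p\<rparr>)" by (rule fg_submodule[OF assms(2) sub])
  show "fg_module A N" by (rule fg_epi[OF assms(2,1,3)])
qed (use assms in \<open>auto simp: ker_iff\<close>)

lemma ext_pres_retract:
  assumes "ext_pres A N Z" "retract A M Z" "fg_module A M" "left_module A N"
  shows "ext_pres A N M"
proof -
  obtain n p where "p \<in> module_epi A (module_power (regular_module A) n) M"
    using free_cover[OF assms(3)] by (auto simp: Gen_iff)
  from kernel_ses[OF this fg_module_power[OF regular_fg[OF ring]] fg_left_module[OF assms(3)]]
  show ?thesis
    by (rule ext_pres_ses_retract[OF assms(1,2) _ projective_module_power[OF projective_regular[OF ring]] assms(4)])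
qed

lemma ext_pres_in_add:
  assumes "ext_pres A N X" "in_add A X M" "left_module A N" "fg_module A X" "left_module A M"
  shows "ext_pres A N M"
proof -
  note X = fg_left_module[OF assms(4)]
  have "ext_pres A N (module_power X n)" for n
  proof (induction n)
    case 0
    show ?case
      by (rule ext_pres_projective[OF projective_zero[OF module_power_left_module module_power_zero] assms(3)]) (rule X)
  next
    case (Suc n)
    show ?case
      by (rule ext_pres_retract[OF ext_pres_prod[OF assms(1) Suc assms(3)] retract_module_power_Suc(1)[OF X]
            fg_module_power[OF assms(4)] assms(3)])
  qed
  moreover obtain n where n: "retract A M (module_power X n)" using assms(2) by (auto simp: in_add_def)
  moreover have "fg_module A M" by (rule fg_retract[OF n fg_module_power[OF assms(4)] assms(5)])
  ultimately show ?thesis using ext_pres_retract assms(3) by blast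
qed

section \<open>Fitting's lemma and indecomposable modules\<close>

lemma hom_funpow: "f \<in> module_hom A M M \<Longrightarrow> f ^^ n \<in> module_hom A M M"
proof (induction n)
  case 0
  then show ?case using hom_id[of A M] by (simp add: id_def)
next
  case (Suc n)
  then show ?case using hom_comp[of "f ^^ n" A M M f M] by (simp add: comp_def)
qed

lemma fitting:
  assumes "fg_module A M" "f \<in> module_hom A M M"
  obtains n where "n > 0" "complementary_submodules A M ((f ^^ n) ` carrier M) (a_kernel M M (f ^^ n))"
proof -
  note M = fg_left_module[OF assms(1)]
  interpret left_module A M by (rule M)
  obtain rk :: "'b set \<Rightarrow> nat" where rk: "\<And>X Y. submodule X A M \<Longrightarrow> submodule Y A M \<Longrightarrow> X \<subset> Y \<Longrightarrow> rk X < rk Y"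
    "\<And>X Y. submodule X A M \<Longrightarrow> submodule Y A M \<Longrightarrow> X \<subseteq> Y \<Longrightarrow> rk X \<le> rk Y"
    by (rule rankE[OF assms(1)]) blast
  define im where "im = (\<lambda>n. (f ^^ n) ` carrier M)"
  define ker where "ker = (\<lambda>n. a_kernel M M (f ^^ n))"
  note fn = hom_funpow[OF assms(2)] and cl = hom_closed[OF hom_funpow[OF assms(2)]]
  have sub: "submodule (im n) A M" "submodule (ker n) A M" for n
    unfolding im_def ker_def by (rule submodule_range[OF fn M M] submodule_ker[OF fn M M])+
  have im_le: "im (n + m) \<subseteq> im n" for n m
    using cl by (auto simp: im_def funpow_add)
  have ker_le: "ker n \<subseteq> ker (n + m)" for n m
    using cl hom_zero[OF fn M M] unfolding ker_def add.commute[of n m] by (auto simp: funpow_add ker_iff)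
  obtain n0 where n0: "\<And>n. rk (im n0) \<le> rk (im n)"
    using ex_has_least_nat[of "\<lambda>_. True" 0 "\<lambda>n. rk (im n)"] by blast
  have "\<forall>n. True \<longrightarrow> rk (ker n) < Suc (rk (carrier M))"
    using rk(2)[OF sub(2) carrier_submodule submodule_subset[OF sub(2)]] by (simp add: less_Suc_eq_le)
  from ex_has_greatest_nat[of "\<lambda>_. True" 0 "\<lambda>n. rk (ker n)", OF TrueI this]
  obtain n1 where n1: "\<And>n. rk (ker n) \<le> rk (ker n1)" by blast
  have im_eq: "im (n0 + m) = im n0" for m
    using rk(1)[OF sub(1) sub(1), of "n0 + m" n0] n0[of "n0 + m"] im_le[of n0 m] by fastforce
  have ker_eq: "ker (n1 + m) = ker n1" for m
    using rk(1)[OF sub(2) sub(2), of n1 "n1 + m"] n1[of "n1 + m"] ker_le[of n1 m] by fastforce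
  \<comment> \<open>Past both the index \<open>n0\<close> from which the images are stationary and
    the index \<open>n1\<close> from which the kernels are. \<open>Suc\<close> keeps the exponent
    positive, which lets the applications split off one factor \<open>f\<close>.\<close>
  define N where "N = Suc (n0 + n1)"
  have im_N: "im (N + N) = im N"
    using im_eq[of "Suc n1"] im_eq[of "Suc n1 + N"] by (simp add: N_def ac_simps)
  have ker_N: "ker (N + N) = ker N"
    using ker_eq[of "Suc n0"] ker_eq[of "Suc n0 + N"] by (simp add: N_def ac_simps)
  have NN: "(f ^^ (N + N)) x = (f ^^ N) ((f ^^ N) x)" for x by (simp add: funpow_add)
  have "complementary_submodules A M (im N) (ker N)"
    unfolding complementary_submodules_def
  proof (intro conjI sub)
    show "im N \<inter> ker N = {\<zero>\<^bsub>M\<^esub>}"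
    proof
      show "{\<zero>\<^bsub>M\<^esub>} \<subseteq> im N \<inter> ker N" using submodule_zero[OF sub(1)] submodule_zero[OF sub(2)] by blast
      show "im N \<inter> ker N \<subseteq> {\<zero>\<^bsub>M\<^esub>}"
      proof
        fix x assume "x \<in> im N \<inter> ker N"
        then obtain y where y: "y \<in> carrier M" "x = (f ^^ N) y" "(f ^^ N) x = \<zero>\<^bsub>M\<^esub>"
          by (auto simp: im_def ker_def ker_iff)
        then have "y \<in> ker (N + N)" by (simp add: ker_def ker_iff NN)
        then show "x \<in> {\<zero>\<^bsub>M\<^esub>}" unfolding ker_N using y by (simp add: ker_def ker_iff)
      qed
    qed
    show "im N <+>\<^bsub>M\<^esub> ker N = carrier M"
    proof
      show "im N <+>\<^bsub>M\<^esub> ker N \<subseteq> carrier M" using submodule_subset[OF submodule_set_add[OF M sub]] .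
      show "carrier M \<subseteq> im N <+>\<^bsub>M\<^esub> ker N"
      proof
        fix x assume x: "x \<in> carrier M"
        then have "(f ^^ N) x \<in> im (N + N)" unfolding im_N by (simp add: im_def)
        then obtain y where y: "y \<in> carrier M" "(f ^^ N) x = (f ^^ N) ((f ^^ N) y)" by (auto simp: im_def NN)
        have "x \<ominus>\<^bsub>M\<^esub> (f ^^ N) y \<in> ker N"
          using x y cl by (simp add: ker_def ker_iff hom_minus[OF fn M M] minus_self)
        moreover have "(f ^^ N) y \<in> im N" using y(1) by (simp add: im_def)
        ultimately show "x \<in> im N <+>\<^bsub>M\<^esub> ker N"
          using set_addI[of "(f ^^ N) y" "im N" _ "ker N" M] x y(1) cl by (metis add_minus_cancel)
      qed
    qed
  qed
  then show thesis using that[of N] by (simp add: N_def im_def ker_def)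
qed

lemma surj_inj:
  assumes "fg_module A M" "f \<in> module_hom A M M" "f ` carrier M = carrier M"
  shows "f \<in> module_mono A M M"
proof -
  note M = fg_left_module[OF assms(1)]
  obtain n where n: "n > 0" "complementary_submodules A M ((f ^^ n) ` carrier M) (a_kernel M M (f ^^ n))"
    by (rule fitting[OF assms(1,2)]) blast
  have im: "(f ^^ m) ` carrier M = carrier M" for m
  proof (induction m)
    case (Suc m)
    have "(f ^^ Suc m) ` carrier M = f ` (f ^^ m) ` carrier M" by (simp add: image_comp)
    with Suc assms(3) show ?case by simp
  qed simp
  have ker: "carrier M \<inter> a_kernel M M (f ^^ n) = {\<zero>\<^bsub>M\<^esub>}"
    using n(2) by (simp add: complementary_submodules_def im)
  obtain m where m: "n = Suc m" using n(1) gr0_implies_Suc by blast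
  show ?thesis
  proof (rule monoI[OF assms(2) M M])
    fix x assume x: "x \<in> carrier M" "f x = \<zero>\<^bsub>M\<^esub>"
    then have "(f ^^ n) x = \<zero>\<^bsub>M\<^esub>"
      unfolding m funpow_Suc_right using hom_zero[OF hom_funpow[OF assms(2)] M M, of m] by simp
    then have "x \<in> carrier M \<inter> a_kernel M M (f ^^ n)" using x(1) by (simp add: ker_iff)
    then show "x = \<zero>\<^bsub>M\<^esub>" unfolding ker by simp
  qed
qed

lemma inj_surj:
  assumes "fg_module A M" "f \<in> module_mono A M M"
  shows "f ` carrier M = carrier M"
proof -
  note M = fg_left_module[OF assms(1)] and f = mono_hom[OF assms(2)]
  interpret left_module A M by (rule M)
  obtain n where n: "n > 0" "complementary_submodules A M ((f ^^ n) ` carrier M) (a_kernel M M (f ^^ n))"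
    by (rule fitting[OF assms(1) f]) blast
  note cl = hom_closed[OF hom_funpow[OF f]]
  have ker: "x = \<zero>\<^bsub>M\<^esub>" if "x \<in> carrier M" "(f ^^ m) x = \<zero>\<^bsub>M\<^esub>" for m x
    using that(2)
  proof (induction m)
    case (Suc m)
    then have "(f ^^ m) x = \<zero>\<^bsub>M\<^esub>" using mono_zero[OF assms(2) M M] cl that(1) by simp
    then show ?case by (rule Suc.IH)
  qed simp
  obtain m where m: "n = Suc m" using n(1) gr0_implies_Suc by blast
  show ?thesis
  proof
    show "f ` carrier M \<subseteq> carrier M" using hom_closed[OF f] by auto
    show "carrier M \<subseteq> f ` carrier M"
    proof
      fix x assume x: "x \<in> carrier M"
      then have "x \<in> (f ^^ n) ` carrier M <+>\<^bsub>M\<^esub> a_kernel M M (f ^^ n)"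
        using n(2) by (simp add: complementary_submodules_def)
      then obtain y k where yk: "y \<in> carrier M" "k \<in> carrier M" "(f ^^ n) k = \<zero>\<^bsub>M\<^esub>" "x = (f ^^ n) y \<oplus>\<^bsub>M\<^esub> k"
        by (auto simp: set_add_iff ker_iff)
      then have "x = f ((f ^^ m) y)" using ker[OF yk(2,3)] cl[of y n] by (simp add: m)
      then show "x \<in> f ` carrier M" using cl[OF yk(1)] by blast
    qed
  qed
qed

text \<open>One of the two Fitting summands vanishes: either the image of a power of
  \<open>f\<close>, or the kernel of that power, and then \<open>f\<close> is injective and so
  bijective.\<close>

lemma indecomposable_nilpotent_or_bij:
  assumes "indecomposable A M" "f \<in> module_hom A M M"
  shows "(\<exists>n. \<forall>x\<in>carrier M. (f ^^ n) x = \<zero>\<^bsub>M\<^esub>) \<or> bij_betw f (carrier M) (carrier M)"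
proof -
  have fg: "fg_module A M" using assms(1) by (simp add: indecomposable_def)
  note M = fg_left_module[OF fg]
  obtain n where n: "n > 0" "complementary_submodules A M ((f ^^ n) ` carrier M) (a_kernel M M (f ^^ n))"
    by (rule fitting[OF fg assms(2)]) blast
  with assms(1) consider "(f ^^ n) ` carrier M = {\<zero>\<^bsub>M\<^esub>}" | "a_kernel M M (f ^^ n) = {\<zero>\<^bsub>M\<^esub>}"
    unfolding indecomposable_def by blast
  then show ?thesis
  proof cases
    case 1
    then have "\<forall>x\<in>carrier M. (f ^^ n) x = \<zero>\<^bsub>M\<^esub>" by auto
    then show ?thesis by blast
  next
    case 2
    obtain m where m: "n = Suc m" using n(1) gr0_implies_Suc by blast
    have "f \<in> module_mono A M M"
    proof (rule monoI[OF assms(2) M M])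
      fix x assume x: "x \<in> carrier M" "f x = \<zero>\<^bsub>M\<^esub>"
      then have "(f ^^ n) x = \<zero>\<^bsub>M\<^esub>"
        unfolding m funpow_Suc_right using hom_zero[OF hom_funpow[OF assms(2)] M M, of m] by simp
      then have "x \<in> a_kernel M M (f ^^ n)" using x(1) by (simp add: ker_iff)
      then show "x = \<zero>\<^bsub>M\<^esub>" using 2 by simp
    qed
    then have "bij_betw f (carrier M) (carrier M)"
      using inj_surj[OF fg] by (auto simp: bij_betw_def module_mono_def)
    then show ?thesis ..
  qed
qed

text \<open>Locality of the endomorphism ring. If \<open>f\<close> is nilpotent, then
  \<open>g x = 0\<close> gives \<open>f x = x\<close> and hence \<open>x = 0\<close>; an injective
  \<open>g\<close> on a nonzero module is not nilpotent.\<close>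

lemma indecomposable_local:
  assumes "indecomposable A M" "f \<in> module_hom A M M" "g \<in> module_hom A M M"
    and fg: "\<And>x. x \<in> carrier M \<Longrightarrow> f x \<oplus>\<^bsub>M\<^esub> g x = x"
  shows "bij_betw f (carrier M) (carrier M) \<or> bij_betw g (carrier M) (carrier M)"
proof (rule ccontr)
  assume neg: "\<not> ?thesis"
  have M: "left_module A M" and nz: "carrier M \<noteq> {\<zero>\<^bsub>M\<^esub>}" using assms(1) by (auto simp: indecomposable_def fg_left_module)
  interpret left_module A M by (rule M)
  obtain n where n: "\<And>x. x \<in> carrier M \<Longrightarrow> (f ^^ n) x = \<zero>\<^bsub>M\<^esub>"
    using indecomposable_nilpotent_or_bij[OF assms(1,2)] neg by blast
  have ginj: "x = \<zero>\<^bsub>M\<^esub>" if x: "x \<in> carrier M" "g x = \<zero>\<^bsub>M\<^esub>" for x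
  proof -
    have "f x = x" using fg[OF x(1)] x hom_closed[OF assms(2) x(1)] by simp
    then have "(f ^^ k) x = x" for k by (induction k) auto
    then show ?thesis using n[OF x(1)] by metis
  qed
  obtain m where m: "\<And>x. x \<in> carrier M \<Longrightarrow> (g ^^ m) x = \<zero>\<^bsub>M\<^esub>"
    using indecomposable_nilpotent_or_bij[OF assms(1,3)] neg by blast
  have "x = \<zero>\<^bsub>M\<^esub>" if "x \<in> carrier M" "(g ^^ k) x = \<zero>\<^bsub>M\<^esub>" for x k
    using that(2)
  proof (induction k)
    case (Suc k)
    then show ?case using ginj[of "(g ^^ k) x"] hom_closed[OF hom_funpow[OF assms(3)] that(1)] by simp
  qed simp
  then have "carrier M = {\<zero>\<^bsub>M\<^esub>}" using m by auto
  with nz show False ..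
qed

lemma retract_indecomposable:
  assumes "retract A X Y" "indecomposable A Y" "left_module A X" "carrier X \<noteq> {\<zero>\<^bsub>X\<^esub>}"
  shows "isomorphic_modules A X Y"
proof -
  have Y: "left_module A Y" using assms(2) by (simp add: indecomposable_def fg_left_module)
  interpret X: left_module A X by fact
  interpret Y: left_module A Y by fact
  obtain s r where sr: "s \<in> module_hom A X Y" "r \<in> module_hom A Y X" "\<And>x. x \<in> carrier X \<Longrightarrow> r (s x) = x"
    using assms(1) by (rule retractE) blast
  have c: "complementary_submodules A Y (s ` carrier X) (a_kernel Y X r)"
    using retract_complementary[OF assms(3) Y sr(1,2)] sr(3) by blast
  then consider "s ` carrier X = {\<zero>\<^bsub>Y\<^esub>}" | "a_kernel Y X r = {\<zero>\<^bsub>Y\<^esub>}"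
    using assms(2) unfolding indecomposable_def by blast
  then show ?thesis
  proof cases
    case 1
    then have "x = \<zero>\<^bsub>X\<^esub>" if "x \<in> carrier X" for x
      using sr(3)[OF that] hom_zero[OF sr(2) Y assms(3)] that by (metis imageI singletonD)
    then show ?thesis using assms(4) X.M.zero_closed by blast
  next
    case 2
    have "s (r y) = y" if y: "y \<in> carrier Y" for y
    proof -
      have "y \<in> s ` carrier X <+>\<^bsub>Y\<^esub> a_kernel Y X r" using c y by (simp add: complementary_submodules_def)
      then obtain x where "x \<in> carrier X" "y = s x" using hom_closed[OF sr(1)] unfolding 2 by (auto simp: set_add_iff)
      then show ?thesis using sr(3) by simp
    qed
    then show ?thesis using sr by (intro isomorphic_modulesI[OF sr(1,2)]) auto
  qed
qed

lemma indecomposable_isomorphic: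
  assumes "indecomposable A M" "isomorphic_modules A M N" "left_module A N"
  shows "indecomposable A N"
proof -
  have fgM: "fg_module A M" and nz: "carrier M \<noteq> {\<zero>\<^bsub>M\<^esub>}" using assms(1) by (auto simp: indecomposable_def)
  note M = fg_left_module[OF fgM]
  obtain f g where fg: "f \<in> module_hom A M N" "g \<in> module_hom A N M"
    "\<And>x. x \<in> carrier M \<Longrightarrow> g (f x) = x" "\<And>y. y \<in> carrier N \<Longrightarrow> f (g y) = y"
    by (rule isomorphic_modulesE[OF assms(2) M]) blast
  note f0 = hom_zero[OF fg(1) M assms(3)] and g0 = hom_zero[OF fg(2) assms(3) M]
  show ?thesis
    unfolding indecomposable_def
  proof (intro conjI allI impI)
    show "fg_module A N" by (rule fg_isomorphic[OF assms(2) fgM assms(3)])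
    show "carrier N \<noteq> {\<zero>\<^bsub>N\<^esub>}"
    proof
      assume "carrier N = {\<zero>\<^bsub>N\<^esub>}"
      then have "x = \<zero>\<^bsub>M\<^esub>" if "x \<in> carrier M" for x
        using fg(3)[OF that] hom_closed[OF fg(1) that] g0 by auto
      then show False using nz submodule_zero[OF left_module.carrier_submodule[OF M]] by blast
    qed
    fix H K assume c: "complementary_submodules A N H K"
    then have HN: "H \<subseteq> carrier N" and KN: "K \<subseteq> carrier N" and sH: "submodule H A N" and sK: "submodule K A N"
      by (auto simp: complementary_submodules_def submodule_mem)
    obtain e where e: "e \<in> module_hom A N N" "\<And>x. x \<in> carrier N \<Longrightarrow> e x \<in> H" "\<And>x. x \<in> H \<Longrightarrow> e x = x"
      "\<And>x. x \<in> K \<Longrightarrow> e x = \<zero>\<^bsub>N\<^esub>"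
      by (rule complementary_projection[OF c assms(3)]) blast
    let ?H = "N\<lparr>carrier := H\<rparr>" and ?r = "\<lambda>x. e (f x)"
    have s: "g \<in> module_hom A ?H M" by (rule hom_restrict_dom[OF fg(2) HN])
    have r: "?r \<in> module_hom A M ?H"
      by (rule hom_restrict_cod[OF hom_comp[OF fg(1) e(1)]]) (simp add: e(2) hom_closed[OF fg(1)])
    have "complementary_submodules A M (g ` carrier ?H) (a_kernel M ?H ?r)"
      by (rule retract_complementary[OF submodule_left_module[OF assms(3) sH] M s r]) (use fg(4) HN e(3) in auto)
    then consider "g ` H = {\<zero>\<^bsub>M\<^esub>}" | "a_kernel M ?H ?r = {\<zero>\<^bsub>M\<^esub>}"
      using assms(1) unfolding indecomposable_def by auto
    then show "H = {\<zero>\<^bsub>N\<^esub>} \<or> K = {\<zero>\<^bsub>N\<^esub>}"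
    proof cases
      case 1
      then have "x = \<zero>\<^bsub>N\<^esub>" if "x \<in> H" for x
        using that fg(4)[of x] HN f0 by (metis imageI singletonD subsetD)
      then show ?thesis using submodule_zero[OF sH] by blast
    next
      case 2
      have "x = \<zero>\<^bsub>N\<^esub>" if x: "x \<in> K" for x
      proof -
        have xN: "x \<in> carrier N" using x KN by blast
        have "g x \<in> a_kernel M ?H ?r"
          using x xN by (simp add: ker_iff hom_closed[OF fg(2)] fg(4) e(4))
        then show ?thesis using fg(4)[OF xN] f0 unfolding 2 by simp
      qed
      then show ?thesis using submodule_zero[OF sK] by blast
    qed
  qed
qed

text \<open>The induction runs over submodules of the fixed module \<open>M\<close>, ordered by
  rank, so that all pieces share one element type; only the indecomposable pieces are replaced by
  standard modules.\<close>

lemma decomposition: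
  fixes M :: "('a, 'm) module"
  assumes "fg_module A M"
  obtains Ns :: "'a std_module list" where "\<And>N. N \<in> set Ns \<Longrightarrow> indecomposable A N"
    "isomorphic_modules A M (direct_sum Ns)"
proof -
  note M = fg_left_module[OF assms]
  interpret left_module A M by (rule M)
  obtain rk :: "'m set \<Rightarrow> nat" where rk: "\<And>X Y. submodule X A M \<Longrightarrow> submodule Y A M \<Longrightarrow> X \<subset> Y \<Longrightarrow> rk X < rk Y"
    by (rule rankE[OF assms]) blast
  have "\<exists>Ns :: 'a std_module list. (\<forall>N\<in>set Ns. indecomposable A N) \<and> isomorphic_modules A (M\<lparr>carrier := H\<rparr>) (direct_sum Ns)"
    if "submodule H A M" for H
    using that
  proof (induction "rk H" arbitrary: H rule: less_induct)
    case less
    let ?H = "M\<lparr>carrier := H\<rparr>"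
    have fgH: "fg_module A ?H" by (rule fg_submodule[OF assms less.prems])
    note lmH = fg_left_module[OF fgH]
    consider "H = {\<zero>\<^bsub>M\<^esub>}" | "indecomposable A ?H" | X Y where "complementary_submodules A ?H X Y"
        "X \<noteq> {\<zero>\<^bsub>M\<^esub>}" "Y \<noteq> {\<zero>\<^bsub>M\<^esub>}"
      using fgH unfolding indecomposable_def by auto
    then show ?case
    proof cases
      case 1
      let ?Z = "direct_sum [] :: ('a, nat \<Rightarrow> (nat \<Rightarrow> 'a) set) module"
      have Z: "left_module A ?Z" by (rule direct_sum_Nil_left_module[OF ring])
      have "carrier ?Z = {\<zero>\<^bsub>?Z\<^esub>}" by (rule direct_sum_Nil)
      then have "isomorphic_modules A ?H ?Z"
        using 1 by (intro isomorphic_modulesI[OF hom_zerof[OF Z] hom_zerof[OF lmH]]) auto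
      then show ?thesis by (intro exI[of _ "[]"]) simp
    next
      case 2
      obtain N :: "'a std_module" where N: "fg_module A N" "isomorphic_modules A ?H N"
        using std_representative[OF fgH] .
      have "indecomposable A N" by (rule indecomposable_isomorphic[OF 2 N(2) fg_left_module[OF N(1)]])
      moreover have "isomorphic_modules A N (direct_sum [N])"
        by (rule isomorphic_modules_sym[OF direct_sum_single direct_sum_left_module])
          (use ring fg_left_module[OF N(1)] in auto)
      ultimately show ?thesis using isomorphic_modules_trans[OF N(2)] by (intro exI[of _ "[N]"]) auto
    next
      case 3
      have X: "submodule X A M" "X \<subseteq> H" and Y: "submodule Y A M" "Y \<subseteq> H"
        using 3(1) submodule_restrict_iff[OF M less.prems] by (auto simp: complementary_submodules_def)
      have XY: "X \<inter> Y = {\<zero>\<^bsub>M\<^esub>}" using 3(1) by (simp add: complementary_submodules_def)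
      have "X \<noteq> H" using XY 3(3) Y by auto
      then obtain Ns1 :: "'a std_module list" where 1: "\<forall>N\<in>set Ns1. indecomposable A N"
          "isomorphic_modules A (M\<lparr>carrier := X\<rparr>) (direct_sum Ns1)"
        using less.hyps[OF rk[OF X(1) less.prems] X(1)] X(2) by blast
      have "Y \<noteq> H" using XY 3(2) X by auto
      then obtain Ns2 :: "'a std_module list" where 2: "\<forall>N\<in>set Ns2. indecomposable A N"
          "isomorphic_modules A (M\<lparr>carrier := Y\<rparr>) (direct_sum Ns2)"
        using less.hyps[OF rk[OF Y(1) less.prems] Y(1)] Y(2) by blast
      have "isomorphic_modules A ?H (prod_module (M\<lparr>carrier := X\<rparr>) (M\<lparr>carrier := Y\<rparr>))"
        using complementary_isomorphic[OF 3(1) lmH] by simp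
      also have "isomorphic_modules A \<dots> (prod_module (direct_sum Ns1) (direct_sum Ns2))"
        by (rule isomorphic_prod[OF 1(2) 2(2) submodule_left_module[OF M X(1)] submodule_left_module[OF M Y(1)]])
      also have "isomorphic_modules A \<dots> (direct_sum (Ns1 @ Ns2))"
        by (rule isomorphic_modules_sym[OF direct_sum_append direct_sum_left_module[OF ring]])
          (use 1 2 in \<open>auto simp: indecomposable_def fg_left_module\<close>)
      finally show ?thesis using 1(1) 2(1) by (intro exI[of _ "Ns1 @ Ns2"]) auto
    qed
  qed
  from this[OF carrier_submodule] that show thesis by auto
qed

text \<open>The envelope is found inside the given injective module, as a minimal image
  \<open>B\<close> of an endomorphism of \<open>I\<close> that fixes \<open>j M\<close> pointwise.
  By minimality every such endomorphism with values in \<open>B\<close> restricts to an automorphism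
  of \<open>B\<close>; this yields both that \<open>B\<close> is a summand and that
  \<open>j M\<close> is essential in it.\<close>

lemma injective_envelope_in:
  assumes "fg_module A M" "j \<in> module_mono A M I" "injective A I"
  obtains B where "submodule B A I" "retract A (I\<lparr>carrier := B\<rparr>) I" "j \<in> module_mono A M (I\<lparr>carrier := B\<rparr>)"
    "\<And>K. submodule K A I \<Longrightarrow> K \<subseteq> B \<Longrightarrow> (\<And>x. x \<in> carrier M \<Longrightarrow> j x \<in> K \<Longrightarrow> x = \<zero>\<^bsub>M\<^esub>) \<Longrightarrow> K = {\<zero>\<^bsub>I\<^esub>}"
proof -
  note fgI = injective_fg[OF assms(3)]
  note I = fg_left_module[OF fgI] and M = fg_left_module[OF assms(1)] and jh = mono_hom[OF assms(2)]
  interpret I: left_module A I by (rule I)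
  interpret M: left_module A M by (rule M)
  let ?P = "\<lambda>B. \<exists>e\<in>module_hom A I I. (\<forall>x\<in>carrier M. e (j x) = j x) \<and> B = e ` carrier I"
  have "?P (carrier I)" by (rule bexI[OF _ hom_id]) simp
  from submodule_minimal[of I _ ?P, OF fgI I.carrier_submodule this]
  obtain B where sB: "submodule B A I" and B: "?P B"
    and min': "\<forall>K. submodule K A I \<and> ?P K \<and> K \<subseteq> B \<longrightarrow> K = B"
    by (elim exE conjE)
  have min: "K = B" if "submodule K A I" "?P K" "K \<subseteq> B" for K
    using min' that by simp
  from B obtain e where e: "e \<in> module_hom A I I" "\<And>x. x \<in> carrier M \<Longrightarrow> e (j x) = j x" "B = e ` carrier I" by blast
  let ?B = "I\<lparr>carrier := B\<rparr>"
  note BI = submodule_subset[OF sB] and fgB = fg_submodule[OF fgI sB]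
  note lB = fg_left_module[OF fgB]
  have minB: "f ` carrier I = B" if f: "f \<in> module_hom A I I" "\<And>x. x \<in> carrier M \<Longrightarrow> f (j x) = j x"
      "\<And>x. x \<in> carrier I \<Longrightarrow> f x \<in> B" for f
    by (rule min[OF submodule_range[OF f(1) I I]]) (use f in auto)
  have jB: "j x \<in> B" if "x \<in> carrier M" for x
    using e(2)[OF that] hom_closed[OF jh that] unfolding e(3) by (metis imageI)
  have eB: "e \<in> module_hom A ?B ?B"
    by (rule hom_restrict_cod[OF hom_restrict_dom[OF e(1) BI]]) (use BI e(3) in auto)
  have "(\<lambda>x. e (e x)) ` carrier I = B"
    by (rule minB[OF hom_comp[OF e(1) e(1)]]) (use e hom_closed[OF e(1)] in auto)
  then have "e ` carrier ?B = carrier ?B" unfolding e(3) by (simp add: image_image)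
  then have e_mono: "e \<in> module_mono A ?B ?B" and "bij_betw e (carrier ?B) (carrier ?B)"
    using surj_inj[OF fgB eB] by (auto simp: bij_betw_def module_mono_def)
  \<comment> \<open>\<open>e\<close> itself need not be idempotent. Corrected by the inverse
    \<open>d\<close> of its restriction to \<open>B\<close>, it becomes a retraction of
    \<open>I\<close> onto \<open>B\<close>.\<close>
  then obtain d where d: "d \<in> module_hom A ?B ?B" "\<And>x. x \<in> carrier ?B \<Longrightarrow> d (e x) = x"
    using bij_hom_inverse[OF eB _ lB] by metis
  have "e \<in> module_hom A I ?B" by (rule hom_restrict_cod[OF e(1)]) (use e(3) in auto)
  from hom_comp[OF this d(1)] have r: "(\<lambda>x. d (e x)) \<in> module_hom A I ?B" .
  have retr: "retract A ?B I"
    by (rule retractI[OF hom_incl[OF BI] r]) (use d(2) in auto)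
  have jmono: "j \<in> module_mono A M ?B"
    using assms(2) hom_restrict_cod[OF jh] jB by (auto simp: module_mono_def)
  show thesis
  proof (rule that[OF sB retr jmono])
    fix K assume K: "submodule K A I" "K \<subseteq> B" and Kj: "\<And>x. x \<in> carrier M \<Longrightarrow> j x \<in> K \<Longrightarrow> x = \<zero>\<^bsub>M\<^esub>"
    have KB: "submodule K A ?B" using K submodule_restrict_iff[OF I sB] by blast
    obtain C :: "'a std_module" and p where C: "fg_module A C" "p \<in> module_epi A ?B C" "a_kernel ?B C p = K"
      by (rule std_quotient[OF fgB KB])
    note p = epi_hom[OF C(2)] and lC = fg_left_module[OF C(1)]
    have pj: "(\<lambda>x. p (j x)) \<in> module_mono A M C"
    proof (rule monoI[OF hom_comp[OF mono_hom[OF jmono] p] M lC])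
      fix x assume x: "x \<in> carrier M" "p (j x) = \<zero>\<^bsub>C\<^esub>"
      then have "j x \<in> a_kernel ?B C p" using jB by (simp add: ker_iff)
      then show "x = \<zero>\<^bsub>M\<^esub>" using Kj x(1) C(3) by blast
    qed
    \<comment> \<open>If \<open>K\<close> meets \<open>j M\<close> only in zero, \<open>M\<close>
      still embeds into \<open>B / K\<close>. Extending \<open>j\<close> from there to
      \<open>I\<close> gives an endomorphism \<open>u\<close> that fixes \<open>j M\<close>, has
      values in \<open>B\<close> and kills \<open>K\<close>. As \<open>u\<close> restricts to an
      automorphism of \<open>B\<close>, \<open>K\<close> is zero.\<close>
    obtain t where t: "t \<in> module_hom A C I" "\<And>x. x \<in> carrier M \<Longrightarrow> t (p (j x)) = j x"
      by (rule injective_extend[OF assms(3,1) C(1) pj jh]) blast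
    define u where "u = (\<lambda>x. e (t (p (d (e x)))))"
    have u: "u \<in> module_hom A I I" unfolding u_def by (rule hom_comp[OF hom_comp[OF hom_comp[OF r p] t(1)] e(1)])
    have uI: "u x \<in> B" if "x \<in> carrier I" for x
      using hom_closed[OF hom_comp[OF hom_comp[OF r p] t(1)] that] unfolding u_def e(3) by blast
    have uj: "u (j x) = j x" if "x \<in> carrier M" for x
      using d(2)[of "j x"] jB[OF that] t(2)[OF that] e(2)[OF that] by (simp add: u_def)
    have uB: "u \<in> module_hom A ?B ?B"
      by (rule hom_restrict_cod[OF hom_restrict_dom[OF u BI]]) (use uI BI in auto)
    have "(\<lambda>x. u (u x)) ` carrier I = B"
      by (rule minB[OF hom_comp[OF u u]]) (use uj uI subsetD[OF BI] in auto)
    moreover have "u ` carrier I = B" by (rule minB[OF u uj uI])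
    ultimately have "u ` carrier ?B = carrier ?B" by (simp flip: image_image)
    then have um: "u \<in> module_mono A ?B ?B" by (rule surj_inj[OF fgB uB])
    have "k = \<zero>\<^bsub>I\<^esub>" if k: "k \<in> K" for k
    proof -
      have "p k = \<zero>\<^bsub>C\<^esub>" using k C(3) by (auto simp: ker_iff)
      then have "u k = \<zero>\<^bsub>I\<^esub>"
        using d(2)[of k] k K(2) hom_zero[OF t(1) lC I] hom_zero[OF e(1) I I] by (auto simp: u_def)
      then show ?thesis using mono_zero[OF um lB lB, of k] k K(2) by auto
    qed
    then show "K = {\<zero>\<^bsub>I\<^esub>}" using submodule_zero[OF K(1)] by blast
  qed
qed

lemma simple_submodule:
  assumes "fg_module A M" "carrier M \<noteq> {\<zero>\<^bsub>M\<^esub>}"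
  obtains S where "submodule S A M" "S \<noteq> {\<zero>\<^bsub>M\<^esub>}"
    "\<And>X. submodule X A M \<Longrightarrow> X \<subseteq> S \<Longrightarrow> X \<noteq> {\<zero>\<^bsub>M\<^esub>} \<Longrightarrow> X = S"
proof -
  interpret left_module A M by (rule fg_left_module[OF assms(1)])
  obtain S where S: "submodule S A M" "S \<noteq> {\<zero>\<^bsub>M\<^esub>}"
    "\<forall>K. submodule K A M \<and> K \<noteq> {\<zero>\<^bsub>M\<^esub>} \<and> K \<subseteq> S \<longrightarrow> K = S"
    using submodule_minimal[of M _ "\<lambda>X. X \<noteq> {\<zero>\<^bsub>M\<^esub>}", OF assms(1) carrier_submodule assms(2)]
    by (elim exE conjE)
  with that show thesis by blast
qed

end

section \<open>Coresolutions of length two by projective-injective modules\<close>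

text \<open>The data of an exact sequence \<open>0 \<rightarrow> P \<rightarrow> E0 \<rightarrow> E1 \<rightarrow> E \<rightarrow> 0\<close> with image \<open>K\<close> in the middle.\<close>

record 'a dres =
  rP :: "'a std_module"
  rj :: "(nat \<Rightarrow> 'a) set \<Rightarrow> (nat \<Rightarrow> 'a) set"
  rE0 :: "'a std_module"
  rp :: "(nat \<Rightarrow> 'a) set \<Rightarrow> (nat \<Rightarrow> 'a) set"
  rK :: "'a std_module"
  rk :: "(nat \<Rightarrow> 'a) set \<Rightarrow> (nat \<Rightarrow> 'a) set"
  rE1 :: "'a std_module"
  rq :: "(nat \<Rightarrow> 'a) set \<Rightarrow> (nat \<Rightarrow> 'a) set"
  rE :: "'a std_module"

text \<open>Minimality is imposed at \<open>rE1\<close>, where \<open>dres_section_zero\<close> uses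
  it. Minimality at \<open>rE0\<close> and injectivity of \<open>rE\<close> are stated separately
  where they are wanted.\<close>

definition is_dres :: "('a, 'x) ring_scheme \<Rightarrow> 'a dres \<Rightarrow> bool" where
  "is_dres A r \<longleftrightarrow> fg_ses A (rP r) (rj r) (rE0 r) (rp r) (rK r) \<and> fg_ses A (rK r) (rk r) (rE1 r) (rq r) (rE r) \<and>
     projective A (rE0 r) \<and> injective A (rE0 r) \<and> projective A (rE1 r) \<and> injective A (rE1 r) \<and>
     essential_submodule A (rk r ` carrier (rK r)) (rE1 r)"

text \<open>A relation and not a function, since the chain map over \<open>\<phi>\<close>, and with
  it the component \<open>fP\<close>, is determined only up to homotopy.\<close>

definition is_lift ::
    "('a, 'x) ring_scheme \<Rightarrow> 'a dres \<Rightarrow> 'a dres \<Rightarrow> ((nat \<Rightarrow> 'a) set \<Rightarrow> (nat \<Rightarrow> 'a) set) \<Rightarrow>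
      ((nat \<Rightarrow> 'a) set \<Rightarrow> (nat \<Rightarrow> 'a) set) \<Rightarrow> bool" where
  "is_lift A r r' \<phi> fP \<longleftrightarrow> \<phi> \<in> module_hom A (rE r) (rE r') \<and> fP \<in> module_hom A (rP r) (rP r') \<and>
     (\<exists>f1\<in>module_hom A (rE1 r) (rE1 r'). \<exists>fK\<in>module_hom A (rK r) (rK r'). \<exists>f0\<in>module_hom A (rE0 r) (rE0 r').
        (\<forall>x\<in>carrier (rE1 r). rq r' (f1 x) = \<phi> (rq r x)) \<and>
        (\<forall>x\<in>carrier (rK r). rk r' (fK x) = f1 (rk r x)) \<and>
        (\<forall>x\<in>carrier (rE0 r). rp r' (f0 x) = fK (rp r x)) \<and>
        (\<forall>x\<in>carrier (rP r). rj r' (fP x) = f0 (rj r x)))"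

context
  fixes A :: "('a, 'x) ring_scheme" and r
  assumes r: "is_dres A r"
begin

lemma dres_ses: "fg_ses A (rP r) (rj r) (rE0 r) (rp r) (rK r)" "fg_ses A (rK r) (rk r) (rE1 r) (rq r) (rE r)"
  using r by (simp_all add: is_dres_def)

lemma dres_proj: "projective A (rE0 r)" "projective A (rE1 r)" and dres_inj: "injective A (rE0 r)" "injective A (rE1 r)"
  using r by (simp_all add: is_dres_def)

lemma dres_hom: "rj r \<in> module_hom A (rP r) (rE0 r)" "rp r \<in> module_hom A (rE0 r) (rK r)"
  "rk r \<in> module_hom A (rK r) (rE1 r)" "rq r \<in> module_hom A (rE1 r) (rE r)"
  using ses_hom1[OF dres_ses(1)] ses_hom2[OF dres_ses(1)] ses_hom1[OF dres_ses(2)] ses_hom2[OF dres_ses(2)] by auto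

lemma dres_lm: "left_module A (rP r)" "left_module A (rE0 r)" "left_module A (rK r)" "left_module A (rE1 r)"
  "left_module A (rE r)"
  using ses_lm[OF dres_ses(1)] ses_lm[OF dres_ses(2)] by auto

lemma dres_essential: "submodule X A (rE1 r) \<Longrightarrow> X \<inter> rk r ` carrier (rK r) = {\<zero>\<^bsub>rE1 r\<^esub>} \<Longrightarrow> X = {\<zero>\<^bsub>rE1 r\<^esub>}"
  using r by (simp add: is_dres_def essential_submodule_def)

end

lemma is_liftE:
  assumes "is_lift A r r' \<phi> fP"
  obtains f1 fK f0 where "\<phi> \<in> module_hom A (rE r) (rE r')" "fP \<in> module_hom A (rP r) (rP r')"
    "f1 \<in> module_hom A (rE1 r) (rE1 r')" "fK \<in> module_hom A (rK r) (rK r')" "f0 \<in> module_hom A (rE0 r) (rE0 r')"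
    "\<And>x. x \<in> carrier (rE1 r) \<Longrightarrow> rq r' (f1 x) = \<phi> (rq r x)"
    "\<And>x. x \<in> carrier (rK r) \<Longrightarrow> rk r' (fK x) = f1 (rk r x)"
    "\<And>x. x \<in> carrier (rE0 r) \<Longrightarrow> rp r' (f0 x) = fK (rp r x)"
    "\<And>x. x \<in> carrier (rP r) \<Longrightarrow> rj r' (fP x) = f0 (rj r x)"
  using assms unfolding is_lift_def by blast

lemma is_liftI:
  assumes "\<phi> \<in> module_hom A (rE r) (rE r')" "fP \<in> module_hom A (rP r) (rP r')"
    "f1 \<in> module_hom A (rE1 r) (rE1 r')" "fK \<in> module_hom A (rK r) (rK r')" "f0 \<in> module_hom A (rE0 r) (rE0 r')"
    "\<And>x. x \<in> carrier (rE1 r) \<Longrightarrow> rq r' (f1 x) = \<phi> (rq r x)"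
    "\<And>x. x \<in> carrier (rK r) \<Longrightarrow> rk r' (fK x) = f1 (rk r x)"
    "\<And>x. x \<in> carrier (rE0 r) \<Longrightarrow> rp r' (f0 x) = fK (rp r x)"
    "\<And>x. x \<in> carrier (rP r) \<Longrightarrow> rj r' (fP x) = f0 (rj r x)"
  shows "is_lift A r r' \<phi> fP"
  unfolding is_lift_def using assms by blast

text \<open>Built from right to left: \<open>f1\<close> and \<open>f0\<close> exist by projectivity
  of \<open>rE1\<close> and \<open>rE0\<close>, while \<open>fK\<close> and \<open>fP\<close> are
  the induced maps on kernels.\<close>

lemma lift_exists:
  assumes "is_dres A r" "is_dres A r'" "\<phi> \<in> module_hom A (rE r) (rE r')"
  shows "\<exists>fP. is_lift A r r' \<phi> fP"
proof -
  note s = dres_ses[OF assms(1)] and s' = dres_ses[OF assms(2)]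
  note h = dres_hom[OF assms(1)] and h' = dres_hom[OF assms(2)]
  note lm = dres_lm[OF assms(1)] and lm' = dres_lm[OF assms(2)]
  obtain f1 where f1: "f1 \<in> module_hom A (rE1 r) (rE1 r')" "\<And>x. x \<in> carrier (rE1 r) \<Longrightarrow> rq r' (f1 x) = \<phi> (rq r x)"
    by (rule projective_lift[OF dres_proj(2)[OF assms(1)] ses_fg(2,3)[OF s'(2)] ses_epi[OF s'(2)] hom_comp[OF h(4) assms(3)]]) blast
  have "rq r' (f1 (rk r x)) = \<zero>\<^bsub>rE r'\<^esub>" if "x \<in> carrier (rK r)" for x
    using f1(2)[OF hom_closed[OF h(3) that]] ses_zero[OF s(2) that] hom_zero[OF assms(3) lm(5) lm'(5)] by simp
  then obtain fK where fK: "fK \<in> module_hom A (rK r) (rK r')" "\<And>x. x \<in> carrier (rK r) \<Longrightarrow> rk r' (fK x) = f1 (rk r x)"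
    using ses_lift[OF s'(2) hom_comp[OF h(3) f1(1)] lm(3)] by blast
  obtain f0 where f0: "f0 \<in> module_hom A (rE0 r) (rE0 r')" "\<And>x. x \<in> carrier (rE0 r) \<Longrightarrow> rp r' (f0 x) = fK (rp r x)"
    by (rule projective_lift[OF dres_proj(1)[OF assms(1)] ses_fg(2,3)[OF s'(1)] ses_epi[OF s'(1)] hom_comp[OF h(2) fK(1)]]) blast
  have "rp r' (f0 (rj r x)) = \<zero>\<^bsub>rK r'\<^esub>" if "x \<in> carrier (rP r)" for x
    using f0(2)[OF hom_closed[OF h(1) that]] ses_zero[OF s(1) that] hom_zero[OF fK(1) lm(3) lm'(3)] by simp
  then obtain fP where fP: "fP \<in> module_hom A (rP r) (rP r')" "\<And>x. x \<in> carrier (rP r) \<Longrightarrow> rj r' (fP x) = f0 (rj r x)"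
    using ses_lift[OF s'(1) hom_comp[OF h(1) f0(1)] lm(1)] by blast
  have "is_lift A r r' \<phi> fP"
    by (rule is_liftI[OF assms(3) fP(1) f1(1) fK(1) f0(1)]) (simp_all add: f1(2) fK(2) f0(2) fP(2))
  then show ?thesis by blast
qed

lemma lift_id: "is_lift A r r (\<lambda>x. x) (\<lambda>x. x)"
  by (rule is_liftI[OF hom_id hom_id hom_id hom_id hom_id]) auto

lemma lift_comp:
  assumes "is_lift A r r' \<phi> fP" "is_lift A r' r'' \<psi> gP"
  shows "is_lift A r r'' (\<lambda>x. \<psi> (\<phi> x)) (\<lambda>x. gP (fP x))"
proof -
  obtain f1 fK f0 where f: "\<phi> \<in> module_hom A (rE r) (rE r')" "fP \<in> module_hom A (rP r) (rP r')"
    "f1 \<in> module_hom A (rE1 r) (rE1 r')" "fK \<in> module_hom A (rK r) (rK r')" "f0 \<in> module_hom A (rE0 r) (rE0 r')"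
    "\<And>x. x \<in> carrier (rE1 r) \<Longrightarrow> rq r' (f1 x) = \<phi> (rq r x)"
    "\<And>x. x \<in> carrier (rK r) \<Longrightarrow> rk r' (fK x) = f1 (rk r x)"
    "\<And>x. x \<in> carrier (rE0 r) \<Longrightarrow> rp r' (f0 x) = fK (rp r x)"
    "\<And>x. x \<in> carrier (rP r) \<Longrightarrow> rj r' (fP x) = f0 (rj r x)"
    using assms(1) by (rule is_liftE) (rule that)
  obtain g1 gK g0 where g: "\<psi> \<in> module_hom A (rE r') (rE r'')" "gP \<in> module_hom A (rP r') (rP r'')"
    "g1 \<in> module_hom A (rE1 r') (rE1 r'')" "gK \<in> module_hom A (rK r') (rK r'')" "g0 \<in> module_hom A (rE0 r') (rE0 r'')"
    "\<And>x. x \<in> carrier (rE1 r') \<Longrightarrow> rq r'' (g1 x) = \<psi> (rq r' x)"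
    "\<And>x. x \<in> carrier (rK r') \<Longrightarrow> rk r'' (gK x) = g1 (rk r' x)"
    "\<And>x. x \<in> carrier (rE0 r') \<Longrightarrow> rp r'' (g0 x) = gK (rp r' x)"
    "\<And>x. x \<in> carrier (rP r') \<Longrightarrow> rj r'' (gP x) = g0 (rj r' x)"
    using assms(2) by (rule is_liftE) (rule that)
  show ?thesis
    by (rule is_liftI[OF hom_comp[OF f(1) g(1)] hom_comp[OF f(2) g(2)] hom_comp[OF f(3) g(3)]
          hom_comp[OF f(4) g(4)] hom_comp[OF f(5) g(5)]])
      (simp_all add: f(6-9) g(6-9) hom_closed[OF f(2)] hom_closed[OF f(3)] hom_closed[OF f(4)] hom_closed[OF f(5)])
qed

lemma lift_minus:
  assumes "is_dres A r" "is_dres A r'" "is_lift A r r' \<phi> fP" "is_lift A r r' \<psi> gP"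
  shows "is_lift A r r' (\<lambda>x. \<phi> x \<ominus>\<^bsub>rE r'\<^esub> \<psi> x) (\<lambda>x. fP x \<ominus>\<^bsub>rP r'\<^esub> gP x)"
proof -
  obtain f1 fK f0 where f: "\<phi> \<in> module_hom A (rE r) (rE r')" "fP \<in> module_hom A (rP r) (rP r')"
    "f1 \<in> module_hom A (rE1 r) (rE1 r')" "fK \<in> module_hom A (rK r) (rK r')" "f0 \<in> module_hom A (rE0 r) (rE0 r')"
    "\<And>x. x \<in> carrier (rE1 r) \<Longrightarrow> rq r' (f1 x) = \<phi> (rq r x)"
    "\<And>x. x \<in> carrier (rK r) \<Longrightarrow> rk r' (fK x) = f1 (rk r x)"
    "\<And>x. x \<in> carrier (rE0 r) \<Longrightarrow> rp r' (f0 x) = fK (rp r x)"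
    "\<And>x. x \<in> carrier (rP r) \<Longrightarrow> rj r' (fP x) = f0 (rj r x)"
    using assms(3) by (rule is_liftE) (rule that)
  obtain g1 gK g0 where g: "\<psi> \<in> module_hom A (rE r) (rE r')" "gP \<in> module_hom A (rP r) (rP r')"
    "g1 \<in> module_hom A (rE1 r) (rE1 r')" "gK \<in> module_hom A (rK r) (rK r')" "g0 \<in> module_hom A (rE0 r) (rE0 r')"
    "\<And>x. x \<in> carrier (rE1 r) \<Longrightarrow> rq r' (g1 x) = \<psi> (rq r x)"
    "\<And>x. x \<in> carrier (rK r) \<Longrightarrow> rk r' (gK x) = g1 (rk r x)"
    "\<And>x. x \<in> carrier (rE0 r) \<Longrightarrow> rp r' (g0 x) = gK (rp r x)"
    "\<And>x. x \<in> carrier (rP r) \<Longrightarrow> rj r' (gP x) = g0 (rj r x)"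
    using assms(4) by (rule is_liftE) (rule that)
  note h = dres_hom[OF assms(1)] and h' = dres_hom[OF assms(2)] and lm = dres_lm[OF assms(2)]
  show ?thesis
    by (rule is_liftI[OF hom_minusf[OF f(1) g(1) lm(5)] hom_minusf[OF f(2) g(2) lm(1)] hom_minusf[OF f(3) g(3) lm(4)]
          hom_minusf[OF f(4) g(4) lm(3)] hom_minusf[OF f(5) g(5) lm(2)]])
      (simp_all add: f(6-9) g(6-9) hom_closed[OF f(2)] hom_closed[OF f(3)] hom_closed[OF f(4)] hom_closed[OF f(5)]
        hom_closed[OF g(2)] hom_closed[OF g(3)] hom_closed[OF g(4)] hom_closed[OF g(5)]
        hom_closed[OF h(1)] hom_closed[OF h(2)] hom_closed[OF h(3)]
        hom_minus[OF h'(1) lm(1,2)] hom_minus[OF h'(2) lm(2,3)] hom_minus[OF h'(3) lm(3,4)] hom_minus[OF h'(4) lm(4,5)])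
qed

text \<open>
  The next two lemmas say that \<open>\<phi> \<mapsto> fP\<close> identifies the endomorphisms of \<open>E\<close> modulo those
  factoring through \<open>E1 \<rightarrow> E\<close> with the endomorphisms of \<open>P\<close> modulo those factoring through
  \<open>P \<rightarrow> E0\<close>.
\<close>

lemma lift_zero:
  assumes "is_dres A r" "is_dres A r'" "is_lift A r r' \<phi> fP"
    and zero: "\<And>x. x \<in> carrier (rE r) \<Longrightarrow> \<phi> x = \<zero>\<^bsub>rE r'\<^esub>"
  obtains h where "h \<in> module_hom A (rE0 r) (rP r')" "\<And>x. x \<in> carrier (rP r) \<Longrightarrow> h (rj r x) = fP x"
proof -
  obtain f1 fK f0 where f: "\<phi> \<in> module_hom A (rE r) (rE r')" "fP \<in> module_hom A (rP r) (rP r')"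
    "f1 \<in> module_hom A (rE1 r) (rE1 r')" "fK \<in> module_hom A (rK r) (rK r')" "f0 \<in> module_hom A (rE0 r) (rE0 r')"
    "\<And>x. x \<in> carrier (rE1 r) \<Longrightarrow> rq r' (f1 x) = \<phi> (rq r x)"
    "\<And>x. x \<in> carrier (rK r) \<Longrightarrow> rk r' (fK x) = f1 (rk r x)"
    "\<And>x. x \<in> carrier (rE0 r) \<Longrightarrow> rp r' (f0 x) = fK (rp r x)"
    "\<And>x. x \<in> carrier (rP r) \<Longrightarrow> rj r' (fP x) = f0 (rj r x)"
    using assms(3) by (rule is_liftE) (rule that)
  note s = dres_ses[OF assms(1)] and s' = dres_ses[OF assms(2)]
  note h = dres_hom[OF assms(1)] and h' = dres_hom[OF assms(2)]
  note lm = dres_lm[OF assms(1)] and lm' = dres_lm[OF assms(2)]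
  interpret K': left_module A "rK r'" by (rule lm')
  interpret E0': left_module A "rE0 r'" by (rule lm')
  \<comment> \<open>A null-homotopy built from the right: over the zero map, \<open>f1\<close> has
    values in \<open>K'\<close> and lifts to a map \<open>l\<close> into \<open>E0'\<close> by
    projectivity of \<open>E1\<close>. Then \<open>f0 - l k p\<close> has values in
    \<open>P'\<close> and agrees with \<open>fP\<close> on \<open>P\<close>.\<close>
  have "rq r' (f1 x) = \<zero>\<^bsub>rE r'\<^esub>" if "x \<in> carrier (rE1 r)" for x
    using f(6)[OF that] zero hom_closed[OF h(4) that] by simp
  then obtain l' where l': "l' \<in> module_hom A (rE1 r) (rK r')" "\<And>x. x \<in> carrier (rE1 r) \<Longrightarrow> rk r' (l' x) = f1 x"
    using ses_lift[OF s'(2) f(3) lm(4)] by blast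
  obtain l where l: "l \<in> module_hom A (rE1 r) (rE0 r')" "\<And>x. x \<in> carrier (rE1 r) \<Longrightarrow> rp r' (l x) = l' x"
    by (rule projective_lift[OF dres_proj(2)[OF assms(1)] ses_fg(2,3)[OF s'(1)] ses_epi[OF s'(1)] l'(1)]) blast
  have fK: "fK x = l' (rk r x)" if x: "x \<in> carrier (rK r)" for x
    by (rule ses_inj[OF s'(2)])
      (simp_all add: x f(7) l'(2) hom_closed[OF h(3)] hom_closed[OF f(4)] hom_closed[OF l'(1)])
  let ?d = "\<lambda>x. f0 x \<ominus>\<^bsub>rE0 r'\<^esub> l (rk r (rp r x))"
  note cl = hom_closed[OF h(1)] hom_closed[OF h(2)] hom_closed[OF h(3)] hom_closed[OF l(1)] hom_closed[OF l'(1)]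
    hom_closed[OF f(5)] hom_closed[OF f(4)] hom_closed[OF f(2)]
  have d: "?d \<in> module_hom A (rE0 r) (rE0 r')"
    by (rule hom_minusf[OF f(5) hom_comp[OF hom_comp[OF h(2,3)] l(1)] lm'(2)])
  have "rp r' (?d x) = \<zero>\<^bsub>rK r'\<^esub>" if "x \<in> carrier (rE0 r)" for x
    using that cl by (simp add: hom_minus[OF h'(2) lm'(2,3)] f(8) l(2) fK K'.minus_self)
  then obtain g where g: "g \<in> module_hom A (rE0 r) (rP r')" "\<And>x. x \<in> carrier (rE0 r) \<Longrightarrow> rj r' (g x) = ?d x"
    using ses_lift[OF s'(1) d lm(2)] by blast
  show thesis
  proof (rule that[OF g(1)])
    fix x assume x: "x \<in> carrier (rP r)"
    have "l (rk r (rp r (rj r x))) = \<zero>\<^bsub>rE0 r'\<^esub>"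
      using ses_zero[OF s(1) x] hom_zero[OF h(3) lm(3,4)] hom_zero[OF l(1) lm(4) lm'(2)] by simp
    then have "rj r' (g (rj r x)) = rj r' (fP x)"
      using x cl by (simp add: g(2) f(9) E0'.minus_zero_right)
    then show "g (rj r x) = fP x"
      by (rule ses_inj[OF s'(1), rotated 2]) (simp_all add: x cl hom_closed[OF g(1)])
  qed
qed

lemma lift_factor:
  assumes "is_dres A r" "is_dres A r'" "is_lift A r r' \<phi> fP"
    and hE: "h \<in> module_hom A (rE0 r) (rP r')" "\<And>x. x \<in> carrier (rP r) \<Longrightarrow> h (rj r x) = fP x"
  obtains m where "m \<in> module_hom A (rE r) (rE1 r')" "\<And>x. x \<in> carrier (rE r) \<Longrightarrow> rq r' (m x) = \<phi> x"
proof -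
  obtain f1 fK f0 where f: "\<phi> \<in> module_hom A (rE r) (rE r')" "fP \<in> module_hom A (rP r) (rP r')"
    "f1 \<in> module_hom A (rE1 r) (rE1 r')" "fK \<in> module_hom A (rK r) (rK r')" "f0 \<in> module_hom A (rE0 r) (rE0 r')"
    "\<And>x. x \<in> carrier (rE1 r) \<Longrightarrow> rq r' (f1 x) = \<phi> (rq r x)"
    "\<And>x. x \<in> carrier (rK r) \<Longrightarrow> rk r' (fK x) = f1 (rk r x)"
    "\<And>x. x \<in> carrier (rE0 r) \<Longrightarrow> rp r' (f0 x) = fK (rp r x)"
    "\<And>x. x \<in> carrier (rP r) \<Longrightarrow> rj r' (fP x) = f0 (rj r x)"
    using assms(3) by (rule is_liftE) (rule that)
  note s = dres_ses[OF assms(1)] and s' = dres_ses[OF assms(2)]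
  note h = dres_hom[OF assms(1)] and h' = dres_hom[OF assms(2)]
  note lm = dres_lm[OF assms(1)] and lm' = dres_lm[OF assms(2)]
  interpret K': left_module A "rK r'" by (rule lm')
  interpret E0': left_module A "rE0 r'" by (rule lm')
  interpret E1': left_module A "rE1 r'" by (rule lm')
  interpret E': left_module A "rE r'" by (rule lm')
  note cl = hom_closed[OF h(1)] hom_closed[OF h(2)] hom_closed[OF h(3)] hom_closed[OF h(4)] hom_closed[OF hE(1)]
    hom_closed[OF f(5)] hom_closed[OF f(4)] hom_closed[OF f(2)] hom_closed[OF f(3)] hom_closed[OF f(1)]
    hom_closed[OF h'(1)] hom_closed[OF h'(2)] hom_closed[OF h'(3)] hom_closed[OF h'(4)]
  \<comment> \<open>The homotopy read from the left: \<open>f0 - j' h\<close> kills \<open>P\<close>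
    and descends to \<open>c\<close> on \<open>K\<close>, and injectivity of \<open>E0'\<close>
    extends \<open>c\<close> to \<open>v\<close> on \<open>E1\<close>. Then
    \<open>f1 - k' p' v\<close> kills \<open>K\<close> and descends to the required
    \<open>m\<close>.\<close>
  let ?d = "\<lambda>x. f0 x \<ominus>\<^bsub>rE0 r'\<^esub> rj r' (h x)"
  have d: "?d \<in> module_hom A (rE0 r) (rE0 r')"
    by (rule hom_minusf[OF f(5) hom_comp[OF hE(1) h'(1)] lm'(2)])
  have "?d (rj r x) = \<zero>\<^bsub>rE0 r'\<^esub>" if "x \<in> carrier (rP r)" for x
    using that cl by (simp add: hE(2) f(9) E0'.minus_self)
  then obtain c where c: "c \<in> module_hom A (rK r) (rE0 r')" "\<And>x. x \<in> carrier (rE0 r) \<Longrightarrow> c (rp r x) = ?d x"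
    using ses_desc[OF s(1) d lm'(2)] by blast
  have pc: "rp r' (c x) = fK x" if x: "x \<in> carrier (rK r)" for x
  proof -
    obtain y where y: "y \<in> carrier (rE0 r)" "x = rp r y" using ses_surj[OF s(1) x] by blast
    then show ?thesis
      using cl ses_zero[OF s'(1)] by (simp add: c(2) hom_minus[OF h'(2) lm'(2,3)] f(8) K'.minus_zero_right)
  qed
  obtain v where v: "v \<in> module_hom A (rE1 r) (rE0 r')" "\<And>x. x \<in> carrier (rK r) \<Longrightarrow> v (rk r x) = c x"
    by (rule injective_extend[OF dres_inj(1)[OF assms(2)] ses_fg(1,2)[OF s(2)] ses_mono[OF s(2)] c(1)]) blast
  let ?e = "\<lambda>x. f1 x \<ominus>\<^bsub>rE1 r'\<^esub> rk r' (rp r' (v x))"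
  have e: "?e \<in> module_hom A (rE1 r) (rE1 r')"
    by (rule hom_minusf[OF f(3) hom_comp[OF hom_comp[OF v(1) h'(2)] h'(3)] lm'(4)])
  have "?e (rk r x) = \<zero>\<^bsub>rE1 r'\<^esub>" if "x \<in> carrier (rK r)" for x
    using that cl f(7)[OF that] by (simp add: v(2) pc E1'.minus_self)
  then obtain m where m: "m \<in> module_hom A (rE r) (rE1 r')" "\<And>x. x \<in> carrier (rE1 r) \<Longrightarrow> m (rq r x) = ?e x"
    using ses_desc[OF s(2) e lm'(4)] by blast
  show thesis
  proof (rule that[OF m(1)])
    fix x assume "x \<in> carrier (rE r)"
    then obtain y where y: "y \<in> carrier (rE1 r)" "x = rq r y" using ses_surj[OF s(2)] by blast
    then show "rq r' (m x) = \<phi> x"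
      using cl hom_closed[OF v(1)] ses_zero[OF s'(2)]
      by (simp add: m(2) hom_minus[OF h'(4) lm'(4,5)] f(6) E'.minus_zero_right)
  qed
qed

lemma projective_ses_retract:
  assumes ses: "fg_ses A K f M g N" and "projective A N"
  shows "retract A K M"
proof -
  note lm = ses_lm[OF ses]
  interpret N: left_module A N by (rule lm)
  interpret M: left_module A M by (rule lm)
  obtain t where t: "t \<in> module_hom A N M" "\<And>x. x \<in> carrier N \<Longrightarrow> g (t x) = x"
    by (rule projective_lift[OF assms(2) ses_fg(2,3)[OF ses] ses_epi[OF ses] hom_id]) blast
  note cl = hom_closed[OF t(1)] hom_closed[OF ses_hom2[OF ses]] hom_closed[OF ses_hom1[OF ses]]
  have d: "(\<lambda>x. x \<ominus>\<^bsub>M\<^esub> t (g x)) \<in> module_hom A M M"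
    by (rule hom_minusf[OF hom_id hom_comp[OF ses_hom2[OF ses] t(1)] lm(2)])
  have "g (x \<ominus>\<^bsub>M\<^esub> t (g x)) = \<zero>\<^bsub>N\<^esub>" if "x \<in> carrier M" for x
    using that cl by (simp add: hom_minus[OF ses_hom2[OF ses] lm(2,3)] t(2) N.minus_self)
  then obtain h where h: "h \<in> module_hom A M K" "\<And>x. x \<in> carrier M \<Longrightarrow> f (h x) = x \<ominus>\<^bsub>M\<^esub> t (g x)"
    using ses_lift[OF ses d lm(2)] by blast
  show ?thesis
  proof (rule retractI[OF ses_hom1[OF ses] h(1)])
    fix x assume x: "x \<in> carrier K"
    have "f (h (f x)) = f x"
      using x cl by (simp add: h(2) ses_zero[OF ses] hom_zero[OF t(1) lm(3,2)] M.minus_zero_right)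
    then show "h (f x) = x"
      by (rule ses_inj[OF ses, rotated 2]) (simp_all add: x cl hom_closed[OF h(1)])
  qed
qed

section \<open>How the last term of a coresolution reflects its first term\<close>

context finite_length_ring
begin

text \<open>An automorphism of \<open>P\<close> that factors through \<open>E0\<close> exhibits
  \<open>P\<close> as a summand of \<open>E0\<close>. For noninjective \<open>P\<close>,
  endomorphisms that factor through \<open>E0\<close> are thus never invertible.\<close>

lemma factor_bij_injective:
  assumes "is_dres A r" "h \<in> module_hom A (rE0 r) (rP r)"
    and "bij_betw (\<lambda>x. h (rj r x)) (carrier (rP r)) (carrier (rP r))"
  shows "injective A (rP r)"
proof -
  note lm = dres_lm[OF assms(1)] and hm = dres_hom[OF assms(1)]
  obtain g where g: "g \<in> module_hom A (rP r) (rP r)" "\<And>x. x \<in> carrier (rP r) \<Longrightarrow> g (h (rj r x)) = x"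
    by (rule bij_hom_inverse[OF hom_comp[OF hm(1) assms(2)] assms(3) lm(1)]) blast
  have "retract A (rP r) (rE0 r)"
    by (rule retractI[OF hm(1) hom_comp[OF assms(2) g(1)]]) (rule g(2))
  then show ?thesis by (rule injective_retract[OF _ dres_inj(1)[OF assms(1)] lm(1)])
qed

text \<open>The image \<open>m H\<close> meets \<open>K\<close> in zero, because \<open>q m\<close>
  is the identity on \<open>H\<close> while \<open>q\<close> kills \<open>K\<close>; essentiality of
  \<open>K\<close> in \<open>E1\<close> then forces it to vanish. So no endomorphism factoring
  through \<open>q\<close> is the identity on a nonzero submodule of \<open>E\<close>.\<close>

lemma dres_section_zero:
  assumes "is_dres A r" "submodule H A (rE r)" "m \<in> module_hom A (rE r) (rE1 r)"
    and sec: "\<And>x. x \<in> H \<Longrightarrow> rq r (m x) = x"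
  shows "H = {\<zero>\<^bsub>rE r\<^esub>}"
proof -
  note lm = dres_lm[OF assms(1)] and hm = dres_hom[OF assms(1)]
  have sub: "submodule (m ` H) A (rE1 r)" by (rule submodule_image[OF assms(3) lm(5,4) assms(2)])
  have "m ` H = {\<zero>\<^bsub>rE1 r\<^esub>}"
  proof (rule dres_essential[OF assms(1) sub])
    have "x = \<zero>\<^bsub>rE1 r\<^esub>" if x: "x \<in> m ` H" "x \<in> rk r ` carrier (rK r)" for x
    proof -
      obtain y z where yz: "y \<in> H" "x = m y" "z \<in> carrier (rK r)" "x = rk r z" using x by blast
      have "y = rq r (rk r z)" using sec[OF yz(1)] yz by simp
      then have "y = \<zero>\<^bsub>rE r\<^esub>" using ses_zero[OF dres_ses(2)[OF assms(1)] yz(3)] by simp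
      then show ?thesis using yz(2) hom_zero[OF assms(3) lm(5,4)] by simp
    qed
    moreover have "\<zero>\<^bsub>rE1 r\<^esub> \<in> m ` H" by (rule submodule_zero[OF sub])
    moreover have "\<zero>\<^bsub>rE1 r\<^esub> \<in> rk r ` carrier (rK r)"
      by (rule submodule_zero[OF submodule_range[OF hm(3) lm(3,4)]])
    ultimately show "m ` H \<inter> rk r ` carrier (rK r) = {\<zero>\<^bsub>rE1 r\<^esub>}" by blast
  qed
  then have "x = \<zero>\<^bsub>rE r\<^esub>" if "x \<in> H" for x
    using sec[OF that] that hom_zero[OF hm(4) lm(4,5)] by (metis imageI singletonD)
  then show ?thesis using submodule_zero[OF assms(2)] by blast
qed

text \<open>If \<open>E\<close> is zero, then \<open>K\<close> is isomorphic to \<open>E1\<close>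
  and hence projective, the first sequence splits, and \<open>P\<close> is a summand of the
  injective module \<open>E0\<close>.\<close>

lemma dres_end_nonzero:
  assumes "is_dres A r" "\<not> injective A (rP r)"
  shows "carrier (rE r) \<noteq> {\<zero>\<^bsub>rE r\<^esub>}"
proof
  assume z: "carrier (rE r) = {\<zero>\<^bsub>rE r\<^esub>}"
  note lm = dres_lm[OF assms(1)] and hm = dres_hom[OF assms(1)] and s = dres_ses[OF assms(1)]
  have "\<exists>y\<in>carrier (rK r). rk r y = x" if "x \<in> carrier (rE1 r)" for x
    using ses_ker[OF s(2) that] hom_closed[OF hm(4) that] z by simp
  then have "bij_betw (rk r) (carrier (rK r)) (carrier (rE1 r))"
    using ses_mono[OF s(2)] hom_closed[OF hm(3)] unfolding bij_betw_def module_mono_def by blast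
  then have "retract A (rK r) (rE1 r)"
    using hm(3) by (intro isomorphic_retract lm) (auto simp: isomorphic_modules_def)
  then have "projective A (rK r)" by (rule projective_retract[OF _ dres_proj(2)[OF assms(1)] lm(3)])
  from injective_retract[OF projective_ses_retract[OF s(1) this] dres_inj(1)[OF assms(1)] lm(1)]
  show False using assms(2) by blast
qed

lemma dres_end_not_projective:
  assumes "is_dres A r" "\<not> injective A (rP r)"
  shows "\<not> projective A (rE r)"
proof
  assume p: "projective A (rE r)"
  note s = dres_ses[OF assms(1)]
  obtain t where t: "t \<in> module_hom A (rE r) (rE1 r)" "\<And>x. x \<in> carrier (rE r) \<Longrightarrow> rq r (t x) = x"
    by (rule projective_lift[OF p ses_fg(2,3)[OF s(2)] ses_epi[OF s(2)] hom_id]) blast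
  have "carrier (rE r) = {\<zero>\<^bsub>rE r\<^esub>}"
    by (rule dres_section_zero[OF assms(1) left_module.carrier_submodule t]) (rule dres_lm[OF assms(1)])
  with dres_end_nonzero[OF assms] show False by blast
qed

lemma dres_end_indecomposable:
  assumes "is_dres A r" "indecomposable A (rP r)" "\<not> injective A (rP r)"
  shows "indecomposable A (rE r)"
proof -
  note lm = dres_lm[OF assms(1)] and hm = dres_hom[OF assms(1)] and s = dres_ses[OF assms(1)]
  interpret P: left_module A "rP r" by (rule lm)
  interpret E: left_module A "rE r" by (rule lm)
  \<comment> \<open>As \<open>\<psi> \<phi> = 0\<close>, the map \<open>gP fP\<close> factors
    through \<open>E0\<close>. If \<open>gP\<close> is invertible, so does \<open>fP\<close>, and
    hence \<open>\<phi>\<close> factors through \<open>E1\<close>; being the identity on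
    \<open>H\<close>, it forces \<open>H\<close> to be zero. This is applied to a projection and its
    complement in either order: their lifts add up to the identity of \<open>P\<close>, so by
    locality one of them is invertible.\<close>
  have key: "H = {\<zero>\<^bsub>rE r\<^esub>}" if H: "submodule H A (rE r)" and lift: "is_lift A r r \<phi> fP" "is_lift A r r \<psi> gP"
    and zero: "\<And>x. x \<in> carrier (rE r) \<Longrightarrow> \<psi> (\<phi> x) = \<zero>\<^bsub>rE r\<^esub>" and id: "\<And>x. x \<in> H \<Longrightarrow> \<phi> x = x"
    and bij: "bij_betw gP (carrier (rP r)) (carrier (rP r))" for H \<phi> \<psi> fP gP
  proof -
    have fP: "fP \<in> module_hom A (rP r) (rP r)" and gP: "gP \<in> module_hom A (rP r) (rP r)"
      using lift by (auto simp: is_lift_def)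
    obtain h where h: "h \<in> module_hom A (rE0 r) (rP r)" "\<And>x. x \<in> carrier (rP r) \<Longrightarrow> h (rj r x) = gP (fP x)"
      by (rule lift_zero[OF assms(1,1) lift_comp[OF lift] zero]) blast+
    obtain u where u: "u \<in> module_hom A (rP r) (rP r)" "\<And>x. x \<in> carrier (rP r) \<Longrightarrow> u (gP x) = x"
      by (rule bij_hom_inverse[OF gP bij lm(1)]) blast
    have "u (h (rj r x)) = fP x" if "x \<in> carrier (rP r)" for x
      using that h(2) u(2) hom_closed[OF fP] by simp
    then obtain m where m: "m \<in> module_hom A (rE r) (rE1 r)" "\<And>x. x \<in> carrier (rE r) \<Longrightarrow> rq r (m x) = \<phi> x"
      using lift_factor[OF assms(1,1) lift(1) hom_comp[OF h(1) u(1)]] by blast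
    show ?thesis
      by (rule dres_section_zero[OF assms(1) H m(1)]) (simp add: m(2) id submodule_mem[OF H])
  qed
  show ?thesis
    unfolding indecomposable_def
  proof (intro conjI allI impI)
    show "fg_module A (rE r)" by (rule ses_fg(3)[OF s(2)])
    show "carrier (rE r) \<noteq> {\<zero>\<^bsub>rE r\<^esub>}" by (rule dres_end_nonzero[OF assms(1,3)])
    fix H K assume c: "complementary_submodules A (rE r) H K"
    then have H: "submodule H A (rE r)" and K: "submodule K A (rE r)" and HK: "H \<inter> K = {\<zero>\<^bsub>rE r\<^esub>}"
      by (auto simp: complementary_submodules_def)
    obtain e where e: "e \<in> module_hom A (rE r) (rE r)" "\<And>x. x \<in> carrier (rE r) \<Longrightarrow> e x \<in> H"
      "\<And>x. x \<in> H \<Longrightarrow> e x = x" "\<And>x. x \<in> K \<Longrightarrow> e x = \<zero>\<^bsub>rE r\<^esub>"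
      "\<And>x. x \<in> carrier (rE r) \<Longrightarrow> x \<ominus>\<^bsub>rE r\<^esub> e x \<in> K"
      by (rule complementary_projection[OF c lm(5)]) blast
    obtain eP where eP: "is_lift A r r e eP" using lift_exists[OF assms(1,1) e(1)] by blast
    define e' where "e' = (\<lambda>x. x \<ominus>\<^bsub>rE r\<^esub> e x)"
    define eP' where "eP' = (\<lambda>x. x \<ominus>\<^bsub>rP r\<^esub> eP x)"
    have eP': "is_lift A r r e' eP'"
      unfolding e'_def eP'_def by (rule lift_minus[OF assms(1,1) lift_id eP])
    have homs: "eP \<in> module_hom A (rP r) (rP r)" "eP' \<in> module_hom A (rP r) (rP r)"
      using eP eP' by (auto simp: is_lift_def)
    have "bij_betw eP (carrier (rP r)) (carrier (rP r)) \<or> bij_betw eP' (carrier (rP r)) (carrier (rP r))"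
      by (rule indecomposable_local[OF assms(2) homs])
        (simp add: eP'_def P.add_minus_cancel hom_closed[OF homs(1)])
    moreover have "e (e' x) = \<zero>\<^bsub>rE r\<^esub>" "e' (e x) = \<zero>\<^bsub>rE r\<^esub>" if "x \<in> carrier (rE r)" for x
      using e(4)[OF e(5)[OF that]] e(3)[OF e(2)[OF that]] hom_closed[OF e(1) that] by (auto simp: e'_def E.minus_self)
    moreover have "e' x = x" if "x \<in> K" for x
      using e(4)[OF that] submodule_mem[OF K that] by (simp add: e'_def E.minus_zero_right)
    ultimately show "H = {\<zero>\<^bsub>rE r\<^esub>} \<or> K = {\<zero>\<^bsub>rE r\<^esub>}"
      using key[OF H eP eP' _ e(3)] key[OF K eP' eP] by blast
  qed
qed

text \<open>\<open>x - g (f x)\<close> is zero on \<open>E\<close>, so \<open>x - gP (fP x)\<close>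
  factors through \<open>E0\<close> and cannot be invertible. By locality \<open>gP fP\<close> is,
  which makes \<open>P\<close> a retract of the indecomposable \<open>P'\<close>.\<close>

lemma dres_end_isomorphic:
  assumes "is_dres A r" "is_dres A r'" "indecomposable A (rP r)" "indecomposable A (rP r')" "\<not> injective A (rP r)"
    and "isomorphic_modules A (rE r) (rE r')"
  shows "isomorphic_modules A (rP r) (rP r')"
proof -
  note lm = dres_lm[OF assms(1)] and hm = dres_hom[OF assms(1)]
  interpret P: left_module A "rP r" by (rule lm)
  interpret E: left_module A "rE r" by (rule lm)
  obtain f g where fg: "f \<in> module_hom A (rE r) (rE r')" "g \<in> module_hom A (rE r') (rE r)"
    "\<And>x. x \<in> carrier (rE r) \<Longrightarrow> g (f x) = x"
    by (rule isomorphic_modulesE[OF assms(6) lm(5)]) blast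
  obtain fP where fP: "is_lift A r r' f fP" using lift_exists[OF assms(1,2) fg(1)] by blast
  obtain gP where gP: "is_lift A r' r g gP" using lift_exists[OF assms(2,1) fg(2)] by blast
  have homs: "fP \<in> module_hom A (rP r) (rP r')" "gP \<in> module_hom A (rP r') (rP r)"
    using fP gP by (auto simp: is_lift_def)
  note gf = hom_comp[OF homs]
  have lift: "is_lift A r r (\<lambda>x. x \<ominus>\<^bsub>rE r\<^esub> g (f x)) (\<lambda>x. x \<ominus>\<^bsub>rP r\<^esub> gP (fP x))"
    by (rule lift_minus[OF assms(1,1) lift_id lift_comp[OF fP gP]])
  obtain h where h: "h \<in> module_hom A (rE0 r) (rP r)"
    "\<And>x. x \<in> carrier (rP r) \<Longrightarrow> h (rj r x) = x \<ominus>\<^bsub>rP r\<^esub> gP (fP x)"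
    by (rule lift_zero[OF assms(1,1) lift]) (auto simp: fg(3) E.minus_self)
  have "bij_betw (\<lambda>x. gP (fP x)) (carrier (rP r)) (carrier (rP r)) \<or>
      bij_betw (\<lambda>x. h (rj r x)) (carrier (rP r)) (carrier (rP r))"
    by (rule indecomposable_local[OF assms(3) gf hom_comp[OF hm(1) h(1)]])
      (simp add: h(2) P.add_minus_cancel hom_closed[OF gf])
  then have bij: "bij_betw (\<lambda>x. gP (fP x)) (carrier (rP r)) (carrier (rP r))"
    using factor_bij_injective[OF assms(1) h(1)] assms(5) by blast
  obtain u where u: "u \<in> module_hom A (rP r) (rP r)" "\<And>x. x \<in> carrier (rP r) \<Longrightarrow> u (gP (fP x)) = x"
    by (rule bij_hom_inverse[OF gf bij lm(1)]) blast
  have "retract A (rP r) (rP r')" by (rule retractI[OF homs(1) hom_comp[OF homs(2) u(1)]]) (rule u(2))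
  then show ?thesis
    using assms(3) by (intro retract_indecomposable[OF _ assms(4) lm(1)]) (simp_all add: indecomposable_def)
qed

end

section \<open>Homological dimensions\<close>

text \<open>Resolutions are indexed by all of \<open>nat\<close>; past the two given entries the
  sequence is constant, for modules as well as for differentials.\<close>

definition two_term :: "'b \<Rightarrow> 'b \<Rightarrow> 'b \<Rightarrow> nat \<Rightarrow> 'b" where
  "two_term a b z n = (if n = 0 then a else if n = 1 then b else z)"

lemma two_term_simps [simp]: "two_term a b z 0 = a" "two_term a b z (Suc 0) = b" "two_term a b z (Suc (Suc n)) = z"
  by (simp_all add: two_term_def)

lemma nat_012:
  fixes n :: nat
  assumes "\<And>n. P (Suc (Suc n))" "P 0" "P (Suc 0)"
  shows "P n"
proof (cases n)
  case (Suc m)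
  with assms show ?thesis by (cases m) auto
qed (use assms in simp)

lemma ext_pres_resolution:
  fixes A :: "('a, 'x) ring_scheme"
  assumes "fg_ses A K i P p M" "projective A K" "projective A P"
  obtains Z :: "'a std_module" where
    "projective_resolution A M p (two_term P K Z) (two_term i (\<lambda>_. \<zero>\<^bsub>K\<^esub>) (\<lambda>_. \<zero>\<^bsub>K\<^esub>))" "carrier Z = {\<zero>\<^bsub>Z\<^esub>}"
proof -
  note s = assms(1) and lm = ses_lm[OF assms(1)]
  let ?Z = "K\<lparr>carrier := {\<zero>\<^bsub>K\<^esub>}\<rparr>"
  have Z: "left_module A ?Z" by (rule zero_restrict[OF lm(1)])
  have K0: "\<zero>\<^bsub>K\<^esub> \<in> carrier K" by (rule submodule_zero[OF left_module.carrier_submodule[OF lm(1)]])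
  have zK: "(\<lambda>_. \<zero>\<^bsub>K\<^esub>) \<in> module_hom A ?Z K" and zZ: "(\<lambda>_. \<zero>\<^bsub>K\<^esub>) \<in> module_hom A ?Z ?Z"
    using hom_zerof[OF lm(1)] hom_zerof[OF Z] by auto
  have i0: "i \<zero>\<^bsub>K\<^esub> = \<zero>\<^bsub>P\<^esub>" by (rule hom_zero[OF ses_hom1[OF s] lm(1,2)])
  let ?P = "two_term P K ?Z" and ?d = "two_term i (\<lambda>_. \<zero>\<^bsub>K\<^esub>) (\<lambda>_. \<zero>\<^bsub>K\<^esub>)"
  have "projective_resolution A M p ?P ?d"
    unfolding projective_resolution_def
  proof (intro conjI allI)
    show "projective A (?P n)" for n
      by (rule nat_012[of "\<lambda>n. projective A (?P n)"]) (simp_all add: assms projective_zero[OF Z])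
    show "p \<in> module_epi A (?P 0) M" using ses_epi[OF s] by simp
    show "?d n \<in> module_hom A (?P (Suc n)) (?P n)" for n
      by (rule nat_012[of "\<lambda>n. ?d n \<in> module_hom A (?P (Suc n)) (?P n)"])
        (simp_all add: zK zZ ses_hom1[OF s])
    show "?d 0 ` carrier (?P 1) = a_kernel (?P 0) M p"
      using s by (simp add: fg_ses_def short_exact_def)
    show "?d (Suc n) ` carrier (?P (Suc (Suc n))) = a_kernel (?P (Suc n)) (?P n) (?d n)" for n
    proof (cases n)
      case 0
      have "x = \<zero>\<^bsub>K\<^esub>" if "x \<in> carrier K" "i x = \<zero>\<^bsub>P\<^esub>" for x
        using mono_zero[OF ses_mono[OF s] lm(1,2) that] .
      then have "a_kernel K P i = {\<zero>\<^bsub>K\<^esub>}" using K0 i0 unfolding a_kernel_def' by blast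
      then show ?thesis using 0 by simp
    next
      case (Suc m)
      then show ?thesis by (cases m) (auto simp: ker_iff)
    qed
  qed
  with that[of ?Z] show thesis by simp
qed

lemma ext_pres_projdim:
  assumes "ext_pres A N M"
  shows "projdim A M \<le> 1"
proof -
  obtain K P :: "'a std_module" and i p where 1: "fg_ses A K i P p M" "projective A K" "projective A P"
    using assms by (auto simp: ext_pres_def)
  obtain Z :: "'a std_module" where Z: "projective_resolution A M p (two_term P K Z) (two_term i (\<lambda>_. \<zero>\<^bsub>K\<^esub>) (\<lambda>_. \<zero>\<^bsub>K\<^esub>))"
      "carrier Z = {\<zero>\<^bsub>Z\<^esub>}"
    using ext_pres_resolution[OF 1] .
  have "\<forall>i>1. carrier (two_term P K Z i) = {\<zero>\<^bsub>two_term P K Z i\<^esub>}"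
    using Z(2) by (simp add: two_term_def)
  with Z(1) have "enat 1 \<in> {enat n | n. \<exists>\<epsilon> P d. projective_resolution A M \<epsilon> P d \<and> (\<forall>i>n. carrier (P i) = {\<zero>\<^bsub>P i\<^esub>})}"
    by blast
  from Inf_lower[OF this] show ?thesis unfolding projdim_def one_enat_def .
qed

lemma ext_pres_Ext_vanishes:
  assumes "ext_pres A N M" "left_module A N"
  shows "Ext_vanishes A 1 M N"
proof -
  interpret N: left_module A N by fact
  obtain K P :: "'a std_module" and i p where 1: "fg_ses A K i P p M" "projective A K" "projective A P"
     "\<And>f. f \<in> module_hom A K N \<Longrightarrow> \<exists>h\<in>module_hom A P N. \<forall>x\<in>carrier K. h (i x) = f x"
    using assms(1) by (auto simp: ext_pres_def)
  obtain Z :: "'a std_module" where Z: "projective_resolution A M p (two_term P K Z) (two_term i (\<lambda>_. \<zero>\<^bsub>K\<^esub>) (\<lambda>_. \<zero>\<^bsub>K\<^esub>))"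
      "carrier Z = {\<zero>\<^bsub>Z\<^esub>}"
    using ext_pres_resolution[OF 1(1-3)] .
  let ?P = "two_term P K Z" and ?d = "two_term i (\<lambda>_. \<zero>\<^bsub>K\<^esub>) (\<lambda>_. \<zero>\<^bsub>K\<^esub>)"
  note lm = ses_lm[OF 1(1)]
  define C where "C = carrier (Hom_group A K N)"
  have C: "f \<in> C \<longleftrightarrow> f \<in> module_hom A K N \<and> f \<in> extensional (carrier K)" for f
    by (simp add: C_def Hom_group_def)
  \<comment> \<open>Every map out of \<open>K\<close> is a cocycle, since the next differential is
    zero; the coboundaries are the maps that extend over \<open>i\<close>. So
    \<open>ext_pres\<close> makes the two sets equal, and what remains is that a group modulo itself
    is trivial.\<close>
  have cocycles: "Ext_cocycles A 1 ?P ?d N = C"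
    using hom_zero[OF _ lm(1) assms(2)] by (auto simp: Ext_cocycles_def C_def Hom_group_def)
  have boundaries: "Ext_coboundaries A 1 ?P ?d N = C"
  proof
    show "Ext_coboundaries A 1 ?P ?d N \<subseteq> C"
    proof
      fix f assume "f \<in> Ext_coboundaries A 1 ?P ?d N"
      then obtain h where h: "h \<in> module_hom A P N" "f = (\<lambda>x\<in>carrier K. h (i x))"
        by (auto simp: Hom_group_def)
      then show "f \<in> C"
        using hom_cong[OF hom_comp[OF ses_hom1[OF 1(1)] h(1)] _ lm(1), of f] by (simp add: C)
    qed
    show "C \<subseteq> Ext_coboundaries A 1 ?P ?d N"
    proof
      fix f assume f: "f \<in> C"
      then obtain h where h: "h \<in> module_hom A P N" "\<forall>x\<in>carrier K. h (i x) = f x" using 1(4) C by blast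
      define h' where "h' = restrict h (carrier P)"
      have "h' \<in> module_hom A P N" using hom_cong[OF h(1) _ lm(2), of h'] by (simp add: h'_def)
      then have "h' \<in> carrier (Hom_group A P N)" by (simp add: Hom_group_def h'_def)
      moreover have "f = (\<lambda>x\<in>carrier K. h' (i x))"
        using f h(2) hom_closed[OF ses_hom1[OF 1(1)]] by (auto simp: C h'_def extensional_def fun_eq_iff)
      ultimately show "f \<in> Ext_coboundaries A 1 ?P ?d N" by auto
    qed
  qed
  define G where "G = (Hom_group A K N)\<lparr>carrier := C\<rparr>"
  have mult: "f \<otimes>\<^bsub>G\<^esub> g = (\<lambda>x\<in>carrier K. f x \<oplus>\<^bsub>N\<^esub> g x)" for f g by (simp add: G_def Hom_group_def)
  have closed: "f \<otimes>\<^bsub>G\<^esub> g \<in> C" if "f \<in> C" "g \<in> C" for f g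
    using that hom_cong[OF hom_addf[of f A K N g] _ lm(1), of "f \<otimes>\<^bsub>G\<^esub> g"] assms(2) by (simp add: C mult)
  have coset: "C #>\<^bsub>G\<^esub> g = C" if g: "g \<in> C" for g
  proof
    show "C #>\<^bsub>G\<^esub> g \<subseteq> C" using closed g by (auto simp: r_coset_def)
    show "C \<subseteq> C #>\<^bsub>G\<^esub> g"
    proof
      fix f assume f: "f \<in> C"
      define h where "h = (\<lambda>x\<in>carrier K. f x \<ominus>\<^bsub>N\<^esub> g x)"
      have "h \<in> C"
        using f g hom_cong[OF hom_minusf[of f A K N g] _ lm(1), of h] assms(2) by (simp add: C h_def)
      moreover have "h \<otimes>\<^bsub>G\<^esub> g = f"
        unfolding mult h_def using f g hom_closed[of f A K N] hom_closed[of g A K N]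
        by (auto simp: C N.minus_add_cancel extensional_def fun_eq_iff)
      ultimately show "f \<in> C #>\<^bsub>G\<^esub> g" by (auto simp: r_coset_def)
    qed
  qed
  have "(\<lambda>x\<in>carrier K. \<zero>\<^bsub>N\<^esub>) \<in> C"
    using hom_cong[OF hom_zerof[OF assms(2)] _ lm(1), of "\<lambda>x\<in>carrier K. \<zero>\<^bsub>N\<^esub>"] by (simp add: C)
  then have "carrier (G Mod C) = {\<one>\<^bsub>G Mod C\<^esub>}"
    using coset by (auto simp: FactGroup_def RCOSETS_def G_def[symmetric]) (auto simp: G_def)
  then have "carrier (Ext_group A 1 ?P ?d N) = {\<one>\<^bsub>Ext_group A 1 ?P ?d N\<^esub>}"
    unfolding Ext_group_def cocycles boundaries by (simp add: G_def)
  with Z(1) show ?thesis unfolding Ext_vanishes_def by blast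
qed

lemma injdim_le_1_injdim:
  fixes A :: "('a, 'x) ring_scheme"
  assumes "injdim_le_1 A M"
  shows "injdim A M \<le> 1"
proof -
  obtain E C :: "'a std_module" and f g where 1: "fg_ses A M f E g C" "injective A E" "injective A C"
    using assms by (auto simp: injdim_le_1_def)
  note lm = ses_lm[OF 1(1)]
  let ?Z = "C\<lparr>carrier := {\<zero>\<^bsub>C\<^esub>}\<rparr>"
  have Z: "left_module A ?Z" by (rule zero_restrict[OF lm(3)])
  have zC: "(\<lambda>_. \<zero>\<^bsub>C\<^esub>) \<in> module_hom A C ?Z" and zZ: "(\<lambda>_. \<zero>\<^bsub>C\<^esub>) \<in> module_hom A ?Z ?Z"
    using hom_zerof[OF Z] by auto
  let ?I = "two_term E C ?Z" and ?d = "two_term g (\<lambda>_. \<zero>\<^bsub>C\<^esub>) (\<lambda>_. \<zero>\<^bsub>C\<^esub>)"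
  have "injective_resolution A M f ?I ?d"
    unfolding injective_resolution_def
  proof (intro conjI allI)
    show "injective A (?I n)" for n
      by (rule nat_012[of "\<lambda>n. injective A (?I n)"]) (simp_all add: 1 injective_zero[OF Z])
    show "f \<in> module_mono A M (?I 0)" using ses_mono[OF 1(1)] by simp
    show "?d n \<in> module_hom A (?I n) (?I (Suc n))" for n
      by (rule nat_012[of "\<lambda>n. ?d n \<in> module_hom A (?I n) (?I (Suc n))"])
        (simp_all add: zC zZ ses_hom2[OF 1(1)])
    show "f ` carrier M = a_kernel (?I 0) (?I 1) (?d 0)"
      using 1(1) by (simp add: fg_ses_def short_exact_def)
    have gE: "g ` carrier E = carrier C" using ses_epi[OF 1(1)] by (simp add: module_epi_def)
    have C0: "carrier C \<noteq> {}" using submodule_zero[OF left_module.carrier_submodule[OF lm(3)]] by blast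
    show "?d n ` carrier (?I n) = a_kernel (?I (Suc n)) (?I (Suc (Suc n))) (?d (Suc n))" for n
    proof (cases n)
      case (Suc m)
      then show ?thesis using C0 by (cases m) (auto simp: a_kernel_def')
    qed (simp add: a_kernel_def' gE)
  qed
  moreover have "\<forall>i>1. carrier (?I i) = {\<zero>\<^bsub>?I i\<^esub>}" by (simp add: two_term_def)
  ultimately have "enat 1 \<in> {enat n | n. \<exists>\<eta> I d. injective_resolution A M \<eta> I d \<and> (\<forall>i>n. carrier (I i) = {\<zero>\<^bsub>I i\<^esub>})}"
    by blast
  from Inf_lower[OF this] show ?thesis unfolding injdim_def one_enat_def .
qed

lemma injdim_leD:
  assumes "injdim A M \<le> enat m"
  obtains \<eta> I d where "injective_resolution A M \<eta> I d" "\<And>i. i > m \<Longrightarrow> carrier (I i) = {\<zero>\<^bsub>I i\<^esub>}"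
proof -
  let ?S = "{enat n | n. \<exists>\<eta> I d. injective_resolution A M \<eta> I d \<and> (\<forall>i>n. carrier (I i) = {\<zero>\<^bsub>I i\<^esub>})}"
  have le: "Inf ?S \<le> enat m" using assms unfolding injdim_def .
  \<comment> \<open>The infimum of a set of extended naturals is attained unless the set is empty;
    the empty set has infimum \<infinity>, which the bound excludes.\<close>
  have Inf_mem: "Inf S \<in> S" if "Inf S \<le> enat m" for S :: "enat set"
  proof (cases "S = {}")
    case False
    then show ?thesis unfolding Inf_enat_def by (auto intro: LeastI)
  qed (use that in \<open>simp add: Inf_enat_def\<close>)
  have "Inf ?S \<in> ?S" by (rule Inf_mem[OF le])
  then obtain n \<eta> I d where *: "Inf ?S = enat n" "injective_resolution A M \<eta> I d" "\<forall>i>n. carrier (I i) = {\<zero>\<^bsub>I i\<^esub>}"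
    by blast
  then have "n \<le> m" using le by simp
  with *(2,3) that show thesis by (metis le_less_trans)
qed

text \<open>The first cosyzygy is the image of \<open>d 0\<close>, so a resolution can be cut there
  and its tail resumed from \<open>X\<close>.\<close>

lemma injective_resolution_cokernel:
  assumes res: "injective_resolution A M \<eta> I d" and ses: "fg_ses A M \<eta> (I 0) p X"
  obtains k where "k \<in> module_mono A X (I 1)" "k ` carrier X = d 0 ` carrier (I 0)"
proof -
  have inj: "\<And>n. injective A (I n)" and d: "\<And>n. d n \<in> module_hom A (I n) (I (Suc n))"
    and ker: "\<eta> ` carrier M = a_kernel (I 0) (I 1) (d 0)"
    using res by (simp_all add: injective_resolution_def)
  note lmI = fg_left_module[OF injective_fg[OF inj]]
  have d0: "d 0 \<in> module_hom A (I 0) (I 1)" using d[of 0] by simp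
  have "d 0 (\<eta> x) = \<zero>\<^bsub>I 1\<^esub>" if "x \<in> carrier M" for x
  proof -
    have "\<eta> x \<in> a_kernel (I 0) (I 1) (d 0)" unfolding ker[symmetric] using that by (rule imageI)
    then show ?thesis by (simp add: ker_iff)
  qed
  then obtain k where k: "k \<in> module_hom A X (I 1)" "\<And>x. x \<in> carrier (I 0) \<Longrightarrow> k (p x) = d 0 x"
    using ses_desc[OF ses d0 lmI] by blast
  have "k \<in> module_mono A X (I 1)"
  proof (rule monoI[OF k(1) ses_lm(3)[OF ses] lmI])
    fix x assume x: "x \<in> carrier X" "k x = \<zero>\<^bsub>I 1\<^esub>"
    then obtain y where y: "y \<in> carrier (I 0)" "x = p y" using ses_surj[OF ses] by blast
    then have "y \<in> \<eta> ` carrier M" using x k(2) unfolding ker by (simp add: ker_iff)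
    then show "x = \<zero>\<^bsub>X\<^esub>" using y ses_zero[OF ses] by blast
  qed
  moreover have "k ` carrier X = d 0 ` carrier (I 0)"
  proof -
    have "carrier X = p ` carrier (I 0)" using ses_epi[OF ses] by (simp add: module_epi_def)
    then show ?thesis using k(2) by (simp add: image_image)
  qed
  ultimately show thesis by (rule that)
qed

text \<open>\<open>injective_envelope_in\<close> yields a submodule of the injective module it
  starts from, so passing to a standard copy of \<open>I\<close> beforehand makes the envelope
  standard as well. That it is a retract of \<open>I\<close> is recorded because this also transfers
  projectivity.\<close>

lemma std_envelope:
  fixes A :: "('a, 'x) ring_scheme"
  assumes fl: "finite_length_ring A" and "fg_module A M" "j \<in> module_mono A M I" "injective A I"
  obtains E :: "'a std_module" and j' where "fg_module A E" "j' \<in> module_mono A M E" "retract A E I"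
    "essential_submodule A (j' ` carrier M) E"
proof -
  interpret finite_length_ring A by (rule fl)
  note lI = fg_left_module[OF injective_fg[OF assms(4)]] and M = fg_left_module[OF assms(2)]
  obtain I' :: "'a std_module" where I': "fg_module A I'" "isomorphic_modules A I I'"
    using std_representative[OF injective_fg[OF assms(4)]] .
  note lI' = fg_left_module[OF I'(1)]
  have injI': "injective A I'" by (rule injective_isomorphic[OF I'(2) assms(4) lI'])
  obtain \<phi> where \<phi>: "\<phi> \<in> module_mono A I I'" using retract_mono[OF isomorphic_retract[OF I'(2) lI]] .
  let ?j = "\<lambda>x. \<phi> (j x)"
  have jm: "?j \<in> module_mono A M I'" by (rule mono_comp[OF assms(3) \<phi>])
  obtain B where B: "submodule B A I'" "retract A (I'\<lparr>carrier := B\<rparr>) I'" "?j \<in> module_mono A M (I'\<lparr>carrier := B\<rparr>)"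
    "\<And>K. submodule K A I' \<Longrightarrow> K \<subseteq> B \<Longrightarrow> (\<And>x. x \<in> carrier M \<Longrightarrow> ?j x \<in> K \<Longrightarrow> x = \<zero>\<^bsub>M\<^esub>) \<Longrightarrow> K = {\<zero>\<^bsub>I'\<^esub>}"
    by (rule injective_envelope_in[OF assms(2) jm injI']) blast
  let ?B = "I'\<lparr>carrier := B\<rparr>"
  have fgB: "fg_module A ?B" by (rule fg_submodule[OF I'(1) B(1)])
  note lB = fg_left_module[OF fgB]
  have "retract A ?B I"
    using retract_trans[OF B(2) isomorphic_retract[OF isomorphic_modules_sym[OF I'(2) lI] lI']] .
  moreover have "essential_submodule A (?j ` carrier M) ?B"
    unfolding essential_submodule_def
  proof (intro conjI allI impI)
    show "submodule (?j ` carrier M) A ?B" by (rule submodule_range[OF mono_hom[OF B(3)] M lB])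
    fix K assume K: "submodule K A ?B \<and> K \<inter> ?j ` carrier M = {\<zero>\<^bsub>?B\<^esub>}"
    have "x = \<zero>\<^bsub>M\<^esub>" if x: "x \<in> carrier M" "?j x \<in> K" for x
    proof -
      have "?j x = \<zero>\<^bsub>?B\<^esub>" using K x by blast
      then show ?thesis by (intro mono_zero[OF B(3) M lB x(1)])
    qed
    then show "K = {\<zero>\<^bsub>?B\<^esub>}" using B(4)[of K] K submodule_restrict_iff[OF lI' B(1)] by simp
  qed
  ultimately show thesis using that[OF fgB B(3)] by blast
qed

lemma ses_power:
  assumes "fg_ses A K f M g N"
  obtains f' g' where "fg_ses A (module_power K n) f' (module_power M n) g' (module_power N n)"
proof -
  note lm = ses_lm[OF assms]
  have "\<exists>f' g'. fg_ses A (module_power K n) f' (module_power M n) g' (module_power N n)"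
  proof (induction n)
    case 0
    let ?p = "\<lambda>X. module_power X 0"
    have z: "(\<lambda>_. \<zero>\<^bsub>?p M\<^esub>) \<in> module_hom A (?p K) (?p M)" "(\<lambda>_. \<zero>\<^bsub>?p N\<^esub>) \<in> module_hom A (?p M) (?p N)"
      by (rule hom_zerof[OF module_power_left_module[OF lm(2)]] hom_zerof[OF module_power_left_module[OF lm(3)]])+
    have c: "carrier (?p K) = {\<zero>\<^bsub>?p K\<^esub>}" "carrier (?p M) = {\<zero>\<^bsub>?p M\<^esub>}" "carrier (?p N) = {\<zero>\<^bsub>?p N\<^esub>}"
      by (rule module_power_zero)+
    have "fg_ses A (?p K) (\<lambda>_. \<zero>\<^bsub>?p M\<^esub>) (?p M) (\<lambda>_. \<zero>\<^bsub>?p N\<^esub>) (?p N)"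
      by (rule fg_sesI) (use z ses_fg[OF assms] in \<open>auto simp: module_mono_def module_epi_def c intro: fg_module_power\<close>)
    then show ?case by blast
  next
    case (Suc n)
    then obtain f' g' where s: "fg_ses A (module_power K n) f' (module_power M n) g' (module_power N n)" by blast
    show ?case
      by (rule ses_isomorphic[OF ses_prod[OF assms s]
          isomorphic_modules_sym[OF module_power_Suc[OF lm(1)] module_power_left_module[OF lm(1)]]
          isomorphic_modules_sym[OF module_power_Suc[OF lm(2)] module_power_left_module[OF lm(2)]]
          isomorphic_modules_sym[OF module_power_Suc[OF lm(3)] module_power_left_module[OF lm(3)]]
          module_power_left_module[OF lm(1)] module_power_left_module[OF lm(2)] module_power_left_module[OF lm(3)]])
        blast
  qed
  with that show thesis by blast
qed

section \<open>Dominant dimension two\<close>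

text \<open>What matters about \<open>Q\<close> is that it is projective-injective and that its
  \<open>add\<close> contains all modules of this kind; \<open>proj_inj_ringI\<close> connects this
  with the list of indecomposables.\<close>

locale proj_inj_ring = finite_length_ring A for A :: "('a, 'x) ring_scheme" +
  fixes Q :: "('a, 'q) module"
  assumes Q_proj: "projective A Q" and Q_inj: "injective A Q"
    and Q_complete_std: "\<And>M :: 'a std_module. projective A M \<Longrightarrow> injective A M \<Longrightarrow> in_add A Q M"
begin

lemma Q_fg: "fg_module A Q" and Q_lm: "left_module A Q"
  using Q_proj by (auto dest: projective_fg fg_left_module)

lemma Q_complete:
  assumes "projective A M" "injective A M"
  shows "in_add A Q M"
proof -
  note M = fg_left_module[OF projective_fg[OF assms(1)]]
  obtain N :: "'a std_module" where N: "fg_module A N" "isomorphic_modules A M N"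
    using std_representative[OF projective_fg[OF assms(1)]] .
  note lN = fg_left_module[OF N(1)]
  have "in_add A Q N"
    by (rule Q_complete_std[OF projective_isomorphic[OF N(2) assms(1) lN] injective_isomorphic[OF N(2) assms(2) lN]])
  then show ?thesis by (rule in_add_retract[OF _ isomorphic_retract[OF N(2) M]])
qed

lemma Cogen_Q: "projective A M \<Longrightarrow> injective A M \<Longrightarrow> M \<in> Cogen A Q"
  by (rule Cogen_in_add[OF Cogen_self[OF Q_fg] Q_complete Q_lm]) (auto dest: projective_fg fg_left_module)

lemma Gen_Q: "projective A M \<Longrightarrow> injective A M \<Longrightarrow> M \<in> Gen A Q"
  by (rule Gen_in_add[OF Gen_self[OF Q_fg] Q_complete Q_lm]) (auto dest: projective_fg fg_left_module)

lemma Cogen_Q_envelope: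
  assumes "M \<in> Cogen A Q"
  obtains E :: "'a std_module" and j where "fg_module A E" "j \<in> module_mono A M E" "projective A E" "injective A E"
    "essential_submodule A (j ` carrier M) E"
proof -
  obtain n f where f: "f \<in> module_mono A M (module_power Q n)" and fg: "fg_module A M"
    using assms by (auto simp: Cogen_iff)
  note inj = injective_module_power[OF Q_inj, of n] and proj = projective_module_power[OF Q_proj, of n]
  obtain E :: "'a std_module" and j where E: "fg_module A E" "j \<in> module_mono A M E" "retract A E (module_power Q n)"
    "essential_submodule A (j ` carrier M) E"
    using std_envelope[OF finite_length_ring_axioms fg f inj] .
  show thesis
    by (rule that[OF E(1,2) projective_retract[OF E(3) proj fg_left_module[OF E(1)]]
          injective_retract[OF E(3) inj fg_left_module[OF E(1)]] E(4)])
qed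

text \<open>The given sequence need not be minimal, nor start at \<open>P\<close>. The cokernel
  \<open>K\<close> of the minimal start \<open>P \<rightarrow> E0\<close> is a retract of
  \<open>X \<oplus> E0\<close>. So \<open>K\<close> inherits from \<open>X\<close> cogeneration by
  \<open>Q\<close>, which makes \<open>E1\<close> projective, and injective dimension at most one,
  which makes \<open>E\<close> injective. Both directions of the theorem use this, with a copy of
  \<Lambda> and with arbitrary projectives in the role of \<open>P\<close>.\<close>

lemma dominant_resolution:
  fixes P :: "'a std_module"
  assumes ses: "fg_ses A Z i I p X" and I: "projective A I" "injective A I" and X: "X \<in> Cogen A Q" "injdim_le_1 A X"
    and P: "retract A P Z" "fg_module A P"
  obtains r where "is_dres A r" "rP r = P" "injective A (rE r)"
    "essential_submodule A (rj r ` carrier P) (rE0 r)" "retract A (rK r) (prod_module X (rE0 r))"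
proof -
  note lI = fg_left_module[OF projective_fg[OF I(1)]] and lX = ses_lm(3)[OF ses]
  obtain s where s: "s \<in> module_mono A P Z" using retract_mono[OF P(1)] .
  obtain E0 :: "'a std_module" and j where E0: "fg_module A E0" "j \<in> module_mono A P E0" "retract A E0 I"
    "essential_submodule A (j ` carrier P) E0"
    using std_envelope[OF finite_length_ring_axioms P(2) mono_comp[OF s ses_mono[OF ses]] I(2)] .
  have pE0: "projective A E0" and iE0: "injective A E0"
    using projective_retract[OF E0(3) I(1)] injective_retract[OF E0(3) I(2)] fg_left_module[OF E0(1)] by auto
  obtain K :: "'a std_module" and p' where K: "fg_ses A P j E0 p' K"
    using std_cokernel[OF P(2) E0(1,2)] .
  note lK = ses_lm(3)[OF K]
  have retr: "retract A K (prod_module X E0)" by (rule cosyzygy_retract[OF K ses iE0 I(2) P(1)])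
  have KQ: "K \<in> Cogen A Q" by (rule Cogen_retract[OF Cogen_prod[OF X(1) Cogen_Q[OF pE0 iE0] Q_lm] retr lK])
  have Kid: "injdim_le_1 A K"
    by (rule injdim_le_1_retract[OF injdim_le_1_prod[OF X(2) injdim_le_1_injective[OF iE0]] retr lK])
  obtain E1 :: "'a std_module" and k where E1: "fg_module A E1" "k \<in> module_mono A K E1" "projective A E1" "injective A E1"
    "essential_submodule A (k ` carrier K) E1"
    using Cogen_Q_envelope[OF KQ] .
  obtain E :: "'a std_module" and q where E: "fg_ses A K k E1 q E"
    using std_cokernel[OF ses_fg(3)[OF K] E1(1,2)] .
  have iE: "injective A E" by (rule injdim_le_1_cokernel[OF Kid retract_refl E E1(4)])
  define r where "r = \<lparr>rP = P, rj = j, rE0 = E0, rp = p', rK = K, rk = k, rE1 = E1, rq = q, rE = E\<rparr>"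
  have "is_dres A r" unfolding is_dres_def r_def using K E pE0 iE0 E1 by simp
  moreover have "rP r = P" "injective A (rE r)" "essential_submodule A (rj r ` carrier P) (rE0 r)"
    "retract A (rK r) (prod_module X (rE0 r))"
    unfolding r_def using iE E0(4) retr by simp_all
  ultimately show thesis by (rule that)
qed

end

section \<open>Coresolutions and the Auslander-Gorenstein condition\<close>

context proj_inj_ring
begin

text \<open>The two short exact sequences are spliced into \<open>E0, E1, E, 0, 0, ...\<close>, a
  minimal injective resolution whose first two terms are projective; the bound 2 is
  \<open>m + 1\<close> for \<open>m = 1\<close>. A coresolution record starts at a standard module,
  so \<open>rP r\<close> is a copy of the regular module, and the isomorphism has to be composed
  with the first embedding.\<close>

lemma auslander_gorensteinI:
  assumes r: "is_dres A r" "injective A (rE r)" "essential_submodule A (rj r ` carrier (rP r)) (rE0 r)"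
    and iso: "isomorphic_modules A (regular_module A) (rP r)"
  shows "auslander_gorenstein 1 A"
proof -
  note s = dres_ses[OF r(1)] and hm = dres_hom[OF r(1)] and lm = dres_lm[OF r(1)]
  obtain \<phi> where \<phi>: "\<phi> \<in> module_hom A (regular_module A) (rP r)"
    "bij_betw \<phi> (carrier (regular_module A)) (carrier (rP r))"
    using iso by (auto simp: isomorphic_modules_def)
  have \<phi>m: "\<phi> \<in> module_mono A (regular_module A) (rP r)"
    and \<phi>im: "\<phi> ` carrier (regular_module A) = carrier (rP r)"
    using \<phi> by (auto simp: module_mono_def bij_betw_def)
  let ?E = "rE r"
  let ?Z = "?E\<lparr>carrier := {\<zero>\<^bsub>?E\<^esub>}\<rparr>"
  have Z: "left_module A ?Z" by (rule zero_restrict[OF lm(5)])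
  define I where "I = case_nat (rE0 r) (two_term (rE1 r) ?E ?Z)"
  define d where "d = case_nat (\<lambda>x. rk r (rp r x)) (two_term (rq r) (\<lambda>_. \<zero>\<^bsub>?E\<^esub>) (\<lambda>_. \<zero>\<^bsub>?E\<^esub>))"
  have I [simp]: "I 0 = rE0 r" "I (Suc 0) = rE1 r" "I (Suc (Suc 0)) = ?E" "I (Suc (Suc (Suc n))) = ?Z" for n
    by (simp_all add: I_def)
  have d [simp]: "d 0 = (\<lambda>x. rk r (rp r x))" "d (Suc 0) = rq r" "d (Suc (Suc n)) = (\<lambda>_. \<zero>\<^bsub>?E\<^esub>)" for n
    by (cases n; simp add: d_def)+
  have nat_0123: "P n" if "P 0" "P (Suc 0)" "P (Suc (Suc 0))" "\<And>n. P (Suc (Suc (Suc n)))" for P and n :: nat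
    using that by (metis not0_implies_Suc)
  have zE: "(\<lambda>_. \<zero>\<^bsub>?E\<^esub>) \<in> module_hom A ?E ?Z" and zZ: "(\<lambda>_. \<zero>\<^bsub>?E\<^esub>) \<in> module_hom A ?Z ?Z"
    using hom_zerof[OF Z] by auto
  have E0: "\<zero>\<^bsub>?E\<^esub> \<in> carrier ?E" by (rule submodule_zero[OF left_module.carrier_submodule[OF lm(5)]])
  have pim: "rp r ` carrier (rE0 r) = carrier (rK r)" and qim: "rq r ` carrier (rE1 r) = carrier ?E"
    using ses_epi[OF s(1)] ses_epi[OF s(2)] by (simp_all add: module_epi_def)
  have d0im: "d 0 ` carrier (I 0) = rk r ` carrier (rK r)" by (simp add: pim flip: image_image)
  let ?\<eta> = "\<lambda>x. rj r (\<phi> x)"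
  have \<eta>im: "?\<eta> ` carrier (regular_module A) = rj r ` carrier (rP r)"
    using \<phi>im by (metis image_image)
  have res: "injective_resolution A (regular_module A) ?\<eta> I d"
    unfolding injective_resolution_def
  proof (intro conjI allI)
    show "injective A (I n)" for n
      by (rule nat_0123[of "\<lambda>n. injective A (I n)"]) (simp_all add: dres_inj[OF r(1)] r(2) injective_zero[OF Z])
    show "?\<eta> \<in> module_mono A (regular_module A) (I 0)" using mono_comp[OF \<phi>m ses_mono[OF s(1)]] by simp
    show "d n \<in> module_hom A (I n) (I (Suc n))" for n
      by (rule nat_0123[of "\<lambda>n. d n \<in> module_hom A (I n) (I (Suc n))"])
        (simp_all add: hom_comp[OF hm(2,3)] hm(4) zE zZ)
    have "a_kernel (rE0 r) (rE1 r) (\<lambda>x. rk r (rp r x)) = a_kernel (rE0 r) (rK r) (rp r)"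
      using mono_zero[OF ses_mono[OF s(2)] lm(3,4)] hom_zero[OF hm(3) lm(3,4)] hom_closed[OF hm(2)]
      unfolding a_kernel_def' by auto
    then show "?\<eta> ` carrier (regular_module A) = a_kernel (I 0) (I 1) (d 0)"
      unfolding \<eta>im using s(1) by (simp add: fg_ses_def short_exact_def)
    show "d n ` carrier (I n) = a_kernel (I (Suc n)) (I (Suc (Suc n))) (d (Suc n))" for n
    proof (rule nat_0123[of "\<lambda>n. d n ` carrier (I n) = a_kernel (I (Suc n)) (I (Suc (Suc n))) (d (Suc n))"])
      show "d 0 ` carrier (I 0) = a_kernel (I (Suc 0)) (I (Suc (Suc 0))) (d (Suc 0))"
        unfolding d0im using s(2) by (simp add: fg_ses_def short_exact_def)
      show "d (Suc 0) ` carrier (I (Suc 0)) = a_kernel (I (Suc (Suc 0))) (I (Suc (Suc (Suc 0)))) (d (Suc (Suc 0)))"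
        by (simp add: qim a_kernel_def')
    qed (use E0 in \<open>auto simp: a_kernel_def'\<close>)
  qed
  have "injdim A (regular_module A) \<le> enat 2"
  proof -
    have "carrier (I i) = {\<zero>\<^bsub>I i\<^esub>}" if i: "i > 2" for i
    proof -
      have "i = Suc (Suc (Suc (i - 3)))" using i by simp
      then have "I i = ?Z" using I(4)[of "i - 3"] by metis
      then show ?thesis by simp
    qed
    with res have "enat 2 \<in> {enat n | n. \<exists>\<eta> I d. injective_resolution A (regular_module A) \<eta> I d \<and>
        (\<forall>i>n. carrier (I i) = {\<zero>\<^bsub>I i\<^esub>})}" by blast
    from Inf_lower[OF this] show ?thesis unfolding injdim_def .
  qed
  moreover have "enat 2 \<le> domdim A"
  proof -
    have "essential_submodule A (d n ` carrier (I n)) (I (Suc n))" for n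
    proof (rule nat_0123[of "\<lambda>n. essential_submodule A (d n ` carrier (I n)) (I (Suc n))"])
      show "essential_submodule A (d 0 ` carrier (I 0)) (I (Suc 0))"
        unfolding d0im using r(1) by (simp add: is_dres_def)
      have triv: "essential_submodule A (carrier M) M" if "left_module A M" for M :: "'a std_module"
        unfolding essential_submodule_def using left_module.carrier_submodule[OF that] submodule_subset
        by (metis Int_absorb2)
      show "essential_submodule A (d (Suc 0) ` carrier (I (Suc 0))) (I (Suc (Suc 0)))"
        using triv[OF lm(5)] by (simp add: qim)
      have "(\<lambda>_. \<zero>\<^bsub>?E\<^esub>) ` carrier ?E = {\<zero>\<^bsub>?E\<^esub>}" using E0 by blast
      then show "essential_submodule A (d (Suc (Suc 0)) ` carrier (I (Suc (Suc 0)))) (I (Suc (Suc (Suc 0))))"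
        using triv[OF Z] by simp
      show "essential_submodule A (d (Suc (Suc (Suc n))) ` carrier (I (Suc (Suc (Suc n))))) (I (Suc (Suc (Suc (Suc n)))))" for n
        using triv[OF Z] by simp
    qed
    then have "minimal_injective_resolution A (regular_module A) ?\<eta> I d"
      unfolding minimal_injective_resolution_def \<eta>im using res r(3) by simp
    moreover have "projective A (I i)" if "i < 2" for i
      using that dres_proj[OF r(1)] by (auto simp: less_2_cases_iff)
    ultimately have "enat 2 \<in> {enat k | k. \<exists>\<eta> I d.
        minimal_injective_resolution A (regular_module A) \<eta> I d \<and> (\<forall>i<k. projective A (I i))}" by blast
    from Sup_upper[OF this] show ?thesis unfolding domdim_def .
  qed
  ultimately show ?thesis by (simp add: auslander_gorenstein_def numeral_2_eq_2)
qed

lemma auslander_gorensteinD: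
  assumes "auslander_gorenstein 1 A"
  obtains I0 X0 :: "'a std_module" and j p where "fg_ses A (regular_module A) j I0 p X0"
    "projective A I0" "injective A I0" "X0 \<in> Cogen A Q" "injdim_le_1 A X0"
proof -
  let ?\<Lambda> = "regular_module A"
  have id: "injdim A ?\<Lambda> \<le> enat 2" and dd: "enat 2 \<le> domdim A"
    using assms by (simp_all add: auslander_gorenstein_def numeral_2_eq_2)
  note fg = regular_fg[OF ring] and lm = regular_left_module[OF ring]
  \<comment> \<open>A supremum of at least 2 forces some member of the set to be at least 2, as
    otherwise 1 would be an upper bound.\<close>
  have "\<exists>k\<ge>2. \<exists>\<eta> I d. minimal_injective_resolution A ?\<Lambda> \<eta> I d \<and> (\<forall>i<k. projective A (I i))"
  proof (rule ccontr)
    assume neg: "\<not> ?thesis"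
    have "domdim A \<le> enat 1"
      unfolding domdim_def
    proof (rule Sup_least)
      fix x assume "x \<in> {enat k | k. \<exists>\<eta> I d. minimal_injective_resolution A ?\<Lambda> \<eta> I d \<and> (\<forall>i<k. projective A (I i))}"
      then obtain k where "x = enat k" "\<exists>\<eta> I d. minimal_injective_resolution A ?\<Lambda> \<eta> I d \<and> (\<forall>i<k. projective A (I i))"
        by blast
      then show "x \<le> enat 1" using neg by (cases "k \<ge> 2") auto
    qed
    with dd have "enat 2 \<le> enat 1" by (rule order_trans)
    then show False by simp
  qed
  then obtain k \<eta> I d where k: "k \<ge> 2" and res: "injective_resolution A ?\<Lambda> \<eta> I d" and proj: "\<forall>i<k. projective A (I i)"
    unfolding minimal_injective_resolution_def by blast
  have inj: "\<And>n. injective A (I n)" and \<eta>: "\<eta> \<in> module_mono A ?\<Lambda> (I 0)"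
    using res by (simp_all add: injective_resolution_def)
  have p0: "projective A (I 0)" "projective A (I 1)" using k proj by simp_all
  obtain X0 :: "'a std_module" and p where X0: "fg_ses A ?\<Lambda> \<eta> (I 0) p X0"
    using std_cokernel[OF fg injective_fg[OF inj] \<eta>] .
  obtain m where m: "m \<in> module_mono A X0 (I 1)"
    using injective_resolution_cokernel[OF res X0] .
  have X0Q: "X0 \<in> Cogen A Q" by (rule Cogen_mono[OF Cogen_Q[OF p0(2) inj] m ses_fg(3)[OF X0]])
  \<comment> \<open>The finite resolution coming from \<open>injdim\<close> and the minimal one
    coming from \<open>domdim\<close> are unrelated; their first cosyzygies \<open>Y\<close> and
    \<open>X0\<close> are compared by \<open>cosyzygy_retract\<close>.\<close>
  obtain \<eta>' J d' where res': "injective_resolution A ?\<Lambda> \<eta>' J d'" and J0: "\<And>i. i > 2 \<Longrightarrow> carrier (J i) = {\<zero>\<^bsub>J i\<^esub>}"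
    by (rule injdim_leD[OF id]) blast
  have inj': "\<And>n. injective A (J n)" and \<eta>': "\<eta>' \<in> module_mono A ?\<Lambda> (J 0)" and d': "\<And>n. d' n \<in> module_hom A (J n) (J (Suc n))"
    and ker': "\<And>n. d' n ` carrier (J n) = a_kernel (J (Suc n)) (J (Suc (Suc n))) (d' (Suc n))"
    using res' by (simp_all add: injective_resolution_def)
  note fgJ = injective_fg[OF inj']
  obtain Y :: "'a std_module" and q where Y: "fg_ses A ?\<Lambda> \<eta>' (J 0) q Y"
    using std_cokernel[OF fg fgJ \<eta>'] .
  obtain l where l: "l \<in> module_mono A Y (J 1)" "l ` carrier Y = d' 0 ` carrier (J 0)"
    using injective_resolution_cokernel[OF res' Y] .
  have d2: "d' (Suc (Suc 0)) x = \<zero>\<^bsub>J (Suc (Suc (Suc 0)))\<^esub>" if "x \<in> carrier (J (Suc (Suc 0)))" for x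
    using hom_closed[OF d' that] J0[of "Suc (Suc (Suc 0))"] by simp
  have "d' (Suc 0) ` carrier (J (Suc 0)) = carrier (J (Suc (Suc 0)))"
    unfolding ker'[of "Suc 0"] using d2 by (auto simp: a_kernel_def')
  then have "short_exact A Y l (J 1) (d' 1) (J 2)"
    using l d'[of 1] ker'[of 0] by (simp add: short_exact_def module_epi_def numeral_2_eq_2)
  then have "fg_ses A Y l (J 1) (d' 1) (J 2)" by (simp add: fg_ses_def ses_fg(3)[OF Y] fgJ)
  then have "injdim_le_1 A Y" by (rule injdim_le_1I[OF _ inj' inj'])
  then have "injdim_le_1 A X0"
    by (rule injdim_le_1_retract[OF injdim_le_1_prod[OF _ injdim_le_1_injective[OF inj]]
          cosyzygy_retract[OF X0 Y inj inj' retract_refl] ses_lm(3)[OF X0]])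
  with that X0 p0(1) inj X0Q show thesis by blast
qed

lemma tilting_imp_auslander_gorenstein:
  assumes T: "T \<in> Gen A Q" "T \<in> Cogen A Q" "injdim_le_1 A T"
    and add: "in_add A T T0" "in_add A T T1" and ses: "fg_ses A (regular_module A) i T0 g T1"
  shows "auslander_gorenstein 1 A"
proof -
  let ?\<Lambda> = "regular_module A"
  note lm = ses_lm[OF ses]
  have lT: "left_module A T" using T(1) by (auto simp: Gen_iff fg_left_module)
  have T0: "T0 \<in> Gen A Q" "T0 \<in> Cogen A Q" and T1: "T1 \<in> Cogen A Q" "injdim_le_1 A T1"
    using Gen_in_add[OF T(1) add(1) Q_lm lm(2)] Cogen_in_add[OF T(2) add(1) Q_lm lm(2)]
      Cogen_in_add[OF T(2) add(2) Q_lm lm(3)] injdim_le_1_in_add[OF T(3) add(2) lT lm(3)] by auto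
  obtain n a where a: "a \<in> module_mono A T0 (module_power Q n)" using T0(2) by (auto simp: Cogen_iff)
  let ?I = "module_power Q n"
  have pI: "projective A ?I" and iI: "injective A ?I"
    by (rule projective_module_power[OF Q_proj] injective_module_power[OF Q_inj])+
  let ?j = "\<lambda>x. a (i x)"
  have jm: "?j \<in> module_mono A ?\<Lambda> ?I" by (rule mono_comp[OF ses_mono[OF ses] a])
  obtain X :: "'a std_module" and p where X: "fg_ses A ?\<Lambda> ?j ?I p X"
    using std_cokernel[OF ses_fg(1)[OF ses] projective_fg[OF pI] jm] .
  obtain m w where w: "w \<in> module_epi A (module_power Q m) T0" using T0(1) by (auto simp: Gen_iff)
  obtain u where u: "u \<in> module_hom A ?\<Lambda> (module_power Q m)" "\<And>x. x \<in> carrier ?\<Lambda> \<Longrightarrow> w (u x) = i x"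
    by (rule projective_lift[OF projective_regular[OF ring] fg_module_power[OF Q_fg] ses_fg(2)[OF ses] w ses_hom1[OF ses]]) blast
  obtain v where v: "v \<in> module_hom A ?I (module_power Q m)" "\<And>x. x \<in> carrier ?\<Lambda> \<Longrightarrow> v (?j x) = u x"
    by (rule injective_extend[OF injective_module_power[OF Q_inj] ses_fg(1)[OF ses] projective_fg[OF pI] jm u(1)]) blast
  \<comment> \<open>\<open>S = w v\<close> maps \<open>I\<close> to \<open>T0\<close> and
    \<open>R = a\<close> maps back, both over the identity of \<Lambda>. Since \<open>T0\<close>
    need not be injective, \<open>v\<close> goes into a power of \<open>Q\<close> above
    \<open>T0\<close>: the map from \<Lambda> lifts there by projectivity and extends to
    \<open>I\<close> by injectivity.\<close>
  have retr: "retract A X (prod_module T1 ?I)"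
    by (rule cosyzygy_retract_gen[OF X ses hom_comp[OF v(1) epi_hom[OF w]] mono_hom[OF a] hom_id hom_id])
      (simp_all add: v(2) u(2) del: regular_module_simps)
  have XQ: "X \<in> Cogen A Q" by (rule Cogen_retract[OF Cogen_prod[OF T1(1) Cogen_Q[OF pI iI] Q_lm] retr ses_lm(3)[OF X]])
  have Xid: "injdim_le_1 A X"
    by (rule injdim_le_1_retract[OF injdim_le_1_prod[OF T1(2) injdim_le_1_injective[OF iI]] retr ses_lm(3)[OF X]])
  obtain P :: "'a std_module" where P: "fg_module A P" "isomorphic_modules A ?\<Lambda> P"
    using std_representative[OF ses_fg(1)[OF ses]] .
  have "retract A P ?\<Lambda>" by (rule isomorphic_retract[OF isomorphic_modules_sym[OF P(2) lm(1)] fg_left_module[OF P(1)]])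
  from dominant_resolution[OF X pI iI XQ Xid this P(1)]
  obtain r where "is_dres A r" "rP r = P" "injective A (rE r)" "essential_submodule A (rj r ` carrier P) (rE0 r)"
    by metis
  with P(2) show ?thesis by (intro auslander_gorensteinI[of r]) simp_all
qed

end

section \<open>Indecomposable injectives over an Auslander-Gorenstein algebra\<close>

lemma nonisomorphic_sublist:
  assumes "\<And>M. M \<in> set Ms \<Longrightarrow> left_module A M"
  shows "\<exists>Ns. set Ns \<subseteq> set Ms \<and>
    (\<forall>i<length Ns. \<forall>j<length Ns. i \<noteq> j \<longrightarrow> \<not> isomorphic_modules A (Ns ! i) (Ns ! j)) \<and>
    (\<forall>M\<in>set Ms. \<exists>N\<in>set Ns. isomorphic_modules A M N)"
  using assms
proof (induction Ms)
  case (Cons M Ms)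
  then obtain Ns where Ns: "set Ns \<subseteq> set Ms"
    "\<And>i j. i < length Ns \<Longrightarrow> j < length Ns \<Longrightarrow> i \<noteq> j \<Longrightarrow> \<not> isomorphic_modules A (Ns ! i) (Ns ! j)"
    "\<And>M. M \<in> set Ms \<Longrightarrow> \<exists>N\<in>set Ns. isomorphic_modules A M N" by auto
  show ?case
  proof (cases "\<exists>N\<in>set Ns. isomorphic_modules A M N")
    case True
    with Ns show ?thesis by (intro exI[of _ Ns]) auto
  next
    case False
    then have "\<not> isomorphic_modules A M N" "\<not> isomorphic_modules A N M" if "N \<in> set Ns" for N
      using that isomorphic_modules_sym[of A N M] Cons.prems Ns(1) by auto
    then have "\<not> isomorphic_modules A ((M # Ns) ! i) ((M # Ns) ! j)"
      if "i < length (M # Ns)" "j < length (M # Ns)" "i \<noteq> j" for i j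
      using that Ns(2) by (cases i; cases j) auto
    moreover have "\<exists>N\<in>set (M # Ns). isomorphic_modules A M' N" if "M' \<in> set (M # Ms)" for M'
      using that Ns(3) isomorphic_modules_refl[of A M] by auto
    ultimately show ?thesis using Ns(1) by (intro exI[of _ "M # Ns"]) auto
  qed
qed simp

lemma direct_sum_nonzero:
  assumes "ring A" "left_module A W" "\<And>M. M \<in> set Ms \<Longrightarrow> left_module A M"
    and "f \<in> module_hom A (direct_sum Ms) W" "x \<in> carrier (direct_sum Ms)" "f x \<noteq> \<zero>\<^bsub>W\<^esub>"
  shows "\<exists>M\<in>set Ms. \<exists>s\<in>module_hom A M (direct_sum Ms). \<exists>y\<in>carrier M. f (s y) \<noteq> \<zero>\<^bsub>W\<^esub>"
  using assms(3-)
proof (induction Ms arbitrary: f x)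
  case Nil
  then show ?case
    using hom_zero[OF Nil(2) direct_sum_Nil_left_module[OF assms(1)] assms(2)]
    by (auto simp: direct_sum_simps restrict_def)
next
  case (Cons M Ms)
  let ?D = "direct_sum Ms" and ?D' = "direct_sum (M # Ms)"
  have lM: "left_module A M" and lD: "left_module A ?D" and lD': "left_module A ?D'"
    using Cons.prems(1) by (auto intro!: direct_sum_left_module assms(1))
  interpret M: left_module A M by (rule lM)
  interpret D: left_module A ?D by (rule lD)
  interpret W: left_module A W by (rule assms(2))
  obtain a b where ab: "a \<in> module_hom A ?D' (prod_module M ?D)" "b \<in> module_hom A (prod_module M ?D) ?D'"
    "\<And>x. x \<in> carrier ?D' \<Longrightarrow> b (a x) = x"
    by (rule isomorphic_modulesE[OF direct_sum_Cons[OF assms(1) Cons.prems(1)] lD']) blast+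
  define m n where "m = fst (a x)" and "n = snd (a x)"
  have mn: "m \<in> carrier M" "n \<in> carrier ?D" "a x = (m, n)"
    using hom_closed[OF ab(1) Cons.prems(3)] by (auto simp: m_def n_def)
  note s1 = hom_comp[OF hom_incl_fst[OF lD] ab(2)] and s2 = hom_comp[OF hom_incl_snd[OF lM] ab(2)]
  have "x = b (m, \<zero>\<^bsub>?D\<^esub>) \<oplus>\<^bsub>?D'\<^esub> b (\<zero>\<^bsub>M\<^esub>, n)"
    using mn ab(3)[OF Cons.prems(3)] by (simp flip: hom_add[OF ab(2)])
  then have fx: "f x = f (b (m, \<zero>\<^bsub>?D\<^esub>)) \<oplus>\<^bsub>W\<^esub> f (b (\<zero>\<^bsub>M\<^esub>, n))"
    using hom_closed[OF s1 mn(1)] hom_closed[OF s2 mn(2)] hom_add[OF Cons.prems(2)] by simp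
  show ?case
  proof (cases "f (b (m, \<zero>\<^bsub>?D\<^esub>)) = \<zero>\<^bsub>W\<^esub>")
    case False
    with s1 mn(1) show ?thesis by (intro bexI[of _ M] bexI[OF _ s1] bexI[of _ m]) auto
  next
    case True
    then have "f (b (\<zero>\<^bsub>M\<^esub>, n)) \<noteq> \<zero>\<^bsub>W\<^esub>" using fx Cons.prems(4) by auto
    from Cons.IH[OF _ hom_comp[OF s2 Cons.prems(2)] mn(2) this]
    obtain N s y where "N \<in> set Ms" "s \<in> module_hom A N ?D" "y \<in> carrier N" "f (b (\<zero>\<^bsub>M\<^esub>, s y)) \<noteq> \<zero>\<^bsub>W\<^esub>"
      using Cons.prems(1) by auto
    then show ?thesis using hom_comp[OF _ s2, of s N]
      by (intro bexI[of _ N] bexI[of _ "\<lambda>x. b (\<zero>\<^bsub>M\<^esub>, s x)"] bexI[of _ y]) auto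
  qed
qed

text \<open>A map from \<open>P\<close> onto a simple submodule of \<open>E\<close>. For
  \<open>P\<close> indecomposable projective and \<open>E\<close> indecomposable injective this says
  that the simple top of \<open>P\<close> is the socle of \<open>E\<close>, without introducing
  radicals, tops or socles.\<close>

definition simple_image ::
    "('a, 'x) ring_scheme \<Rightarrow> ('a, 'm) module \<Rightarrow> ('a, 'n) module \<Rightarrow> ('m \<Rightarrow> 'n) \<Rightarrow> bool" where
  "simple_image A P E \<theta> \<longleftrightarrow> \<theta> \<in> module_hom A P E \<and> \<theta> ` carrier P \<noteq> {\<zero>\<^bsub>E\<^esub>} \<and>
     (\<forall>X. submodule X A E \<and> X \<subseteq> \<theta> ` carrier P \<and> X \<noteq> {\<zero>\<^bsub>E\<^esub>} \<longrightarrow> X = \<theta> ` carrier P)"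

context finite_length_ring
begin

text \<open>An indecomposable projective has a single maximal submodule. If \<open>\<theta>\<close>
  did not vanish on the kernel of \<open>\<theta>'\<close>, simplicity would make it map that kernel
  onto its whole image, and \<open>\<theta>\<close> would lift to an endomorphism
  \<open>\<alpha>\<close> of \<open>P\<close> with values in the kernel and
  \<open>\<theta> \<alpha> = \<theta>\<close>. Such an \<open>\<alpha>\<close> is neither nilpotent
  nor bijective.\<close>

lemma simple_image_kernel:
  assumes P: "indecomposable A P" "projective A P" and E: "left_module A E" "left_module A E'"
    and \<theta>: "simple_image A P E \<theta>" "simple_image A P E' \<theta>'" and y: "y \<in> carrier P" "\<theta>' y = \<zero>\<^bsub>E'\<^esub>"
  shows "\<theta> y = \<zero>\<^bsub>E\<^esub>"
proof (rule ccontr)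
  assume neq: "\<theta> y \<noteq> \<zero>\<^bsub>E\<^esub>"
  note fgP = projective_fg[OF P(2)]
  note lP = fg_left_module[OF fgP]
  have h: "\<theta> \<in> module_hom A P E" "\<theta>' \<in> module_hom A P E'" using \<theta> by (auto simp: simple_image_def)
  have nz: "\<theta> ` carrier P \<noteq> {\<zero>\<^bsub>E\<^esub>}" "\<theta>' ` carrier P \<noteq> {\<zero>\<^bsub>E'\<^esub>}" using \<theta> by (auto simp: simple_image_def)
  have ex0: "\<zero>\<^bsub>P\<^esub> \<in> carrier P" by (rule submodule_zero[OF left_module.carrier_submodule[OF lP]])
  let ?m = "a_kernel P E' \<theta>'"
  have m: "submodule ?m A P" by (rule submodule_ker[OF h(2) lP E(2)])
  have im: "\<theta> ` ?m = \<theta> ` carrier P"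
  proof -
    have "submodule (\<theta> ` ?m) A E" by (rule submodule_image[OF h(1) lP E(1) m])
    moreover have "\<theta> ` ?m \<subseteq> \<theta> ` carrier P" using submodule_subset[OF m] by blast
    moreover have "\<theta> y \<in> \<theta> ` ?m" using y by (intro imageI) (simp add: ker_iff)
    then have "\<theta> ` ?m \<noteq> {\<zero>\<^bsub>E\<^esub>}" using neq by blast
    ultimately show ?thesis using \<theta>(1) unfolding simple_image_def by blast
  qed
  let ?S = "E\<lparr>carrier := \<theta> ` carrier P\<rparr>" and ?M = "P\<lparr>carrier := ?m\<rparr>"
  have S: "submodule (\<theta> ` carrier P) A E" by (rule submodule_range[OF h(1) lP E(1)])
  have \<theta>S: "\<theta> \<in> module_hom A P ?S" by (rule hom_restrict_cod[OF h(1)]) simp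
  have \<theta>M: "\<theta> \<in> module_epi A ?M ?S"
    using hom_restrict_dom[OF \<theta>S submodule_subset[OF m]] im by (simp add: module_epi_def)
  have "\<theta> \<in> module_epi A P ?S" using \<theta>S by (simp add: module_epi_def)
  then have fgS: "fg_module A ?S" by (rule fg_epi[OF fgP _ submodule_left_module[OF E(1) S]])
  obtain \<alpha> where \<alpha>: "\<alpha> \<in> module_hom A P ?M" "\<And>x. x \<in> carrier P \<Longrightarrow> \<theta> (\<alpha> x) = \<theta> x"
    by (rule projective_lift[OF P(2) fg_submodule[OF fgP m] fgS \<theta>M \<theta>S]) blast
  have \<alpha>P: "\<alpha> \<in> module_hom A P P" using hom_comp[OF \<alpha>(1) hom_incl[OF submodule_subset[OF m]]] by simp
  from indecomposable_nilpotent_or_bij[OF P(1) \<alpha>P] show False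
  proof
    assume "\<exists>n. \<forall>x\<in>carrier P. (\<alpha> ^^ n) x = \<zero>\<^bsub>P\<^esub>"
    then obtain n where n: "\<And>x. x \<in> carrier P \<Longrightarrow> (\<alpha> ^^ n) x = \<zero>\<^bsub>P\<^esub>" by blast
    have "\<theta> ((\<alpha> ^^ k) y) = \<theta> y" for k
      using \<alpha>(2) hom_closed[OF hom_funpow[OF \<alpha>P] y(1)] by (induction k) auto
    from this[of n] n[OF y(1)] neq hom_zero[OF h(1) lP E(1)] show False by simp
  next
    assume bij: "bij_betw \<alpha> (carrier P) (carrier P)"
    have "\<theta>' x = \<zero>\<^bsub>E'\<^esub>" if x: "x \<in> carrier P" for x
    proof -
      obtain z where "z \<in> carrier P" "x = \<alpha> z" using bij x unfolding bij_betw_def by blast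
      then show ?thesis using hom_closed[OF \<alpha>(1)] by (simp add: ker_iff)
    qed
    then have "\<theta>' ` carrier P = (\<lambda>_. \<zero>\<^bsub>E'\<^esub>) ` carrier P" by (rule image_cong[OF refl])
    then have "\<theta>' ` carrier P = {\<zero>\<^bsub>E'\<^esub>}" using ex0 by auto
    with nz(2) show False by blast
  qed
qed

text \<open>By the inclusion of kernels, \<open>\<theta>'\<close> factors through the image of
  \<open>\<theta>\<close>; injectivity of \<open>E'\<close> extends the resulting map to
  \<open>E\<close>.\<close>

lemma simple_image_extend:
  assumes P: "indecomposable A P" "projective A P" and E: "fg_module A E" "injective A E'"
    and \<theta>: "simple_image A P E \<theta>" "simple_image A P E' \<theta>'"
  obtains \<alpha> where "\<alpha> \<in> module_hom A E E'" "\<And>x. x \<in> carrier P \<Longrightarrow> \<alpha> (\<theta> x) = \<theta>' x"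
proof -
  note lE = fg_left_module[OF E(1)] and lE' = fg_left_module[OF injective_fg[OF E(2)]]
    and lP = fg_left_module[OF projective_fg[OF P(2)]]
  have h: "\<theta> \<in> module_hom A P E" "\<theta>' \<in> module_hom A P E'" using \<theta> by (auto simp: simple_image_def)
  let ?S = "E\<lparr>carrier := \<theta> ` carrier P\<rparr>"
  have S: "submodule (\<theta> ` carrier P) A E" by (rule submodule_range[OF h(1) lP lE])
  have \<theta>S: "\<theta> \<in> module_epi A P ?S" using hom_restrict_cod[OF h(1)] by (auto simp: module_epi_def)
  obtain \<sigma> where \<sigma>: "\<sigma> \<in> module_hom A ?S E'" "\<And>x. x \<in> carrier P \<Longrightarrow> \<sigma> (\<theta> x) = \<theta>' x"
    by (rule epi_factor[OF \<theta>S h(2) lP submodule_left_module[OF lE S] lE'])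
      (use simple_image_kernel[OF P lE' lE \<theta>(2,1)] in auto)
  have "(\<lambda>x. x) \<in> module_mono A ?S E" using hom_incl[OF submodule_subset[OF S]] by (auto simp: module_mono_def)
  from injective_extend[OF E(2) fg_submodule[OF E(1) S] E(1) this \<sigma>(1)]
  obtain \<alpha> where \<alpha>: "\<alpha> \<in> module_hom A E E'" "\<And>x. x \<in> carrier ?S \<Longrightarrow> \<alpha> x = \<sigma> x" by blast
  show thesis by (rule that[OF \<alpha>(1)]) (simp add: \<alpha>(2) \<sigma>(2))
qed

text \<open>The composite \<open>\<beta> \<alpha>\<close> of the two extensions fixes the nonzero
  image of \<open>\<theta>\<close> pointwise, so it is not nilpotent and must be an automorphism of
  \<open>E\<close>.\<close>

lemma simple_image_isomorphic:
  assumes P: "indecomposable A P" "projective A P" and E: "indecomposable A E" "injective A E"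
    and E': "indecomposable A E'" "injective A E'"
    and \<theta>: "simple_image A P E \<theta>" "simple_image A P E' \<theta>'"
  shows "isomorphic_modules A E E'"
proof -
  note fgE = injective_fg[OF E(2)] and fgE' = injective_fg[OF E'(2)]
  note lE = fg_left_module[OF fgE] and lP = fg_left_module[OF projective_fg[OF P(2)]]
  obtain \<alpha> where \<alpha>: "\<alpha> \<in> module_hom A E E'" "\<And>x. x \<in> carrier P \<Longrightarrow> \<alpha> (\<theta> x) = \<theta>' x"
    by (rule simple_image_extend[OF P fgE E'(2) \<theta>]) (rule that)
  obtain \<beta> where \<beta>: "\<beta> \<in> module_hom A E' E" "\<And>x. x \<in> carrier P \<Longrightarrow> \<beta> (\<theta>' x) = \<theta> x"
    by (rule simple_image_extend[OF P fgE' E(2) \<theta>(2,1)]) (rule that)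
  have h: "\<theta> \<in> module_hom A P E" and nz: "\<theta> ` carrier P \<noteq> {\<zero>\<^bsub>E\<^esub>}" using \<theta>(1) by (auto simp: simple_image_def)
  note ba = hom_comp[OF \<alpha>(1) \<beta>(1)]
  have fix\<theta>: "((\<lambda>x. \<beta> (\<alpha> x)) ^^ k) (\<theta> x) = \<theta> x" if "x \<in> carrier P" for k x
    using that by (induction k) (simp_all add: \<alpha>(2) \<beta>(2))
  have "\<not> (\<exists>n. \<forall>x\<in>carrier E. ((\<lambda>x. \<beta> (\<alpha> x)) ^^ n) x = \<zero>\<^bsub>E\<^esub>)"
  proof
    assume "\<exists>n. \<forall>x\<in>carrier E. ((\<lambda>x. \<beta> (\<alpha> x)) ^^ n) x = \<zero>\<^bsub>E\<^esub>"
    then obtain n where n: "\<forall>x\<in>carrier E. ((\<lambda>x. \<beta> (\<alpha> x)) ^^ n) x = \<zero>\<^bsub>E\<^esub>" by blast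
    have "\<theta> x = \<zero>\<^bsub>E\<^esub>" if "x \<in> carrier P" for x
      using n hom_closed[OF h that] fix\<theta>[OF that, of n] by simp
    then have "\<theta> ` carrier P = (\<lambda>_. \<zero>\<^bsub>E\<^esub>) ` carrier P" by (rule image_cong[OF refl])
    then have "\<theta> ` carrier P = {\<zero>\<^bsub>E\<^esub>}"
      using submodule_zero[OF left_module.carrier_submodule[OF lP]] by auto
    with nz show False by blast
  qed
  with indecomposable_nilpotent_or_bij[OF E(1) ba]
  have bij: "bij_betw (\<lambda>x. \<beta> (\<alpha> x)) (carrier E) (carrier E)" by blast
  obtain u where u: "u \<in> module_hom A E E" "\<And>x. x \<in> carrier E \<Longrightarrow> u (\<beta> (\<alpha> x)) = x"
    by (rule bij_hom_inverse[OF ba bij lE]) blast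
  have "retract A E E'" by (rule retractI[OF \<alpha>(1) hom_comp[OF \<beta>(1) u(1)]]) (rule u(2))
  then show ?thesis using E(1) by (intro retract_indecomposable[OF _ E'(1) lE]) (simp_all add: indecomposable_def)
qed

text \<open>A nonzero element \<open>x\<close> of a simple submodule of \<open>E\<close> defines a
  nonzero map \<open>a \<mapsto> a x\<close> on the regular module. It is nonzero on some summand
  \<open>N\<close>, whose image is then the whole simple submodule.\<close>

lemma simple_image_exists:
  fixes Ns :: "('a, 'n) module list"
  assumes E: "fg_module A E" "carrier E \<noteq> {\<zero>\<^bsub>E\<^esub>}"
    and Ns: "isomorphic_modules A (regular_module A) (direct_sum Ns)" "\<And>N. N \<in> set Ns \<Longrightarrow> left_module A N"
  obtains N \<theta> where "N \<in> set Ns" "simple_image A N E \<theta>"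
proof -
  note lE = fg_left_module[OF E(1)] and lR = regular_left_module[OF ring]
  have lD: "left_module A (direct_sum Ns)" by (rule direct_sum_left_module[OF ring Ns(2)])
  interpret E: left_module A E by (rule lE)
  interpret A: ring A by (rule ring)
  obtain S where S: "submodule S A E" "S \<noteq> {\<zero>\<^bsub>E\<^esub>}"
    "\<And>X. submodule X A E \<Longrightarrow> X \<subseteq> S \<Longrightarrow> X \<noteq> {\<zero>\<^bsub>E\<^esub>} \<Longrightarrow> X = S"
    by (rule simple_submodule[OF E]) blast
  obtain x where x: "x \<in> S" "x \<noteq> \<zero>\<^bsub>E\<^esub>" using S(2) submodule_zero[OF S(1)] by blast
  have xE: "x \<in> carrier E" by (rule submodule_mem[OF S(1) x(1)])
  obtain a b where ab: "a \<in> module_hom A (regular_module A) (direct_sum Ns)" "b \<in> module_hom A (direct_sum Ns) (regular_module A)"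
    "\<And>x. x \<in> carrier (regular_module A) \<Longrightarrow> b (a x) = x"
    by (rule isomorphic_modulesE[OF Ns(1) lR]) blast
  let ?f = "\<lambda>y. b y \<odot>\<^bsub>E\<^esub> x"
  have f: "?f \<in> module_hom A (direct_sum Ns) E" by (rule hom_comp[OF ab(2) hom_regular[OF lE xE]])
  have "a \<one>\<^bsub>A\<^esub> \<in> carrier (direct_sum Ns)" using hom_closed[OF ab(1)] by simp
  moreover have "?f (a \<one>\<^bsub>A\<^esub>) \<noteq> \<zero>\<^bsub>E\<^esub>" using ab(3)[of "\<one>\<^bsub>A\<^esub>"] x(2) E.smult_one[OF xE] by simp
  ultimately obtain N s y where N: "N \<in> set Ns" "s \<in> module_hom A N (direct_sum Ns)" "y \<in> carrier N" "?f (s y) \<noteq> \<zero>\<^bsub>E\<^esub>"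
    using direct_sum_nonzero[OF ring lE Ns(2) f] by blast
  let ?\<theta> = "\<lambda>z. ?f (s z)"
  have \<theta>: "?\<theta> \<in> module_hom A N E" by (rule hom_comp[OF N(2) f])
  have "?\<theta> ` carrier N \<subseteq> S"
    using submodule_smult[OF S(1) _ x(1)] hom_closed[OF hom_comp[OF N(2) ab(2)]] by auto
  moreover have nz: "?\<theta> ` carrier N \<noteq> {\<zero>\<^bsub>E\<^esub>}" using N(3,4) by blast
  ultimately have "?\<theta> ` carrier N = S" by (rule S(3)[OF submodule_range[OF \<theta> Ns(2)[OF N(1)] lE]])
  then have "simple_image A N E ?\<theta>" using \<theta> nz S(3) by (simp add: simple_image_def)
  with N(1) show thesis by (rule that)
qed

end

section \<open>Coresolutions of injective modules by summands of powers of
  \<open>Q \<oplus> X0\<close>\<close>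

lemma projective_retract_free:
  assumes "projective A P"
  obtains n where "retract A P (module_power (regular_module A) n)"
proof -
  note fgP = projective_fg[OF assms]
  note R = left_module_ring[OF fg_left_module[OF fgP]]
  obtain n p where p: "p \<in> module_epi A (module_power (regular_module A) n) P"
    using free_cover[OF fgP] by (auto simp: Gen_iff)
  obtain s where s: "s \<in> module_hom A P (module_power (regular_module A) n)" "\<And>x. x \<in> carrier P \<Longrightarrow> p (s x) = x"
    by (rule projective_lift[OF assms fg_module_power[OF regular_fg[OF R]] fgP p hom_id]) blast
  show thesis by (rule that[OF retractI[OF s(1) epi_hom[OF p]]]) (rule s(2))
qed

text \<open>The outcome of \<open>auslander_gorensteinD\<close>, fixed once. The sequence
  \<open>ses0\<close> serves at the same time as the tilting sequence for \<Lambda> and as a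
  projective presentation of \<open>X0\<close>.\<close>

locale ag_ring = proj_inj_ring A Q for A :: "('a, 'x) ring_scheme" and Q :: "('a, 'q) module" +
  fixes I0 X0 :: "'a std_module" and j0 p0
  assumes ses0: "fg_ses A (regular_module A) j0 I0 p0 X0"
    and I0: "projective A I0" "injective A I0" and X0: "X0 \<in> Cogen A Q" "injdim_le_1 A X0"
begin

abbreviation Z :: "('a, 'q \<times> (nat \<Rightarrow> 'a) set) module" where "Z \<equiv> prod_module Q X0"

lemma X0_fg: "fg_module A X0" and X0_lm: "left_module A X0"
  using ses_fg(3)[OF ses0] ses_lm(3)[OF ses0] by auto

lemma Z_fg: "fg_module A Z" and Z_lm: "left_module A Z"
  using fg_prod[OF Q_fg X0_fg] by (auto intro: fg_left_module)

lemma in_add_Z: "in_add A Z Q" "in_add A Z X0"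
  using in_add_retract[OF in_add_self[OF Z_lm]] retract_prod_fst[OF Q_lm X0_lm] retract_prod_snd[OF Q_lm X0_lm]
  by auto

lemma in_add_Z_proj_inj: "projective A M \<Longrightarrow> injective A M \<Longrightarrow> in_add A Z M"
  by (rule in_add_trans[OF in_add_Z(1) Q_complete Z_lm Q_lm])

lemma X0_Gen: "X0 \<in> Gen A Q"
  by (rule Gen_epi[OF Gen_Q[OF I0] ses_epi[OF ses0] X0_lm])

text \<open>\<open>P\<close> is a summand of a free module of some rank \<open>n\<close>, so
  \<open>dominant_resolution\<close> is applied to the \<open>n\<close>-fold power of
  \<open>ses0\<close>.\<close>

lemma projective_dres:
  fixes P :: "'a std_module"
  assumes "projective A P"
  obtains r where "is_dres A r" "rP r = P" "injective A (rE r)" "in_add A Z (rK r)"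
proof -
  obtain n where n: "retract A P (module_power (regular_module A) n)"
    using projective_retract_free[OF assms] .
  let ?X = "module_power X0 n" and ?I = "module_power I0 n"
  obtain f g where ses: "fg_ses A (module_power (regular_module A) n) f ?I g ?X"
    using ses_power[OF ses0] .
  have addX: "in_add A X0 ?X" by (rule in_add_power[OF in_add_self[OF X0_lm] X0_lm X0_lm])
  note lX = module_power_left_module[OF X0_lm, of n]
  have XQ: "?X \<in> Cogen A Q" by (rule Cogen_in_add[OF X0(1) addX Q_lm lX])
  have Xid: "injdim_le_1 A ?X" by (rule injdim_le_1_in_add[OF X0(2) addX X0_lm lX])
  from dominant_resolution[OF ses projective_module_power[OF I0(1)] injective_module_power[OF I0(2)] XQ Xid n projective_fg[OF assms]]
  obtain r where r: "is_dres A r" "rP r = P" "injective A (rE r)" "retract A (rK r) (prod_module ?X (rE0 r))" by metis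
  have "in_add A Z (prod_module ?X (rE0 r))"
    by (rule in_add_prod[OF in_add_trans[OF in_add_Z(2) addX Z_lm X0_lm]
          in_add_Z_proj_inj[OF dres_proj(1)[OF r(1)] dres_inj(1)[OF r(1)]] Z_lm])
  from in_add_retract[OF this r(4)] have "in_add A Z (rK r)" .
  with r(1-3) show thesis by (rule that)
qed

text \<open>The third cotilting condition for \<open>Z\<close>, with an arbitrary \<open>E\<close>
  in place of D \<Lambda>. It is closed under finite direct sums, which reduces all injectives to
  the indecomposable ones.\<close>

definition cores :: "('a, 'e) module \<Rightarrow> bool" where
  "cores E \<longleftrightarrow> (\<exists>(C0 :: 'a std_module) (C1 :: 'a std_module) f g.
     in_add A Z C0 \<and> in_add A Z C1 \<and> fg_ses A C0 f C1 g E)"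

lemma coresI:
  assumes "fg_ses A C0 f C1 g E" "in_add A Z C0" "in_add A Z C1"
  shows "cores E"
proof -
  note fg = ses_fg[OF assms(1)] and lm = ses_lm[OF assms(1)]
  obtain C0' :: "'a std_module" where C0': "fg_module A C0'" "isomorphic_modules A C0 C0'"
    using std_representative[OF fg(1)] .
  obtain C1' :: "'a std_module" where C1': "fg_module A C1'" "isomorphic_modules A C1 C1'"
    using std_representative[OF fg(2)] .
  note lm' = fg_left_module[OF C0'(1)] fg_left_module[OF C1'(1)]
  obtain f' g' where "fg_ses A C0' f' C1' g' E"
    using ses_isomorphic[OF assms(1) C0'(2) C1'(2) isomorphic_modules_refl lm' lm(3)] .
  moreover have "in_add A Z C0'" "in_add A Z C1'"
    using in_add_retract[OF assms(2) isomorphic_retract[OF isomorphic_modules_sym[OF C0'(2) lm(1)] lm'(1)]]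
      in_add_retract[OF assms(3) isomorphic_retract[OF isomorphic_modules_sym[OF C1'(2) lm(2)] lm'(2)]] by auto
  ultimately show ?thesis unfolding cores_def by blast
qed

lemma cores_isomorphic:
  assumes "cores E" "isomorphic_modules A E E'" "left_module A E'"
  shows "cores E'"
proof -
  obtain C0 C1 :: "'a std_module" and f g where C: "in_add A Z C0" "in_add A Z C1" "fg_ses A C0 f C1 g E"
    using assms(1) by (auto simp: cores_def)
  obtain f' g' where "fg_ses A C0 f' C1 g' E'"
    using ses_isomorphic[OF C(3) isomorphic_modules_refl isomorphic_modules_refl assms(2) ses_lm(1,2)[OF C(3)] assms(3)] .
  from coresI[OF this C(1,2)] show ?thesis .
qed

lemma cores_prod:
  assumes "cores E" "cores E'"
  shows "cores (prod_module E E')"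
proof -
  obtain C0 C1 :: "'a std_module" and f g where C: "in_add A Z C0" "in_add A Z C1" "fg_ses A C0 f C1 g E"
    using assms(1) by (auto simp: cores_def)
  obtain D0 D1 :: "'a std_module" and f' g' where D: "in_add A Z D0" "in_add A Z D1" "fg_ses A D0 f' D1 g' E'"
    using assms(2) by (auto simp: cores_def)
  show ?thesis
    by (rule coresI[OF ses_prod[OF C(3) D(3)] in_add_prod[OF C(1) D(1) Z_lm] in_add_prod[OF C(2) D(2) Z_lm]])
qed

lemma cores_proj_inj:
  assumes "projective A E" "injective A E"
  shows "cores E"
proof (rule coresI[OF zero_ses[OF projective_fg[OF assms(1)]]])
  note E = fg_left_module[OF projective_fg[OF assms(1)]]
  show "in_add A Z (E\<lparr>carrier := {\<zero>\<^bsub>E\<^esub>}\<rparr>)"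
    by (rule in_add_zero[OF zero_restrict[OF E] _ Z_lm]) simp
  show "in_add A Z E" by (rule in_add_Z_proj_inj[OF assms])
qed

lemma cores_direct_sum:
  assumes "\<And>N. N \<in> set Ns \<Longrightarrow> left_module A N" "\<And>N. N \<in> set Ns \<Longrightarrow> cores N"
  shows "cores (direct_sum Ns)"
  using assms
proof (induction Ns)
  case Nil
  show ?case
    by (rule cores_proj_inj[OF projective_direct_sum[OF ring] injective_direct_sum[OF ring]]) simp_all
next
  case (Cons N Ns)
  have lD: "left_module A (direct_sum (N # Ns))"
    by (rule direct_sum_left_module[OF ring Cons.prems(1)])
  have iso: "isomorphic_modules A (direct_sum (N # Ns)) (prod_module N (direct_sum Ns))"
    by (rule direct_sum_Cons[OF ring Cons.prems(1)])
  have "cores (prod_module N (direct_sum Ns))"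
    using Cons.prems by (intro cores_prod Cons.IH) simp_all
  then show ?case by (rule cores_isomorphic[OF _ isomorphic_modules_sym[OF iso lD] lD])
qed

text \<open>
  \<open>P \<mapsto> \<Phi> P\<close> (the last term of the coresolution, or \<open>P\<close> itself if \<open>P\<close> is injective) is injective
  from indecomposable projectives to indecomposable injectives up to isomorphism, and so is
  \<open>E \<mapsto> \<psi> E\<close> (the projective cover of the socle) in the opposite direction. As there are finitely
  many indecomposable projectives, every indecomposable injective is some \<open>\<Phi> P\<close>.
\<close>

lemma indecomposable_injective_cores:
  fixes E :: "'a std_module"
  assumes E: "indecomposable A E" "injective A E"
  shows "cores E"
proof -
  note fgR = regular_fg[OF ring] and lR = regular_left_module[OF ring]
  obtain Ns :: "'a std_module list" where Ns: "\<And>N. N \<in> set Ns \<Longrightarrow> indecomposable A N"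
    "isomorphic_modules A (regular_module A) (direct_sum Ns)"
    by (rule decomposition[OF fgR]) blast
  have lN: "left_module A N" if "N \<in> set Ns" for N
    using Ns(1)[OF that] by (simp add: indecomposable_def fg_left_module)
  have lD: "left_module A (direct_sum Ns)" by (rule direct_sum_left_module[OF ring lN])
  obtain Ps where Ps: "set Ps \<subseteq> set Ns"
    "\<forall>i<length Ps. \<forall>j<length Ps. i \<noteq> j \<longrightarrow> \<not> isomorphic_modules A (Ps ! i) (Ps ! j)"
    "\<forall>N\<in>set Ns. \<exists>P\<in>set Ps. isomorphic_modules A N P"
    using nonisomorphic_sublist[of Ns A] lN by blast
  \<comment> \<open>Isomorphic members of \<open>Ps\<close> are equal, so that counting classes
    becomes counting elements of a finite set.\<close>
  have iso_eq: "P = P'" if "P \<in> set Ps" "P' \<in> set Ps" "isomorphic_modules A P P'" for P P'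
    using that Ps(2) unfolding in_set_conv_nth by metis
  have ind: "indecomposable A P" and proj: "projective A P" and lP: "left_module A P" if P: "P \<in> set Ps" for P
  proof -
    have N: "P \<in> set Ns" using Ps(1) P by blast
    show "indecomposable A P" by (rule Ns(1)[OF N])
    show "left_module A P" by (rule lN[OF N])
    have "retract A P (regular_module A)"
      by (rule retract_trans[OF retract_direct_sum[OF ring lN N] isomorphic_retract[OF isomorphic_modules_sym[OF Ns(2) lR] lD]])
    then show "projective A P" by (rule projective_retract[OF _ projective_regular[OF ring] lN[OF N]])
  qed
  \<comment> \<open>The choice of \<open>\<Phi>\<close> would forget how its values were found;
    injectivity of \<open>\<Phi>\<close> needs their origin, so it is made part of the chosen
    property.\<close>
  let ?rel = "\<lambda>P F. injective A P \<and> F = P \<or> \<not> injective A P \<and> (\<exists>r. is_dres A r \<and> rP r = P \<and> rE r = F)"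
  have "\<forall>P\<in>set Ps. \<exists>F. indecomposable A F \<and> injective A F \<and> cores F \<and> ?rel P F"
  proof
    fix P assume P: "P \<in> set Ps"
    show "\<exists>F. indecomposable A F \<and> injective A F \<and> cores F \<and> ?rel P F"
    proof (cases "injective A P")
      case True
      with ind[OF P] cores_proj_inj[OF proj[OF P] True] show ?thesis by blast
    next
      case False
      obtain r where r: "is_dres A r" "rP r = P" "injective A (rE r)" "in_add A Z (rK r)"
        using projective_dres[OF proj[OF P]] .
      have "indecomposable A (rE r)" by (rule dres_end_indecomposable[OF r(1)]) (use r(2) ind[OF P] False in auto)
      moreover have "cores (rE r)"
        by (rule coresI[OF dres_ses(2)[OF r(1)] r(4) in_add_Z_proj_inj[OF dres_proj(2)[OF r(1)] dres_inj(2)[OF r(1)]]])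
      ultimately show ?thesis using False r(1-3) by blast
    qed
  qed
  from bchoice[OF this] obtain \<Phi> where \<Phi>: "\<And>P. P \<in> set Ps \<Longrightarrow> indecomposable A (\<Phi> P)"
    "\<And>P. P \<in> set Ps \<Longrightarrow> injective A (\<Phi> P)" "\<And>P. P \<in> set Ps \<Longrightarrow> cores (\<Phi> P)" "\<And>P. P \<in> set Ps \<Longrightarrow> ?rel P (\<Phi> P)"
    by blast
  \<comment> \<open>An injective \<open>P\<close> is kept as \<open>\<Phi> P = P\<close>, which is
    projective, whereas the last term belonging to a noninjective module never is.\<close>
  have mixed: False if P: "P \<in> set Ps" "P' \<in> set Ps" "injective A P" "\<not> injective A P'"
      and iso: "isomorphic_modules A (\<Phi> P) (\<Phi> P')" for P P'
  proof -
    obtain r where r: "is_dres A r" "rP r = P'" "rE r = \<Phi> P'" using \<Phi>(4)[OF P(2)] P(4) by blast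
    have "\<Phi> P = P" using \<Phi>(4)[OF P(1)] P(3) by blast
    then have "projective A (rE r)"
      using projective_isomorphic[OF iso _ ] proj[OF P(1)] dres_lm(5)[OF r(1)] r(3) by simp
    then show False using dres_end_not_projective[OF r(1)] P(4) r(2) by simp
  qed
  have \<Phi>_inj: "P = P'" if P: "P \<in> set Ps" "P' \<in> set Ps" and iso: "isomorphic_modules A (\<Phi> P) (\<Phi> P')" for P P'
  proof -
    have l: "left_module A (\<Phi> P)" using \<Phi>(1)[OF P(1)] by (simp add: indecomposable_def fg_left_module)
    consider "injective A P" "injective A P'" | "\<not> injective A P" "\<not> injective A P'"
      using mixed[OF P _ _ iso] mixed[OF P(2,1) _ _ isomorphic_modules_sym[OF iso l]] by blast
    then show ?thesis
    proof cases
      case 1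
      then show ?thesis using iso_eq[OF P] iso \<Phi>(4)[OF P(1)] \<Phi>(4)[OF P(2)] by auto
    next
      case 2
      obtain r r' where "is_dres A r" "rP r = P" "rE r = \<Phi> P" "is_dres A r'" "rP r' = P'" "rE r' = \<Phi> P'"
        using 2 \<Phi>(4)[OF P(1)] \<Phi>(4)[OF P(2)] by blast
      then have "isomorphic_modules A P P'"
        using dres_end_isomorphic[of r r'] ind[OF P(1)] ind[OF P(2)] 2(1) iso by simp
      then show ?thesis by (rule iso_eq[OF P])
    qed
  qed
  have ex_top: "\<exists>P. P \<in> set Ps \<and> (\<exists>\<theta>. simple_image A P F \<theta>)"
    if F: "indecomposable A F" for F :: "'a std_module"
  proof -
    have "fg_module A F" "carrier F \<noteq> {\<zero>\<^bsub>F\<^esub>}" using F by (simp_all add: indecomposable_def)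
    from simple_image_exists[OF this Ns(2) lN]
    obtain N \<theta> where N: "N \<in> set Ns" "simple_image A N F \<theta>" by blast
    obtain P where P: "P \<in> set Ps" "isomorphic_modules A N P" using Ps(3) N(1) by blast
    obtain f g where fg: "f \<in> module_hom A N P" "g \<in> module_hom A P N"
      "\<And>x. x \<in> carrier N \<Longrightarrow> g (f x) = x"
      by (rule isomorphic_modulesE[OF P(2) lN[OF N(1)]]) blast
    have "carrier N = g ` carrier P"
    proof
      show "carrier N \<subseteq> g ` carrier P"
      proof
        fix x assume x: "x \<in> carrier N"
        show "x \<in> g ` carrier P"
          by (rule image_eqI[where x = "f x"]) (simp_all add: fg(3)[OF x] hom_closed[OF fg(1) x])
      qed
      show "g ` carrier P \<subseteq> carrier N" using hom_closed[OF fg(2)] by blast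
    qed
    then have "(\<lambda>x. \<theta> (g x)) ` carrier P = \<theta> ` carrier N" by (simp add: image_image)
    then have "simple_image A P F (\<lambda>x. \<theta> (g x))"
      using N(2) hom_comp[OF fg(2), of \<theta> F] by (simp add: simple_image_def)
    with P(1) show ?thesis by blast
  qed
  define \<psi> where "\<psi> = (\<lambda>F :: 'a std_module. SOME P. P \<in> set Ps \<and> (\<exists>\<theta>. simple_image A P F \<theta>))"
  have \<psi>: "\<psi> F \<in> set Ps \<and> (\<exists>\<theta>. simple_image A (\<psi> F) F \<theta>)" if "indecomposable A F" for F :: "'a std_module"
    unfolding \<psi>_def by (rule someI_ex[OF ex_top[OF that]])
  have \<psi>_inj: "isomorphic_modules A F F'" if F: "indecomposable A F" "injective A F" "indecomposable A F'" "injective A F'"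
      and eq: "\<psi> F = \<psi> F'" for F F' :: "'a std_module"
  proof -
    obtain \<theta> \<theta>' where "simple_image A (\<psi> F) F \<theta>" "simple_image A (\<psi> F) F' \<theta>'"
      using \<psi>[OF F(1)] \<psi>[OF F(3)] eq by auto
    moreover have "\<psi> F \<in> set Ps" using \<psi>[OF F(1)] by blast
    ultimately show ?thesis using simple_image_isomorphic[OF ind proj F] by blast
  qed
  \<comment> \<open>The composite of \<open>\<Phi>\<close> and \<open>\<psi>\<close> is an injective
    selfmap of a finite set, hence onto. So \<open>\<psi> E = \<psi> (\<Phi> P)\<close> for some
    \<open>P\<close>, and \<open>\<psi>\<close> determines an indecomposable injective up to
    isomorphism.\<close>
  have "inj_on (\<lambda>P. \<psi> (\<Phi> P)) (set Ps)"
    by (rule inj_onI) (use \<psi>_inj \<Phi>(1,2) \<Phi>_inj in blast)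
  moreover have "(\<lambda>P. \<psi> (\<Phi> P)) ` set Ps \<subseteq> set Ps" using \<psi> \<Phi>(1) by blast
  ultimately have "(\<lambda>P. \<psi> (\<Phi> P)) ` set Ps = set Ps" by (intro endo_inj_surj) simp_all
  then obtain P where P: "P \<in> set Ps" "\<psi> E = \<psi> (\<Phi> P)" using \<psi>[OF E(1)] by blast
  have "isomorphic_modules A (\<Phi> P) E" by (rule \<psi>_inj[OF \<Phi>(1,2)[OF P(1)] E P(2)[symmetric]])
  moreover have "left_module A E" using E(1) by (simp add: indecomposable_def fg_left_module)
  ultimately show ?thesis using cores_isomorphic[OF \<Phi>(3)[OF P(1)]] by blast
qed

lemma injective_cores:
  assumes "injective A E"
  shows "cores E"
proof -
  note fgE = injective_fg[OF assms]
  note lE = fg_left_module[OF fgE]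
  obtain Ns :: "'a std_module list" where Ns: "\<And>N. N \<in> set Ns \<Longrightarrow> indecomposable A N"
    "isomorphic_modules A E (direct_sum Ns)"
    by (rule decomposition[OF fgE]) blast
  have lN: "left_module A N" if "N \<in> set Ns" for N
    using Ns(1)[OF that] by (simp add: indecomposable_def fg_left_module)
  have lD: "left_module A (direct_sum Ns)" by (rule direct_sum_left_module[OF ring lN])
  have iso: "isomorphic_modules A (direct_sum Ns) E" by (rule isomorphic_modules_sym[OF Ns(2) lE])
  have "cores N" if N: "N \<in> set Ns" for N
  proof (rule indecomposable_injective_cores[OF Ns(1)[OF N]])
    show "injective A N"
      by (rule injective_retract[OF retract_trans[OF retract_direct_sum[OF ring lN N] isomorphic_retract[OF iso lD]] assms lN[OF N]])
  qed
  from cores_isomorphic[OF cores_direct_sum[OF lN this] iso lE] show ?thesis by blast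
qed

section \<open>Tilting and cotilting properties of \<open>Q \<oplus> X0\<close> and its basic
  version\<close>

lemma Z_Gen: "Z \<in> Gen A Q" and Z_Cogen: "Z \<in> Cogen A Q" and Z_injdim: "injdim_le_1 A Z"
  by (rule Gen_prod[OF Gen_self[OF Q_fg] X0_Gen Q_lm] Cogen_prod[OF Cogen_self[OF Q_fg] X0(1) Q_lm]
      injdim_le_1_prod[OF injdim_le_1_injective[OF Q_inj] X0(2)])+

text \<open>\<open>ses0\<close> is a projective presentation of \<open>X0\<close>, so the claim is
  that maps from \<Lambda> to \<open>N\<close> extend to \<open>I0\<close>. As \<open>N\<close> is a
  quotient of a power of \<open>Q\<close>, such a map lifts to that power and extends there by
  injectivity. Modules in \<open>add Z\<close> lie in \<open>Gen A Q\<close> themselves, so this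
  gives both rigidity and projective dimension at most one.\<close>

lemma ext_pres_Z:
  assumes "N \<in> Gen A Q"
  shows "ext_pres A N Z"
proof -
  obtain n w where w: "w \<in> module_epi A (module_power Q n) N" and fgN: "fg_module A N"
    using assms by (auto simp: Gen_iff)
  note lN = fg_left_module[OF fgN] and fgR = regular_fg[OF ring]
  have "ext_pres A N X0"
  proof (rule ext_presI[OF ses0 projective_regular[OF ring] I0(1)])
    fix f assume f: "f \<in> module_hom A (regular_module A) N"
    obtain u where u: "u \<in> module_hom A (regular_module A) (module_power Q n)"
      "\<And>x. x \<in> carrier (regular_module A) \<Longrightarrow> w (u x) = f x"
      by (rule projective_lift[OF projective_regular[OF ring] fg_module_power[OF Q_fg] fgN w f]) blast
    obtain v where v: "v \<in> module_hom A I0 (module_power Q n)"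
      "\<And>x. x \<in> carrier (regular_module A) \<Longrightarrow> v (j0 x) = u x"
      by (rule injective_extend[OF injective_module_power[OF Q_inj] fgR injective_fg[OF I0(2)] ses_mono[OF ses0] u(1)]) blast
    show "\<exists>h\<in>module_hom A I0 N. \<forall>x\<in>carrier (regular_module A). h (j0 x) = f x"
      by (intro bexI[OF _ hom_comp[OF v(1) epi_hom[OF w]]] ballI) (simp add: u(2) v(2) del: regular_module_simps)
  qed
  from ext_pres_prod[OF ext_pres_projective[OF Q_proj lN] this lN] show ?thesis .
qed

text \<open>The last claim is stated for every injective \<open>E\<close> over any element type, so
  that it applies to D \<Lambda>, whose elements are functions into the dualizing module.\<close>

lemma tilting_cotilting_module:
  fixes T :: "'a std_module"
  assumes T: "basic_module A T" "in_add A Z T" "in_add A T Z"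
  shows "T \<in> Gen A Q" "T \<in> Cogen A Q" "tilting A T" "injdim A T \<le> 1" "Ext_vanishes A 1 T T"
    and "injective A E \<Longrightarrow> \<exists>(C0 :: 'a std_module) (C1 :: 'a std_module) f g.
      C0 \<in> add_closure A T \<and> C1 \<in> add_closure A T \<and> short_exact A C0 f C1 g E"
proof -
  have fgT: "fg_module A T" using T(1) by (simp add: basic_module_def)
  note lT = fg_left_module[OF fgT]
  show Gen: "T \<in> Gen A Q" by (rule Gen_in_add[OF Z_Gen T(2) Q_lm lT])
  show "T \<in> Cogen A Q" by (rule Cogen_in_add[OF Z_Cogen T(2) Q_lm lT])
  show "injdim A T \<le> 1" by (rule injdim_le_1_injdim[OF injdim_le_1_in_add[OF Z_injdim T(2) Z_lm lT]])
  have ext: "ext_pres A T T" by (rule ext_pres_in_add[OF ext_pres_Z[OF Gen] T(2) lT Z_fg lT])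
  show Ext: "Ext_vanishes A 1 T T" by (rule ext_pres_Ext_vanishes[OF ext lT])
  have add: "M \<in> add_closure A T" if "fg_module A M" "in_add A Z M" for M
    using that in_add_trans[OF T(3) that(2) lT Z_lm] by (simp add: add_closure_iff[OF lT])
  have "I0 \<in> add_closure A T" "X0 \<in> add_closure A T"
    using add[OF projective_fg[OF I0(1)] in_add_Z_proj_inj[OF I0]] add[OF X0_fg in_add_Z(2)] by auto
  moreover have "short_exact A (regular_module A) j0 I0 p0 X0" using ses0 by (simp add: fg_ses_def)
  ultimately show "tilting A T"
    unfolding tilting_def using fgT T(1) ext_pres_projdim[OF ext] Ext by blast
  assume "injective A E"
  from injective_cores[OF this] obtain C0 C1 :: "'a std_module" and f g
    where "in_add A Z C0" "in_add A Z C1" "fg_ses A C0 f C1 g E" by (auto simp: cores_def)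
  then show "\<exists>(C0 :: 'a std_module) (C1 :: 'a std_module) f g.
      C0 \<in> add_closure A T \<and> C1 \<in> add_closure A T \<and> short_exact A C0 f C1 g E"
    using add unfolding fg_ses_def by blast
qed

text \<open>A tilting module has to be basic, so \<open>Z\<close> is replaced by the sum of one copy
  of each of its indecomposable summands; mutual membership in \<open>add\<close> transfers the
  properties of \<open>Z\<close> to \<open>T\<close>.\<close>

lemma basic_representative:
  fixes Qs :: "'a std_module list"
  assumes "isomorphic_modules A Q (direct_sum Qs)" "\<And>M. M \<in> set Qs \<Longrightarrow> indecomposable A M"
  obtains T :: "'a std_module" where "basic_module A T" "in_add A Z T" "in_add A T Z"
proof -
  obtain Ns :: "'a std_module list" where Ns: "\<And>N. N \<in> set Ns \<Longrightarrow> indecomposable A N"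
    "isomorphic_modules A X0 (direct_sum Ns)"
    by (rule decomposition[OF X0_fg]) blast
  have ind: "indecomposable A M" if "M \<in> set (Qs @ Ns)" for M
    using that assms(2) Ns(1) by auto
  have fgM: "fg_module A M" and lM: "left_module A M" if "M \<in> set (Qs @ Ns)" for M
    using ind[OF that] by (simp_all add: indecomposable_def fg_left_module)
  obtain Ms where Ms: "set Ms \<subseteq> set (Qs @ Ns)"
    "\<forall>i<length Ms. \<forall>j<length Ms. i \<noteq> j \<longrightarrow> \<not> isomorphic_modules A (Ms ! i) (Ms ! j)"
    "\<forall>M\<in>set (Qs @ Ns). \<exists>N\<in>set Ms. isomorphic_modules A M N"
    using nonisomorphic_sublist[of "Qs @ Ns" A] lM by blast
  have fgMs: "fg_module A (direct_sum Ms)" using Ms(1) fgM by (intro fg_direct_sum[OF ring]) blast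
  note lMs = fg_left_module[OF fgMs]
  obtain T :: "'a std_module" where T: "fg_module A T" "isomorphic_modules A (direct_sum Ms) T"
    using std_representative[OF fgMs] .
  note lT = fg_left_module[OF T(1)]
  have iso: "isomorphic_modules A T (direct_sum Ms)" by (rule isomorphic_modules_sym[OF T(2) lMs])
  have "basic_module A T"
    unfolding basic_module_def using T(1) Ms ind iso by blast
  moreover have "in_add A Z T"
  proof (rule in_add_retract[OF in_add_direct_sum[OF Z_lm] isomorphic_retract[OF iso lT]])
    fix M assume M: "M \<in> set Ms"
    then show "left_module A M" using Ms(1) lM by blast
    have lQs: "left_module A (direct_sum Qs)" and lNs: "left_module A (direct_sum Ns)"
      using lM by (auto intro!: direct_sum_left_module[OF ring])
    consider "M \<in> set Qs" | "M \<in> set Ns" using M Ms(1) by auto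
    then show "in_add A Z M"
    proof cases
      case 1
      have "retract A M (direct_sum Qs)" by (rule retract_direct_sum[OF ring _ 1]) (use lM in auto)
      from retract_trans[OF this isomorphic_retract[OF isomorphic_modules_sym[OF assms(1) Q_lm] lQs]]
      show ?thesis by (rule in_add_retract[OF in_add_Z(1)])
    next
      case 2
      have "retract A M (direct_sum Ns)" by (rule retract_direct_sum[OF ring _ 2]) (use lM in auto)
      from retract_trans[OF this isomorphic_retract[OF isomorphic_modules_sym[OF Ns(2) X0_lm] lNs]]
      show ?thesis by (rule in_add_retract[OF in_add_Z(2)])
    qed
  qed
  moreover have "in_add A T Z"
  proof (rule in_add_prod[OF _ _ lT])
    have *: "in_add A T M" if M: "M \<in> set (Qs @ Ns)" for M
    proof -
      obtain N where N: "N \<in> set Ms" "isomorphic_modules A M N" using Ms(3) M by blast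
      have "retract A N (direct_sum Ms)" by (rule retract_direct_sum[OF ring _ N(1)]) (use lM Ms(1) in blast)
      from retract_trans[OF isomorphic_retract[OF N(2) lM[OF M]] retract_trans[OF this isomorphic_retract[OF T(2) lMs]]]
      show ?thesis by (rule in_add_retract[OF in_add_self[OF lT]])
    qed
    show "in_add A T Q"
      by (rule in_add_retract[OF in_add_direct_sum[OF lT] isomorphic_retract[OF assms(1) Q_lm]]) (use * lM in auto)
    show "in_add A T X0"
      by (rule in_add_retract[OF in_add_direct_sum[OF lT] isomorphic_retract[OF Ns(2) X0_lm]]) (use * lM in auto)
  qed
  ultimately show thesis by (rule that)
qed

end

section \<open>The dual of the regular module\<close>

text \<open>An element \<open>r\<close> of the base ring acts through \<open>r \<cdot> 1\<close>,
  which is central in an artin algebra. This lets injectivity of the dualizing module over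
  \<open>R\<close> be applied to modules over the algebra.\<close>

definition restrict_scalars ::
    "('r, 'a) module \<Rightarrow> ('a, 'm) module \<Rightarrow> ('r, 'm) module" where
  "restrict_scalars L M = \<lparr>carrier = carrier M, monoid.mult = undefined, one = undefined,
     ring.zero = \<zero>\<^bsub>M\<^esub>, add = (\<lambda>x y. x \<oplus>\<^bsub>M\<^esub> y), smult = (\<lambda>r x. (r \<odot>\<^bsub>L\<^esub> \<one>\<^bsub>L\<^esub>) \<odot>\<^bsub>M\<^esub> x)\<rparr>"

lemma restrict_scalars_simps [simp]:
  "carrier (restrict_scalars L M) = carrier M" "\<zero>\<^bsub>restrict_scalars L M\<^esub> = \<zero>\<^bsub>M\<^esub>"
  "x \<oplus>\<^bsub>restrict_scalars L M\<^esub> y = x \<oplus>\<^bsub>M\<^esub> y" "r \<odot>\<^bsub>restrict_scalars L M\<^esub> x = (r \<odot>\<^bsub>L\<^esub> \<one>\<^bsub>L\<^esub>) \<odot>\<^bsub>M\<^esub> x"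
  by (simp_all add: restrict_scalars_def)

section \<open>Artin algebras over their base ring\<close>

locale artin_alg =
  fixes R :: "('r, 'x) ring_scheme" and L :: "('r, 'a) module"
  assumes artin: "artin_algebra R L"
begin

lemma R_artin: "artinian_cring R" and L_ring: "ring L" and L_fg: "fg_module R L"
  and mult_assoc: "\<And>r x y. r \<in> carrier R \<Longrightarrow> x \<in> carrier L \<Longrightarrow> y \<in> carrier L \<Longrightarrow> (r \<odot>\<^bsub>L\<^esub> x) \<otimes>\<^bsub>L\<^esub> y = r \<odot>\<^bsub>L\<^esub> (x \<otimes>\<^bsub>L\<^esub> y)"
  and mult_assoc2: "\<And>r x y. r \<in> carrier R \<Longrightarrow> x \<in> carrier L \<Longrightarrow> y \<in> carrier L \<Longrightarrow> x \<otimes>\<^bsub>L\<^esub> (r \<odot>\<^bsub>L\<^esub> y) = r \<odot>\<^bsub>L\<^esub> (x \<otimes>\<^bsub>L\<^esub> y)"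
  using artin by (simp_all add: artin_algebra_def)

lemma R_cring: "cring R"
  using R_artin by (simp add: artinian_cring_def)

lemma L_lm: "left_module R L"
  by (rule fg_left_module[OF L_fg])

sublocale L: ring L by (rule L_ring)
sublocale R: cring R by (rule R_cring)
sublocale RL: left_module R L by (rule L_lm)

lemma scalar_closed: "r \<in> carrier R \<Longrightarrow> r \<odot>\<^bsub>L\<^esub> \<one>\<^bsub>L\<^esub> \<in> carrier L"
  by (rule RL.smult_closed) simp_all

lemma scalar_left: "r \<in> carrier R \<Longrightarrow> x \<in> carrier L \<Longrightarrow> (r \<odot>\<^bsub>L\<^esub> \<one>\<^bsub>L\<^esub>) \<otimes>\<^bsub>L\<^esub> x = r \<odot>\<^bsub>L\<^esub> x"
  by (simp add: mult_assoc)

lemma scalar_right: "r \<in> carrier R \<Longrightarrow> x \<in> carrier L \<Longrightarrow> x \<otimes>\<^bsub>L\<^esub> (r \<odot>\<^bsub>L\<^esub> \<one>\<^bsub>L\<^esub>) = r \<odot>\<^bsub>L\<^esub> x"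
  by (simp add: mult_assoc2)

lemma R_finite_length_ring: "finite_length_ring R"
  by (rule finite_length_ring.intro[OF R.ring_axioms artinian_finite_length[OF R_artin]])

text \<open>Left ideals of the algebra are submodules over \<open>R\<close>, so a rank function over
  \<open>R\<close> serves for them.\<close>

lemma L_finite_length_ring: "finite_length_ring L"
proof (rule finite_length_ring.intro[OF L_ring])
  interpret FR: finite_length_ring R by (rule R_finite_length_ring)
  have sub: "submodule X R L" if X: "submodule X L (regular_module L)" for X
  proof (rule RL.submoduleI)
    show "X \<subseteq> carrier L" using submodule_subset[OF X] by simp
    show "\<zero>\<^bsub>L\<^esub> \<in> X" using submodule_zero[OF X] by simp
    show "x \<oplus>\<^bsub>L\<^esub> y \<in> X" if "x \<in> X" "y \<in> X" for x y using submodule_add[OF X that] by simp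
    show "r \<odot>\<^bsub>L\<^esub> x \<in> X" if "r \<in> carrier R" "x \<in> X" for r x
      using submodule_smult[OF X scalar_closed[OF that(1)] that(2)] submodule_mem[OF X that(2)]
      by (simp add: scalar_left[OF that(1)])
  qed
  obtain rk :: "'a set \<Rightarrow> nat" where rk: "\<And>X Y. submodule X R L \<Longrightarrow> submodule Y R L \<Longrightarrow> X \<subset> Y \<Longrightarrow> rk X < rk Y"
    by (rule FR.rankE[OF L_fg]) blast
  show "finite_length_on L (regular_module L) (carrier L)"
    by (rule finite_length_onI[where rk = rk]) (simp add: rk sub)
qed

lemma restrict_scalars_left_module:
  assumes "left_module L M"
  shows "left_module R (restrict_scalars L M)"
proof -
  interpret M: left_module L M by fact
  show ?thesis
  proof (rule left_moduleI)
    show "ring R" by (rule R.ring_axioms)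
    show "\<exists>y\<in>carrier (restrict_scalars L M). y \<oplus>\<^bsub>restrict_scalars L M\<^esub> x = \<zero>\<^bsub>restrict_scalars L M\<^esub>"
      if "x \<in> carrier (restrict_scalars L M)" for x
      using that M.M.l_neg M.M.a_inv_closed by auto
    show "(a \<otimes>\<^bsub>R\<^esub> b) \<odot>\<^bsub>restrict_scalars L M\<^esub> x = a \<odot>\<^bsub>restrict_scalars L M\<^esub> (b \<odot>\<^bsub>restrict_scalars L M\<^esub> x)"
      if "a \<in> carrier R" "b \<in> carrier R" "x \<in> carrier (restrict_scalars L M)" for a b x
      using that by (simp add: scalar_closed scalar_left RL.smult_assoc flip: M.smult_assoc)
    show "(a \<oplus>\<^bsub>R\<^esub> b) \<odot>\<^bsub>restrict_scalars L M\<^esub> x =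
        a \<odot>\<^bsub>restrict_scalars L M\<^esub> x \<oplus>\<^bsub>restrict_scalars L M\<^esub> b \<odot>\<^bsub>restrict_scalars L M\<^esub> x"
      if "a \<in> carrier R" "b \<in> carrier R" "x \<in> carrier (restrict_scalars L M)" for a b x
      using that by (simp add: scalar_closed RL.smult_l_distr M.smult_l_distr)
  qed (auto simp: scalar_closed M.smult_closed M.smult_r_distr M.smult_one RL.smult_one M.M.a_ac)
qed

lemma restrict_scalars_hom: "f \<in> module_hom L M N \<Longrightarrow> f \<in> module_hom R (restrict_scalars L M) (restrict_scalars L N)"
  by (auto simp: module_hom_def scalar_closed)

lemma restrict_scalars_mono:
  "f \<in> module_mono L M N \<Longrightarrow> f \<in> module_mono R (restrict_scalars L M) (restrict_scalars L N)"
  by (auto simp: module_mono_def restrict_scalars_hom)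

text \<open>Products \<open>t s\<close> of generators generate over \<open>R\<close>: for
  \<open>s\<close> in \<open>S\<close>, the \<open>l\<close> with \<open>l s\<close> in
  \<open>H\<close> form an \<open>R\<close>-submodule containing \<open>T\<close>, and the
  \<open>x\<close> with all \<open>l x\<close> in \<open>H\<close> form a submodule over the algebra
  containing \<open>S\<close>.\<close>

lemma restrict_scalars_fg:
  assumes "fg_module L M"
  shows "fg_module R (restrict_scalars L M)"
proof -
  note M = fg_left_module[OF assms]
  interpret M: left_module L M by (rule M)
  obtain S where S: "finite S" "S \<subseteq> carrier M" "\<And>H. submodule H L M \<Longrightarrow> S \<subseteq> H \<Longrightarrow> H = carrier M"
    by (rule fg_moduleE[OF assms]) blast
  obtain T where T: "finite T" "T \<subseteq> carrier L" "\<And>H. submodule H R L \<Longrightarrow> T \<subseteq> H \<Longrightarrow> H = carrier L"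
    by (rule fg_moduleE[OF L_fg]) blast
  let ?G = "(\<lambda>(t, s). t \<odot>\<^bsub>M\<^esub> s) ` (T \<times> S)"
  show ?thesis
  proof (rule fg_moduleI[OF restrict_scalars_left_module[OF M]])
    show "finite ?G" using S(1) T(1) by simp
    show "?G \<subseteq> carrier (restrict_scalars L M)" using S(2) T(2) by (auto intro!: M.smult_closed)
    fix H x assume H: "submodule H R (restrict_scalars L M)" "?G \<subseteq> H" and x: "x \<in> carrier (restrict_scalars L M)"
    note Hz = submodule_zero[OF H(1), simplified] and Hadd = submodule_add[OF H(1), simplified]
      and Hsm = submodule_smult[OF H(1), simplified]
    have LS: "l \<odot>\<^bsub>M\<^esub> s \<in> H" if s: "s \<in> S" and l: "l \<in> carrier L" for s l
    proof -
      have sM: "s \<in> carrier M" using s S(2) by blast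
      have "{l \<in> carrier L. l \<odot>\<^bsub>M\<^esub> s \<in> H} = carrier L"
      proof (rule T(3))
        show "submodule {l \<in> carrier L. l \<odot>\<^bsub>M\<^esub> s \<in> H} R L"
        proof (rule RL.submoduleI)
          show "r \<odot>\<^bsub>L\<^esub> l \<in> {l \<in> carrier L. l \<odot>\<^bsub>M\<^esub> s \<in> H}"
            if r: "r \<in> carrier R" and l: "l \<in> {l \<in> carrier L. l \<odot>\<^bsub>M\<^esub> s \<in> H}" for r l
          proof -
            have "(r \<odot>\<^bsub>L\<^esub> \<one>\<^bsub>L\<^esub>) \<odot>\<^bsub>M\<^esub> (l \<odot>\<^bsub>M\<^esub> s) = (r \<odot>\<^bsub>L\<^esub> l) \<odot>\<^bsub>M\<^esub> s"
              using r l sM scalar_closed[OF r] by (simp add: scalar_left flip: M.smult_assoc)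
            then show ?thesis using r l Hsm[of r "l \<odot>\<^bsub>M\<^esub> s"] RL.smult_closed by simp
          qed
        qed (use sM Hz Hadd in \<open>auto simp: M.smult_l_null M.smult_l_distr\<close>)
        show "T \<subseteq> {l \<in> carrier L. l \<odot>\<^bsub>M\<^esub> s \<in> H}" using T(2) H(2) s by auto
      qed
      with l show ?thesis by blast
    qed
    have "{x \<in> carrier M. \<forall>l\<in>carrier L. l \<odot>\<^bsub>M\<^esub> x \<in> H} = carrier M"
    proof (rule S(3))
      show "submodule {x \<in> carrier M. \<forall>l\<in>carrier L. l \<odot>\<^bsub>M\<^esub> x \<in> H} L M"
        by (rule M.submoduleI)
          (auto simp: M.smult_r_null M.smult_r_distr Hz Hadd M.smult_closed simp flip: M.smult_assoc)
      show "S \<subseteq> {x \<in> carrier M. \<forall>l\<in>carrier L. l \<odot>\<^bsub>M\<^esub> x \<in> H}" using S(2) LS by auto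
    qed
    then have "\<one>\<^bsub>L\<^esub> \<odot>\<^bsub>M\<^esub> x \<in> H" using x by auto
    then show "x \<in> H" using x by (simp add: M.smult_one)
  qed
qed

section \<open>The left module D \<Lambda>\<close>

context
  fixes J :: "('r, 'j) module"
  assumes J_fg: "fg_module R J"
begin

lemma J_lm: "left_module R J"
  by (rule fg_left_module[OF J_fg])

abbreviation D where "D \<equiv> dual_regular R J L"

lemma dual_simps:
  "f \<in> carrier D \<longleftrightarrow> f \<in> module_hom R L J \<and> f \<in> extensional (carrier L)"
  "\<zero>\<^bsub>D\<^esub> = (\<lambda>x\<in>carrier L. \<zero>\<^bsub>J\<^esub>)" "f \<oplus>\<^bsub>D\<^esub> g = (\<lambda>x\<in>carrier L. f x \<oplus>\<^bsub>J\<^esub> g x)"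
  "a \<odot>\<^bsub>D\<^esub> f = (\<lambda>x\<in>carrier L. f (x \<otimes>\<^bsub>L\<^esub> a))"
  by (simp_all add: dual_regular_def)

lemma dual_mem: "f \<in> module_hom R L J \<Longrightarrow> (\<lambda>x\<in>carrier L. f x) \<in> carrier D"
  using hom_cong[of f R L J "\<lambda>x\<in>carrier L. f x"] L_lm by (simp add: dual_simps)

lemma dual_eqI: "f \<in> carrier D \<Longrightarrow> g \<in> carrier D \<Longrightarrow> (\<And>x. x \<in> carrier L \<Longrightarrow> f x = g x) \<Longrightarrow> f = g"
  by (rule extensionalityI[of f "carrier L"]) (simp_all add: dual_simps)

lemma hom_mult_right:
  assumes "a \<in> carrier L"
  shows "(\<lambda>x. x \<otimes>\<^bsub>L\<^esub> a) \<in> module_hom R L L"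
  using assms by (intro module_homI) (auto simp: L.l_distr mult_assoc)

lemma dual_left_module: "left_module L D"
proof -
  interpret J: left_module R J by (rule J_lm)
  have add: "f \<oplus>\<^bsub>D\<^esub> g \<in> carrier D" if "f \<in> carrier D" "g \<in> carrier D" for f g
    using dual_mem[OF hom_addf[of f R L J g]] that J_lm by (simp add: dual_simps)
  have smult: "a \<odot>\<^bsub>D\<^esub> f \<in> carrier D" if "a \<in> carrier L" "f \<in> carrier D" for a f
    using dual_mem[OF hom_comp[OF hom_mult_right[OF that(1)], of f J]] that(2) by (simp add: dual_simps)
  have zero: "\<zero>\<^bsub>D\<^esub> \<in> carrier D"
    using dual_mem[OF hom_zerof[OF J_lm]] by (simp add: dual_simps)
  have cl: "f x \<in> carrier J" if "f \<in> carrier D" "x \<in> carrier L" for f x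
    using that hom_closed[of f R L J] by (simp add: dual_simps)
  have fadd: "f (x \<oplus>\<^bsub>L\<^esub> y) = f x \<oplus>\<^bsub>J\<^esub> f y" if "f \<in> carrier D" "x \<in> carrier L" "y \<in> carrier L" for f x y
    using that hom_add[of f R L J] by (simp add: dual_simps)
  note val = dual_simps(2-4)
  show ?thesis
  proof (rule left_moduleI)
    show "ring L" by (rule L_ring)
    show "\<exists>g\<in>carrier D. g \<oplus>\<^bsub>D\<^esub> f = \<zero>\<^bsub>D\<^esub>" if f: "f \<in> carrier D" for f
    proof -
      have "(\<lambda>x\<in>carrier L. \<zero>\<^bsub>J\<^esub> \<ominus>\<^bsub>J\<^esub> f x) \<in> carrier D"
        using f by (intro dual_mem hom_minusf hom_zerof J_lm) (simp add: dual_simps)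
      moreover have "(\<lambda>x\<in>carrier L. \<zero>\<^bsub>J\<^esub> \<ominus>\<^bsub>J\<^esub> f x) \<oplus>\<^bsub>D\<^esub> f = \<zero>\<^bsub>D\<^esub>"
        using cl[OF f] by (auto simp: val fun_eq_iff J.minus_add_cancel)
      ultimately show ?thesis by blast
    qed
    show "f \<oplus>\<^bsub>D\<^esub> g \<oplus>\<^bsub>D\<^esub> h = f \<oplus>\<^bsub>D\<^esub> (g \<oplus>\<^bsub>D\<^esub> h)" if "f \<in> carrier D" "g \<in> carrier D" "h \<in> carrier D" for f g h
      using cl that by (auto simp: val fun_eq_iff J.M.a_assoc)
    show "f \<oplus>\<^bsub>D\<^esub> g = g \<oplus>\<^bsub>D\<^esub> f" if "f \<in> carrier D" "g \<in> carrier D" for f g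
      using cl that by (auto simp: val fun_eq_iff J.M.a_comm)
    show "\<zero>\<^bsub>D\<^esub> \<oplus>\<^bsub>D\<^esub> f = f" if "f \<in> carrier D" for f
      by (rule dual_eqI[OF add[OF zero that] that]) (simp add: val cl[OF that])
    show "(a \<oplus>\<^bsub>L\<^esub> b) \<odot>\<^bsub>D\<^esub> f = a \<odot>\<^bsub>D\<^esub> f \<oplus>\<^bsub>D\<^esub> b \<odot>\<^bsub>D\<^esub> f" if "a \<in> carrier L" "b \<in> carrier L" "f \<in> carrier D" for a b f
      using that by (auto simp: val fun_eq_iff L.r_distr fadd)
    show "a \<odot>\<^bsub>D\<^esub> (f \<oplus>\<^bsub>D\<^esub> g) = a \<odot>\<^bsub>D\<^esub> f \<oplus>\<^bsub>D\<^esub> a \<odot>\<^bsub>D\<^esub> g" if "a \<in> carrier L" "f \<in> carrier D" "g \<in> carrier D" for a f g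
      using that by (auto simp: val fun_eq_iff)
    show "(a \<otimes>\<^bsub>L\<^esub> b) \<odot>\<^bsub>D\<^esub> f = a \<odot>\<^bsub>D\<^esub> (b \<odot>\<^bsub>D\<^esub> f)" if "a \<in> carrier L" "b \<in> carrier L" "f \<in> carrier D" for a b f
      using that by (auto simp: val fun_eq_iff L.m_assoc)
    show "\<one>\<^bsub>L\<^esub> \<odot>\<^bsub>D\<^esub> f = f" if "f \<in> carrier D" for f
      by (rule dual_eqI[OF smult[OF _ that] that]) (simp_all add: val)
  qed (use add smult zero in auto)
qed

text \<open>Evaluation at finitely many generators of the algebra over \<open>R\<close> embeds the
  dual into a power of \<open>J\<close>. Submodules of finitely generated \<open>R\<close>-modules
  are finitely generated, and generators over \<open>R\<close> also generate over the
  algebra.\<close>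

lemma dual_fg: "fg_module L D"
proof -
  interpret FR: finite_length_ring R by (rule R_finite_length_ring)
  obtain S where S: "finite S" "S \<subseteq> carrier L" "\<And>H. submodule H R L \<Longrightarrow> S \<subseteq> H \<Longrightarrow> H = carrier L"
    by (rule fg_moduleE[OF L_fg]) blast
  obtain ls where ls: "set ls = S" using finite_list[OF S(1)] by blast
  have lsL: "ls ! i \<in> carrier L" if "i < length ls" for i using ls S(2) that nth_mem by blast
  note lD = restrict_scalars_left_module[OF dual_left_module]
  let ?J = "module_power J (length ls)" and ?ev = "\<lambda>f. \<lambda>i\<in>{..<length ls}. f (ls ! i)"
  have J_carrier: "carrier ?J = (\<Pi>\<^sub>E i\<in>{..<length ls}. carrier J)"
    unfolding module_power_def direct_sum_simps length_replicate by (rule PiE_cong) simp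
  have J_simps: "\<zero>\<^bsub>?J\<^esub> = (\<lambda>i\<in>{..<length ls}. \<zero>\<^bsub>J\<^esub>)"
    "x \<oplus>\<^bsub>?J\<^esub> y = (\<lambda>i\<in>{..<length ls}. x i \<oplus>\<^bsub>J\<^esub> y i)" "r \<odot>\<^bsub>?J\<^esub> x = (\<lambda>i\<in>{..<length ls}. r \<odot>\<^bsub>J\<^esub> x i)" for x y r
    by (simp_all add: module_power_def direct_sum_simps cong: restrict_cong)
  note J_simps = J_carrier J_simps
  have ev: "?ev \<in> module_hom R (restrict_scalars L D) ?J"
  proof (rule module_homI)
    show "?ev f \<in> carrier ?J" if "f \<in> carrier (restrict_scalars L D)" for f
      using that lsL hom_closed[of f R L J] by (auto simp: J_simps dual_simps)
    show "?ev (f \<oplus>\<^bsub>restrict_scalars L D\<^esub> g) = ?ev f \<oplus>\<^bsub>?J\<^esub> ?ev g"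
      if "f \<in> carrier (restrict_scalars L D)" "g \<in> carrier (restrict_scalars L D)" for f g
      using lsL by (auto simp: J_simps dual_simps fun_eq_iff)
    show "?ev (r \<odot>\<^bsub>restrict_scalars L D\<^esub> f) = r \<odot>\<^bsub>?J\<^esub> ?ev f"
      if "r \<in> carrier R" "f \<in> carrier (restrict_scalars L D)" for r f
      using that lsL hom_smult[of f R L J r] by (auto simp: J_simps dual_simps fun_eq_iff scalar_right)
  qed
  have "?ev \<in> module_mono R (restrict_scalars L D) ?J"
  proof (rule monoI[OF ev lD module_power_left_module[OF J_lm]])
    fix f assume f: "f \<in> carrier (restrict_scalars L D)" "?ev f = \<zero>\<^bsub>?J\<^esub>"
    have fh: "f \<in> module_hom R L J" using f(1) by (simp add: dual_simps)
    have "f s = \<zero>\<^bsub>J\<^esub>" if s: "s \<in> S" for s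
    proof -
      obtain i where i: "i < length ls" "s = ls ! i" using s ls by (auto simp: in_set_conv_nth)
      have "?ev f i = \<zero>\<^bsub>J\<^esub>" using f(2) i(1) by (simp add: J_simps)
      then show ?thesis using i by simp
    qed
    then have "a_kernel L J f = carrier L"
      using S(2) by (intro S(3) submodule_ker[OF fh L_lm J_lm]) (auto simp: a_kernel_def')
    then have "f x = \<zero>\<^bsub>J\<^esub>" if "x \<in> carrier L" for x using that by (auto simp: a_kernel_def')
    then show "f = \<zero>\<^bsub>restrict_scalars L D\<^esub>"
      using f(1) by (auto simp: dual_simps extensional_def fun_eq_iff)
  qed
  then have "fg_module R (restrict_scalars L D)"
    by (rule FR.fg_mono[OF _ fg_module_power[OF J_fg] lD])
  then obtain G where G: "finite G" "G \<subseteq> carrier (restrict_scalars L D)"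
    "\<And>H. submodule H R (restrict_scalars L D) \<Longrightarrow> G \<subseteq> H \<Longrightarrow> H = carrier (restrict_scalars L D)"
    by (rule fg_moduleE) blast
  show ?thesis
  proof (rule fg_moduleI[OF dual_left_module G(1)])
    show "G \<subseteq> carrier D" using G(2) by simp
    fix H x assume H: "submodule H L D" "G \<subseteq> H" and x: "x \<in> carrier D"
    have "submodule H R (restrict_scalars L D)"
      by (rule left_module.submoduleI[OF lD])
        (use submodule_subset[OF H(1)] submodule_zero[OF H(1)] submodule_add[OF H(1)] submodule_smult[OF H(1)]
          scalar_closed in auto)
    from G(3)[OF this H(2)] x show "x \<in> H" by simp
  qed
qed

text \<open>The adjunction between maps \<open>M \<rightarrow> D\<close> over the algebra and
  \<open>R\<close>-linear maps \<open>M \<rightarrow> J\<close>: \<open>f\<close> corresponds to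
  \<open>m \<mapsto> f m 1\<close>, and \<open>u\<close> to
  \<open>m \<mapsto> (x \<mapsto> u (x m))\<close>. The extension from \<open>M\<close> to
  \<open>N\<close> is carried out on the side of \<open>J\<close>.\<close>

lemma dual_injective:
  assumes J: "injective R J"
  shows "injective L D"
  unfolding injective_def
proof (intro conjI allI impI)
  show "fg_module L D" by (rule dual_fg)
  note lD = dual_left_module
  fix M N :: "'a std_module" and g f
  assume *: "fg_module L M \<and> fg_module L N \<and> g \<in> module_mono L M N \<and> f \<in> module_hom L M D"
  then have g: "g \<in> module_mono L M N" and f: "f \<in> module_hom L M D" and fg: "fg_module L M" "fg_module L N" by auto
  note gh = mono_hom[OF g]
  interpret M: left_module L M by (rule fg_left_module[OF fg(1)])
  interpret N: left_module L N by (rule fg_left_module[OF fg(2)])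
  let ?u = "\<lambda>m. f m \<one>\<^bsub>L\<^esub>"
  have fm: "f m \<in> module_hom R L J" if "m \<in> carrier M" for m
    using hom_closed[OF f that] by (simp add: dual_simps)
  have fsm: "f (x \<odot>\<^bsub>M\<^esub> m) \<one>\<^bsub>L\<^esub> = f m x" if "x \<in> carrier L" "m \<in> carrier M" for x m
    using that by (simp add: hom_smult[OF f] dual_simps)
  have u: "?u \<in> module_hom R (restrict_scalars L M) J"
  proof (rule module_homI)
    show "?u m \<in> carrier J" if "m \<in> carrier (restrict_scalars L M)" for m
      using that hom_closed[OF fm] by simp
    show "?u (m \<oplus>\<^bsub>restrict_scalars L M\<^esub> m') = ?u m \<oplus>\<^bsub>J\<^esub> ?u m'"
      if "m \<in> carrier (restrict_scalars L M)" "m' \<in> carrier (restrict_scalars L M)" for m m'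
      using that by (simp add: hom_add[OF f] dual_simps)
    show "?u (r \<odot>\<^bsub>restrict_scalars L M\<^esub> m) = r \<odot>\<^bsub>J\<^esub> ?u m"
      if "r \<in> carrier R" "m \<in> carrier (restrict_scalars L M)" for r m
      using that by (simp add: fsm scalar_closed hom_smult[OF fm])
  qed
  obtain h where h: "h \<in> module_hom R (restrict_scalars L N) J" "\<And>m. m \<in> carrier (restrict_scalars L M) \<Longrightarrow> h (g m) = ?u m"
    by (rule injective_extend[OF J restrict_scalars_fg[OF fg(1)] restrict_scalars_fg[OF fg(2)] restrict_scalars_mono[OF g] u]) blast
  have hadd: "h (x \<oplus>\<^bsub>N\<^esub> y) = h x \<oplus>\<^bsub>J\<^esub> h y" if "x \<in> carrier N" "y \<in> carrier N" for x y
    using hom_add[OF h(1), of x y] that by simp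
  have hsm: "h ((r \<odot>\<^bsub>L\<^esub> \<one>\<^bsub>L\<^esub>) \<odot>\<^bsub>N\<^esub> x) = r \<odot>\<^bsub>J\<^esub> h x" if "r \<in> carrier R" "x \<in> carrier N" for r x
    using hom_smult[OF h(1), of r x] that by simp
  have hcl: "h x \<in> carrier J" if "x \<in> carrier N" for x using hom_closed[OF h(1), of x] that by simp
  let ?h = "\<lambda>n. \<lambda>x\<in>carrier L. h (x \<odot>\<^bsub>N\<^esub> n)"
  have hn: "(\<lambda>x. h (x \<odot>\<^bsub>N\<^esub> n)) \<in> module_hom R L J" if n: "n \<in> carrier N" for n
  proof (rule module_homI)
    show "h (r \<odot>\<^bsub>L\<^esub> x \<odot>\<^bsub>N\<^esub> n) = r \<odot>\<^bsub>J\<^esub> h (x \<odot>\<^bsub>N\<^esub> n)" if "r \<in> carrier R" "x \<in> carrier L" for r x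
      using hsm[OF that(1) N.smult_closed[OF that(2) n]] n that
      by (simp add: scalar_closed scalar_left flip: N.smult_assoc)
  qed (use n in \<open>simp_all add: hcl hadd N.smult_closed N.smult_l_distr\<close>)
  have hD: "?h \<in> module_hom L N D"
  proof (rule module_homI)
    show "?h n \<in> carrier D" if "n \<in> carrier N" for n using dual_mem[OF hn[OF that]] .
    show "?h (n \<oplus>\<^bsub>N\<^esub> n') = ?h n \<oplus>\<^bsub>D\<^esub> ?h n'" if "n \<in> carrier N" "n' \<in> carrier N" for n n'
      using that by (auto simp: dual_simps fun_eq_iff N.smult_r_distr hadd N.smult_closed)
    show "?h (a \<odot>\<^bsub>N\<^esub> n) = a \<odot>\<^bsub>D\<^esub> ?h n" if "a \<in> carrier L" "n \<in> carrier N" for a n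
      using that by (auto simp: dual_simps fun_eq_iff N.smult_assoc)
  qed
  show "\<exists>h\<in>module_hom L N D. \<forall>x\<in>carrier M. h (g x) = f x"
  proof (intro bexI[OF _ hD] ballI)
    fix m assume m: "m \<in> carrier M"
    show "?h (g m) = f m"
    proof (rule dual_eqI[OF hom_closed[OF hD hom_closed[OF gh m]] hom_closed[OF f m]])
      fix x assume x: "x \<in> carrier L"
      have "h (x \<odot>\<^bsub>N\<^esub> g m) = h (g (x \<odot>\<^bsub>M\<^esub> m))" using x m by (simp add: hom_smult[OF gh])
      also have "\<dots> = f m x" using x m h(2)[of "x \<odot>\<^bsub>M\<^esub> m"] by (simp add: M.smult_closed fsm)
      finally show "?h (g m) x = f m x" using x by simp
    qed
  qed
qed

end

end

section \<open>From the defining conditions to the abstract setting\<close>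

lemma injdim_le_1_if_injdim:
  assumes "injdim A M \<le> 1" "fg_module A M"
  shows "injdim_le_1 A M"
proof -
  obtain \<eta> I d where res: "injective_resolution A M \<eta> I d" and z: "\<And>i. i > 1 \<Longrightarrow> carrier (I i) = {\<zero>\<^bsub>I i\<^esub>}"
    by (rule injdim_leD[OF assms(1)[unfolded one_enat_def]]) blast
  have inj: "\<And>n. injective A (I n)" and \<eta>: "\<eta> \<in> module_mono A M (I 0)" and d: "\<And>n. d n \<in> module_hom A (I n) (I (Suc n))"
    and ker: "\<eta> ` carrier M = a_kernel (I 0) (I 1) (d 0)"
    "d 0 ` carrier (I 0) = a_kernel (I (Suc 0)) (I (Suc (Suc 0))) (d (Suc 0))"
    using res by (simp_all add: injective_resolution_def)
  have "d (Suc 0) x = \<zero>\<^bsub>I (Suc (Suc 0))\<^esub>" if "x \<in> carrier (I (Suc 0))" for x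
    using hom_closed[OF d that] z[of "Suc (Suc 0)"] by simp
  then have "d 0 ` carrier (I 0) = carrier (I 1)" unfolding ker(2) by (auto simp: a_kernel_def')
  then have "fg_ses A M \<eta> (I 0) (d 0) (I 1)"
    using \<eta> d[of 0] ker(1) assms(2) injective_fg[OF inj]
    by (simp add: fg_ses_def short_exact_def module_epi_def)
  then show ?thesis by (rule injdim_le_1I[OF _ inj inj])
qed

text \<open>A projective-injective module is decomposed into indecomposables. Each of them is again
  projective and injective, hence isomorphic to a member of \<open>Qs\<close> and a summand of
  \<open>direct_sum Qs\<close>.\<close>

lemma proj_inj_ringI:
  fixes A :: "('a, 'x) ring_scheme" and Qs :: "'a std_module list"
  assumes "finite_length_ring A" "proj_inj_representatives A Qs"
  shows "proj_inj_ring A (direct_sum Qs)"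
proof -
  interpret finite_length_ring A by fact
  have Qs: "indecomposable A M" "projective A M" "injective A M" "left_module A M" if "M \<in> set Qs" for M
    using assms(2) that by (auto simp: proj_inj_representatives_def indecomposable_def fg_left_module)
  show ?thesis
  proof (intro proj_inj_ring.intro proj_inj_ring_axioms.intro finite_length_ring_axioms)
    show "projective A (direct_sum Qs)" by (rule projective_direct_sum[OF ring Qs(2)])
    show "injective A (direct_sum Qs)" by (rule injective_direct_sum[OF ring Qs(3)])
    have lQ: "left_module A (direct_sum Qs)" by (rule direct_sum_left_module[OF ring Qs(4)])
    fix M :: "'a std_module" assume M: "projective A M" "injective A M"
    note fgM = projective_fg[OF M(1)]
    obtain Ns :: "'a std_module list" where Ns: "\<And>N. N \<in> set Ns \<Longrightarrow> indecomposable A N"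
      "isomorphic_modules A M (direct_sum Ns)"
      by (rule decomposition[OF fgM]) blast
    have lN: "left_module A N" if "N \<in> set Ns" for N
      using Ns(1)[OF that] by (simp add: indecomposable_def fg_left_module)
    have lD: "left_module A (direct_sum Ns)" by (rule direct_sum_left_module[OF ring lN])
    have iso: "isomorphic_modules A (direct_sum Ns) M"
      by (rule isomorphic_modules_sym[OF Ns(2) fg_left_module[OF fgM]])
    have "in_add A (direct_sum Qs) N" if N: "N \<in> set Ns" for N
    proof -
      have r: "retract A N M"
        by (rule retract_trans[OF retract_direct_sum[OF ring lN N] isomorphic_retract[OF iso lD]])
      have "projective A N" "injective A N"
        using projective_retract[OF r M(1) lN[OF N]] injective_retract[OF r M(2) lN[OF N]] by auto
      then obtain Q where Q: "Q \<in> set Qs" "isomorphic_modules A N Q"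
        using assms(2) Ns(1)[OF N] unfolding proj_inj_representatives_def by blast
      have "retract A Q (direct_sum Qs)" by (rule retract_direct_sum[OF ring Qs(4) Q(1)])
      from retract_trans[OF isomorphic_retract[OF Q(2) lN[OF N]] this]
      show ?thesis by (rule in_add_retract[OF in_add_self[OF lQ]])
    qed
    from in_add_retract[OF in_add_direct_sum[OF lQ lN this] isomorphic_retract[OF Ns(2) fg_left_module[OF fgM]]]
    show "in_add A (direct_sum Qs) M" by blast
  qed
qed

theorem theorem2:
  fixes R :: "('r, 'x) ring_scheme"
    and J :: "('r, 'j) module"
    and \<Lambda> :: "('r, 'a) module"
    and Qs :: "'a std_module list"
  assumes "artin_algebra R \<Lambda>"
    and "dualizing_module R J"
    and "proj_inj_representatives \<Lambda> Qs"
  defines "Q \<equiv> direct_sum Qs"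
  shows "(\<exists>T :: 'a std_module. T \<in> Gen \<Lambda> Q \<inter> Cogen \<Lambda> Q \<and> tilting \<Lambda> T \<and> cotilting R J \<Lambda> T)
    \<longleftrightarrow> auslander_gorenstein 1 \<Lambda>"
proof
  interpret artin_alg R \<Lambda> by (rule artin_alg.intro) fact
  interpret proj_inj_ring \<Lambda> Q
    unfolding Q_def by (rule proj_inj_ringI[OF L_finite_length_ring assms(3)])
  {
    assume "\<exists>T :: 'a std_module. T \<in> Gen \<Lambda> Q \<inter> Cogen \<Lambda> Q \<and> tilting \<Lambda> T \<and> cotilting R J \<Lambda> T"
    then obtain T :: "'a std_module" where T: "T \<in> Gen \<Lambda> Q" "T \<in> Cogen \<Lambda> Q" "tilting \<Lambda> T" "cotilting R J \<Lambda> T"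
      by blast
    have fgT: "fg_module \<Lambda> T" using T(3) by (simp add: tilting_def)
    note lT = fg_left_module[OF fgT]
    obtain T0 T1 :: "'a std_module" and f g where T01: "T0 \<in> add_closure \<Lambda> T" "T1 \<in> add_closure \<Lambda> T"
      "short_exact \<Lambda> (regular_module \<Lambda>) f T0 g T1"
      using T(3) unfolding tilting_def by blast
    then have "fg_ses \<Lambda> (regular_module \<Lambda>) f T0 g T1" "in_add \<Lambda> T T0" "in_add \<Lambda> T T1"
      using regular_fg[OF ring] by (simp_all add: fg_ses_def add_closure_iff[OF lT])
    moreover have "injdim_le_1 \<Lambda> T"
      using T(4) fgT by (intro injdim_le_1_if_injdim) (simp_all add: cotilting_def)
    ultimately show "auslander_gorenstein 1 \<Lambda>"
      using tilting_imp_auslander_gorenstein[OF T(1,2)] by blast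
  }
  assume "auslander_gorenstein 1 \<Lambda>"
  then obtain I0 X0 :: "'a std_module" and j p where AG: "fg_ses \<Lambda> (regular_module \<Lambda>) j I0 p X0"
    "projective \<Lambda> I0" "injective \<Lambda> I0" "X0 \<in> Cogen \<Lambda> Q" "injdim_le_1 \<Lambda> X0"
    by (rule auslander_gorensteinD)
  interpret ag_ring \<Lambda> Q I0 X0 j p by (unfold_locales) (rule AG)+
  have J: "injective R J" using assms(2) by (simp add: dualizing_module_def injective_envelope_def)
  have DL: "injective \<Lambda> (dual_regular R J \<Lambda>)" by (rule dual_injective[OF injective_fg[OF J] J])
  have "isomorphic_modules \<Lambda> Q (direct_sum Qs)" unfolding Q_def by (rule isomorphic_modules_refl)
  then obtain T :: "'a std_module" where T: "basic_module \<Lambda> T" "in_add \<Lambda> Z T" "in_add \<Lambda> T Z"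
    by (rule basic_representative) (use assms(3) in \<open>simp add: proj_inj_representatives_def\<close>)
  note tc = tilting_cotilting_module[OF T]
  have "cotilting R J \<Lambda> T"
    unfolding cotilting_def using tc(3-5) tc(6)[OF DL] by (simp add: tilting_def)
  with tc(1-3) show "\<exists>T :: 'a std_module. T \<in> Gen \<Lambda> Q \<inter> Cogen \<Lambda> Q \<and> tilting \<Lambda> T \<and> cotilting R J \<Lambda> T"
    by blast
qed

end
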